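(* For every integer $N\ge1$ and every $\varphi=(\varphi_1,\varphi_2) \in H^N_c$: (i) $\displaystyle \Delta(\mu_n)=2(-1)^n +\frac{\ell^2_n}{n^{N+1}}$ as $|n|\to \infty$; (ii) $\displaystyle \delta(\mu_n)=(-1)^n i\,\big(\hat \varphi_1(-n)-\hat\varphi_2(n) \big) +\frac{\ell^2_n}{n^{N+1}}$ as $|n|\to \infty$; both uniformly on bounded sets of $H^N_c$.
   Context: For an integer $N\ge0$, $H^N$ is the Sobolev space of 1-periodic complex-valued functions on $\mathbb{R}$ with its standard norm, $H^0=L^2$, and $H^N_c:=H^N\times H^N$. For $u\in L^2$, $\hat u(n):=\int_0^1u(x)e^{-2\pi i n x}\,dx$, $n\in\mathbb{Z}$. For $\varphi=(\varphi_1,\varphi_2)\in L^2_c:=H^0_c$ the Zakharov--Shabat operator is \[L(\varphi)= i \begin{pmatrix}1&0\\0&-1\end{pmatrix}\partial_x + \begin{pmatrix}0& \varphi_1 \\ \varphi_2 &0\end{pmatrix}.\] The Dirichlet spectrum of $L(\varphi)$ is the spectrum of $L(\varphi)$ on $[0,1]$ with domain the set of $F=(F_1,F_2)\in H^1([0,1],\mathbb{C})^2$ with $F_1(0)=F_2(0)$, $F_1(1)=F_2(1)$. It is discrete, and the eigenvalues, counted with algebraic multiplicities, are listed in lexicographic order $\cdots\preceq\mu_n\preceq\mu_{n+1}\preceq\cdots$ in such a way that $(\mu_n-n\pi)_{n\in\mathbb{Z}}\in\ell^2$. Here $a\preceq b$ means $\operatorname{Re}a<\operatorname{Re}b$, or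 $\operatorname{Re}a=\operatorname{Re}b$ and $\operatorname{Im}a\le\operatorname{Im}b$. $M(x,\lambda)=\begin{pmatrix} m_1 & m_2 \\ m_3 & m_4 \end{pmatrix}$ is the fundamental solution of $L(\varphi)M=\lambda M$ with $M(0,\lambda)=\mathrm{Id}$; $\Delta(\lambda):=m_1(1,\lambda)+m_4(1,\lambda)$ and $\delta(\lambda):=m_2(1,\lambda)+m_3(1,\lambda)$. Notation: $x_n=y_n+\frac{\ell^p_n}{n^{s}}$ as $|n|\to\infty$ means that $x_n=y_n+\frac{e_n}{|n|^{s}}$ for $|n|$ large with $\sum|e_n|^p<\infty$. "Uniformly on bounded sets" means that for every bounded set of potentials there are $n_0\ge1$ and $C>0$ such that $\sum_{|n|\ge n_0}|e_n|^p\le C$ for all potentials in that set. *)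

theory Defs
  imports "HOL-Analysis.Analysis" "HOL-Library.Function_Algebras"
begin

section \<open>Function spaces\<close>

definition L2_on :: "real set \<Rightarrow> (real \<Rightarrow> 'b::euclidean_space) \<Rightarrow> bool" where
  "L2_on S f \<longleftrightarrow>
     set_borel_measurable lborel S f \<and> set_integrable lborel S (\<lambda>x. (norm (f x))\<^sup>2)"

definition L2_norm_on :: "real set \<Rightarrow> (real \<Rightarrow> 'b::euclidean_space) \<Rightarrow> real" where
  "L2_norm_on S f = sqrt (LINT x:S|lborel. (norm (f x))\<^sup>2)"

text \<open>On an interval \<open>S\<close> containing \<open>0\<close>: \<open>f\<close> is the (locally) absolutely continuous
  representative of a \<open>W\<^sup>1\<^sup>,\<^sup>1\<close> function, and \<open>g\<close> is its weak derivative
  (which is determined up to null sets).\<close>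

definition has_weak_deriv_on ::
    "(real \<Rightarrow> 'b::euclidean_space) \<Rightarrow> (real \<Rightarrow> 'b) \<Rightarrow> real set \<Rightarrow> bool" where
  "has_weak_deriv_on f g S \<longleftrightarrow>
     (\<forall>a b. {a..b} \<subseteq> S \<longrightarrow> set_integrable lborel {a..b} g) \<and>
     (\<forall>x\<in>S. f x = f 0 + (LBINT t=0..x. g t))"

definition L2_per :: "(real \<Rightarrow> complex) \<Rightarrow> bool" where
  "L2_per u \<longleftrightarrow> (\<forall>x. u (x + 1) = u x) \<and> L2_on {0..1} u"

text \<open>\<open>d k\<close> is a \<open>k\<close>-th weak derivative of \<open>u\<close> for \<open>k \<le> N\<close>. For \<open>N \<ge> 1\<close> the elements of
  the Sobolev space are identified with their continuous representatives.\<close>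

definition sobolev_derivs :: "nat \<Rightarrow> (real \<Rightarrow> complex) \<Rightarrow> (nat \<Rightarrow> real \<Rightarrow> complex) \<Rightarrow> bool" where
  "sobolev_derivs N u d \<longleftrightarrow>
     d 0 = u \<and> (\<forall>k\<le>N. L2_per (d k)) \<and> (\<forall>k<N. has_weak_deriv_on (d k) (d (Suc k)) UNIV)"

definition sobolev :: "nat \<Rightarrow> (real \<Rightarrow> complex) set" where
  "sobolev N = {u. \<exists>d. sobolev_derivs N u d}"

text \<open>The value does not depend on the choice, since weak derivatives are unique almost
  everywhere.\<close>

definition sobolev_norm :: "nat \<Rightarrow> (real \<Rightarrow> complex) \<Rightarrow> real" where
  "sobolev_norm N u =
     sqrt (\<Sum>k\<le>N. (L2_norm_on {0..1} ((SOME d. sobolev_derivs N u d) k))\<^sup>2)"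

type_synonym potential = "(real \<Rightarrow> complex) \<times> (real \<Rightarrow> complex)"

definition Hc :: "nat \<Rightarrow> potential set" where
  "Hc N = sobolev N \<times> sobolev N"

definition Hc_norm :: "nat \<Rightarrow> potential \<Rightarrow> real" where
  "Hc_norm N \<phi> = sqrt ((sobolev_norm N (fst \<phi>))\<^sup>2 + (sobolev_norm N (snd \<phi>))\<^sup>2)"

definition Hc_bounded :: "nat \<Rightarrow> potential set \<Rightarrow> bool" where
  "Hc_bounded N B \<longleftrightarrow> B \<subseteq> Hc N \<and> (\<exists>R. \<forall>\<phi>\<in>B. Hc_norm N \<phi> \<le> R)"

definition fourier_coeff :: "(real \<Rightarrow> complex) \<Rightarrow> int \<Rightarrow> complex" where
  "fourier_coeff u n =
     (LBINT x=0..1. u x * exp (- 2 * of_real pi * \<i> * of_int n * of_real x))"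


section \<open>The Zakharov--Shabat operator\<close>

definition ZS_sigma :: "complex^2^2" where
  "ZS_sigma = vector [vector [\<i>, 0], vector [0, - \<i>]]"

definition ZS_pot :: "potential \<Rightarrow> real \<Rightarrow> complex^2^2" where
  "ZS_pot \<phi> x = vector [vector [0, fst \<phi> x], vector [snd \<phi> x, 0]]"

text \<open>Potentials in \<open>L\<^sup>2\<close> only give an equation almost everywhere; the solution is the
  absolutely continuous one, so it is unique as a function on the real line.\<close>

definition ZS_fund :: "potential \<Rightarrow> complex \<Rightarrow> real \<Rightarrow> complex^2^2" where
  "ZS_fund \<phi> z = (THE M. M 0 = mat 1 \<and>
     (\<exists>M'. has_weak_deriv_on M M' UNIV \<and>
        (AE x in lborel. ZS_sigma ** M' x + ZS_pot \<phi> x ** M x = mat z ** M x)))"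

definition ZS_Delta :: "potential \<Rightarrow> complex \<Rightarrow> complex" where
  "ZS_Delta \<phi> z = ZS_fund \<phi> z 1 $ 1 $ 1 + ZS_fund \<phi> z 1 $ 2 $ 2"

definition ZS_delta :: "potential \<Rightarrow> complex \<Rightarrow> complex" where
  "ZS_delta \<phi> z = ZS_fund \<phi> z 1 $ 1 $ 2 + ZS_fund \<phi> z 1 $ 2 $ 1"


section \<open>The Dirichlet spectrum\<close>

text \<open>Elements of the domain are represented by their continuous representative on \<open>[0,1]\<close>,
  extended by \<open>0\<close>, so that equality of functions is equality in \<open>H\<^sup>1([0,1])\<close>.\<close>

definition dirichlet_dom :: "(real \<Rightarrow> complex^2) set" where
  "dirichlet_dom = {F. (\<forall>x. x \<notin> {0..1} \<longrightarrow> F x = 0) \<and>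
     (\<exists>F'. L2_on {0..1} F' \<and> has_weak_deriv_on F F' {0..1}) \<and>
     F 0 $ 1 = F 0 $ 2 \<and> F 1 $ 1 = F 1 $ 2}"

text \<open>The graph of the Dirichlet operator: \<open>F\<close> is in the domain and \<open>G\<close> represents \<open>L(\<phi>) F\<close>.\<close>

definition dirichlet_graph :: "potential \<Rightarrow> (real \<Rightarrow> complex^2) \<Rightarrow> (real \<Rightarrow> complex^2) \<Rightarrow> bool" where
  "dirichlet_graph \<phi> F G \<longleftrightarrow> F \<in> dirichlet_dom \<and>
     (\<exists>F'. L2_on {0..1} F' \<and> has_weak_deriv_on F F' {0..1} \<and>
        (AE x in lborel. x \<in> {0..1} \<longrightarrow> G x = ZS_sigma *v F' x + ZS_pot \<phi> x *v F x))"

text \<open>\<open>dirichlet_shift \<phi> z F G\<close> says \<open>(L(\<phi>) - z) F = G\<close>.\<close>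

definition dirichlet_shift ::
    "potential \<Rightarrow> complex \<Rightarrow> (real \<Rightarrow> complex^2) \<Rightarrow> (real \<Rightarrow> complex^2) \<Rightarrow> bool" where
  "dirichlet_shift \<phi> z F G \<longleftrightarrow> dirichlet_graph \<phi> F (\<lambda>x. z *s F x + G x)"

definition dirichlet_resolvent_set :: "potential \<Rightarrow> complex set" where
  "dirichlet_resolvent_set \<phi> = {z.
     (\<forall>G. L2_on {0..1} G \<longrightarrow> (\<exists>!F. dirichlet_shift \<phi> z F G)) \<and>
     (\<exists>C. \<forall>F G. L2_on {0..1} G \<and> dirichlet_shift \<phi> z F G \<longrightarrow>
        L2_norm_on {0..1} F \<le> C * L2_norm_on {0..1} G)}"

definition dirichlet_spectrum :: "potential \<Rightarrow> complex set" where
  "dirichlet_spectrum \<phi> = - dirichlet_resolvent_set \<phi>"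

text \<open>\<open>ker (L(\<phi>) - z)\<^sup>k\<close>, with the natural domain of the power.\<close>

primrec dirichlet_ker :: "potential \<Rightarrow> complex \<Rightarrow> nat \<Rightarrow> (real \<Rightarrow> complex^2) set" where
  "dirichlet_ker \<phi> z 0 = {0}"
| "dirichlet_ker \<phi> z (Suc k) = {F. \<exists>G\<in>dirichlet_ker \<phi> z k. dirichlet_shift \<phi> z F G}"

definition cscale :: "complex \<Rightarrow> (real \<Rightarrow> complex^2) \<Rightarrow> real \<Rightarrow> complex^2" where
  "cscale c F = (\<lambda>x. c *s F x)"

lemma vector_space_cscale: "vector_space cscale"
  by unfold_locales
    (auto simp: cscale_def fun_eq_iff vec_eq_iff algebra_simps)

definition dirichlet_mult :: "potential \<Rightarrow> complex \<Rightarrow> nat" where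
  "dirichlet_mult \<phi> z = vector_space.dim cscale (\<Union>k. dirichlet_ker \<phi> z k)"

definition lex_le :: "complex \<Rightarrow> complex \<Rightarrow> bool" where
  "lex_le a b \<longleftrightarrow> Re a < Re b \<or> (Re a = Re b \<and> Im a \<le> Im b)"

text \<open>\<open>\<mu>\<close> is the listing of the Dirichlet eigenvalues, with algebraic multiplicities; the
  \<open>\<ell>\<^sup>2\<close> condition fixes the index shift.\<close>

definition dirichlet_listing :: "potential \<Rightarrow> (int \<Rightarrow> complex) \<Rightarrow> bool" where
  "dirichlet_listing \<phi> \<mu> \<longleftrightarrow>
     range \<mu> = dirichlet_spectrum \<phi> \<and>
     (\<forall>z. finite {n. \<mu> n = z} \<and> card {n. \<mu> n = z} = dirichlet_mult \<phi> z) \<and>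
     (\<forall>n. lex_le (\<mu> n) (\<mu> (n + 1))) \<and>
     (\<lambda>n. (cmod (\<mu> n - of_real (of_int n * pi)))\<^sup>2) summable_on UNIV"


section \<open>Asymptotics with \<open>\<ell>\<^sup>p\<close> remainders\<close>

text \<open>\<open>x\<^sub>n = y\<^sub>n + e\<^sub>n / |n|\<^sup>s\<close> for \<open>|n| \<ge> n0\<close>.\<close>

definition remainder_from ::
    "nat \<Rightarrow> nat \<Rightarrow> (int \<Rightarrow> complex) \<Rightarrow> (int \<Rightarrow> complex) \<Rightarrow> (int \<Rightarrow> complex) \<Rightarrow> bool" where
  "remainder_from n0 s x y e \<longleftrightarrow>
     (\<forall>n. int n0 \<le> \<bar>n\<bar> \<longrightarrow> x n = y n + e n / of_int \<bar>n\<bar> ^ s)"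

text \<open>\<open>x\<^sub>n = y\<^sub>n + \<ell>\<^sup>p\<^sub>n / n\<^sup>s\<close> as \<open>|n| \<rightarrow> \<infinity>\<close>.\<close>

definition lp_asymp :: "nat \<Rightarrow> nat \<Rightarrow> (int \<Rightarrow> complex) \<Rightarrow> (int \<Rightarrow> complex) \<Rightarrow> bool" where
  "lp_asymp p s x y \<longleftrightarrow>
     (\<exists>n0\<ge>1. \<exists>e. remainder_from n0 s x y e \<and>
        (\<lambda>n. cmod (e n) ^ p) summable_on {n. int n0 \<le> \<bar>n\<bar>})"

text \<open>The same, with prescribed \<open>n0\<close> and prescribed bound on the remainder.\<close>

definition lp_asymp_bound ::
    "nat \<Rightarrow> real \<Rightarrow> nat \<Rightarrow> nat \<Rightarrow> (int \<Rightarrow> complex) \<Rightarrow> (int \<Rightarrow> complex) \<Rightarrow> bool" where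
  "lp_asymp_bound n0 C p s x y \<longleftrightarrow>
     (\<exists>e. remainder_from n0 s x y e \<and>
        (\<lambda>n. cmod (e n) ^ p) summable_on {n. int n0 \<le> \<bar>n\<bar>} \<and>
        (\<Sum>\<^sub>\<infinity>n\<in>{n. int n0 \<le> \<bar>n\<bar>}. cmod (e n) ^ p) \<le> C)"

end

theory Submission
  imports Defs "HOL-Computational_Algebra.Formal_Power_Series"
begin

text \<open>Put \<open>u = \<i> \<phi>\<^sub>1\<close> and \<open>v = - \<i> \<phi>\<^sub>2\<close>. A solution \<open>F = (f, g)\<close> of \<open>L(\<phi>) F = z F\<close> satisfies
\<open>f' = - \<i> z f + u g\<close> and \<open>g' = \<i> z g + v f\<close>. If \<open>z\<close> is a Dirichlet eigenvalue, normalise \<open>f(0) = g(0) = 1\<close>; then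
\<open>f(1) = g(1) = \<kappa>\<close> for a number \<open>\<kappa>\<close>, and because the fundamental matrix has determinant one,
\<open>\<Delta>(z) = \<kappa> + 1/\<kappa>\<close> and \<open>\<delta>(z) = \<kappa> - 1/\<kappa>\<close>. Since \<open>\<kappa>\<close> is close to \<open>s = (-1)\<^sup>n\<close> at the \<open>n\<close>-th eigenvalue,
\<open>\<delta>\<close> is essentially \<open>s (\<kappa>\<^sup>2 - 1)\<close> and \<open>\<Delta> - 2 s = (\<kappa> - s)\<^sup>2 / \<kappa>\<close> is quadratically small. Both claims thus reduce to
\<open>\<kappa>\<^sup>2 - 1\<close> being the sum of the Fourier coefficients of \<open>v\<close> at \<open>n\<close> and of \<open>u\<close> at \<open>- n\<close>, up to an \<open>\<ell>\<^sup>2\<close> sequence divided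
by \<open>n\<^sup>N\<^sup>+\<^sup>1\<close> (\<open>kappa_asymptotics\<close>, \<open>trace_pointwise\<close>).

To reach \<open>\<kappa>\<^sup>2\<close> to this accuracy, consider a quadratic form \<open>Y = A f\<^sup>2 + B f g + C g\<^sup>2\<close> with periodic coefficients. It would be
constant if \<open>A\<close>, \<open>B\<close>, \<open>C\<close> were the formal series in \<open>1/(2 \<i> z)\<close> generated by the AKNS recursion. Truncation of the series after order
\<open>N\<close> leaves one term only (\<open>akns_identity\<close>):
\<open>(\<kappa>\<^sup>2 - 1) Y(0)\<close> is \<open>(2 \<i> z)\<^sup>-\<^sup>N\<close> times the integral of \<open>a\<^sub>N\<^sub>+\<^sub>1 f\<^sup>2 - c\<^sub>N\<^sub>+\<^sub>1 g\<^sup>2\<close>. The functions \<open>a\<^sub>N\<^sub>+\<^sub>1\<close> and \<open>c\<^sub>N\<^sub>+\<^sub>1\<close> do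
not depend on \<open>z\<close>. Their leading parts are the \<open>N\<close>-th derivatives of \<open>v\<close> and, up to sign, of \<open>u\<close>, and produce the main
term; the remaining parts have one more derivative.

It remains to replace \<open>f\<^sup>2\<close> by \<open>exp (- 2 \<pi> \<i> n x)\<close> and \<open>g\<^sup>2\<close> by \<open>exp (2 \<pi> \<i> n x)\<close> with an error \<open>\<ell>\<^sup>2/n\<close>, where a crude estimate
gives only \<open>O(1/n)\<close>. The part of \<open>f\<^sup>2\<close> that does not oscillate is \<open>2 u / (2 \<i> z)\<close> to leading order. It contributes nothing, because the
integral of \<open>a\<^sub>N\<^sub>+\<^sub>1 u + c\<^sub>N\<^sub>+\<^sub>1 v\<close> vanishes: up to a factor this function is the derivative of the periodic function \<open>b\<^sub>N\<^sub>+\<^sub>1\<close>.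
After removal of this part, the corrections of order \<open>1/n\<close> are \<open>exp (- 2 \<pi> \<i> n x)\<close> times functions that are either independent of \<open>n\<close> or
partial Fourier integrals of \<open>u'\<close>, and Bessel's inequality makes both square summable (\<open>second_order_integrated\<close>).

Uniformity over bounded sets requires that the \<open>n\<close>-th listed eigenvalue is the one near \<open>n \<pi>\<close> from an \<open>n\<close> on that depends on the
bound only. For large \<open>|z|\<close> the Dirichlet condition reads \<open>exp (2 \<i> z) = 1 + O(1/|z|)\<close>, which puts all large eigenvalues near multiples of
\<open>\<pi>\<close>; Brouwer's theorem gives an eigenvalue near each large \<open>n \<pi>\<close>; Wronskian identities show that it is unique and simple. The order of
the listing and its \<open>\<ell>\<^sup>2\<close> condition then fix the index (\<open>listing_location\<close>).\<close>

section \<open>Absolutely continuous functions on the unit interval\<close>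

text \<open>The values of \<open>f\<close> on \<open>[0,1]\<close> are those of an integral of \<open>f'\<close>. The pair is kept together because the top derivative of a Sobolev
function is determined only almost everywhere.\<close>

definition abs_cont :: "(real \<Rightarrow> complex) \<Rightarrow> (real \<Rightarrow> complex) \<Rightarrow> bool" where
  "abs_cont f f' \<longleftrightarrow> set_integrable lborel {0..1} f' \<and> (\<forall>x\<in>{0..1}. integral {0..x} f' = f x - f 0)"

lemma set_integrable_sub:
  fixes f :: "real \<Rightarrow> 'a::euclidean_space"
  assumes "set_integrable lborel {0..1} f" "0 \<le> a" "b \<le> 1"
  shows "set_integrable lborel {a..b} f" "f integrable_on {a..b}"
    "(LINT x:{a..b}|lborel. f x) = integral {a..b} f"
proof -
  show 1: "set_integrable lborel {a..b} f"
    by (rule set_integrable_subset[OF assms(1)]) (use assms in auto)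
  show "f integrable_on {a..b}" "(LINT x:{a..b}|lborel. f x) = integral {a..b} f"
    using set_borel_integral_eq_integral[OF 1] by auto
qed

lemma set_integrable_cont:
  fixes f :: "real \<Rightarrow> 'a::euclidean_space"
  assumes "continuous_on {0..1} f"
  shows "set_integrable lborel {0..1} f"
  using borel_integrable_atLeastAtMost'[OF assms] .

lemma set_integrable_mult_cont:
  fixes f g :: "real \<Rightarrow> complex"
  assumes f: "set_integrable lborel {0..1} f" and g: "continuous_on {0..1} g"
  shows "set_integrable lborel {0..1} (\<lambda>x. f x * g x)"
proof -
  have "compact (g ` {0..1})"
    by (rule compact_continuous_image[OF g]) simp
  then obtain B where B: "\<forall>x\<in>{0..1}. cmod (g x) \<le> B"
    by (meson bounded_iff compact_imp_bounded imageI)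
  have B0: "0 \<le> B" using B[rule_format, of 0] by (simp add: order_trans[OF norm_ge_zero])
  have fi: "integrable lborel (\<lambda>x. indicator {0..1} x *\<^sub>R f x)"
    using f by (simp add: set_integrable_def)
  have fm: "(\<lambda>x. indicator {0..1} x *\<^sub>R f x) \<in> borel_measurable lborel"
    using fi by simp
  have gm: "(\<lambda>x. indicator {0..1} x *\<^sub>R g x) \<in> borel_measurable lborel"
    using borel_measurable_continuous_on_indicator[OF _ g] by simp
  have m: "(\<lambda>x. (indicator {0..1} x *\<^sub>R f x) * (indicator {0..1} x *\<^sub>R g x)) \<in> borel_measurable lborel"
    using fm gm by (rule borel_measurable_times)
  have e: "(\<lambda>x. (indicator {0..1} x *\<^sub>R f x) * (indicator {0..1} x *\<^sub>R g x))
      = (\<lambda>x. indicator {0..1} x *\<^sub>R (f x * g x))"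
    by (auto simp: indicator_def fun_eq_iff)
  show ?thesis
    unfolding set_integrable_def
  proof (rule Bochner_Integration.integrable_bound)
    show "integrable lborel (\<lambda>x. complex_of_real B * (indicator {0..1} x *\<^sub>R f x))"
      by (rule Bochner_Integration.integrable_mult_right) (rule fi)
    show "(\<lambda>x. indicator {0..1} x *\<^sub>R (f x * g x)) \<in> borel_measurable lborel"
      using m unfolding e .
    show "AE x in lborel. norm (indicator {0..1} x *\<^sub>R (f x * g x))
        \<le> norm (complex_of_real B * (indicator {0..1} x *\<^sub>R f x))"
    proof (rule AE_I2)
      fix x
      show "norm (indicator {0..1} x *\<^sub>R (f x * g x))
        \<le> norm (complex_of_real B * (indicator {0..1} x *\<^sub>R f x))"
        using B B0 by (cases "x \<in> {0..1}") (auto simp: norm_mult mult.commute[of B] intro!: mult_left_mono)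
    qed
  qed
qed

lemma abs_cont_cont: "abs_cont f f' \<Longrightarrow> continuous_on {0..1} f"
proof -
  assume a: "abs_cont f f'"
  have "continuous_on {0..1} (\<lambda>x. f 0 + integral {0..x} f')"
    using set_integrable_sub(2)[of f' 0 1] a unfolding abs_cont_def
    by (intro continuous_intros indefinite_integral_continuous_1) simp
  moreover have "continuous_on {0..1} f \<longleftrightarrow> continuous_on {0..1} (\<lambda>x. f 0 + integral {0..x} f')"
    using a by (intro continuous_on_cong) (auto simp: abs_cont_def)
  ultimately show ?thesis by simp
qed

lemma abs_cont_eval: "abs_cont f f' \<Longrightarrow> x \<in> {0..1} \<Longrightarrow> f x = f 0 + integral {0..x} f'"
  by (simp add: abs_cont_def)

lemma abs_cont_int: "abs_cont f f' \<Longrightarrow> set_integrable lborel {0..1} f'"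
  by (simp add: abs_cont_def)

lemma abs_cont_total: "abs_cont f f' \<Longrightarrow> integral {0..1} f' = f 1 - f 0"
  using abs_cont_eval[of f f' 1] by simp

lemma abs_cont_const: "abs_cont (\<lambda>x. c) (\<lambda>x. 0)"
  by (simp add: abs_cont_def set_integrable_def)

lemma abs_cont_add:
  assumes "abs_cont f f'" "abs_cont g g'" shows "abs_cont (\<lambda>x. f x + g x) (\<lambda>x. f' x + g' x)"
  unfolding abs_cont_def
proof (intro conjI ballI)
  show "set_integrable lborel {0..1} (\<lambda>x. f' x + g' x)"
    using assms[THEN abs_cont_int] by (rule set_integral_add)
  fix x :: real assume x: "x \<in> {0..1}"
  have "integral {0..x} (\<lambda>x. f' x + g' x) = integral {0..x} f' + integral {0..x} g'"
    using set_integrable_sub(2)[OF abs_cont_int[OF assms(1)], of 0 x] set_integrable_sub(2)[OF abs_cont_int[OF assms(2)], of 0 x] x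
    by (intro Henstock_Kurzweil_Integration.integral_add) auto
  then show "integral {0..x} (\<lambda>x. f' x + g' x) = f x + g x - (f 0 + g 0)"
    using x abs_cont_eval[OF assms(1) x] abs_cont_eval[OF assms(2) x] by simp
qed

lemma abs_cont_cmult:
  assumes "abs_cont f f'" shows "abs_cont (\<lambda>x. c * f x) (\<lambda>x. c * f' x)"
  using assms by (simp add: abs_cont_def right_diff_distrib)

lemma abs_cont_C1:
  assumes "\<And>x. x \<in> {0..1} \<Longrightarrow> (f has_vector_derivative f' x) (at x within {0..1})"
    and "continuous_on {0..1} f'"
  shows "abs_cont f f'"
  unfolding abs_cont_def
proof (intro conjI ballI)
  show "set_integrable lborel {0..1} f'" using assms(2) by (rule set_integrable_cont)
  fix x :: real assume x: "x \<in> {0..1}"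
  have "(f' has_integral (f x - f 0)) {0..x}"
    by (rule fundamental_theorem_of_calculus)
      (use x in \<open>auto intro!: has_vector_derivative_within_subset[OF assms(1)]\<close>)
  then show "integral {0..x} f' = f x - f 0" by (simp add: integral_unique)
qed

lemma abs_cont_cong:
  assumes "abs_cont f f'" "\<And>x. x \<in> {0..1} \<Longrightarrow> g x = f x" "\<And>x. x \<in> {0..1} \<Longrightarrow> g' x = f' x"
  shows "abs_cont g g'"
proof -
  have 1: "set_integrable lborel {0..1} g'"
    using abs_cont_int[OF assms(1)] by (subst set_integrable_cong[OF refl refl assms(3)]) auto
  have "integral {0..x} g' = integral {0..x} f'" if "x \<in> {0..1}" for x
    by (rule Henstock_Kurzweil_Integration.integral_cong) (use assms(3) that in auto)
  then show ?thesis using assms(1,2) 1 by (simp add: abs_cont_def)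
qed

text \<open>The two terms are the integrals of \<open>F(t) G(s)\<close> over the half planes \<open>s \<le> t\<close> and \<open>t \<le> s\<close>, which overlap in a null set.\<close>

lemma triangle_Fubini:
  fixes F G :: "real \<Rightarrow> complex"
  assumes F: "integrable lborel F" and G: "integrable lborel G"
  shows "(\<integral>t. F t * (\<integral>s. indicator {..t} s *\<^sub>R G s \<partial>lborel) \<partial>lborel)
       + (\<integral>s. G s * (\<integral>t. indicator {..s} t *\<^sub>R F t \<partial>lborel) \<partial>lborel)
       = (\<integral>t. F t \<partial>lborel) * (\<integral>s. G s \<partial>lborel)" (is "?A + ?B = _")
proof -
  have [measurable]: "F \<in> borel_measurable borel" "G \<in> borel_measurable borel"
    using F G by auto
  let ?P = "lborel \<Otimes>\<^sub>M (lborel :: real measure)"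
  have H: "integrable ?P (\<lambda>(t,s). F t * G s)"
  proof (rule lborel_pair.Fubini_integrable)
    show "(\<lambda>(t,s). F t * G s) \<in> borel_measurable ?P" by measurable
    show "integrable lborel (\<lambda>x. LINT y|lborel. norm (case (x, y) of (t, s) \<Rightarrow> F t * G s))"
      using F by (simp add: norm_mult)
    show "AE x in lborel. integrable lborel (\<lambda>y. case (x, y) of (t, s) \<Rightarrow> F t * G s)"
      using G by simp
  qed
  have H1: "integrable ?P (\<lambda>(t,s). indicator {..t} s *\<^sub>R (F t * G s))"
  proof (rule Bochner_Integration.integrable_bound[OF H])
    have "(\<lambda>z::real \<times> real. indicat_real {..fst z} (snd z)) = indicat_real {z. snd z \<le> fst z}"
      by (auto simp: indicator_def fun_eq_iff)
    moreover have "{z::real\<times>real. snd z \<le> fst z} \<in> sets ?P" 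
    proof -
      have "closed {z::real\<times>real. snd z \<le> fst z}"
        by (intro closed_Collect_le continuous_intros)
      then show ?thesis by (simp only: lborel_prod) simp
    qed
    ultimately have [measurable]: "(\<lambda>z::real \<times> real. indicat_real {..fst z} (snd z)) \<in> borel_measurable ?P"
      by simp
    show "(\<lambda>(t,s). indicator {..t} s *\<^sub>R (F t * G s)) \<in> borel_measurable ?P"
      unfolding case_prod_beta by measurable
  qed (auto simp: indicator_def norm_mult)
  have H2: "integrable ?P (\<lambda>(t,s). indicator {t<..} s *\<^sub>R (F t * G s))"
  proof -
    have "(\<lambda>(t,s). indicator {t<..} s *\<^sub>R (F t * G s))
        = (\<lambda>z. (case z of (t,s) \<Rightarrow> F t * G s) - (case z of (t,s) \<Rightarrow> indicator {..t} s *\<^sub>R (F t * G s)))"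
      by (auto simp: fun_eq_iff indicator_def)
    then show ?thesis using Bochner_Integration.integrable_diff[OF H H1] by simp
  qed
  have "(\<integral>t. F t \<partial>lborel) * (\<integral>s. G s \<partial>lborel) = (\<integral>t. (\<integral>s. F t * G s \<partial>lborel) \<partial>lborel)"
    by simp
  also have "\<dots> = integral\<^sup>L ?P (\<lambda>(t,s). F t * G s)"
    using lborel_pair.integral_fst'[OF H] by simp
  also have "\<dots> = integral\<^sup>L ?P (\<lambda>(t,s). indicator {..t} s *\<^sub>R (F t * G s))
      + integral\<^sup>L ?P (\<lambda>(t,s). indicator {t<..} s *\<^sub>R (F t * G s))"
    by (subst Bochner_Integration.integral_add[OF H1 H2, symmetric], rule Bochner_Integration.integral_cong)
      (auto simp: indicator_def)
  also have "integral\<^sup>L ?P (\<lambda>(t,s). indicator {..t} s *\<^sub>R (F t * G s)) = ?A"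
    using lborel_pair.integral_fst'[OF H1] by (simp add: mult_scaleR_right[symmetric] del: mult_scaleR_right)
  also have "integral\<^sup>L ?P (\<lambda>(t,s). indicator {t<..} s *\<^sub>R (F t * G s))
      = (\<integral>s. (\<integral>t. indicator {t<..} s *\<^sub>R (F t * G s) \<partial>lborel) \<partial>lborel)"
    using lborel_pair.integral_snd[of "\<lambda>t s. indicator {t<..} s *\<^sub>R (F t * G s)"] H2 by simp
  also have "\<dots> = ?B"
  proof (rule Bochner_Integration.integral_cong[OF refl])
    fix s :: real
    have "(\<integral>t. indicator {t<..} s *\<^sub>R (F t * G s) \<partial>lborel)
        = (\<integral>t. G s * (indicator {..<s} t *\<^sub>R F t) \<partial>lborel)"
      by (rule Bochner_Integration.integral_cong) (auto simp: indicator_def)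
    also have "\<dots> = G s * (\<integral>t. indicator {..<s} t *\<^sub>R F t \<partial>lborel)"
      by (rule Bochner_Integration.integral_mult_right_zero)
    also have "(\<integral>t. indicator {..<s} t *\<^sub>R F t \<partial>lborel) = (\<integral>t. indicator {..s} t *\<^sub>R F t \<partial>lborel)"
    proof (rule integral_cong_AE)
      show "AE t in lborel. indicator {..<s} t *\<^sub>R F t = indicator {..s} t *\<^sub>R F t"
        using AE_lborel_singleton[of s] by eventually_elim (auto simp: indicator_def)
    qed auto
    finally show "(\<integral>t. indicator {t<..} s *\<^sub>R (F t * G s) \<partial>lborel)
        = G s * (\<integral>t. indicator {..s} t *\<^sub>R F t \<partial>lborel)" .
  qed
  finally show ?thesis by simp
qed

text \<open>There are no pointwise derivatives to multiply, so the product rule comes from Fubini's theorem on the square \<open>[0,x]\<^sup>2\<close>, cut along its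
diagonal.\<close>

lemma abs_cont_mult:
  assumes f: "abs_cont f f'" and g: "abs_cont g g'"
  shows "abs_cont (\<lambda>x. f x * g x) (\<lambda>x. f' x * g x + f x * g' x)"
  unfolding abs_cont_def
proof (intro conjI ballI)
  have i1: "set_integrable lborel {0..1} (\<lambda>x. f' x * g x)"
    by (intro set_integrable_mult_cont abs_cont_int[OF f] abs_cont_cont[OF g])
  have i2: "set_integrable lborel {0..1} (\<lambda>x. f x * g' x)"
    using set_integrable_mult_cont[OF abs_cont_int[OF g] abs_cont_cont[OF f]] by (simp add: mult.commute)
  show "set_integrable lborel {0..1} (\<lambda>x. f' x * g x + f x * g' x)"
    using i1 i2 by (rule set_integral_add)
  fix x :: real assume x: "x \<in> {0..1}"
  define F where "F = (\<lambda>t. indicator {0..x} t *\<^sub>R f' t)"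
  define G where "G = (\<lambda>t. indicator {0..x} t *\<^sub>R g' t)"
  have F: "integrable lborel F" and G: "integrable lborel G"
    using set_integrable_sub(1)[OF abs_cont_int[OF f], of 0 x] set_integrable_sub(1)[OF abs_cont_int[OF g], of 0 x] x
    by (auto simp: F_def G_def set_integrable_def)
  have part: "(\<integral>s. indicator {..t} s *\<^sub>R (indicator {0..x} s *\<^sub>R k' s) \<partial>lborel) = k t - k 0"
    if "abs_cont k k'" "t \<in> {0..x}" for k k' t
  proof -
    have "(\<integral>s. indicator {..t} s *\<^sub>R (indicator {0..x} s *\<^sub>R k' s) \<partial>lborel) = (LINT s:{0..t}|lborel. k' s)"
      unfolding set_lebesgue_integral_def
      by (rule Bochner_Integration.integral_cong) (use that in \<open>auto simp: indicator_def\<close>)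
    also have "\<dots> = integral {0..t} k'"
      using set_integrable_sub(3)[OF abs_cont_int[OF that(1)], of 0 t] that x by auto
    finally show ?thesis using abs_cont_eval[OF that(1), of t] that x by auto
  qed
  have tot: "(\<integral>s. indicator {0..x} s *\<^sub>R k' s \<partial>lborel) = k x - k 0" if "abs_cont k k'" for k k'
    using set_integrable_sub(3)[OF abs_cont_int[OF that], of 0 x] abs_cont_eval[OF that, of x] x
    by (simp add: set_lebesgue_integral_def)
  have half: "(\<integral>t. (indicator {0..x} t *\<^sub>R h' t) *
        (\<integral>s. indicator {..t} s *\<^sub>R (indicator {0..x} s *\<^sub>R k' s) \<partial>lborel) \<partial>lborel)
      = integral {0..x} (\<lambda>t. h' t * k t) - k 0 * (h x - h 0)"
    if h: "abs_cont h h'" and k: "abs_cont k k'" for h h' k k'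
  proof -
    have i: "set_integrable lborel {0..1} (\<lambda>t. h' t * k t)"
      by (intro set_integrable_mult_cont abs_cont_int[OF h] abs_cont_cont[OF k])
    have i2: "set_integrable lborel {0..1} (\<lambda>t. h' t * (k t - k 0))"
      by (intro set_integrable_mult_cont abs_cont_int[OF h] continuous_intros abs_cont_cont[OF k])
    have "(\<integral>t. (indicator {0..x} t *\<^sub>R h' t) *
        (\<integral>s. indicator {..t} s *\<^sub>R (indicator {0..x} s *\<^sub>R k' s) \<partial>lborel) \<partial>lborel)
        = (LINT t:{0..x}|lborel. h' t * (k t - k 0))"
      unfolding set_lebesgue_integral_def
    proof (rule Bochner_Integration.integral_cong[OF refl])
      fix t show "(indicator {0..x} t *\<^sub>R h' t) *
        (\<integral>s. indicator {..t} s *\<^sub>R (indicator {0..x} s *\<^sub>R k' s) \<partial>lborel)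
        = indicator {0..x} t *\<^sub>R (h' t * (k t - k 0))"
        using part[OF k, of t] by (cases "t \<in> {0..x}") (auto simp: indicator_def)
    qed
    also have "\<dots> = integral {0..x} (\<lambda>t. h' t * (k t - k 0))"
      using set_integrable_sub(3)[OF i2, of 0 x] x by auto
    also have "\<dots> = integral {0..x} (\<lambda>t. h' t * k t - k 0 * h' t)"
      by (simp add: algebra_simps)
    also have "\<dots> = integral {0..x} (\<lambda>t. h' t * k t) - integral {0..x} (\<lambda>t. k 0 * h' t)"
      using set_integrable_sub(2)[OF i, of 0 x] set_integrable_sub(2)[OF abs_cont_int[OF h], of 0 x] x
      by (intro Henstock_Kurzweil_Integration.integral_diff integrable_on_mult_right) auto
    finally show ?thesis using abs_cont_eval[OF h, of x] x by simp
  qed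
  have "(integral {0..x} (\<lambda>t. f' t * g t) - g 0 * (f x - f 0)) +
      (integral {0..x} (\<lambda>t. g' t * f t) - f 0 * (g x - g 0)) = (f x - f 0) * (g x - g 0)"
    using triangle_Fubini[OF F G] half[OF f g] half[OF g f] tot[OF f] tot[OF g]
    unfolding F_def G_def by metis
  moreover have "integral {0..x} (\<lambda>t. f' t * g t + f t * g' t)
      = integral {0..x} (\<lambda>t. f' t * g t) + integral {0..x} (\<lambda>t. f t * g' t)"
    using set_integrable_sub(2)[OF i1, of 0 x] set_integrable_sub(2)[OF i2, of 0 x] x
    by (intro Henstock_Kurzweil_Integration.integral_add) auto
  ultimately show "integral {0..x} (\<lambda>t. f' t * g t + f t * g' t) = f x * g x - f 0 * g 0"
    by (simp add: algebra_simps)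
qed

section \<open>Square integrable functions and Fourier coefficients\<close>

definition fourier_mode :: "int \<Rightarrow> real \<Rightarrow> complex" where
  "fourier_mode n x = exp (- 2 * of_real pi * \<i> * of_int n * of_real x)"

definition fcoeff :: "(real \<Rightarrow> complex) \<Rightarrow> int \<Rightarrow> complex" where
  "fcoeff g n = integral {0..1} (\<lambda>x. g x * fourier_mode n x)"

text \<open>Integrability of \<open>|g|\<^sup>2\<close> says nothing about the measurability of \<open>g\<close>, so integrability of \<open>g\<close> is required as well.\<close>

definition L2_bound :: "real \<Rightarrow> (real \<Rightarrow> complex) \<Rightarrow> bool" where
  "L2_bound K g \<longleftrightarrow> 0 \<le> K \<and> set_integrable lborel {0..1} g \<and>
     set_integrable lborel {0..1} (\<lambda>x. (cmod (g x))\<^sup>2) \<and>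
     integral {0..1} (\<lambda>x. (cmod (g x))\<^sup>2) \<le> K\<^sup>2"

lemma fourier_mode_norm [simp]: "cmod (fourier_mode n x) = 1"
  by (simp add: fourier_mode_def norm_exp_eq_Re)

lemma fourier_mode_deriv: "(fourier_mode n has_vector_derivative (- 2 * of_real pi * \<i> * of_int n) * fourier_mode n x) (at x within S)"
proof -
  define c where "c = - 2 * complex_of_real pi * \<i> * of_int n"
  have "((\<lambda>z. exp (c * z)) has_field_derivative c * exp (c * of_real x)) (at (of_real x))"
    by (auto intro!: derivative_eq_intros)
  then have "((\<lambda>x. exp (c * of_real x)) has_vector_derivative c * exp (c * of_real x)) (at x within S)"
    by (rule has_vector_derivative_real_field)
  then show ?thesis by (simp only: fourier_mode_def[abs_def] c_def)
qed

lemma fourier_mode_cont [continuous_intros]: "continuous_on S (fourier_mode n)"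
  unfolding fourier_mode_def[abs_def] by (intro continuous_intros)

lemma fourier_mode_abs_cont: "abs_cont (fourier_mode n) (\<lambda>x. (- 2 * of_real pi * \<i> * of_int n) * fourier_mode n x)"
  by (rule abs_cont_C1[OF fourier_mode_deriv]) (intro continuous_intros)

lemma fourier_mode_0 [simp]: "fourier_mode n 0 = 1" "fourier_mode 0 x = 1"
  by (simp_all add: fourier_mode_def)

lemma fourier_mode_1 [simp]: "fourier_mode n 1 = 1"
proof -
  have "fourier_mode n 1 = exp (- 2 * of_real pi * \<i> * of_int n)" by (simp add: fourier_mode_def)
  also have "\<dots> = 1" unfolding exp_eq_1 by (auto intro!: exI[of _ "- n"])
  finally show ?thesis .
qed

lemma fourier_mode_mult: "fourier_mode n x * cnj (fourier_mode m x) = fourier_mode (n - m) x"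
  unfolding fourier_mode_def by (simp add: exp_cnj mult_exp_exp algebra_simps)

lemma fourier_mode_integral: "integral {0..1} (fourier_mode k) = (if k = 0 then 1 else 0)"
proof (cases "k = 0")
  case False
  have "integral {0..1} (\<lambda>x. (- 2 * of_real pi * \<i> * of_int k) * fourier_mode k x) = 0"
    using abs_cont_total[OF fourier_mode_abs_cont[of k]] by simp
  then show ?thesis using False by simp
next
  case True
  then have "fourier_mode k = (\<lambda>x. 1)" by (simp add: fun_eq_iff)
  then show ?thesis using True by simp
qed

lemma set_int_dominated:
  fixes f :: "real \<Rightarrow> 'a::euclidean_space" and g :: "real \<Rightarrow> real"
  assumes "set_integrable lborel {0..1} g" "set_borel_measurable lborel {0..1} f"
    "\<And>x. x \<in> {0..1} \<Longrightarrow> norm (f x) \<le> g x"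
  shows "set_integrable lborel {0..1} f"
  by (rule set_integrable_bound[OF assms(1,2)])
    (use assms(3) in \<open>auto intro!: AE_I2 intro: order_trans[OF _ abs_ge_self]\<close>)

lemma set_meas: "set_integrable lborel {0..1} f \<Longrightarrow> set_borel_measurable lborel {0..1} f"
  for f :: "real \<Rightarrow> 'a::euclidean_space"
  unfolding set_integrable_def set_borel_measurable_def by (rule borel_measurable_integrable)

lemma set_meas_mult: 
  fixes f g :: "real \<Rightarrow> 'a::{euclidean_space,real_normed_field}"
  assumes "set_borel_measurable lborel {0..1} f" "set_borel_measurable lborel {0..1} g"
  shows "set_borel_measurable lborel {0..1} (\<lambda>x. f x * g x)"
proof -
  have "(\<lambda>x. (indicator {0..1} x *\<^sub>R f x) * (indicator {0..1} x *\<^sub>R g x)) \<in> borel_measurable lborel"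
    using assms unfolding set_borel_measurable_def by (rule borel_measurable_times)
  moreover have "(\<lambda>x. (indicator {0..1} x *\<^sub>R f x) * (indicator {0..1} x *\<^sub>R g x))
      = (\<lambda>x. indicator {0..1} x *\<^sub>R (f x * g x))"
    by (auto simp: indicator_def fun_eq_iff)
  ultimately show ?thesis by (simp add: set_borel_measurable_def)
qed

lemma set_meas_norm: 
  fixes f :: "real \<Rightarrow> 'a::euclidean_space"
  assumes "set_borel_measurable lborel {0..1} f"
  shows "set_borel_measurable lborel {0..1} (\<lambda>x. norm (f x))"
proof -
  have "(\<lambda>x. norm (indicator {0..1} x *\<^sub>R f x)) \<in> borel_measurable lborel"
    using assms unfolding set_borel_measurable_def by measurable
  moreover have "(\<lambda>x. norm (indicator {0..1} x *\<^sub>R f x)) = (\<lambda>x. indicator {0..1} x *\<^sub>R norm (f x))"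
    by (auto simp: indicator_def fun_eq_iff)
  ultimately show ?thesis by (simp add: set_borel_measurable_def)
qed

lemma set_int_norm:
  fixes f :: "real \<Rightarrow> 'a::euclidean_space"
  assumes "set_integrable lborel {0..1} f" shows "set_integrable lborel {0..1} (\<lambda>x. norm (f x))"
  using set_integrable_norm[OF assms] .

lemma integral_nonneg_always:
  fixes f :: "real \<Rightarrow> real"
  assumes "\<And>x. 0 \<le> f x" shows "0 \<le> integral S f"
  using assms by (cases "f integrable_on S") (auto intro: Henstock_Kurzweil_Integration.integral_nonneg simp: not_integrable_integral)

lemma integral_norm_le:
  fixes f :: "real \<Rightarrow> complex"
  assumes "set_integrable lborel {0..1} f" "x \<in> {0..1}"
  shows "cmod (integral {0..x} f) \<le> integral {0..x} (\<lambda>t. cmod (f t))"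
    "integral {0..x} (\<lambda>t. cmod (f t)) \<le> integral {0..1} (\<lambda>t. cmod (f t))"
proof -
  have i: "f integrable_on {0..x}" "(\<lambda>t. cmod (f t)) integrable_on {0..x}" "(\<lambda>t. cmod (f t)) integrable_on {0..1}"
    using set_integrable_sub(2)[OF assms(1), of 0 x] set_integrable_sub(2)[OF set_int_norm[OF assms(1)], of 0]
      assms(2) by auto
  show "cmod (integral {0..x} f) \<le> integral {0..x} (\<lambda>t. cmod (f t))"
    by (rule integral_norm_bound_integral) (use i in auto)
  show "integral {0..x} (\<lambda>t. cmod (f t)) \<le> integral {0..1} (\<lambda>t. cmod (f t))"
    by (rule integral_subset_le) (use i assms(2) in auto)
qed

text \<open>The quadratic polynomial \<open>\<integral> (f - t g)\<^sup>2\<close> in \<open>t\<close> is nonnegative, hence so is its discriminant with reversed sign.\<close>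

lemma cs_integral:
  fixes f g :: "real \<Rightarrow> real"
  assumes i: "(\<lambda>x. (f x)\<^sup>2) integrable_on S" "(\<lambda>x. (g x)\<^sup>2) integrable_on S" "(\<lambda>x. f x * g x) integrable_on S"
  shows "(integral S (\<lambda>x. f x * g x))\<^sup>2 \<le> integral S (\<lambda>x. (f x)\<^sup>2) * integral S (\<lambda>x. (g x)\<^sup>2)"
proof -
  define A B C where "A = integral S (\<lambda>x. (f x)\<^sup>2)" and "B = integral S (\<lambda>x. f x * g x)" and "C = integral S (\<lambda>x. (g x)\<^sup>2)"
  have quad: "0 \<le> A - 2 * t * B + t\<^sup>2 * C" for t
  proof -
    have e: "(\<lambda>x. (f x - t * g x)\<^sup>2) = (\<lambda>x. ((f x)\<^sup>2 - (2 * t) * (f x * g x)) + t\<^sup>2 * (g x)\<^sup>2)"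
      by (auto simp: power2_eq_square algebra_simps fun_eq_iff)
    have j: "(\<lambda>x. (2 * t) * (f x * g x)) integrable_on S" "(\<lambda>x. t\<^sup>2 * (g x)\<^sup>2) integrable_on S"
      using i by (auto intro: integrable_on_mult_right)
    have j2: "(\<lambda>x. (f x)\<^sup>2 - (2 * t) * (f x * g x)) integrable_on S"
      using i j by (intro integrable_diff)
    have j3: "(\<lambda>x. (f x - t * g x)\<^sup>2) integrable_on S"
      unfolding e by (rule integrable_add[OF j2 j(2)])
    have "0 \<le> integral S (\<lambda>x. (f x - t * g x)\<^sup>2)"
      by (rule Henstock_Kurzweil_Integration.integral_nonneg[OF j3]) simp
    also have "\<dots> = (A - (2 * t) * B) + t\<^sup>2 * C"
      unfolding e A_def B_def C_def
      using i j j2 by (simp only: Henstock_Kurzweil_Integration.integral_add Henstock_Kurzweil_Integration.integral_diff integral_mult_right)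
    finally show ?thesis by simp
  qed
  have C0: "0 \<le> C" unfolding C_def by (rule Henstock_Kurzweil_Integration.integral_nonneg[OF i(2)]) auto
  show ?thesis
  proof (cases "C = 0")
    case True
    have A0: "0 \<le> A" using quad[of 0] by simp
    have "B = 0"
    proof (rule ccontr)
      assume "B \<noteq> 0"
      then show False using quad[of "(A + 1) / (2 * B)"] True A0 by (simp add: field_simps)
    qed
    then show ?thesis using True by (simp add: A_def B_def C_def)
  next
    case False
    then have "0 \<le> A - B\<^sup>2 / C" using quad[of "B / C"] C0 by (simp add: power2_eq_square field_simps)
    then show ?thesis using False C0 by (simp add: A_def B_def C_def field_simps)
  qed
qed

lemma L2_bound_integral_norm:
  assumes "L2_bound K g" shows "integral {0..1} (\<lambda>x. cmod (g x)) \<le> K"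
proof -
  have K: "0 \<le> K" and g: "set_integrable lborel {0..1} g"
    and g2: "set_integrable lborel {0..1} (\<lambda>x. (cmod (g x))\<^sup>2)"
    and b: "integral {0..1} (\<lambda>x. (cmod (g x))\<^sup>2) \<le> K\<^sup>2" using assms by (auto simp: L2_bound_def)
  have i: "(\<lambda>x. cmod (g x)) integrable_on {0..1}" "(\<lambda>x. (cmod (g x))\<^sup>2) integrable_on {0..1}"
    using set_integrable_sub(2)[OF set_int_norm[OF g], of 0 1] set_integrable_sub(2)[OF g2, of 0 1] by auto
  have "(integral {0..1} (\<lambda>x. cmod (g x)))\<^sup>2 \<le> K\<^sup>2"
    using cs_integral[of "\<lambda>x. cmod (g x)" "{0..1}" "\<lambda>x. 1"] i b integrable_const_ivl[of "1::real" "0::real" 1] by simp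
  then show ?thesis using K by (rule power2_le_imp_le)
qed

lemma integral_mult_bound:
  fixes f g :: "real \<Rightarrow> complex"
  assumes f: "set_integrable lborel {0..1} f" and g: "continuous_on {0..1} g"
    and B: "\<And>t. t \<in> {0..x} \<Longrightarrow> cmod (g t) \<le> B" and x: "x \<in> {0..1}"
    and L: "integral {0..1} (\<lambda>t. cmod (f t)) \<le> L"
  shows "cmod (integral {0..x} (\<lambda>t. f t * g t)) \<le> L * B"
proof -
  have fi: "set_integrable lborel {0..1} (\<lambda>t. f t * g t)" by (rule set_integrable_mult_cont[OF f g])
  have i: "(\<lambda>t. f t * g t) integrable_on {0..x}" "(\<lambda>t. cmod (f t)) integrable_on {0..x}"
    using set_integrable_sub(2)[OF fi, of 0 x] set_integrable_sub(2)[OF set_int_norm[OF f], of 0 x] x by auto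
  have B0: "0 \<le> B" using B[of 0] x by (auto intro: order_trans[OF norm_ge_zero])
  have "cmod (integral {0..x} (\<lambda>t. f t * g t)) \<le> integral {0..x} (\<lambda>t. cmod (f t) * B)"
    by (rule integral_norm_bound_integral)
      (use i B in \<open>auto simp: norm_mult intro!: mult_left_mono integrable_on_mult_left\<close>)
  also have "\<dots> = integral {0..x} (\<lambda>t. cmod (f t)) * B" by simp
  also have "\<dots> \<le> L * B" using integral_norm_le(2)[OF f x] L B0 by (intro mult_right_mono) auto
  finally show ?thesis .
qed

text \<open>Expand the square of the distance from \<open>g\<close> to its partial Fourier sum.\<close>

lemma bessel:
  assumes g: "set_integrable lborel {0..1} g" and g2: "set_integrable lborel {0..1} (\<lambda>x. (cmod (g x))\<^sup>2)"
    and S: "finite S"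
  shows "(\<Sum>n\<in>S. (cmod (fcoeff g n))\<^sup>2) \<le> integral {0..1} (\<lambda>x. (cmod (g x))\<^sup>2)"
proof -
  define P where "P = (\<lambda>x. \<Sum>n\<in>S. cnj (fcoeff g n) * fourier_mode n x)"
  have Pc: "continuous_on {0..1} P" unfolding P_def by (intro continuous_intros)
  have gP: "(\<lambda>x. g x * P x) integrable_on {0..1}"
    using set_integrable_sub(2)[OF set_integrable_mult_cont[OF g Pc], of 0 1] by simp
  have gE: "(\<lambda>x. g x * fourier_mode n x) integrable_on {0..1}" for n
    using set_integrable_sub(2)[OF set_integrable_mult_cont[OF g fourier_mode_cont], of 0 1] by simp
  have gi2: "(\<lambda>x. (cmod (g x))\<^sup>2) integrable_on {0..1}"
    using set_integrable_sub(2)[OF g2, of 0 1] by simp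
  define s where "s = (\<Sum>n\<in>S. (cmod (fcoeff g n))\<^sup>2)"
  have I1: "integral {0..1} (\<lambda>x. g x * P x) = of_real s"
  proof -
    have "integral {0..1} (\<lambda>x. g x * P x) = integral {0..1} (\<lambda>x. \<Sum>n\<in>S. cnj (fcoeff g n) * (g x * fourier_mode n x))"
      by (simp add: P_def sum_distrib_left algebra_simps)
    also have "\<dots> = (\<Sum>n\<in>S. cnj (fcoeff g n) * fcoeff g n)"
      by (subst Henstock_Kurzweil_Integration.integral_sum[OF S]) (simp_all add: integrable_on_mult_right gE fcoeff_def)
    also have "\<dots> = of_real s"
      unfolding s_def of_real_sum by (intro sum.cong refl) (metis complex_norm_square mult.commute)
    finally show ?thesis .
  qed
  have I2: "integral {0..1} (\<lambda>x. P x * cnj (P x)) = of_real s"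
  proof -
    have "integral {0..1} (\<lambda>x. P x * cnj (P x))
        = integral {0..1} (\<lambda>x. \<Sum>n\<in>S. \<Sum>m\<in>S. (cnj (fcoeff g n) * fcoeff g m) * fourier_mode (n - m) x)"
      by (subst mult.commute, unfold P_def cnj_sum sum_product, intro arg_cong[where f = "integral {0..1}"] ext sum.cong refl)
        (simp add: fourier_mode_mult[symmetric] mult_ac)
    also have "\<dots> = (\<Sum>n\<in>S. \<Sum>m\<in>S. (cnj (fcoeff g n) * fcoeff g m) * (if n = m then 1 else 0))"
    proof -
      have i: "(\<lambda>x. c * fourier_mode k x) integrable_on {0..1}" for c k
        by (intro integrable_on_mult_right integrable_continuous_interval fourier_mode_cont)
      show ?thesis
        using S by (simp add: Henstock_Kurzweil_Integration.integral_sum integrable_sum i fourier_mode_integral)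
    qed
    also have "\<dots> = (\<Sum>n\<in>S. cnj (fcoeff g n) * fcoeff g n)"
      using S by (simp add: if_distrib cong: if_cong)
    also have "\<dots> = of_real s"
      unfolding s_def of_real_sum by (intro sum.cong refl) (metis complex_norm_square mult.commute)
    finally show ?thesis .
  qed
  have I2': "integral {0..1} (\<lambda>x. (cmod (P x))\<^sup>2) = s"
  proof -
    have "(\<lambda>x. (cmod (P x))\<^sup>2) integrable_on {0..1}"
      by (intro integrable_continuous_interval continuous_intros Pc)
    then have "integral {0..1} (\<lambda>x. complex_of_real ((cmod (P x))\<^sup>2)) = of_real (integral {0..1} (\<lambda>x. (cmod (P x))\<^sup>2))"
      using integral_linear[OF _ bounded_linear_of_real, of "\<lambda>x. (cmod (P x))\<^sup>2" "{0..1}"] by (simp add: o_def)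
    then have "complex_of_real (integral {0..1} (\<lambda>x. (cmod (P x))\<^sup>2)) = of_real s"
      using I2 by (simp only: complex_norm_square)
    then show ?thesis by (simp only: of_real_eq_iff)
  qed
  have I1': "integral {0..1} (\<lambda>x. Re (g x * P x)) = s"
    using integral_linear[OF gP bounded_linear_Re] I1 by (simp add: o_def)
  have rgP: "(\<lambda>x. Re (g x * P x)) integrable_on {0..1}"
    using integrable_linear[OF gP bounded_linear_Re] by (simp add: o_def)
  have P2: "(\<lambda>x. (cmod (P x))\<^sup>2) integrable_on {0..1}"
    by (intro integrable_continuous_interval continuous_intros Pc)
  have e: "(cmod (g x - cnj (P x)))\<^sup>2 = ((cmod (g x))\<^sup>2 - 2 * Re (g x * P x)) + (cmod (P x))\<^sup>2" for x
    unfolding cmod_power2 by (simp add: power2_eq_square algebra_simps)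
  have "0 \<le> integral {0..1} (\<lambda>x. (cmod (g x - cnj (P x)))\<^sup>2)"
    by (rule integral_nonneg_always) auto
  also have "\<dots> = (integral {0..1} (\<lambda>x. (cmod (g x))\<^sup>2) - 2 * s) + s"
    unfolding e
    apply (subst Henstock_Kurzweil_Integration.integral_add)
      apply (intro integrable_diff gi2 integrable_on_mult_right rgP)
     apply (rule P2)
    apply (subst Henstock_Kurzweil_Integration.integral_diff)
      apply (rule gi2)
     apply (intro integrable_on_mult_right rgP)
    using I1' I2' by (simp only: integral_mult_right)
  finally show ?thesis by (simp add: s_def)
qed

text \<open>Bessel's inequality for the restriction of \<open>g\<close> to \<open>[0,x]\<close>; the bound does not depend on \<open>x\<close>.\<close>

lemma bessel_partial:
  assumes g: "L2_bound K g" and S: "finite S" and x: "x \<in> {0..1}"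
  shows "(\<Sum>n\<in>S. (cmod (integral {0..x} (\<lambda>t. g t * fourier_mode n t)))\<^sup>2) \<le> K\<^sup>2"
proof -
  define h where "h = (\<lambda>t. indicator {0..x} t *\<^sub>R g t)"
  have gi: "set_integrable lborel {0..1} g" "set_integrable lborel {0..1} (\<lambda>x. (cmod (g x))\<^sup>2)"
      "integral {0..1} (\<lambda>x. (cmod (g x))\<^sup>2) \<le> K\<^sup>2" using g by (auto simp: L2_bound_def)
  have h1: "set_integrable lborel {0..1} h"
  proof -
    have "(\<lambda>t. indicator {0..1} t *\<^sub>R h t) = (\<lambda>t. indicator {0..x} t *\<^sub>R g t)"
      using x by (auto simp: h_def indicator_def fun_eq_iff)
    then show ?thesis using set_integrable_sub(1)[OF gi(1), of 0 x] x by (simp add: set_integrable_def)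
  qed
  have h2: "set_integrable lborel {0..1} (\<lambda>t. (cmod (h t))\<^sup>2)"
  proof -
    have "(\<lambda>t. indicator {0..1} t *\<^sub>R (cmod (h t))\<^sup>2) = (\<lambda>t. indicator {0..x} t *\<^sub>R (cmod (g t))\<^sup>2)"
      using x by (auto simp: h_def indicator_def fun_eq_iff)
    then show ?thesis using set_integrable_sub(1)[OF gi(2), of 0 x] x by (simp add: set_integrable_def)
  qed
  have "fcoeff h n = integral {0..x} (\<lambda>t. g t * fourier_mode n t)" for n
  proof -
    have "fcoeff h n = integral {0..1} (\<lambda>t. if t \<in> {0..x} then g t * fourier_mode n t else 0)"
      unfolding fcoeff_def by (rule Henstock_Kurzweil_Integration.integral_cong) (simp add: h_def indicator_def)
    also have "\<dots> = integral ({0..x} \<inter> {0..1}) (\<lambda>t. g t * fourier_mode n t)" by (rule integral_restrict_Int)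
    finally show ?thesis using x by (simp add: min_def)
  qed
  then have "(\<Sum>n\<in>S. (cmod (integral {0..x} (\<lambda>t. g t * fourier_mode n t)))\<^sup>2) \<le> integral {0..1} (\<lambda>x. (cmod (h x))\<^sup>2)"
    using bessel[OF h1 h2 S] by simp
  also have "\<dots> \<le> integral {0..1} (\<lambda>x. (cmod (g x))\<^sup>2)"
    by (rule integral_le) (use set_integrable_sub(2)[OF h2, of 0 1] set_integrable_sub(2)[OF gi(2), of 0 1] in \<open>auto simp: h_def indicator_def\<close>)
  finally show ?thesis using gi(3) by simp
qed

lemma bessel_L2_bound:
  assumes "L2_bound K g" "finite S" shows "(\<Sum>n\<in>S. (cmod (fcoeff g n))\<^sup>2) \<le> K\<^sup>2"
  using bessel_partial[OF assms, of 1] by (simp add: fcoeff_def)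

text \<open>Control of the partial Fourier integrals uniformly in \<open>x\<close> would require a maximal inequality. Their mean square in \<open>x\<close> is enough below,
and it only requires the previous bound to be integrated over \<open>x\<close>.\<close>

lemma bessel_square_function:
  assumes g: "L2_bound K g" and S: "finite S"
  shows "(\<Sum>n\<in>S. integral {0..1} (\<lambda>x. (cmod (integral {0..x} (\<lambda>t. g t * fourier_mode n t)))\<^sup>2)) \<le> K\<^sup>2"
proof -
  have c: "continuous_on {0..1} (\<lambda>x. integral {0..x} (\<lambda>t. g t * fourier_mode n t))" for n
    using set_integrable_sub(2)[OF set_integrable_mult_cont[of g "fourier_mode n"], of 0 1] g fourier_mode_cont
    by (intro indefinite_integral_continuous_1) (auto simp: L2_bound_def)
  have i: "(\<lambda>x. (cmod (integral {0..x} (\<lambda>t. g t * fourier_mode n t)))\<^sup>2) integrable_on {0..1}" for n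
    by (intro integrable_continuous_interval continuous_intros c)
  have "(\<Sum>n\<in>S. integral {0..1} (\<lambda>x. (cmod (integral {0..x} (\<lambda>t. g t * fourier_mode n t)))\<^sup>2))
     = integral {0..1} (\<lambda>x. \<Sum>n\<in>S. (cmod (integral {0..x} (\<lambda>t. g t * fourier_mode n t)))\<^sup>2)"
    by (rule Henstock_Kurzweil_Integration.integral_sum[symmetric]) (use S i in auto)
  also have "\<dots> \<le> integral {0..1} (\<lambda>x::real. K\<^sup>2)"
    by (rule integral_le) (use bessel_partial[OF g S] i S in \<open>auto intro!: integrable_sum\<close>)
  finally show ?thesis by simp
qed

lemma L2_bound_mono: "L2_bound K g \<Longrightarrow> K \<le> L \<Longrightarrow> L2_bound L g"
  unfolding L2_bound_def by (auto intro: order_trans power_mono)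

lemma L2_bound_mult_cont:
  assumes g: "L2_bound K g" and f: "continuous_on {0..1} f" and B: "\<And>x. x \<in> {0..1} \<Longrightarrow> cmod (f x) \<le> B"
  shows "L2_bound (K * B) (\<lambda>x. g x * f x)"
proof -
  have B0: "0 \<le> B" using B[of 0] by (auto intro: order_trans[OF norm_ge_zero])
  have g': "0 \<le> K" "set_integrable lborel {0..1} g" "set_integrable lborel {0..1} (\<lambda>x. (cmod (g x))\<^sup>2)"
      "integral {0..1} (\<lambda>x. (cmod (g x))\<^sup>2) \<le> K\<^sup>2" using g by (auto simp: L2_bound_def)
  have 1: "set_integrable lborel {0..1} (\<lambda>x. g x * f x)" by (rule set_integrable_mult_cont[OF g'(2) f])
  have le: "(cmod (g x * f x))\<^sup>2 \<le> (cmod (g x))\<^sup>2 * B\<^sup>2" if "x \<in> {0..1}" for x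
    using B[OF that] by (auto simp: norm_mult power_mult_distrib intro!: mult_left_mono power_mono)
  have gB: "set_integrable lborel {0..1} (\<lambda>x. (cmod (g x))\<^sup>2 * B\<^sup>2)"
    using g'(3) by simp
  have 2: "set_integrable lborel {0..1} (\<lambda>x. (cmod (g x * f x))\<^sup>2)"
    by (rule set_int_dominated[OF gB])
      (use le set_meas_mult[OF set_meas_norm[OF set_meas[OF 1]] set_meas_norm[OF set_meas[OF 1]]]
       in \<open>auto simp: power2_eq_square\<close>)
  have "integral {0..1} (\<lambda>x. (cmod (g x * f x))\<^sup>2) \<le> integral {0..1} (\<lambda>x. (cmod (g x))\<^sup>2 * B\<^sup>2)"
    by (rule integral_le) (use set_integrable_sub(2)[OF 2, of 0 1] set_integrable_sub(2)[OF gB, of 0 1] le in auto)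
  also have "\<dots> = integral {0..1} (\<lambda>x. (cmod (g x))\<^sup>2) * B\<^sup>2" by simp
  also have "\<dots> \<le> K\<^sup>2 * B\<^sup>2" by (intro mult_right_mono g') auto
  finally show ?thesis using 1 2 g' B0 by (simp add: L2_bound_def power_mult_distrib)
qed

lemma L2_bound_cont:
  assumes f: "continuous_on {0..1} f" and B: "\<And>x. x \<in> {0..1} \<Longrightarrow> cmod (f x) \<le> B"
  shows "L2_bound B f"
proof -
  have "L2_bound 1 (\<lambda>x. 1)" by (simp add: L2_bound_def set_integrable_cont)
  from L2_bound_mult_cont[OF this f B] show ?thesis by simp
qed

lemma L2_bound_add:
  assumes f: "L2_bound K f" and g: "L2_bound L g"
  shows "L2_bound (2 * (K + L)) (\<lambda>x. f x + g x)"
proof -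
  have f': "0 \<le> K" "set_integrable lborel {0..1} f" "set_integrable lborel {0..1} (\<lambda>x. (cmod (f x))\<^sup>2)"
      "integral {0..1} (\<lambda>x. (cmod (f x))\<^sup>2) \<le> K\<^sup>2" using f by (auto simp: L2_bound_def)
  have g': "0 \<le> L" "set_integrable lborel {0..1} g" "set_integrable lborel {0..1} (\<lambda>x. (cmod (g x))\<^sup>2)"
      "integral {0..1} (\<lambda>x. (cmod (g x))\<^sup>2) \<le> L\<^sup>2" using g by (auto simp: L2_bound_def)
  have 1: "set_integrable lborel {0..1} (\<lambda>x. f x + g x)" using f'(2) g'(2) by (rule set_integral_add)
  have le: "(cmod (f x + g x))\<^sup>2 \<le> 2 * (cmod (f x))\<^sup>2 + 2 * (cmod (g x))\<^sup>2" for x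
  proof -
    have "(cmod (f x + g x))\<^sup>2 \<le> (cmod (f x) + cmod (g x))\<^sup>2"
      by (intro power_mono norm_triangle_ineq) auto
    moreover have "0 \<le> (cmod (f x) - cmod (g x))\<^sup>2" by simp
    ultimately show ?thesis unfolding power2_sum power2_diff by linarith
  qed
  have d: "set_integrable lborel {0..1} (\<lambda>x. 2 * (cmod (f x))\<^sup>2 + 2 * (cmod (g x))\<^sup>2)"
    using f'(3) g'(3) by (intro set_integral_add set_integrable_mult_right) auto
  have 2: "set_integrable lborel {0..1} (\<lambda>x. (cmod (f x + g x))\<^sup>2)"
    by (rule set_int_dominated[OF d])
      (use le set_meas_mult[OF set_meas_norm[OF set_meas[OF 1]] set_meas_norm[OF set_meas[OF 1]]]
       in \<open>auto simp: power2_eq_square\<close>)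
  have "integral {0..1} (\<lambda>x. (cmod (f x + g x))\<^sup>2) \<le> integral {0..1} (\<lambda>x. 2 * (cmod (f x))\<^sup>2 + 2 * (cmod (g x))\<^sup>2)"
    by (rule integral_le) (use set_integrable_sub(2)[OF 2, of 0 1] set_integrable_sub(2)[OF d, of 0 1] le in auto)
  also have "\<dots> = 2 * integral {0..1} (\<lambda>x. (cmod (f x))\<^sup>2) + 2 * integral {0..1} (\<lambda>x. (cmod (g x))\<^sup>2)"
    by (subst Henstock_Kurzweil_Integration.integral_add)
      (use set_integrable_sub(2)[OF f'(3), of 0 1] set_integrable_sub(2)[OF g'(3), of 0 1] in \<open>auto intro: integrable_on_mult_right\<close>)
  also have "\<dots> \<le> 2 * K\<^sup>2 + 2 * L\<^sup>2" using f' g' by auto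
  also have "\<dots> \<le> (2 * (K + L))\<^sup>2" using f' g' by (simp add: power2_eq_square algebra_simps)
  finally show ?thesis using 1 2 f' g' by (simp add: L2_bound_def)
qed

lemma fcoeff_deriv:
  assumes f: "abs_cont f f'" and per: "f 1 = f 0"
  shows "fcoeff f' n = 2 * of_real pi * \<i> * of_int n * fcoeff f n"
proof -
  have m: "abs_cont (\<lambda>x. f x * fourier_mode n x) (\<lambda>x. f' x * fourier_mode n x + f x * ((- 2 * of_real pi * \<i> * of_int n) * fourier_mode n x))"
    by (rule abs_cont_mult[OF f fourier_mode_abs_cont])
  have i1: "(\<lambda>x. f' x * fourier_mode n x) integrable_on {0..1}"
    using set_integrable_sub(2)[OF set_integrable_mult_cont[OF abs_cont_int[OF f] fourier_mode_cont], of 0 1] by simp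
  have i2: "(\<lambda>x. f x * fourier_mode n x) integrable_on {0..1}"
    by (intro integrable_continuous_interval continuous_intros abs_cont_cont[OF f])
  have "0 = integral {0..1} (\<lambda>x. f' x * fourier_mode n x + f x * ((- 2 * of_real pi * \<i> * of_int n) * fourier_mode n x))"
    using abs_cont_total[OF m] per by simp
  also have "\<dots> = integral {0..1} (\<lambda>x. f' x * fourier_mode n x + (- 2 * of_real pi * \<i> * of_int n) * (f x * fourier_mode n x))"
    by (simp add: algebra_simps)
  also have "\<dots> = fcoeff f' n + (- 2 * of_real pi * \<i> * of_int n) * fcoeff f n"
    unfolding fcoeff_def
    by (subst Henstock_Kurzweil_Integration.integral_add[OF i1 integrable_on_mult_right[OF i2]])
      (simp only: integral_mult_right)
  finally show ?thesis by simp
qed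

section \<open>The linear system: existence and uniqueness\<close>

text \<open>The integral from \<open>0\<close> to \<open>x\<close> with its sign for \<open>x < 0\<close>, written with Henstock--Kurzweil integrals because their fundamental theorem
needs no measurability conditions.\<close>

definition oriented_integral :: "(real \<Rightarrow> 'a::euclidean_space) \<Rightarrow> real \<Rightarrow> 'a" where
  "oriented_integral f x = integral {0..x} f - integral {x..0} f"

lemma oriented_integral_0 [simp]: "oriented_integral f 0 = 0"
  by (simp add: oriented_integral_def)

lemma oriented_integral_nonneg: "0 \<le> x \<Longrightarrow> oriented_integral f x = integral {0..x} f"
  by (cases "x = 0") (auto simp: oriented_integral_def)

lemma oriented_integral_nonpos: "x \<le> 0 \<Longrightarrow> oriented_integral f x = - integral {x..0} f"
  by (cases "x = 0") (auto simp: oriented_integral_def)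

lemma oriented_integral_shift:
  assumes f: "f integrable_on {-b..b}" and x: "x \<in> {-b..b}"
  shows "oriented_integral f x = integral {-b..x} f - integral {-b..0} f"
proof (cases "0 \<le> x")
  case True
  have "integral {-b..0} f + integral {0..x} f = integral {-b..x} f"
    by (rule Henstock_Kurzweil_Integration.integral_combine)
      (use True x in \<open>auto intro: integrable_subinterval_real[OF f]\<close>)
  then show ?thesis using True by (simp add: oriented_integral_nonneg algebra_simps)
next
  case False
  have "integral {-b..x} f + integral {x..0} f = integral {-b..0} f"
    by (rule Henstock_Kurzweil_Integration.integral_combine)
      (use False x in \<open>auto intro: integrable_subinterval_real[OF f]\<close>)
  then show ?thesis using False by (simp add: oriented_integral_nonpos algebra_simps)
qed

lemma oriented_integral_deriv:
  assumes f: "continuous_on UNIV f"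
  shows "(oriented_integral f has_vector_derivative f x) (at x)"
proof -
  define b where "b = \<bar>x\<bar> + 1"
  have x: "x \<in> {-b<..<b}" by (auto simp: b_def)
  have fcoeff: "continuous_on {-b..b} f" using f by (rule continuous_on_subset) auto
  have "((\<lambda>u. integral {-b..u} f - integral {-b..0} f) has_vector_derivative f x - 0) (at x within {-b..b})"
    by (intro has_vector_derivative_diff integral_has_vector_derivative[OF fcoeff] has_vector_derivative_const)
      (use x in auto)
  then have "(oriented_integral f has_vector_derivative f x - 0) (at x within {-b..b})"
    by (rule has_vector_derivative_transform[rotated 2])
      (use x oriented_integral_shift[OF integrable_continuous_interval[OF fcoeff]] in auto)
  moreover have "at x within {-b..b} = at x" by (rule at_within_interior) (use x in auto)
  ultimately show ?thesis by simp
qed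

lemma oriented_integral_cont:
  assumes f: "\<And>b. f integrable_on {-b..b}"
  shows "continuous_on UNIV (oriented_integral f)"
proof -
  have "isCont (oriented_integral f) x" for x
  proof -
    define b where "b = \<bar>x\<bar> + 1"
    have x: "x \<in> {-b<..<b}" by (auto simp: b_def)
    have "continuous_on {-b..b} (\<lambda>u. integral {-b..u} f - integral {-b..0} f)"
      by (intro continuous_intros indefinite_integral_continuous_1 f)
    then have "continuous_on {-b..b} (oriented_integral f)"
      by (rule continuous_on_eq) (auto simp: oriented_integral_shift[OF f])
    then have "continuous_on {-b<..<b} (oriented_integral f)" by (rule continuous_on_subset) auto
    then show ?thesis using x by (simp add: continuous_on_eq_continuous_at)
  qed
  then show ?thesis by (simp add: continuous_at_imp_continuous_on)
qed

lemma oriented_integral_LBINT: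
  fixes g :: "real \<Rightarrow> 'a::euclidean_space"
  assumes "\<And>a b. {a..b} \<subseteq> S \<Longrightarrow> set_integrable lborel {a..b} g"
    and "{0..x} \<subseteq> S" "{x..0} \<subseteq> S"
  shows "(LBINT t=0..x. g t) = oriented_integral g x"
proof (cases "0 \<le> x")
  case True
  then show ?thesis using interval_integral_eq_integral[OF True assms(1)[OF assms(2)]]
    by (simp add: oriented_integral_nonneg zero_ereal_def)
next
  case False
  then have x: "x \<le> 0" by simp
  have "(LBINT t=x..0. g t) = integral {x..0} g"
    using interval_integral_eq_integral[OF x assms(1)[OF assms(3)]] by (simp add: zero_ereal_def)
  then show ?thesis using x by (subst interval_integral_endpoints_reverse) (simp add: oriented_integral_nonpos)
qed

lemma oriented_integral_bound:
  fixes f :: "real \<Rightarrow> 'a::euclidean_space"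
  assumes f: "continuous_on UNIV f" and k: "0 < k"
    and le: "\<And>t. norm (f t) \<le> c * exp (k * \<bar>t\<bar>)"
  shows "norm (oriented_integral f x) \<le> c / k * exp (k * \<bar>x\<bar>)"
proof -
  have i: "f integrable_on {a..b}" for a b
    by (rule integrable_continuous_interval[OF continuous_on_subset[OF f]]) auto
  have c: "0 \<le> c" using order_trans[OF norm_ge_zero le[of 0]] by simp
  show ?thesis
  proof (cases "0 \<le> x")
    case True
    have h: "((\<lambda>t. c * exp (k * t)) has_integral (c / k * exp (k * x) - c / k * exp (k * 0))) {0..x}"
      by (rule fundamental_theorem_of_calculus)
        (use True k in \<open>auto intro!: derivative_eq_intros simp flip: has_real_derivative_iff_has_vector_derivative\<close>)
    have "norm (integral {0..x} f) \<le> integral {0..x} (\<lambda>t. c * exp (k * t))"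
      by (rule integral_norm_bound_integral[OF i]) (use h le True in \<open>auto simp: abs_of_nonneg dest: has_integral_integrable split: if_splits intro: order_trans[OF le]\<close>)
    also have "\<dots> \<le> c / k * exp (k * x)" using integral_unique[OF h] c k by simp
    finally show ?thesis using True by (simp add: oriented_integral_nonneg)
  next
    case False
    have h: "((\<lambda>t. c * exp (- (k * t))) has_integral (- c / k * exp (- (k * 0)) - (- c / k * exp (- (k * x))))) {x..0}"
      by (rule fundamental_theorem_of_calculus)
        (use False k in \<open>auto intro!: derivative_eq_intros simp flip: has_real_derivative_iff_has_vector_derivative\<close>)
    have "norm (integral {x..0} f) \<le> integral {x..0} (\<lambda>t. c * exp (- (k * t)))"
    proof (rule integral_norm_bound_integral[OF i])
      show "(\<lambda>t. c * exp (- (k * t))) integrable_on {x..0}" using h by (rule has_integral_integrable)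
      fix t assume "t \<in> {x..0}" then show "norm (f t) \<le> c * exp (- (k * t))" using le[of t] by simp
    qed
    also have "\<dots> \<le> c / k * exp (- (k * x))" using integral_unique[OF h] c k by simp
    finally show ?thesis using False by (simp add: oriented_integral_nonpos)
  qed
qed

text \<open>For the rescaled unknown \<open>exp (- 2 k |x|) y(x)\<close> the Picard map acts on bounded continuous functions on the whole line and contracts
distances by \<open>1/2\<close>, so that a single fixed point gives a global solution.\<close>

lemma linear_ode_exists:
  fixes L :: "real \<Rightarrow> 'a::euclidean_space \<Rightarrow> 'a"
  assumes lin: "\<And>x. linear (L x)" and bd: "\<And>x y. norm (L x y) \<le> k * norm y" and k: "0 < k"
    and cont: "\<And>y. continuous_on UNIV y \<Longrightarrow> continuous_on UNIV (\<lambda>x. L x (y x))"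
  obtains y where "y 0 = y0" "\<And>x. (y has_vector_derivative L x (y x)) (at x)"
proof -
  define w where "w = (\<lambda>x::real. exp (2 * k * \<bar>x\<bar>))"
  have wpos: "w x > 0" for x by (simp add: w_def)
  have w1: "w x \<ge> 1" for x using k by (simp add: w_def)
  have wc: "continuous_on UNIV w" unfolding w_def by (intro continuous_intros)
  \<comment> \<open>If \<open>n\<close> is the rescaled unknown, then \<open>f n\<close> is the right-hand side for \<open>y = w n\<close>.\<close>
  define f where "f = (\<lambda>n x. w x *\<^sub>R L x (n x))"
  define T where "T = (\<lambda>n x. (y0 + oriented_integral (f n) x) /\<^sub>R w x)"
  have fcont: "continuous_on UNIV (f n)" if "continuous_on UNIV n" for n
    unfolding f_def by (intro continuous_intros wc cont that)
  have fdiff: "f n x - f m x = f (\<lambda>x. n x - m x) x" for n m x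
    by (simp add: f_def linear_diff[OF lin] scaleR_diff_right)
  have fbd: "norm (f n t) \<le> (k * d) * exp ((2 * k) * \<bar>t\<bar>)" if "norm (n t) \<le> d" for n t d
  proof -
    have "norm (L t (n t)) \<le> k * d" using bd[of t "n t"] that k by (meson mult_left_mono less_imp_le order_trans)
    then show ?thesis by (simp add: f_def w_def mult.commute mult_left_mono)
  qed
  have obd: "norm (oriented_integral (f n) x) \<le> d / 2 * w x" if "continuous_on UNIV n" "\<And>t. norm (n t) \<le> d" for n x d
    using oriented_integral_bound[OF fcont[OF that(1)], of "2 * k" "k * d" x] fbd that(2) k by (simp add: w_def)
  have Tcont: "continuous_on UNIV (T n)" if "continuous_on UNIV n" for n
    unfolding T_def
    by (intro continuous_intros wc continuous_at_imp_continuous_on ballI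
        has_vector_derivative_continuous[OF oriented_integral_deriv[OF fcont[OF that]]])
      (use wpos in \<open>auto simp: less_imp_neq[symmetric] dest: less_imp_neq\<close>)
  have Tb: "T (apply_bcontfun n) \<in> bcontfun" for n :: "real \<Rightarrow>\<^sub>C 'a"
  proof (rule bcontfun_normI[OF Tcont])
    show "continuous_on UNIV (apply_bcontfun n)" by simp
    fix x
    have "norm (oriented_integral (f (apply_bcontfun n)) x) \<le> norm n / 2 * w x"
      by (rule obd) (auto simp: norm_bounded)
    then have *: "norm (y0 + oriented_integral (f (apply_bcontfun n)) x) \<le> norm y0 * w x + norm n / 2 * w x"
      using norm_triangle_ineq[of y0 "oriented_integral (f (apply_bcontfun n)) x"] mult_left_mono[OF w1[of x], of "norm y0"] by simp
    show "norm (T (apply_bcontfun n) x) \<le> norm y0 + norm n / 2"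
    proof -
      have e: "norm (T (apply_bcontfun n) x) = norm (y0 + oriented_integral (f (apply_bcontfun n)) x) / w x"
        using wpos[of x] by (simp add: T_def divide_inverse mult.commute)
      show ?thesis using * wpos[of x] unfolding e by (subst pos_divide_le_eq) (auto simp: algebra_simps)
    qed
  qed
  define T' where "T' = (\<lambda>n :: real \<Rightarrow>\<^sub>C 'a. Bcontfun (T (apply_bcontfun n)))"
  have T'a: "apply_bcontfun (T' n) = T (apply_bcontfun n)" for n
    unfolding T'_def by (rule Bcontfun_inverse[OF Tb])
  have lip: "dist (T' n) (T' m) \<le> 1 / 2 * dist n m" for n m
  proof (rule dist_bound)
    fix x
    let ?n = "apply_bcontfun n" and ?m = "apply_bcontfun m"
    have c: "continuous_on UNIV ?n" "continuous_on UNIV ?m" by auto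
    have i: "f k integrable_on {a..b}" if "continuous_on UNIV k" for k a b
      by (rule integrable_continuous_interval[OF continuous_on_subset[OF fcont[OF that]]]) auto
    have "oriented_integral (f ?n) x - oriented_integral (f ?m) x = oriented_integral (f (\<lambda>x. ?n x - ?m x)) x"
      unfolding oriented_integral_def fdiff[symmetric]
      using i[OF c(1)] i[OF c(2)] by (simp add: Henstock_Kurzweil_Integration.integral_diff)
    moreover have "norm (oriented_integral (f (\<lambda>x. ?n x - ?m x)) x) \<le> dist n m / 2 * w x"
      by (rule obd) (auto intro!: continuous_intros simp: dist_norm[symmetric] dist_bounded)
    ultimately have "norm (oriented_integral (f ?n) x - oriented_integral (f ?m) x) \<le> dist n m / 2 * w x" by simp
    moreover have "dist (T ?n x) (T ?m x) = norm (oriented_integral (f ?n) x - oriented_integral (f ?m) x) / w x"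
      using wpos[of x] by (simp add: T_def dist_norm divide_inverse mult.commute flip: scaleR_diff_right)
    ultimately show "dist (apply_bcontfun (T' n) x) (apply_bcontfun (T' m) x) \<le> 1 / 2 * dist n m"
      using wpos[of x] unfolding T'a by (simp add: pos_divide_le_eq)
  qed
  obtain n where n: "T' n = n"
    using banach_fix_type[of "1/2" T'] lip by auto
  define y where "y = (\<lambda>x. w x *\<^sub>R apply_bcontfun n x)"
  have fy: "f (apply_bcontfun n) x = L x (y x)" for x
    by (simp add: f_def y_def linear_cmul[OF lin])
  have yeq: "y x = y0 + oriented_integral (\<lambda>x. L x (y x)) x" for x
  proof -
    have "apply_bcontfun n x = T (apply_bcontfun n) x" using T'a[of n] n by simp
    then have "apply_bcontfun n x = (y0 + oriented_integral (\<lambda>x. L x (y x)) x) /\<^sub>R w x"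
      unfolding T_def by (simp add: fy[abs_def])
    then show ?thesis using wpos[of x] by (simp add: y_def)
  qed
  have yc: "continuous_on UNIV y" unfolding y_def by (intro continuous_intros wc) auto
  show thesis
  proof
    show "y 0 = y0" using yeq[of 0] by simp
    fix x
    have "((\<lambda>x. y0 + oriented_integral (\<lambda>x. L x (y x)) x) has_vector_derivative 0 + L x (y x)) (at x)"
      by (intro has_vector_derivative_add has_vector_derivative_const oriented_integral_deriv cont yc)
    moreover have "(\<lambda>x. y0 + oriented_integral (\<lambda>x. L x (y x)) x) = y" by (rule ext) (rule yeq[symmetric])
    ultimately show "(y has_vector_derivative L x (y x)) (at x)" by simp
  qed
qed

text \<open>The first-order form of \<open>L(\<phi>) F = z F\<close> for \<open>u = \<i> \<phi>\<^sub>1\<close> and \<open>v = - \<i> \<phi>\<^sub>2\<close>. Derivatives are relative to \<open>S\<close>, which is the whole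
line for the fundamental matrix and \<open>[0,1]\<close> for eigenfunctions.\<close>

definition zs_on :: "real set \<Rightarrow> complex \<Rightarrow> (real \<Rightarrow> complex) \<Rightarrow> (real \<Rightarrow> complex) \<Rightarrow>
    (real \<Rightarrow> complex) \<Rightarrow> (real \<Rightarrow> complex) \<Rightarrow> bool" where
  "zs_on S z u v f g \<longleftrightarrow> (\<forall>x\<in>S.
     (f has_vector_derivative (- \<i> * z * f x + u x * g x)) (at x within S) \<and>
     (g has_vector_derivative (\<i> * z * g x + v x * f x)) (at x within S))"

lemma zs_on_subset: "zs_on S z u v f g \<Longrightarrow> T \<subseteq> S \<Longrightarrow> zs_on T z u v f g"
  unfolding zs_on_def by (blast intro: has_vector_derivative_within_subset)

lemma zs_on_combine:
  assumes "zs_on S z u v f g" "zs_on S z u v h k"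
  shows "zs_on S z u v (\<lambda>x. a * f x + b * h x) (\<lambda>x. a * g x + b * k x)"
  using assms unfolding zs_on_def
  by (auto intro!: derivative_eq_intros simp: algebra_simps)

text \<open>The coefficient matrix has trace zero, so the potential drops out and only the difference of the spectral parameters remains.\<close>

lemma zs_wronskian_deriv:
  assumes 1: "zs_on S z u v f g" and 2: "zs_on S w u v h k" and x: "x \<in> S"
  shows "((\<lambda>x. f x * k x - g x * h x) has_vector_derivative (\<i> * (w - z) * (f x * k x + g x * h x))) (at x within S)"
proof -
  have d: "(f has_vector_derivative (- \<i> * z * f x + u x * g x)) (at x within S)"
     "(g has_vector_derivative (\<i> * z * g x + v x * f x)) (at x within S)"
     "(h has_vector_derivative (- \<i> * w * h x + u x * k x)) (at x within S)"
     "(k has_vector_derivative (\<i> * w * k x + v x * h x)) (at x within S)"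
    using 1 2 x by (auto simp: zs_on_def)
  have "((\<lambda>x. f x * k x - g x * h x) has_vector_derivative
     ((f x * (\<i> * w * k x + v x * h x) + (- \<i> * z * f x + u x * g x) * k x)
     - (g x * (- \<i> * w * h x + u x * k x) + (\<i> * z * g x + v x * f x) * h x))) (at x within S)"
    by (intro has_vector_derivative_diff has_vector_derivative_mult d)
  then show ?thesis by (simp add: algebra_simps)
qed

lemma zs_wronskian_const:
  assumes 1: "zs_on S z u v f g" and 2: "zs_on S z u v h k" and S: "convex S" "x \<in> S" "0 \<in> S"
  shows "f x * k x - g x * h x = f 0 * k 0 - g 0 * h 0"
proof -
  have "\<exists>c. \<forall>x\<in>S. f x * k x - g x * h x = c"
    by (rule has_derivative_zero_constant[OF S(1)])
      (use zs_wronskian_deriv[OF 1 2] in \<open>auto simp: has_vector_derivative_def\<close>)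
  then show ?thesis using S by metis
qed

lemma zs_exists:
  assumes u: "continuous_on UNIV u" "\<And>x. cmod (u x) \<le> U" and v: "continuous_on UNIV v" "\<And>x. cmod (v x) \<le> U"
  obtains f g where "f 0 = a" "g 0 = b" "zs_on UNIV z u v f g"
proof -
  define L where "L = (\<lambda>x (y::complex \<times> complex). (- \<i> * z * fst y + u x * snd y, \<i> * z * snd y + v x * fst y))"
  have U0: "0 \<le> U" using order_trans[OF norm_ge_zero u(2)] .
  define k where "k = 4 * (cmod z + U) + 1"
  have kpos: "0 < k" using U0 by (simp add: k_def add_nonneg_pos)
  obtain y where y: "y 0 = (a, b)" "\<And>x. (y has_vector_derivative L x (y x)) (at x)"
  proof (rule linear_ode_exists[of L k "(a, b)"])
    show "linear (L x)" for x
      by (rule linearI) (auto simp: L_def algebra_simps)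
    show "norm (L x y) \<le> k * norm y" for x y
    proof -
      have n: "cmod (fst y) \<le> norm y" "cmod (snd y) \<le> norm y"
        using norm_fst_le[of "fst y" "snd y"] norm_snd_le[of "snd y" "fst y"] by auto
      have "cmod (- \<i> * z * fst y + u x * snd y) \<le> cmod z * norm y + U * norm y"
        by (rule order_trans[OF norm_triangle_ineq]) (auto simp: norm_mult intro!: add_mono mult_mono n u U0)
      moreover have "cmod (\<i> * z * snd y + v x * fst y) \<le> cmod z * norm y + U * norm y"
        by (rule order_trans[OF norm_triangle_ineq]) (auto simp: norm_mult intro!: add_mono mult_mono n v U0)
      ultimately have "norm (L x y) \<le> 2 * (cmod z + U) * norm y"
        unfolding L_def by (intro order_trans[OF norm_Pair_le]) (auto simp: algebra_simps)
      also have "\<dots> \<le> k * norm y" using U0 by (intro mult_right_mono) (auto simp: k_def)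
      finally show ?thesis .
    qed
    show "continuous_on UNIV (\<lambda>x. L x (y x))" if "continuous_on UNIV y" for y
      unfolding L_def by (intro continuous_intros that u v)
  qed (use kpos in auto)
  show thesis
  proof (rule that[of "\<lambda>x. fst (y x)" "\<lambda>x. snd (y x)"])
    show "fst (y 0) = a" "snd (y 0) = b" using y by auto
    show "zs_on UNIV z u v (\<lambda>x. fst (y x)) (\<lambda>x. snd (y x))"
      unfolding zs_on_def
    proof (intro ballI conjI)
      fix x
      show "((\<lambda>x. fst (y x)) has_vector_derivative - \<i> * z * fst (y x) + u x * snd (y x)) (at x)"
        using bounded_linear.has_vector_derivative[OF bounded_linear_fst y(2)[of x]] by (simp add: L_def)
      show "((\<lambda>x. snd (y x)) has_vector_derivative \<i> * z * snd (y x) + v x * fst (y x)) (at x)"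
        using bounded_linear.has_vector_derivative[OF bounded_linear_snd y(2)[of x]] by (simp add: L_def)
    qed
  qed
qed

text \<open>The Wronskians of \<open>(f, g)\<close> with two solutions that have Wronskian one are constant and vanish at \<open>0\<close>; they determine \<open>f\<close> and \<open>g\<close>.\<close>

lemma zs_zero:
  assumes u: "continuous_on UNIV u" "\<And>x. cmod (u x) \<le> U" and v: "continuous_on UNIV v" "\<And>x. cmod (v x) \<le> U"
    and f: "zs_on S z u v f g" "f 0 = 0" "g 0 = 0" and S: "convex S" "0 \<in> S" "x \<in> S"
  shows "f x = 0 \<and> g x = 0"
proof -
  obtain p q where p: "p 0 = 1" "q 0 = 0" "zs_on UNIV z u v p q" using zs_exists[OF u v] .
  obtain r s where r: "r 0 = 0" "s 0 = 1" "zs_on UNIV z u v r s" using zs_exists[OF u v] .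
  have p': "zs_on S z u v p q" and r': "zs_on S z u v r s"
    using zs_on_subset[OF p(3)] zs_on_subset[OF r(3)] by auto
  have 1: "p x * s x - q x * r x = 1" using zs_wronskian_const[OF p' r' S(1,3,2)] p r by simp
  have 2: "f x * q x - g x * p x = 0" "f x * s x - g x * r x = 0"
    using zs_wronskian_const[OF f(1) p' S(1,3,2)] zs_wronskian_const[OF f(1) r' S(1,3,2)] f by auto
  have "f x * (p x * s x - q x * r x) = p x * (f x * s x - g x * r x) - r x * (f x * q x - g x * p x)"
       "g x * (p x * s x - q x * r x) = q x * (f x * s x - g x * r x) - s x * (f x * q x - g x * p x)"
    by (simp_all add: algebra_simps)
  then show ?thesis unfolding 1 2 by simp
qed

lemma zs_unique:
  assumes u: "continuous_on UNIV u" "\<And>x. cmod (u x) \<le> U" and v: "continuous_on UNIV v" "\<And>x. cmod (v x) \<le> U"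
    and f: "zs_on S z u v f g" "zs_on S z u v h k" "f 0 = h 0" "g 0 = k 0" and S: "convex S" "0 \<in> S" "x \<in> S"
  shows "f x = h x" "g x = k x"
  using zs_zero[OF u v zs_on_combine[OF f(1,2), of 1 "-1"] _ _ S] f(3,4) by auto

section \<open>First-order asymptotics of solutions\<close>

definition cexp :: "complex \<Rightarrow> real \<Rightarrow> complex" where
  "cexp c x = exp (c * of_real x)"

lemma cexp_deriv: "(cexp c has_vector_derivative c * cexp c x) (at x within S)"
proof -
  have "((\<lambda>z. exp (c * z)) has_field_derivative c * exp (c * of_real x)) (at (of_real x))"
    by (auto intro!: derivative_eq_intros)
  then have "((\<lambda>x. exp (c * of_real x)) has_vector_derivative c * exp (c * of_real x)) (at x within S)"
    by (rule has_vector_derivative_real_field)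
  then show ?thesis by (simp only: cexp_def[abs_def])
qed

lemma cexp_cont [continuous_intros]: "continuous_on S (cexp c)"
  unfolding cexp_def[abs_def] by (intro continuous_intros)

lemma cexp_abs_cont: "abs_cont (cexp c) (\<lambda>x. c * cexp c x)"
  by (rule abs_cont_C1[OF cexp_deriv]) (intro continuous_intros)

lemma cexp_0 [simp]: "cexp c 0 = 1" "cexp 0 x = 1" by (simp_all add: cexp_def)
lemma cexp_1: "cexp c 1 = exp c" by (simp add: cexp_def)
lemma cexp_add: "cexp c x * cexp d x = cexp (c + d) x"
  by (simp add: cexp_def mult_exp_exp distrib_right)

lemma cexp_bound: "x \<in> {0..1} \<Longrightarrow> \<bar>Re c\<bar> \<le> B \<Longrightarrow> cmod (cexp c x) \<le> exp B"
proof -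
  assume x: "x \<in> {0..1}" and c: "\<bar>Re c\<bar> \<le> B"
  have "Re c * x \<le> \<bar>Re c\<bar> * x" using x by (intro mult_right_mono) auto
  also have "\<dots> \<le> B * 1" using x c by (intro mult_mono) auto
  finally show ?thesis by (simp add: cexp_def norm_exp_eq_Re)
qed

text \<open>Bounds implied by a bound in \<open>H\<^sup>1\<close>; all constants below depend on \<open>K\<close> only.\<close>

definition potential_bound :: "real \<Rightarrow> (real \<Rightarrow> complex) \<Rightarrow> (real \<Rightarrow> complex) \<Rightarrow> (real \<Rightarrow> complex) \<Rightarrow> (real \<Rightarrow> complex) \<Rightarrow> bool" where
  "potential_bound K u u' v v' \<longleftrightarrow> 1 \<le> K \<and> abs_cont u u' \<and> abs_cont v v' \<and> L2_bound K u' \<and> L2_bound K v' \<and>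
     (\<forall>x\<in>{0..1}. cmod (u x) \<le> K \<and> cmod (v x) \<le> K)"

abbreviation zs_sol :: "complex \<Rightarrow> (real \<Rightarrow> complex) \<Rightarrow> (real \<Rightarrow> complex) \<Rightarrow>
    (real \<Rightarrow> complex) \<Rightarrow> (real \<Rightarrow> complex) \<Rightarrow> bool" where
  "zs_sol \<equiv> zs_on {0..1}"

lemma potential_bound_swap: "potential_bound K u u' v v' \<Longrightarrow> potential_bound K v v' u u'"
  by (auto simp: potential_bound_def)

text \<open>Exchange of the components reverses the spectral parameter. Each estimate for \<open>f\<close> therefore yields one for \<open>g\<close>.\<close>

lemma zs_swap: "zs_on S z u v f g \<Longrightarrow> zs_on S (- z) v u g f"
  by (auto simp: zs_on_def)

lemma zs_cont:
  assumes "zs_on S z u v f g" shows "continuous_on S f" "continuous_on S g"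
  using assms unfolding zs_on_def continuous_on_eq_continuous_within
  by (blast intro: has_vector_derivative_continuous)+

lemma zs_abs_cont:
  assumes s: "zs_sol z u v f g" and u: "continuous_on {0..1} u" and v: "continuous_on {0..1} v"
  shows "abs_cont f (\<lambda>x. - \<i> * z * f x + u x * g x)" "abs_cont g (\<lambda>x. \<i> * z * g x + v x * f x)"
  by (rule abs_cont_C1; use s in \<open>auto simp: zs_on_def intro!: continuous_intros u v zs_cont[OF s]\<close>)+

lemma zs_energy_deriv:
  assumes s: "zs_sol z u v f g" and x: "x \<in> {0..1}"
  shows "((\<lambda>x. (cmod (f x))\<^sup>2) has_real_derivative 2 * (Im z * (cmod (f x))\<^sup>2 + f x \<bullet> (u x * g x))) (at x within {0..1})"
    "((\<lambda>x. (cmod (g x))\<^sup>2) has_real_derivative 2 * (- Im z * (cmod (g x))\<^sup>2 + g x \<bullet> (v x * f x))) (at x within {0..1})"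
proof -
  have d: "(f has_vector_derivative (- \<i> * z * f x + u x * g x)) (at x within {0..1})"
     "(g has_vector_derivative (\<i> * z * g x + v x * f x)) (at x within {0..1})"
    using s x by (auto simp: zs_on_def)
  show "((\<lambda>x. (cmod (f x))\<^sup>2) has_real_derivative 2 * (Im z * (cmod (f x))\<^sup>2 + f x \<bullet> (u x * g x))) (at x within {0..1})"
    using bounded_bilinear.has_vector_derivative[OF bounded_bilinear_inner d(1) d(1)]
    unfolding has_real_derivative_iff_has_vector_derivative power2_norm_eq_inner
    by (rule back_subst) (simp add: inner_complex_def algebra_simps)
  show "((\<lambda>x. (cmod (g x))\<^sup>2) has_real_derivative 2 * (- Im z * (cmod (g x))\<^sup>2 + g x \<bullet> (v x * f x))) (at x within {0..1})"
    using bounded_bilinear.has_vector_derivative[OF bounded_bilinear_inner d(2) d(2)]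
    unfolding has_real_derivative_iff_has_vector_derivative power2_norm_eq_inner
    by (rule back_subst) (simp add: inner_complex_def algebra_simps)
qed

lemma inner_potential_bound:
  assumes "cmod (u::complex) \<le> K"
  shows "\<bar>f \<bullet> (u * g)\<bar> \<le> K / 2 * ((cmod f)\<^sup>2 + (cmod g)\<^sup>2)"
proof -
  have K0: "0 \<le> K" using order_trans[OF norm_ge_zero assms] .
  have "\<bar>f \<bullet> (u * g)\<bar> \<le> cmod f * cmod (u * g)" by (rule Cauchy_Schwarz_ineq2)
  also have "\<dots> = cmod u * (cmod f * cmod g)" by (simp add: norm_mult)
  also have "\<dots> \<le> K * (cmod f * cmod g)" using assms by (intro mult_right_mono) auto
  also have "cmod f * cmod g \<le> ((cmod f)\<^sup>2 + (cmod g)\<^sup>2) / 2"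
    using zero_le_power2[of "cmod f - cmod g"] by (simp add: power2_diff)
  finally show ?thesis using K0 by (simp add: mult_left_mono)
qed

lemma within_interior: "0 < x \<Longrightarrow> x < 1 \<Longrightarrow> at x within {0..1} = at (x::real)"
  by (rule at_within_interior) simp

text \<open>The derivative of \<open>|f|\<^sup>2 + |g|\<^sup>2\<close> is at most \<open>4 K\<close> times this function: half of the rate comes from the imaginary part of \<open>z\<close>, half
from the potential.\<close>

lemma zs_growth:
  assumes s: "zs_sol z u v f g" and K: "\<bar>Im z\<bar> \<le> K" and uv: "\<And>x. x \<in> {0..1} \<Longrightarrow> cmod (u x) \<le> K \<and> cmod (v x) \<le> K"
    and i: "f 0 = 1" "g 0 = 1" and x: "x \<in> {0..1}"
  shows "cmod (f x) \<le> 2 * exp (2 * K)" "cmod (g x) \<le> 2 * exp (2 * K)"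
proof -
  define h where "h = (\<lambda>x. (cmod (f x))\<^sup>2 + (cmod (g x))\<^sup>2)"
  have K0: "0 \<le> K" using K by simp
  have hb: "h x \<le> 2 * exp (4 * K)"
  proof (cases "x = 0")
    case True then show ?thesis using i K0 by (simp add: h_def)
  next
    case False
    then have x0: "0 < x" using x by auto
    \<comment> \<open>Gronwall: the weighted energy decreases.\<close>
    have "exp (- 4 * K * x) * h x \<le> exp (- 4 * K * 0) * h 0"
    proof (rule DERIV_nonpos_imp_decreasing_open[OF less_imp_le[OF x0]])
      show "continuous_on {0..x} (\<lambda>x. exp (- 4 * K * x) * h x)"
        unfolding h_def using x
        by (intro continuous_intros continuous_on_subset[OF zs_cont(1)[OF s]] continuous_on_subset[OF zs_cont(2)[OF s]]) auto
      fix t assume t: "0 < t" "t < x"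
      then have t01: "t \<in> {0..1}" "t < 1" using x by auto
      define D where "D = 2 * (Im z * (cmod (f t))\<^sup>2 + f t \<bullet> (u t * g t)) + 2 * (- Im z * (cmod (g t))\<^sup>2 + g t \<bullet> (v t * f t))"
      have "(h has_real_derivative D) (at t within {0..1})"
        unfolding h_def D_def by (intro DERIV_add zs_energy_deriv[OF s t01(1)])
      then have hd: "(h has_real_derivative D) (at t)" using within_interior[of t] t t01 by simp
      have Dle: "D \<le> 4 * K * h t"
      proof -
        have "Im z * (cmod (f t))\<^sup>2 \<le> K * (cmod (f t))\<^sup>2" "- Im z * (cmod (g t))\<^sup>2 \<le> K * (cmod (g t))\<^sup>2"
          using K by (intro mult_right_mono; simp)+
        moreover have "f t \<bullet> (u t * g t) \<le> K / 2 * h t" "g t \<bullet> (v t * f t) \<le> K / 2 * h t"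
          using inner_potential_bound[of "u t" K "f t" "g t"] inner_potential_bound[of "v t" K "g t" "f t"] uv[OF t01(1)]
          unfolding h_def by (simp_all add: add.commute)
        ultimately show ?thesis unfolding D_def h_def by (simp add: algebra_simps)
      qed
      have "((\<lambda>x. exp (- 4 * K * x) * h x) has_real_derivative (exp (- 4 * K * t) * (- 4 * K) * h t + exp (- 4 * K * t) * D)) (at t)"
        by (auto intro!: derivative_eq_intros hd simp: algebra_simps)
      moreover have "exp (- 4 * K * t) * (- 4 * K) * h t + exp (- 4 * K * t) * D = exp (- 4 * K * t) * (D - 4 * K * h t)"
        by (simp add: algebra_simps)
      moreover have "exp (- 4 * K * t) * (D - 4 * K * h t) \<le> 0" using Dle by (simp add: mult_nonneg_nonpos)
      ultimately show "\<exists>y. ((\<lambda>x. exp (- 4 * K * x) * h x) has_real_derivative y) (at t) \<and> y \<le> 0" by auto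
    qed
    then have "exp (- (4 * K * x)) * h x \<le> 2" using i by (simp add: h_def)
    then have "h x \<le> 2 * exp (4 * K * x)" by (simp add: exp_minus field_simps)
    also have "\<dots> \<le> 2 * exp (4 * K)" using x K0 mult_left_mono[of x 1 K] by simp
    finally show ?thesis .
  qed
  have e: "exp (4 * K) = (exp (2 * K))\<^sup>2" by (simp flip: exp_double add: power2_eq_square mult_exp_exp)
  have "(cmod (f x))\<^sup>2 \<le> (2 * exp (2 * K))\<^sup>2" "(cmod (g x))\<^sup>2 \<le> (2 * exp (2 * K))\<^sup>2"
    using hb zero_le_power2[of "cmod (f x)"] zero_le_power2[of "cmod (g x)"] zero_le_power2[of "exp (2 * K)"]
    unfolding h_def e power_mult_distrib by (simp_all; linarith)+
  then show "cmod (f x) \<le> 2 * exp (2 * K)" "cmod (g x) \<le> 2 * exp (2 * K)"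
    by (auto intro: power2_le_imp_le)
qed

text \<open>The Dirichlet conditions make \<open>|f|\<^sup>2 - |g|\<^sup>2\<close> vanish at both ends. Its derivative is \<open>2 Im z (|f|\<^sup>2 + |g|\<^sup>2)\<close> plus terms bounded by
\<open>2 K (|f|\<^sup>2 + |g|\<^sup>2)\<close>.\<close>

lemma dirichlet_Im_bound:
  assumes s: "zs_sol z u v f g" and uv: "\<And>x. x \<in> {0..1} \<Longrightarrow> cmod (u x) \<le> K \<and> cmod (v x) \<le> K"
    and uvc: "continuous_on {0..1} u" "continuous_on {0..1} v"
    and i: "f 0 = 1" "g 0 = 1" and d: "f 1 = g 1"
  shows "\<bar>Im z\<bar> \<le> K"
proof -
  define h where "h = (\<lambda>x. (cmod (f x))\<^sup>2 + (cmod (g x))\<^sup>2)"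
  define e where "e = (\<lambda>x. 2 * (f x \<bullet> (u x * g x)) - 2 * (g x \<bullet> (v x * f x)))"
  note c = zs_cont[OF s]
  have hc: "continuous_on {0..1} h" unfolding h_def by (intro continuous_intros c)
  have ec: "continuous_on {0..1} e" unfolding e_def by (intro continuous_intros c uvc)
  have hi: "h integrable_on {0..1}" "e integrable_on {0..1}"
    using hc ec by (auto intro: integrable_continuous_interval)
  have "((\<lambda>x. 2 * Im z * h x + e x) has_integral ((cmod (f 1))\<^sup>2 - (cmod (g 1))\<^sup>2) - ((cmod (f 0))\<^sup>2 - (cmod (g 0))\<^sup>2)) {0..1}"
  proof (rule fundamental_theorem_of_calculus)
    fix x :: real assume x: "x \<in> {0..1}"
    have "((\<lambda>x. (cmod (f x))\<^sup>2 - (cmod (g x))\<^sup>2) has_real_derivative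
      2 * (Im z * (cmod (f x))\<^sup>2 + f x \<bullet> (u x * g x)) - 2 * (- Im z * (cmod (g x))\<^sup>2 + g x \<bullet> (v x * f x))) (at x within {0..1})"
      by (intro DERIV_diff zs_energy_deriv[OF s x])
    then show "((\<lambda>x. (cmod (f x))\<^sup>2 - (cmod (g x))\<^sup>2) has_vector_derivative 2 * Im z * h x + e x) (at x within {0..1})"
      unfolding has_real_derivative_iff_has_vector_derivative
      by (rule back_subst) (simp add: h_def e_def algebra_simps)
  qed simp
  then have "integral {0..1} (\<lambda>x. 2 * Im z * h x + e x) = 0" using i d by (simp add: integral_unique)
  then have eq: "2 * Im z * integral {0..1} h + integral {0..1} e = 0"
    using hi by (simp add: Henstock_Kurzweil_Integration.integral_add integrable_on_mult_right)
  have "norm (integral {0..1} e) \<le> integral {0..1} (\<lambda>x. 2 * K * h x)"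
  proof (rule integral_norm_bound_integral[OF hi(2)])
    show "(\<lambda>x. 2 * K * h x) integrable_on {0..1}" using hi by (intro integrable_on_mult_right)
    fix x :: real assume x: "x \<in> {0..1}"
    have "\<bar>f x \<bullet> (u x * g x)\<bar> \<le> K / 2 * h x" "\<bar>g x \<bullet> (v x * f x)\<bar> \<le> K / 2 * h x"
      using inner_potential_bound[of "u x" K "f x" "g x"] inner_potential_bound[of "v x" K "g x" "f x"] uv[OF x]
      unfolding h_def by (simp_all add: add.commute)
    moreover have "2 * K * h x = 4 * (K / 2 * h x)" by simp
    ultimately show "norm (e x) \<le> 2 * K * h x" unfolding e_def real_norm_def by linarith
  qed
  then have le: "\<bar>integral {0..1} e\<bar> \<le> 2 * K * integral {0..1} h" by simp
  have "0 \<le> integral {0..1} h" by (rule Henstock_Kurzweil_Integration.integral_nonneg[OF hi(1)]) (simp add: h_def)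
  moreover have "integral {0..1} h \<noteq> 0"
  proof
    assume z: "integral {0..1} h = 0"
    have "integral {0..1} h = 0 \<longleftrightarrow> (\<forall>x\<in>{0..1}. h x = 0)"
      by (rule integral_eq_0_iff[OF hc]) (simp_all add: h_def)
    then have "\<forall>x\<in>{0..1}. h x = 0" using z by blast
    then have "h 0 = 0" by simp
    then show False using i by (simp add: h_def)
  qed
  ultimately have pos: "0 < integral {0..1} h" by simp
  have "2 * \<bar>Im z\<bar> * integral {0..1} h = \<bar>integral {0..1} e\<bar>"
    using eq pos by (simp add: abs_mult add_eq_0_iff)
  then have "\<bar>Im z\<bar> * integral {0..1} h \<le> K * integral {0..1} h" using le by simp
  then show ?thesis using pos by (simp add: mult_le_cancel_right)
qed

text \<open>The product of all constants that enter the first-order estimate: growth of the solution, of the exponential, and two factors \<open>K\<close>.\<close>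

definition first_order_const :: "real \<Rightarrow> real" where "first_order_const K = 4 * K\<^sup>2 * exp (5 * K)"

lemma first_order_const_ge1: "1 \<le> K \<Longrightarrow> 1 \<le> first_order_const K"
proof -
  assume K: "1 \<le> K"
  have "1 \<le> 4 * K\<^sup>2" using one_le_power[OF K, of 2] by linarith
  then have "1 * 1 \<le> (4 * K\<^sup>2) * exp (5 * K)" using K by (intro mult_mono) auto
  then show ?thesis by (simp add: first_order_const_def)
qed

text \<open>The function \<open>a = exp (\<i> z x) f\<close> has derivative \<open>u g exp (\<i> z x)\<close>, which oscillates like \<open>exp (2 \<i> z x)\<close>; integration by parts gains
the factor \<open>1/z\<close>.\<close>

lemma zs_first_order_aux:
  assumes data: "potential_bound K u u' v v'" and s: "zs_sol z u v f g" and K: "\<bar>Im z\<bar> \<le> K"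
    and i: "f 0 = 1" "g 0 = 1" and x: "x \<in> {0..1}" and z: "z \<noteq> 0"
  shows "cmod (cexp (\<i> * z) x * f x - 1) \<le> first_order_const K / cmod z"
proof -
  have D: "1 \<le> K" "abs_cont u u'" "abs_cont v v'" "L2_bound K u'" "L2_bound K v'" "\<And>x. x \<in> {0..1} \<Longrightarrow> cmod (u x) \<le> K \<and> cmod (v x) \<le> K"
    using data by (auto simp: potential_bound_def)
  note uc = abs_cont_cont[OF D(2)] and vc = abs_cont_cont[OF D(3)]
  note fg = zs_cont[OF s]
  note gr = zs_growth[OF s K D(6) i]
  define a where "a = (\<lambda>x. cexp (\<i> * z) x * f x)"
  have a_ac: "abs_cont a (\<lambda>x. u x * (g x * cexp (\<i> * z) x))"
    by (rule abs_cont_cong[OF abs_cont_mult[OF cexp_abs_cont zs_abs_cont(1)[OF s uc vc]]]) (auto simp: a_def algebra_simps)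
  define P where "P = (\<lambda>x. u x * (g x * cexp (\<i> * z) x))"
  define q where "q = (\<lambda>x. u' x * (g x * cexp (\<i> * z) x))"
  define r where "r = (\<lambda>x. u x * (v x * (f x * cexp (\<i> * z) x)))"
  have P_ac: "abs_cont P (\<lambda>x. (q x + r x) + (2 * \<i> * z) * P x)"
    unfolding P_def
    by (rule abs_cont_cong[OF abs_cont_mult[OF D(2) abs_cont_mult[OF zs_abs_cont(2)[OF s uc vc] cexp_abs_cont]]]) (auto simp: q_def r_def P_def algebra_simps)
  have eb: "cmod (cexp (\<i> * z) t) \<le> exp K" if "t \<in> {0..1}" for t
    by (rule cexp_bound[OF that]) (use K in simp)
  have gc: "continuous_on {0..1} (\<lambda>x. g x * cexp (\<i> * z) x)" by (intro continuous_intros fg)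
  have rc: "continuous_on {0..1} r" unfolding r_def by (intro continuous_intros fg uc vc)
  have Pc: "continuous_on {0..1} P" by (rule abs_cont_cont[OF P_ac])
  define B where "B = 2 * exp (2 * K) * exp K"
  have B: "B = 2 * exp (3 * K)" by (simp add: B_def mult_exp_exp)
  have gb: "cmod (g t * cexp (\<i> * z) t) \<le> B" "cmod (f t * cexp (\<i> * z) t) \<le> B" if "t \<in> {0..1}" for t
    unfolding B_def norm_mult using that by (intro mult_mono gr eb; simp)+
  have B0: "0 \<le> B" by (simp add: B)
  have qi: "set_integrable lborel {0..1} q" unfolding q_def
    by (rule set_integrable_mult_cont[OF _ gc]) (use D(4) in \<open>simp add: L2_bound_def\<close>)
  have q: "cmod (integral {0..x} q) \<le> K * B"
    unfolding q_def by (rule integral_mult_bound[OF _ gc gb(1) x L2_bound_integral_norm[OF D(4)]])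
      (use x D(4) in \<open>auto simp: L2_bound_def\<close>)
  have rb: "cmod (r t) \<le> K * K * B" if "t \<in> {0..1}" for t
    unfolding r_def norm_mult[of "u t"] norm_mult[of "v t"] mult.assoc
    using D(1) B0 D(6)[OF that] gb[OF that] by (intro mult_mono) (auto intro!: mult_nonneg_nonneg)
  have r: "cmod (integral {0..x} r) \<le> K * K * B"
  proof -
    have "cmod (integral {0..x} r) \<le> K * K * B * (x - 0)"
      by (rule integral_bound) (use x rb in \<open>auto intro!: continuous_on_subset[OF rc]\<close>)
    also have "\<dots> \<le> K * K * B * 1" using x D(1) B0 by (intro mult_left_mono) auto
    finally show ?thesis by simp
  qed
  have Pb: "cmod (P t) \<le> K * B" if "t \<in> {0..1}" for t
    unfolding P_def norm_mult[of "u t"] using D(1,6) gb that by (intro mult_mono) auto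
  have int: "q integrable_on {0..x}" "r integrable_on {0..x}" "P integrable_on {0..x}"
    using set_integrable_sub(2)[OF qi, of 0 x] set_integrable_sub(2)[OF set_integrable_cont[OF rc], of 0 x]
      set_integrable_sub(2)[OF set_integrable_cont[OF Pc], of 0 x] x by auto
  have "P x = P 0 + integral {0..x} (\<lambda>x. (q x + r x) + (2 * \<i> * z) * P x)" by (rule abs_cont_eval[OF P_ac x])
  also have "integral {0..x} (\<lambda>x. (q x + r x) + (2 * \<i> * z) * P x) =
      (integral {0..x} q + integral {0..x} r) + (2 * \<i> * z) * integral {0..x} P"
    using int by (simp add: Henstock_Kurzweil_Integration.integral_add integrable_add integrable_on_mult_right)
  also have "integral {0..x} P = a x - 1"
    using abs_cont_eval[OF a_ac x] i by (simp add: P_def a_def)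
  finally have "(2 * \<i> * z) * (a x - 1) = P x - P 0 - integral {0..x} q - integral {0..x} r" by simp
  then have "2 * cmod z * cmod (a x - 1) = cmod (P x - P 0 - integral {0..x} q - integral {0..x} r)"
    by (metis norm_mult norm_ii norm_numeral mult.right_neutral)
  also have "\<dots> \<le> K * B + K * B + K * B + K * K * B"
    by (intro order_trans[OF norm_triangle_ineq4] add_mono Pb q r) (use x in auto)
  also have "\<dots> \<le> 4 * (K * K * B)"
  proof -
    have "1 * (K * B) \<le> K * (K * B)" using D(1) B0 by (intro mult_right_mono) auto
    then have "K * B \<le> K * K * B" by (simp only: mult.assoc mult_1)
    then show ?thesis by linarith
  qed
  also have "\<dots> = 2 * (4 * K\<^sup>2 * exp (3 * K))" by (simp add: B power2_eq_square)
  also have "\<dots> \<le> 2 * first_order_const K" using D(1) unfolding first_order_const_def by (intro mult_left_mono) auto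
  finally have "cmod z * cmod (a x - 1) \<le> first_order_const K" by simp
  then show ?thesis using z by (simp add: a_def field_simps)
qed

lemma zs_first_order:
  assumes data: "potential_bound K u u' v v'" and s: "zs_sol z u v f g" and K: "\<bar>Im z\<bar> \<le> K"
    and i: "f 0 = 1" "g 0 = 1" and x: "x \<in> {0..1}" and z: "z \<noteq> 0"
  shows "cmod (cexp (\<i> * z) x * f x - 1) \<le> first_order_const K / cmod z"
    "cmod (cexp (- \<i> * z) x * g x - 1) \<le> first_order_const K / cmod z"
  using zs_first_order_aux[OF data s K i x z]
    zs_first_order_aux[OF potential_bound_swap[OF data] zs_swap[OF s] _ i(2,1) x] K z by auto

section \<open>The AKNS recursion\<close>

text \<open>Coefficients of the formal series \<open>A = \<Sum> a\<^sub>k \<nu>\<^sup>-\<^sup>k\<close> (and \<open>B\<close>, \<open>C\<close>), \<open>\<nu> = 2 \<i> z\<close>, for which \<open>A f\<^sup>2 + B f g + C g\<^sup>2\<close> is formally constant. The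
arguments are Taylor series of \<open>u\<close> and \<open>v\<close> at a point, so that \<open>fps_deriv\<close> is differentiation in \<open>x\<close> and the rules for power series do the
work of a differential algebra. The equation for \<open>b\<^sub>k\<close> prescribes only its derivative; it is replaced by the conservation law
\<open>B\<^sup>2 - 4 A C = 1\<close>, which gives \<open>b\<^sub>k\<close> as a polynomial in earlier coefficients, and hence as a periodic function.\<close>

fun akns_a akns_b akns_c :: "complex fps \<Rightarrow> complex fps \<Rightarrow> nat \<Rightarrow> complex fps" where
  "akns_a U V 0 = 0"
| "akns_a U V (Suc k) = fps_deriv (akns_a U V k) + akns_b U V k * V"
| "akns_c U V 0 = 0"
| "akns_c U V (Suc k) = - (fps_deriv (akns_c U V k) + akns_b U V k * U)"
| "akns_b U V 0 = 1"
| "akns_b U V (Suc k) = (\<Sum>i\<in>{1..k}. 2 * (akns_a U V i * akns_c U V (Suc k - i)))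
     - fps_const (1/2) * (\<Sum>i\<in>{1..k}. akns_b U V i * akns_b U V (Suc k - i))"

lemma fps_deriv_sum': "fps_deriv (\<Sum>i\<in>I. F i) = (\<Sum>i\<in>I. fps_deriv (F i))"
  by (induction I rule: infinite_finite_induct) auto

lemma fps_deriv_akns_a: "fps_deriv (akns_a U V k) = akns_a U V (Suc k) - akns_b U V k * V"
  and fps_deriv_akns_c: "fps_deriv (akns_c U V k) = - akns_c U V (Suc k) - akns_b U V k * U"
  by simp_all

lemma sum_reflect: "(\<Sum>i\<in>{1..k}. F i (Suc k - i)) = (\<Sum>i\<in>{1..k}. F (Suc k - i) i)" for F :: "nat \<Rightarrow> nat \<Rightarrow> 'a::comm_monoid_add"
  by (rule sum.reindex_bij_witness[of _ "\<lambda>i. Suc k - i" "\<lambda>i. Suc k - i"]) auto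

lemma fps_half: "fps_const (1/2) * (2 * F) = (F :: complex fps)"
proof -
  have "fps_const (1/2) * 2 = (1 :: complex fps)"
    by (simp flip: numeral_fps_const)
  then show ?thesis by (simp flip: mult.assoc)
qed

text \<open>Differentiation of the conservation law: the terms with \<open>a\<^sub>i\<^sub>+\<^sub>1 c\<^sub>j - a\<^sub>i c\<^sub>j\<^sub>+\<^sub>1\<close> telescope to the right-hand side, and the other terms cancel
by the induction hypothesis.\<close>

lemma fps_deriv_akns_b: "fps_deriv (akns_b U V k) = - 2 * (akns_a U V k * U + akns_c U V k * V)"
proof (induction k rule: less_induct)
  case (less k)
  show ?case
  proof (cases k)
    case (Suc n)
    let ?A = "akns_a U V" and ?B = "akns_b U V" and ?C = "akns_c U V"
    let ?I = "{1..n}"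
    have T: "(\<Sum>i\<in>?I. ?A (Suc i) * ?C (Suc n - i) - ?A i * ?C (Suc (Suc n - i))) = - (?A (Suc n) * U + ?C (Suc n) * V)"
    proof -
      have "(\<Sum>i\<in>?I. ?A (Suc i) * ?C (Suc n - i) - ?A i * ?C (Suc (Suc n - i)))
          = (\<Sum>i\<in>?I. ?A (Suc i) * ?C (Suc (Suc n) - Suc i) - ?A i * ?C (Suc (Suc n) - i))"
        by (intro sum.cong refl) (simp add: Suc_diff_le del: akns_a.simps akns_c.simps)
      also have "\<dots> = ?A (Suc n) * ?C (Suc (Suc n) - Suc n) - ?A 1 * ?C (Suc (Suc n) - 1)"
        by (rule sum_Suc_diff) simp
      also have "\<dots> = ?A (Suc n) * ?C (Suc 0) - ?A (Suc 0) * ?C (Suc n)" by (simp del: akns_a.simps akns_c.simps)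
      also have "\<dots> = - (?A (Suc n) * U + ?C (Suc n) * V)"
        by (simp add: akns_a.simps(2)[of U V 0] akns_c.simps(2)[of U V 0] algebra_simps del: akns_a.simps(2) akns_c.simps(2))
      finally show ?thesis .
    qed
    have B': "fps_deriv (?B i) = - 2 * (?A i * U + ?C i * V)" if "i \<in> ?I" for i
      using less[of i] that Suc by auto
    have B'': "fps_deriv (?B (Suc n - i)) = - 2 * (?A (Suc n - i) * U + ?C (Suc n - i) * V)" if "i \<in> ?I" for i
      using less[of "Suc n - i"] that Suc by auto
    \<comment> \<open>The terms that do not telescope; they occur in both sums below and cancel.\<close>
    define X where "X = (\<Sum>i\<in>?I. ?B i * (?C (Suc n - i) * V) + ?A i * (?B (Suc n - i) * U))"
    have P: "(\<Sum>i\<in>?I. fps_deriv (?A i * ?C (Suc n - i))) = - (?A (Suc n) * U + ?C (Suc n) * V) - X"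
    proof -
      have "(\<Sum>i\<in>?I. fps_deriv (?A i * ?C (Suc n - i))) =
          (\<Sum>i\<in>?I. (?A (Suc i) * ?C (Suc n - i) - ?A i * ?C (Suc (Suc n - i)))
            - (?B i * (?C (Suc n - i) * V) + ?A i * (?B (Suc n - i) * U)))"
        unfolding fps_deriv_mult fps_deriv_akns_a fps_deriv_akns_c
        by (intro sum.cong refl) (simp add: algebra_simps del: akns_a.simps akns_c.simps)
      then show ?thesis unfolding T[symmetric] X_def by (simp only: sum_subtractf)
    qed
    have Q: "(\<Sum>i\<in>?I. fps_deriv (?B i * ?B (Suc n - i))) = - 4 * X"
    proof -
      have "(\<Sum>i\<in>?I. fps_deriv (?B i * ?B (Suc n - i)))
          = (\<Sum>i\<in>?I. - 2 * (?B i * (?A (Suc n - i) * U + ?C (Suc n - i) * V)) + - 2 * (?B (Suc n - i) * (?A i * U + ?C i * V)))"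
        unfolding fps_deriv_mult
        by (intro sum.cong refl) (simp only: B' B'', simp add: algebra_simps del: akns_a.simps akns_c.simps)
      also have "\<dots> = - 2 * (\<Sum>i\<in>?I. ?B i * (?A (Suc n - i) * U + ?C (Suc n - i) * V))
          + - 2 * (\<Sum>i\<in>?I. ?B (Suc n - i) * (?A i * U + ?C i * V))"
        unfolding sum.distrib sum_distrib_left ..
      also have "(\<Sum>i\<in>?I. ?B i * (?A (Suc n - i) * U + ?C (Suc n - i) * V)) = X"
        using sum_reflect[of "\<lambda>i j. ?B i * (?A j * U)" n]
        by (simp add: X_def distrib_left sum.distrib mult_ac del: akns_a.simps akns_c.simps akns_b.simps)
      also have "(\<Sum>i\<in>?I. ?B (Suc n - i) * (?A i * U + ?C i * V)) = X"
        using sum_reflect[of "\<lambda>i j. ?C i * (?B j * V)" n]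
        by (simp add: X_def distrib_left sum.distrib mult_ac del: akns_a.simps akns_c.simps akns_b.simps)
      finally show ?thesis by (simp add: algebra_simps)
    qed
    have "fps_deriv (?B (Suc n)) = 2 * (\<Sum>i\<in>?I. fps_deriv (?A i * ?C (Suc n - i)))
        - fps_const (1/2) * (\<Sum>i\<in>?I. fps_deriv (?B i * ?B (Suc n - i)))"
      by (simp add: fps_deriv_sum' sum_distrib_left algebra_simps del: akns_a.simps akns_c.simps akns_b.simps(1))
    also have "\<dots> = 2 * (- (?A (Suc n) * U + ?C (Suc n) * V) - X) - fps_const (1/2) * (2 * (- 2 * X))"
      unfolding P Q by simp
    also have "\<dots> = - 2 * (?A (Suc n) * U + ?C (Suc n) * V)"
      unfolding fps_half by (simp add: algebra_simps del: akns_a.simps akns_c.simps)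
    finally show ?thesis using Suc by simp
  qed simp
qed

text \<open>The recursion is invariant under exchange of \<open>u\<close> and \<open>v\<close> together with \<open>\<nu> \<mapsto> - \<nu>\<close>.\<close>

lemma akns_swap:
  "akns_c U V k = (-1) ^ k * akns_a V U k \<and> akns_a U V k = (-1) ^ k * akns_c V U k \<and> akns_b U V k = (-1) ^ k * akns_b V U k"
proof (induction k rule: less_induct)
  case (less k)
  show ?case
  proof (cases k)
    case (Suc n)
    have IH: "akns_c U V i = (-1) ^ i * akns_a V U i" "akns_a U V i = (-1) ^ i * akns_c V U i" "akns_b U V i = (-1) ^ i * akns_b V U i"
      if "i < Suc n" for i using less[of i] that Suc by auto
    have pow: "(-1) ^ i * (-1) ^ (Suc n - i) = ((-1) ^ Suc n :: complex fps)" if "i \<in> {1..n}" for i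
      using that by (simp only: power_add[symmetric]) simp
    have 1: "(\<Sum>i\<in>{1..n}. 2 * (akns_a U V i * akns_c U V (Suc n - i)))
        = (-1) ^ Suc n * (\<Sum>i\<in>{1..n}. 2 * (akns_a V U i * akns_c V U (Suc n - i)))"
    proof -
      have "(\<Sum>i\<in>{1..n}. 2 * (akns_a U V i * akns_c U V (Suc n - i)))
         = (\<Sum>i\<in>{1..n}. ((-1) ^ i * (-1) ^ (Suc n - i)) * (2 * (akns_c V U i * akns_a V U (Suc n - i))))"
      proof (intro sum.cong refl)
        fix i assume i: "i \<in> {1..n}"
        show "2 * (akns_a U V i * akns_c U V (Suc n - i)) = ((-1) ^ i * (-1) ^ (Suc n - i)) * (2 * (akns_c V U i * akns_a V U (Suc n - i)))"
          using IH(2)[of i] IH(1)[of "Suc n - i"] i by (simp only: atLeastAtMost_iff) (simp del: akns_a.simps akns_c.simps)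
      qed
      also have "\<dots> = (\<Sum>i\<in>{1..n}. (-1) ^ Suc n * (2 * (akns_c V U i * akns_a V U (Suc n - i))))"
        by (intro sum.cong refl) (simp only: pow)
      also have "\<dots> = (-1) ^ Suc n * (\<Sum>i\<in>{1..n}. 2 * (akns_c V U i * akns_a V U (Suc n - i)))"
        by (simp only: sum_distrib_left)
      also have "(\<Sum>i\<in>{1..n}. 2 * (akns_c V U i * akns_a V U (Suc n - i))) = (\<Sum>i\<in>{1..n}. 2 * (akns_a V U i * akns_c V U (Suc n - i)))"
        using sum_reflect[of "\<lambda>i j. 2 * (akns_c V U i * akns_a V U j)" n]
        by (simp only: mult.commute[of "akns_c V U _"])
      finally show ?thesis .
    qed
    have 2: "(\<Sum>i\<in>{1..n}. akns_b U V i * akns_b U V (Suc n - i)) = (-1) ^ Suc n * (\<Sum>i\<in>{1..n}. akns_b V U i * akns_b V U (Suc n - i))"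
    proof -
      have "(\<Sum>i\<in>{1..n}. akns_b U V i * akns_b U V (Suc n - i))
         = (\<Sum>i\<in>{1..n}. ((-1) ^ i * (-1) ^ (Suc n - i)) * (akns_b V U i * akns_b V U (Suc n - i)))"
      proof (intro sum.cong refl)
        fix i assume i: "i \<in> {1..n}"
        show "akns_b U V i * akns_b U V (Suc n - i) = ((-1) ^ i * (-1) ^ (Suc n - i)) * (akns_b V U i * akns_b V U (Suc n - i))"
          using IH(3)[of i] IH(3)[of "Suc n - i"] i by (simp only: atLeastAtMost_iff) (simp del: akns_b.simps)
      qed
      also have "\<dots> = (\<Sum>i\<in>{1..n}. (-1) ^ Suc n * (akns_b V U i * akns_b V U (Suc n - i)))"
        by (intro sum.cong refl) (simp only: pow)
      also have "\<dots> = (-1) ^ Suc n * (\<Sum>i\<in>{1..n}. akns_b V U i * akns_b V U (Suc n - i))"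
        by (simp only: sum_distrib_left)
      finally show ?thesis .
    qed
    have "akns_b U V (Suc n) = (-1) ^ Suc n * akns_b V U (Suc n)"
      unfolding akns_b.simps(2) 1 2 by (simp add: algebra_simps del: power_Suc)
    moreover have "akns_c U V (Suc n) = (-1) ^ Suc n * akns_a V U (Suc n)"
      unfolding akns_c.simps akns_a.simps using IH(1)[of n] IH(3)[of n] by (cases "even n") simp_all
    moreover have "akns_a U V (Suc n) = (-1) ^ Suc n * akns_c V U (Suc n)"
      unfolding akns_c.simps akns_a.simps using IH(2)[of n] IH(3)[of n] by (cases "even n") simp_all
    ultimately show ?thesis using Suc by simp
  qed simp
qed

abbreviation fps_coeff :: "complex fps \<Rightarrow> nat \<Rightarrow> complex" (infixl "!$" 75) where
  "F !$ j \<equiv> fps_nth F j"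

text \<open>\<open>F x\<close> is the jet at \<open>x\<close> of the periodic function \<open>F x !$ 0\<close>. The coefficients below \<open>m\<close> are bounded by \<open>K\<close> and absolutely continuous; the
coefficient \<open>m\<close> is merely integrable.\<close>

definition jet_tower :: "nat \<Rightarrow> real \<Rightarrow> (real \<Rightarrow> complex fps) \<Rightarrow> bool" where
  "jet_tower m K F \<longleftrightarrow> 0 \<le> K \<and> (\<forall>j<m. abs_cont (\<lambda>x. F x !$ j) (\<lambda>x. of_nat (Suc j) * F x !$ Suc j) \<and>
      F 1 !$ j = F 0 !$ j \<and> (\<forall>x\<in>{0..1}. cmod (F x !$ j) \<le> K))"

lemma jet_tower_mono: "jet_tower m K F \<Longrightarrow> m' \<le> m \<Longrightarrow> K \<le> K' \<Longrightarrow> jet_tower m' K' F"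
  unfolding jet_tower_def by (meson less_le_trans order_trans)

lemma jet_tower_const: "jet_tower m (norm c) (\<lambda>x. fps_const c)"
  unfolding jet_tower_def by (auto simp: abs_cont_const)

lemma jet_tower_add: "jet_tower m K F \<Longrightarrow> jet_tower m L G \<Longrightarrow> jet_tower m (K + L) (\<lambda>x. F x + G x)"
  unfolding jet_tower_def
  by (auto simp: distrib_left intro!: abs_cont_add norm_triangle_mono simp del: of_nat_Suc)

lemma abs_cont_sum: "finite I \<Longrightarrow> (\<And>i. i \<in> I \<Longrightarrow> abs_cont (f i) (f' i)) \<Longrightarrow> abs_cont (\<lambda>x. \<Sum>i\<in>I. f i x) (\<lambda>x. \<Sum>i\<in>I. f' i x)"
  by (induction I rule: finite_induct) (auto intro: abs_cont_add abs_cont_const)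

text \<open>The Leibniz rule for jets is the product rule for \<open>fps_deriv\<close>.\<close>

lemma jet_tower_mult:
  assumes F: "jet_tower m K F" and G: "jet_tower m L G"
  shows "jet_tower m (real m * (K * L)) (\<lambda>x. F x * G x)"
  unfolding jet_tower_def
proof (intro conjI allI impI)
  have KL: "0 \<le> K" "0 \<le> L" using F G by (auto simp: jet_tower_def)
  show "0 \<le> real m * (K * L)" using KL by simp
  fix j assume j: "j < m"
  have Fi: "abs_cont (\<lambda>x. F x !$ i) (\<lambda>x. of_nat (Suc i) * F x !$ Suc i)" "F 1 !$ i = F 0 !$ i" "\<forall>x\<in>{0..1}. cmod (F x !$ i) \<le> K" if "i \<le> j" for i
    using F j that by (auto simp: jet_tower_def)
  have Gi: "abs_cont (\<lambda>x. G x !$ i) (\<lambda>x. of_nat (Suc i) * G x !$ Suc i)" "G 1 !$ i = G 0 !$ i" "\<forall>x\<in>{0..1}. cmod (G x !$ i) \<le> L" if "i \<le> j" for i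
    using G j that by (auto simp: jet_tower_def)
  have "abs_cont (\<lambda>x. \<Sum>i=0..j. F x !$ i * G x !$ (j - i))
     (\<lambda>x. \<Sum>i=0..j. (of_nat (Suc i) * F x !$ Suc i) * G x !$ (j - i) + F x !$ i * (of_nat (Suc (j - i)) * G x !$ Suc (j - i)))"
    by (intro abs_cont_sum abs_cont_mult Fi Gi) auto
  moreover have "(\<Sum>i=0..j. (of_nat (Suc i) * F x !$ Suc i) * G x !$ (j - i) + F x !$ i * (of_nat (Suc (j - i)) * G x !$ Suc (j - i)))
      = of_nat (Suc j) * (F x * G x) !$ Suc j" for x
  proof -
    have "of_nat (Suc j) * (F x * G x) !$ Suc j = fps_deriv (F x * G x) !$ j" by (simp only: fps_deriv_nth Suc_eq_plus1)
    also have "\<dots> = (F x * fps_deriv (G x)) !$ j + (fps_deriv (F x) * G x) !$ j"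
      by (simp only: fps_deriv_mult fps_add_nth)
    also have "\<dots> = (\<Sum>i=0..j. (of_nat (Suc i) * F x !$ Suc i) * G x !$ (j - i) + F x !$ i * (of_nat (Suc (j - i)) * G x !$ Suc (j - i)))"
      unfolding fps_mult_nth sum.distrib by (simp add: add.commute)
    finally show ?thesis by simp
  qed
  ultimately show "abs_cont (\<lambda>x. (F x * G x) !$ j) (\<lambda>x. of_nat (Suc j) * (F x * G x) !$ Suc j)"
    by (simp add: fps_mult_nth[of _ _ j] del: of_nat_Suc)
  show "(F 1 * G 1) !$ j = (F 0 * G 0) !$ j"
    unfolding fps_mult_nth using Fi(2) Gi(2) by (intro sum.cong refl) auto
  show "\<forall>x\<in>{0..1}. cmod ((F x * G x) !$ j) \<le> real m * (K * L)"
  proof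
    fix x :: real assume x: "x \<in> {0..1}"
    have "cmod ((F x * G x) !$ j) \<le> (\<Sum>i=0..j. K * L)"
      unfolding fps_mult_nth
      by (rule sum_norm_le) (use Fi(3) Gi(3) x KL in \<open>auto simp: norm_mult intro!: mult_mono\<close>)
    also have "\<dots> = real (Suc j) * (K * L)" by simp
    also have "\<dots> \<le> real m * (K * L)" using j KL by (intro mult_right_mono) auto
    finally show "cmod ((F x * G x) !$ j) \<le> real m * (K * L)" .
  qed
qed

lemma jet_tower_deriv:
  assumes F: "jet_tower (Suc m) K F"
  shows "jet_tower m (real (Suc m) * K) (\<lambda>x. fps_deriv (F x))"
  unfolding jet_tower_def
proof (intro conjI allI impI)
  have K: "0 \<le> K" using F by (simp add: jet_tower_def)
  show "0 \<le> real (Suc m) * K" using K by simp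
  fix j assume j: "j < m"
  have Fj: "abs_cont (\<lambda>x. F x !$ Suc j) (\<lambda>x. of_nat (Suc (Suc j)) * F x !$ Suc (Suc j))" "F 1 !$ Suc j = F 0 !$ Suc j"
     "\<forall>x\<in>{0..1}. cmod (F x !$ Suc j) \<le> K" using F j by (auto simp: jet_tower_def)
  show "abs_cont (\<lambda>x. fps_deriv (F x) !$ j) (\<lambda>x. of_nat (Suc j) * fps_deriv (F x) !$ Suc j)"
    using abs_cont_cmult[OF Fj(1), of "of_nat (Suc j)"] by (simp add: fps_deriv_nth del: of_nat_Suc)
  show "fps_deriv (F 1) !$ j = fps_deriv (F 0) !$ j" using Fj by simp
  show "\<forall>x\<in>{0..1}. cmod (fps_deriv (F x) !$ j) \<le> real (Suc m) * K"
  proof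
    fix x :: real assume "x \<in> {0..1}"
    then have "real (Suc j) * cmod (F x !$ Suc j) \<le> real (Suc m) * K"
      using Fj(3) K j by (intro mult_mono) auto
    moreover have "cmod (fps_deriv (F x) !$ j) = real (Suc j) * cmod (F x !$ Suc j)"
      unfolding fps_deriv_nth norm_mult norm_of_nat by simp
    ultimately show "cmod (fps_deriv (F x) !$ j) \<le> real (Suc m) * K" by simp
  qed
qed

text \<open>A differential expression that turns functions with \<open>N\<close> derivatives into functions with \<open>m\<close> derivatives, with bounds that are
uniform over bounded sets.\<close>

definition uniform_tower :: "nat \<Rightarrow> nat \<Rightarrow> (complex fps \<Rightarrow> complex fps \<Rightarrow> complex fps) \<Rightarrow> bool" where
  "uniform_tower N m \<Phi> \<longleftrightarrow> (\<forall>K. \<exists>L. \<forall>U V. jet_tower N K U \<longrightarrow> jet_tower N K V \<longrightarrow> jet_tower m L (\<lambda>x. \<Phi> (U x) (V x)))"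

lemma uniform_tower_mono: "uniform_tower N m \<Phi> \<Longrightarrow> m' \<le> m \<Longrightarrow> uniform_tower N m' \<Phi>"
  unfolding uniform_tower_def by (meson order_refl jet_tower_mono)

lemma uniform_tower_U: "uniform_tower N N (\<lambda>U V. U)" and uniform_tower_V: "uniform_tower N N (\<lambda>U V. V)"
  unfolding uniform_tower_def by blast+

lemma uniform_tower_const: "uniform_tower N m (\<lambda>U V. fps_const c)"
  unfolding uniform_tower_def using jet_tower_const by blast

lemma uniform_tower_0: "uniform_tower N m (\<lambda>U V. 0)" and uniform_tower_1: "uniform_tower N m (\<lambda>U V. 1)"
  using uniform_tower_const[of N m 0] uniform_tower_const[of N m 1] by simp_all

lemma uniform_tower_add: "uniform_tower N m \<Phi> \<Longrightarrow> uniform_tower N m \<Psi> \<Longrightarrow> uniform_tower N m (\<lambda>U V. \<Phi> U V + \<Psi> U V)"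
  unfolding uniform_tower_def
proof
  fix K
  assume "\<forall>K. \<exists>L. \<forall>U V. jet_tower N K U \<longrightarrow> jet_tower N K V \<longrightarrow> jet_tower m L (\<lambda>x. \<Phi> (U x) (V x))"
    and "\<forall>K. \<exists>L. \<forall>U V. jet_tower N K U \<longrightarrow> jet_tower N K V \<longrightarrow> jet_tower m L (\<lambda>x. \<Psi> (U x) (V x))"
  then obtain L L' where L: "\<forall>U V. jet_tower N K U \<longrightarrow> jet_tower N K V \<longrightarrow> jet_tower m L (\<lambda>x. \<Phi> (U x) (V x))"
    and L': "\<forall>U V. jet_tower N K U \<longrightarrow> jet_tower N K V \<longrightarrow> jet_tower m L' (\<lambda>x. \<Psi> (U x) (V x))" by meson
  have "\<forall>U V. jet_tower N K U \<longrightarrow> jet_tower N K V \<longrightarrow> jet_tower m (L + L') (\<lambda>x. \<Phi> (U x) (V x) + \<Psi> (U x) (V x))"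
  proof (intro allI impI)
    fix U V assume "jet_tower N K U" "jet_tower N K V"
    then show "jet_tower m (L + L') (\<lambda>x. \<Phi> (U x) (V x) + \<Psi> (U x) (V x))"
      using L L' by (intro jet_tower_add) simp_all
  qed
  then show "\<exists>L. \<forall>U V. jet_tower N K U \<longrightarrow> jet_tower N K V \<longrightarrow> jet_tower m L (\<lambda>x. \<Phi> (U x) (V x) + \<Psi> (U x) (V x))" by blast
qed

lemma uniform_tower_mult: "uniform_tower N m \<Phi> \<Longrightarrow> uniform_tower N m \<Psi> \<Longrightarrow> uniform_tower N m (\<lambda>U V. \<Phi> U V * \<Psi> U V)"
  unfolding uniform_tower_def
proof
  fix K
  assume "\<forall>K. \<exists>L. \<forall>U V. jet_tower N K U \<longrightarrow> jet_tower N K V \<longrightarrow> jet_tower m L (\<lambda>x. \<Phi> (U x) (V x))"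
    and "\<forall>K. \<exists>L. \<forall>U V. jet_tower N K U \<longrightarrow> jet_tower N K V \<longrightarrow> jet_tower m L (\<lambda>x. \<Psi> (U x) (V x))"
  then obtain L L' where L: "\<forall>U V. jet_tower N K U \<longrightarrow> jet_tower N K V \<longrightarrow> jet_tower m L (\<lambda>x. \<Phi> (U x) (V x))"
    and L': "\<forall>U V. jet_tower N K U \<longrightarrow> jet_tower N K V \<longrightarrow> jet_tower m L' (\<lambda>x. \<Psi> (U x) (V x))" by meson
  have "\<forall>U V. jet_tower N K U \<longrightarrow> jet_tower N K V \<longrightarrow> jet_tower m (real m * (L * L')) (\<lambda>x. \<Phi> (U x) (V x) * \<Psi> (U x) (V x))"
  proof (intro allI impI)
    fix U V assume "jet_tower N K U" "jet_tower N K V"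
    then show "jet_tower m (real m * (L * L')) (\<lambda>x. \<Phi> (U x) (V x) * \<Psi> (U x) (V x))"
      using L L' by (intro jet_tower_mult) simp_all
  qed
  then show "\<exists>L. \<forall>U V. jet_tower N K U \<longrightarrow> jet_tower N K V \<longrightarrow> jet_tower m L (\<lambda>x. \<Phi> (U x) (V x) * \<Psi> (U x) (V x))" by blast
qed

lemma uniform_tower_cmult: "uniform_tower N m \<Phi> \<Longrightarrow> uniform_tower N m (\<lambda>U V. fps_const c * \<Phi> U V)"
  by (intro uniform_tower_mult uniform_tower_const)

lemma uniform_tower_uminus: "uniform_tower N m \<Phi> \<Longrightarrow> uniform_tower N m (\<lambda>U V. - \<Phi> U V)"
  using uniform_tower_cmult[of N m \<Phi> "- 1"] by (simp flip: fps_const_neg)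

lemma uniform_tower_deriv: "uniform_tower N (Suc m) \<Phi> \<Longrightarrow> uniform_tower N m (\<lambda>U V. fps_deriv (\<Phi> U V))"
  unfolding uniform_tower_def
proof
  fix K
  assume "\<forall>K. \<exists>L. \<forall>U V. jet_tower N K U \<longrightarrow> jet_tower N K V \<longrightarrow> jet_tower (Suc m) L (\<lambda>x. \<Phi> (U x) (V x))"
  then obtain L where L: "\<forall>U V. jet_tower N K U \<longrightarrow> jet_tower N K V \<longrightarrow> jet_tower (Suc m) L (\<lambda>x. \<Phi> (U x) (V x))" by meson
  have "\<forall>U V. jet_tower N K U \<longrightarrow> jet_tower N K V \<longrightarrow> jet_tower m (real (Suc m) * L) (\<lambda>x. fps_deriv (\<Phi> (U x) (V x)))"
    using L by (intro allI impI jet_tower_deriv) simp_all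
  then show "\<exists>L. \<forall>U V. jet_tower N K U \<longrightarrow> jet_tower N K V \<longrightarrow> jet_tower m L (\<lambda>x. fps_deriv (\<Phi> (U x) (V x)))" by blast
qed

lemma uniform_tower_sum: "finite I \<Longrightarrow> (\<And>i. i \<in> I \<Longrightarrow> uniform_tower N m (\<Phi> i)) \<Longrightarrow> uniform_tower N m (\<lambda>U V. \<Sum>i\<in>I. \<Phi> i U V)"
  by (induction I rule: finite_induct) (auto intro: uniform_tower_add uniform_tower_0)

lemma akns_b_1 [simp]: "akns_b U V (Suc 0) = 0"
  by simp

text \<open>The coefficients \<open>a\<^sub>k\<close> and \<open>c\<^sub>k\<close> contain derivatives up to order \<open>k - 1\<close> and \<open>b\<^sub>k\<close> up to order \<open>k - 2\<close>. The exceptional cases \<open>b\<^sub>0 = 1\<close> and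
\<open>b\<^sub>1 = 0\<close> are smoother than the formula says.\<close>

lemma uniform_tower_akns:
  "(1 \<le> k \<longrightarrow> k \<le> N \<longrightarrow> uniform_tower N (N + 1 - k) (\<lambda>U V. akns_a U V k) \<and> uniform_tower N (N + 1 - k) (\<lambda>U V. akns_c U V k)) \<and>
   (2 \<le> k \<longrightarrow> k \<le> N + 1 \<longrightarrow> uniform_tower N (N + 2 - k) (\<lambda>U V. akns_b U V k))"
proof (induction k rule: less_induct)
  case (less k)
  have IHa: "uniform_tower N m (\<lambda>U V. akns_a U V i)" "uniform_tower N m (\<lambda>U V. akns_c U V i)" if "i < k" "i \<le> N" "m \<le> N + 1 - i" for i m
    using less[of i] that uniform_tower_0 by (cases "i = 0"; auto intro: uniform_tower_mono[OF _ that(3)])+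
  have IHb: "uniform_tower N m (\<lambda>U V. akns_b U V i)" if "i < k" "i \<le> N + 1" "m \<le> N + 2 - i" "m \<le> N" for i m
  proof -
    consider "i = 0" | "i = 1" | "2 \<le> i" by linarith
    then show ?thesis
    proof cases
      case 3
      then show ?thesis using less[of i] that by (auto intro: uniform_tower_mono[OF _ that(3)])
    qed (auto simp: uniform_tower_0 uniform_tower_1)
  qed
  show ?case
  proof (cases k)
    case (Suc n)
    have "uniform_tower N (N + 1 - k) (\<lambda>U V. akns_a U V k)" if "k \<le> N"
      unfolding Suc akns_a.simps
      by (intro uniform_tower_add uniform_tower_mult uniform_tower_deriv IHa IHb uniform_tower_mono[OF uniform_tower_V]) (use that Suc in auto)
    moreover have "uniform_tower N (N + 1 - k) (\<lambda>U V. akns_c U V k)" if "k \<le> N"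
      unfolding Suc akns_c.simps
      by (intro uniform_tower_uminus uniform_tower_add uniform_tower_mult uniform_tower_deriv IHa IHb uniform_tower_mono[OF uniform_tower_U]) (use that Suc in auto)
    moreover have "uniform_tower N (N + 2 - k) (\<lambda>U V. akns_b U V k)" if "2 \<le> k" "k \<le> N + 1"
    proof -
      have "uniform_tower N (N + 2 - k) (\<lambda>U V. (\<Sum>i\<in>{1..n}. fps_const 2 * (akns_a U V i * akns_c U V (Suc n - i)))
         + - (fps_const (1/2) * (\<Sum>i\<in>{1..n}. akns_b U V i * akns_b U V (Suc n - i))))"
        by (intro uniform_tower_uminus uniform_tower_add uniform_tower_mult uniform_tower_const uniform_tower_sum finite_atLeastAtMost IHa IHb) (use that Suc in auto)
      then show ?thesis unfolding Suc akns_b.simps by (simp add: numeral_fps_const del: akns_a.simps akns_b.simps akns_c.simps)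
    qed
    ultimately show ?thesis by blast
  qed simp
qed

text \<open>What is left of \<open>a\<^sub>k\<^sub>+\<^sub>1\<close> after its linear part \<open>v\<^sup>(\<^sup>k\<^sup>)\<close> is removed. It contains derivatives up to order \<open>k - 2\<close> only.\<close>

definition akns_rest :: "nat \<Rightarrow> complex fps \<Rightarrow> complex fps \<Rightarrow> complex fps" where
  "akns_rest k U V = akns_a U V (Suc k) - (fps_deriv ^^ k) V"

lemma akns_rest_rec: "akns_rest 0 U V = 0" "akns_rest (Suc k) U V = fps_deriv (akns_rest k U V) + akns_b U V (Suc k) * V"
  by (simp_all add: akns_rest_def)

lemma uniform_tower_akns_rest: "k \<le> N \<Longrightarrow> uniform_tower N (if k \<le> 1 then N else N + 2 - k) (akns_rest k)"
proof (induction k)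
  case 0
  then show ?case by (simp add: akns_rest_rec[abs_def] uniform_tower_0)
next
  case (Suc k)
  show ?case
  proof (cases "k = 0")
    case True
    then have "akns_rest (Suc k) = (\<lambda>U V. 0)" by (auto simp: fun_eq_iff akns_rest_rec simp del: akns_b.simps)
    then show ?thesis by (simp add: uniform_tower_0)
  next
    case k: False
    have d: "uniform_tower N (N + 1 - k) (\<lambda>U V. fps_deriv (akns_rest k U V))"
    proof (cases "k = 1")
      case True
      then have "akns_rest k = (\<lambda>U V. 0)" by (auto simp: fun_eq_iff akns_rest_rec simp del: akns_b.simps)
      then show ?thesis by (simp add: uniform_tower_0)
    next
      case False
      then show ?thesis using Suc k by (intro uniform_tower_deriv) (auto simp: Suc_diff_le)
    qed
    have "uniform_tower N (N + 1 - k) (\<lambda>U V. akns_b U V (Suc k))"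
      using uniform_tower_akns[of "Suc k" N] Suc k by auto
    then have "uniform_tower N (N + 1 - k) (\<lambda>U V. fps_deriv (akns_rest k U V) + akns_b U V (Suc k) * V)"
      by (intro uniform_tower_add uniform_tower_mult d uniform_tower_mono[OF uniform_tower_V]) (use k in auto)
    then show ?thesis using k by (simp add: akns_rest_rec[abs_def] del: akns_b.simps)
  qed
qed

lemma uniform_tower_akns_rest': "1 \<le> N \<Longrightarrow> uniform_tower N 2 (akns_rest N)"
proof (cases "N = 1")
  case True
  then have "akns_rest N = (\<lambda>U V. 0)" by (auto simp: fun_eq_iff akns_rest_rec simp del: akns_b.simps)
  then show ?thesis by (simp add: uniform_tower_0)
next
  case False
  assume "1 \<le> N" then show ?thesis using False uniform_tower_akns_rest[of N N] by simp
qed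

section \<open>The quadratic form behind the Floquet multiplier\<close>

text \<open>A function in \<open>H\<^sup>N\<close>, given by its derivatives \<open>d 0\<close>, ..., \<open>d N\<close>.\<close>

definition sobolev_tower :: "nat \<Rightarrow> real \<Rightarrow> (nat \<Rightarrow> real \<Rightarrow> complex) \<Rightarrow> bool" where
  "sobolev_tower N K d \<longleftrightarrow> 1 \<le> K \<and> (\<forall>k<N. abs_cont (d k) (d (Suc k)) \<and> d k 1 = d k 0 \<and>
     (\<forall>x\<in>{0..1}. cmod (d k x) \<le> K)) \<and> L2_bound K (d N)"

text \<open>The factorials make \<open>fps_deriv\<close> shift the sequence of derivatives.\<close>

definition jet :: "(nat \<Rightarrow> real \<Rightarrow> complex) \<Rightarrow> real \<Rightarrow> complex fps" where
  "jet d x = Abs_fps (\<lambda>j. d j x / fact j)"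

lemma jet_tower_jet:
  assumes "sobolev_tower N K d" shows "jet_tower N K (jet d)"
  unfolding jet_tower_def
proof (intro conjI allI impI)
  have K: "1 \<le> K" using assms by (simp add: sobolev_tower_def)
  then show "0 \<le> K" by simp
  fix j assume "j < N"
  then have d: "abs_cont (d j) (d (Suc j))" "d j 1 = d j 0" "\<forall>x\<in>{0..1}. cmod (d j x) \<le> K"
    using assms by (auto simp: sobolev_tower_def)
  show "abs_cont (\<lambda>x. jet d x !$ j) (\<lambda>x. of_nat (Suc j) * jet d x !$ Suc j)"
    by (rule abs_cont_cong[OF abs_cont_cmult[OF d(1), of "1 / fact j"]])
      (simp_all add: jet_def divide_simps del: of_nat_Suc)
  show "jet d 1 !$ j = jet d 0 !$ j" using d by (simp add: jet_def)
  show "\<forall>x\<in>{0..1}. cmod (jet d x !$ j) \<le> K"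
  proof
    fix x :: real assume "x \<in> {0..1}"
    then have "cmod (d j x) / fact j \<le> K / 1" using d(3) K by (intro frac_le) (auto simp: fact_ge_1)
    then show "cmod (jet d x !$ j) \<le> K" by (simp add: jet_def norm_divide)
  qed
qed

lemma fps_deriv_pow_0: "(fps_deriv ^^ k) F !$ 0 = fact k * F !$ k"
  by (induction k arbitrary: F) (simp_all add: funpow_swap1 algebra_simps)

lemma uniform_tower_uniform:
  assumes "finite I" "\<And>i. i \<in> I \<Longrightarrow> uniform_tower N (m i) (\<Phi> i)"
  shows "\<exists>L\<ge>1. \<forall>U V. jet_tower N K U \<longrightarrow> jet_tower N K V \<longrightarrow> (\<forall>i\<in>I. jet_tower (m i) L (\<lambda>x. \<Phi> i (U x) (V x)))"
  using assms
proof (induction I rule: finite_induct)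
  case (insert j I)
  then obtain L where L: "L \<ge> 1" "\<forall>U V. jet_tower N K U \<longrightarrow> jet_tower N K V \<longrightarrow> (\<forall>i\<in>I. jet_tower (m i) L (\<lambda>x. \<Phi> i (U x) (V x)))" by auto
  have "uniform_tower N (m j) (\<Phi> j)" using insert by simp
  then obtain L' where L': "\<forall>U V. jet_tower N K U \<longrightarrow> jet_tower N K V \<longrightarrow> jet_tower (m j) L' (\<lambda>x. \<Phi> j (U x) (V x))"
    unfolding uniform_tower_def by meson
  show ?case
  proof (intro exI[of _ "max L L'"] conjI allI impI)
    show "1 \<le> max L L'" using L by simp
    fix U V assume UV: "jet_tower N K U" "jet_tower N K V"
    show "\<forall>i\<in>insert j I. jet_tower (m i) (max L L') (\<lambda>x. \<Phi> i (U x) (V x))"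
    proof
      fix i assume "i \<in> insert j I"
      then show "jet_tower (m i) (max L L') (\<lambda>x. \<Phi> i (U x) (V x))"
        using L(2) L' UV jet_tower_mono[OF _ order_refl max.cobounded1[of L L']] jet_tower_mono[OF _ order_refl max.cobounded2[of L' L]]
        by (cases "i = j") auto
    qed
  qed
qed (auto intro!: exI[of _ 1])

text \<open>The recursion read as a system of functions on \<open>[0,1]\<close>, with the bounds at \<open>0\<close> that control \<open>Y(0)\<close>.\<close>

definition akns_sys :: "nat \<Rightarrow> real \<Rightarrow> (real \<Rightarrow> complex) \<Rightarrow> (real \<Rightarrow> complex) \<Rightarrow> (nat \<Rightarrow> real \<Rightarrow> complex) \<Rightarrow>
    (nat \<Rightarrow> real \<Rightarrow> complex) \<Rightarrow> (nat \<Rightarrow> real \<Rightarrow> complex) \<Rightarrow> bool" where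
  "akns_sys N L u v a b c \<longleftrightarrow> (\<forall>x. a 0 x = 0 \<and> b 0 x = 1 \<and> c 0 x = 0) \<and>
     (\<forall>k\<le>N. abs_cont (a k) (\<lambda>x. a (Suc k) x - b k x * v x) \<and> abs_cont (c k) (\<lambda>x. - c (Suc k) x - b k x * u x) \<and>
       a k 1 = a k 0 \<and> c k 1 = c k 0 \<and> cmod (a k 0) \<le> L \<and> cmod (c k 0) \<le> L \<and> cmod (b k 0) \<le> L) \<and>
     (\<forall>k\<le>Suc N. abs_cont (b k) (\<lambda>x. - 2 * (a k x * u x + c k x * v x)) \<and> b k 1 = b k 0)"

definition smooth_rest :: "real \<Rightarrow> (real \<Rightarrow> complex) \<Rightarrow> bool" where
  "smooth_rest L r \<longleftrightarrow> L2_bound L r \<and> r 1 = r 0 \<and> (\<exists>r'. abs_cont r r' \<and> L2_bound L r')"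

lemma smooth_rest_jet_tower:
  assumes "jet_tower 2 L F" shows "smooth_rest L (\<lambda>x. F x !$ 0)"
  unfolding smooth_rest_def
proof (intro conjI exI)
  have F: "abs_cont (\<lambda>x. F x !$ 0) (\<lambda>x. F x !$ 1)" "F 1 !$ 0 = F 0 !$ 0" "\<forall>x\<in>{0..1}. cmod (F x !$ 0) \<le> L"
    "abs_cont (\<lambda>x. F x !$ 1) (\<lambda>x. 2 * F x !$ 2)" "\<forall>x\<in>{0..1}. cmod (F x !$ 1) \<le> L"
    using assms[unfolded jet_tower_def, THEN conjunct2, rule_format, of 0] assms[unfolded jet_tower_def, THEN conjunct2, rule_format, of 1]
    by (simp_all add: numeral_2_eq_2)
  show "L2_bound L (\<lambda>x. F x !$ 0)" "L2_bound L (\<lambda>x. F x !$ 1)"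
    using F by (auto intro: L2_bound_cont abs_cont_cont)
  show "F 1 !$ 0 = F 0 !$ 0" "abs_cont (\<lambda>x. F x !$ 0) (\<lambda>x. F x !$ 1)" using F by auto
qed

text \<open>The leading parts of \<open>a\<^sub>N\<^sub>+\<^sub>1\<close> and \<open>c\<^sub>N\<^sub>+\<^sub>1\<close> are the top derivatives, which are only square integrable; the rests \<open>r\<close> and \<open>s\<close> have one
derivative to spare.\<close>

lemma akns_exists:
  assumes N: "1 \<le> N"
  shows "\<exists>L\<ge>1. \<forall>d e. sobolev_tower N K d \<longrightarrow> sobolev_tower N K e \<longrightarrow>
    (\<exists>a b c r s. akns_sys N L (d 0) (e 0) a b c \<and> smooth_rest L r \<and> smooth_rest L s \<and>
       (\<forall>x. a (Suc N) x = e N x + r x) \<and> (\<forall>x. c (Suc N) x = (-1) ^ Suc N * d N x + s x))"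
proof -
  obtain L1 where L1: "L1 \<ge> 1" "\<And>U V k. jet_tower N K U \<Longrightarrow> jet_tower N K V \<Longrightarrow> k \<in> {1..N} \<Longrightarrow> jet_tower (N + 1 - k) L1 (\<lambda>x. akns_a (U x) (V x) k)"
    using uniform_tower_uniform[of "{1..N}" N "\<lambda>k. N + 1 - k" "\<lambda>k U V. akns_a U V k" K] uniform_tower_akns[of _ N] by auto
  obtain L2 where L2: "L2 \<ge> 1" "\<And>U V k. jet_tower N K U \<Longrightarrow> jet_tower N K V \<Longrightarrow> k \<in> {1..N} \<Longrightarrow> jet_tower (N + 1 - k) L2 (\<lambda>x. akns_c (U x) (V x) k)"
    using uniform_tower_uniform[of "{1..N}" N "\<lambda>k. N + 1 - k" "\<lambda>k U V. akns_c U V k" K] uniform_tower_akns[of _ N] by auto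
  obtain L3 where L3: "L3 \<ge> 1" "\<And>U V k. jet_tower N K U \<Longrightarrow> jet_tower N K V \<Longrightarrow> k \<in> {2..N+1} \<Longrightarrow> jet_tower (N + 2 - k) L3 (\<lambda>x. akns_b (U x) (V x) k)"
    using uniform_tower_uniform[of "{2..N+1}" N "\<lambda>k. N + 2 - k" "\<lambda>k U V. akns_b U V k" K] uniform_tower_akns[of _ N] by auto
  obtain L4 where L4: "\<And>U V. jet_tower N K U \<Longrightarrow> jet_tower N K V \<Longrightarrow> jet_tower 2 L4 (\<lambda>x. akns_rest N (U x) (V x))"
    using uniform_tower_akns_rest'[OF N] unfolding uniform_tower_def by meson
  define L where "L = max (max L1 L2) (max L3 L4)"
  have Lge: "1 \<le> L" "L1 \<le> L" "L2 \<le> L" "L3 \<le> L" "L4 \<le> L" using L1 by (auto simp: L_def)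
  show ?thesis
  proof (intro exI[of _ L] conjI allI impI)
    show "1 \<le> L" by (rule Lge)
    fix d e assume de: "sobolev_tower N K d" "sobolev_tower N K e"
    note T = jet_tower_jet[OF de(1)] jet_tower_jet[OF de(2)]
    define a where "a = (\<lambda>k x. akns_a (jet d x) (jet e x) k !$ 0)"
    define b where "b = (\<lambda>k x. akns_b (jet d x) (jet e x) k !$ 0)"
    define c where "c = (\<lambda>k x. akns_c (jet d x) (jet e x) k !$ 0)"
    define r where "r = (\<lambda>x. akns_rest N (jet d x) (jet e x) !$ 0)"
    define s where "s = (\<lambda>x. (-1) ^ Suc N * akns_rest N (jet e x) (jet d x) !$ 0)"
    have a_eq: "akns_a (jet d x) (jet e x) k !$ 0 = a k x"
      and b_eq: "akns_b (jet d x) (jet e x) k !$ 0 = b k x"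
      and c_eq: "akns_c (jet d x) (jet e x) k !$ 0 = c k x" for k x
      by (simp_all add: a_def b_def c_def)
    have j0: "jet d x !$ 0 = d 0 x" "jet e x !$ 0 = e 0 x" for x by (simp_all add: jet_def)
    have coeff0: "fps_deriv F !$ 0 = F !$ 1" for F :: "complex fps" by simp
    have aD: "akns_a (jet d x) (jet e x) k !$ 1 = a (Suc k) x - b k x * e 0 x" for k x
      unfolding coeff0[symmetric] fps_deriv_akns_a fps_sub_nth fps_mult_nth a_def b_def by (simp add: j0)
    have cD: "akns_c (jet d x) (jet e x) k !$ 1 = - c (Suc k) x - b k x * d 0 x" for k x
      unfolding coeff0[symmetric] fps_deriv_akns_c fps_sub_nth fps_mult_nth fps_neg_nth c_def b_def by (simp add: j0)
    have bD: "akns_b (jet d x) (jet e x) k !$ 1 = - 2 * (a k x * d 0 x + c k x * e 0 x)" for k x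
    proof -
      have "akns_b (jet d x) (jet e x) k !$ 1 = (- 2 * (akns_a (jet d x) (jet e x) k * jet d x + akns_c (jet d x) (jet e x) k * jet e x)) !$ 0"
        unfolding coeff0[symmetric] fps_deriv_akns_b ..
      also have "\<dots> = - 2 * (a k x * d 0 x + c k x * e 0 x)"
        by (simp add: a_def c_def j0 fps_numeral_nth del: akns_a.simps akns_c.simps)
      finally show ?thesis .
    qed
    have z: "\<forall>x. a 0 x = 0 \<and> b 0 x = 1 \<and> c 0 x = 0" by (simp add: a_def b_def c_def)
    have b1: "b (Suc 0) x = 0" for x by (simp add: b_def)
    have towE: "abs_cont (\<lambda>x. F x !$ 0) (\<lambda>x. F x !$ 1) \<and> F 1 !$ 0 = F 0 !$ 0 \<and> cmod (F 0 !$ 0) \<le> L'"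
      if "jet_tower m L' F" "0 < m" for m L' F using that by (auto simp: jet_tower_def dest!: spec[of _ 0])
    have A: "abs_cont (a k) (\<lambda>x. a (Suc k) x - b k x * e 0 x) \<and> a k 1 = a k 0 \<and> cmod (a k 0) \<le> L" if k: "k \<le> N" for k
    proof (cases "k = 0")
      case True
      have "a (Suc 0) x = e 0 x" for x by (simp add: a_def j0)
      then show ?thesis using True z Lge(1) by (auto simp: a_def abs_cont_const)
    next
      case False
      have "abs_cont (\<lambda>x. akns_a (jet d x) (jet e x) k !$ 0) (\<lambda>x. akns_a (jet d x) (jet e x) k !$ 1) \<and>
          akns_a (jet d 1) (jet e 1) k !$ 0 = akns_a (jet d 0) (jet e 0) k !$ 0 \<and> cmod (akns_a (jet d 0) (jet e 0) k !$ 0) \<le> L1"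
        by (rule towE[OF L1(2)[OF T, of k]]) (use False k in auto)
      then show ?thesis unfolding aD a_eq using Lge(2) by (meson order_trans)
    qed
    have C: "abs_cont (c k) (\<lambda>x. - c (Suc k) x - b k x * d 0 x) \<and> c k 1 = c k 0 \<and> cmod (c k 0) \<le> L" if k: "k \<le> N" for k
    proof (cases "k = 0")
      case True
      have "c (Suc 0) x = - d 0 x" for x by (simp add: c_def j0)
      then show ?thesis using True z Lge(1) by (auto simp: c_def abs_cont_const)
    next
      case False
      have "abs_cont (\<lambda>x. akns_c (jet d x) (jet e x) k !$ 0) (\<lambda>x. akns_c (jet d x) (jet e x) k !$ 1) \<and>
          akns_c (jet d 1) (jet e 1) k !$ 0 = akns_c (jet d 0) (jet e 0) k !$ 0 \<and> cmod (akns_c (jet d 0) (jet e 0) k !$ 0) \<le> L2"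
        by (rule towE[OF L2(2)[OF T, of k]]) (use False k in auto)
      then show ?thesis unfolding cD c_eq using Lge(3) by (meson order_trans)
    qed
    have B: "abs_cont (b k) (\<lambda>x. - 2 * (a k x * d 0 x + c k x * e 0 x)) \<and> b k 1 = b k 0 \<and> cmod (b k 0) \<le> L" if k: "k \<le> Suc N" for k
    proof -
      consider "k = 0" | "k = 1" | "2 \<le> k" by linarith
      then show ?thesis
      proof cases
        case 1
        then show ?thesis using z Lge(1) by (auto simp: b_def abs_cont_const)
      next
        case 2
        have "a (Suc 0) x * d 0 x + c (Suc 0) x * e 0 x = 0" for x by (simp add: a_def c_def j0)
        then show ?thesis using 2 b1 Lge(1) abs_cont_const[of 0] by (simp add: b1[abs_def])
      next
        case 3
      have "abs_cont (\<lambda>x. akns_b (jet d x) (jet e x) k !$ 0) (\<lambda>x. akns_b (jet d x) (jet e x) k !$ 1) \<and>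
          akns_b (jet d 1) (jet e 1) k !$ 0 = akns_b (jet d 0) (jet e 0) k !$ 0 \<and> cmod (akns_b (jet d 0) (jet e 0) k !$ 0) \<le> L3"
        by (rule towE[OF L3(2)[OF T, of k]]) (use 3 k in auto)
      then show ?thesis unfolding bD b_eq using Lge(4) by (meson order_trans)
      qed
    qed
    have sys: "akns_sys N L (d 0) (e 0) a b c"
      unfolding akns_sys_def using z A B C by simp
    have r: "smooth_rest L r" unfolding r_def
      by (rule smooth_rest_jet_tower[OF jet_tower_mono[OF L4[OF T] order_refl Lge(5)]])
    have "smooth_rest L (\<lambda>x. akns_rest N (jet e x) (jet d x) !$ 0)"
      by (rule smooth_rest_jet_tower[OF jet_tower_mono[OF L4[OF T(2,1)] order_refl Lge(5)]])
    then have s: "smooth_rest L s"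
    proof -
      assume h: "smooth_rest L (\<lambda>x. akns_rest N (jet e x) (jet d x) !$ 0)"
      have m: "L2_bound L (\<lambda>x. (-1) ^ Suc N * q x)" if "L2_bound L q" for q
        using L2_bound_mult_cont[OF that, of "\<lambda>x. (-1) ^ Suc N" 1] by (simp add: mult.commute norm_power)
      from h obtain h' where h': "abs_cont (\<lambda>x. akns_rest N (jet e x) (jet d x) !$ 0) h'" "L2_bound L h'"
        "L2_bound L (\<lambda>x. akns_rest N (jet e x) (jet d x) !$ 0)" "akns_rest N (jet e 1) (jet d 1) !$ 0 = akns_rest N (jet e 0) (jet d 0) !$ 0"
        by (auto simp: smooth_rest_def)
      show ?thesis unfolding smooth_rest_def s_def
        by (intro conjI exI[of _ "\<lambda>x. (-1) ^ Suc N * h' x"] m h' abs_cont_cmult) (simp only: h'(4))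
    qed
    have a1: "\<forall>x. a (Suc N) x = e N x + r x"
      by (simp add: a_def r_def akns_rest_def fps_deriv_pow_0 jet_def del: akns_a.simps)
    have c1: "\<forall>x. c (Suc N) x = (-1) ^ Suc N * d N x + s x"
    proof
      fix x
      have "c (Suc N) x = ((-1) ^ Suc N * akns_a (jet e x) (jet d x) (Suc N)) !$ 0"
        unfolding c_def using akns_swap by metis
      also have "\<dots> = (-1) ^ Suc N * akns_a (jet e x) (jet d x) (Suc N) !$ 0"
        by (cases "even N") (simp_all del: akns_a.simps)
      also have "akns_a (jet e x) (jet d x) (Suc N) !$ 0 = d N x + akns_rest N (jet e x) (jet d x) !$ 0"
        by (simp add: akns_rest_def fps_deriv_pow_0 jet_def del: akns_a.simps)
      finally show "c (Suc N) x = (-1) ^ Suc N * d N x + s x" by (simp add: s_def distrib_left)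
    qed
    show "\<exists>a b c r s. akns_sys N L (d 0) (e 0) a b c \<and> smooth_rest L r \<and> smooth_rest L s \<and>
       (\<forall>x. a (Suc N) x = e N x + r x) \<and> (\<forall>x. c (Suc N) x = (-1) ^ Suc N * d N x + s x)"
      using sys r s a1 c1 by blast
  qed
qed

text \<open>The integrand is \<open>- 1/2\<close> times the derivative of the periodic function \<open>b\<^sub>N\<^sub>+\<^sub>1\<close>.\<close>

lemma akns_orthogonality:
  assumes "akns_sys N L u v a b c"
  shows "integral {0..1} (\<lambda>x. a (Suc N) x * u x + c (Suc N) x * v x) = 0"
proof -
  have "abs_cont (b (Suc N)) (\<lambda>x. - 2 * (a (Suc N) x * u x + c (Suc N) x * v x))" "b (Suc N) 1 = b (Suc N) 0"
    using assms by (auto simp: akns_sys_def)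
  from abs_cont_total[OF this(1)] this(2) show ?thesis by (simp only: integral_mult_right) simp
qed

lemma telescope_power:
  fixes A :: "nat \<Rightarrow> complex"
  assumes "q * \<nu> = 1"
  shows "(\<Sum>k\<le>N. q ^ k * (A (Suc k) - \<nu> * A k)) = q ^ N * A (Suc N) - \<nu> * A 0"
proof (induction N)
  case (Suc N)
  have "q ^ Suc N * (\<nu> * A (Suc N)) = q ^ N * ((q * \<nu>) * A (Suc N))" by (simp add: mult_ac)
  also have "\<dots> = q ^ N * A (Suc N)" using assms by simp
  finally show ?case using Suc by (simp add: right_diff_distrib)
qed simp

text \<open>The form \<open>Y = \<Sum> q\<^sup>k (a\<^sub>k f\<^sup>2 + b\<^sub>k f g + c\<^sub>k g\<^sup>2)\<close>, \<open>k \<le> N\<close>, is multiplied by \<open>f(1)\<^sup>2\<close> over one period. In its derivative the terms with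
\<open>f g\<close> cancel, and those with \<open>f\<^sup>2\<close> and \<open>g\<^sup>2\<close> telescope to the two terms of index \<open>N + 1\<close>.\<close>

lemma akns_identity:
  assumes sys: "akns_sys N L u v a b c" and s: "zs_sol z u v f g"
    and uv: "continuous_on {0..1} u" "continuous_on {0..1} v"
    and q: "q * (2 * \<i> * z) = 1" and i: "f 0 = 1" "g 0 = 1" and e: "f 1 = g 1"
  shows "((f 1)\<^sup>2 - 1) * (\<Sum>k\<le>N. q ^ k * (a k 0 + b k 0 + c k 0))
    = q ^ N * integral {0..1} (\<lambda>x. a (Suc N) x * (f x)\<^sup>2 - c (Suc N) x * (g x)\<^sup>2)"
proof -
  define \<nu> where "\<nu> = 2 * \<i> * z"
  note fa = zs_abs_cont[OF s uv]
  have A: "abs_cont (a k) (\<lambda>x. a (Suc k) x - b k x * v x)" "abs_cont (c k) (\<lambda>x. - c (Suc k) x - b k x * u x)"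
    "abs_cont (b k) (\<lambda>x. - 2 * (a k x * u x + c k x * v x))" "a k 1 = a k 0" "b k 1 = b k 0" "c k 1 = c k 0" if "k \<in> {..N}" for k
    using sys that by (auto simp: akns_sys_def)
  define Y where "Y = (\<lambda>x. \<Sum>k\<le>N. q ^ k * (a k x * (f x * f x) + b k x * (f x * g x) + c k x * (g x * g x)))"
  have "abs_cont Y (\<lambda>x. q ^ N * (a (Suc N) x * (f x)\<^sup>2 - c (Suc N) x * (g x)\<^sup>2))"
  proof (rule abs_cont_cong)
    show "abs_cont (\<lambda>x. \<Sum>k\<le>N. q ^ k * (a k x * (f x * f x) + b k x * (f x * g x) + c k x * (g x * g x)))
      (\<lambda>x. \<Sum>k\<le>N. q ^ k * (
        ((a (Suc k) x - b k x * v x) * (f x * f x) + a k x * ((- \<i> * z * f x + u x * g x) * f x + f x * (- \<i> * z * f x + u x * g x))) +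
        ((- 2 * (a k x * u x + c k x * v x)) * (f x * g x) + b k x * ((- \<i> * z * f x + u x * g x) * g x + f x * (\<i> * z * g x + v x * f x))) +
        ((- c (Suc k) x - b k x * u x) * (g x * g x) + c k x * ((\<i> * z * g x + v x * f x) * g x + g x * (\<i> * z * g x + v x * f x)))))"
      by (intro abs_cont_sum abs_cont_cmult abs_cont_add abs_cont_mult A fa) auto
  next
    fix x
    have "(\<Sum>k\<le>N. q ^ k * (
        ((a (Suc k) x - b k x * v x) * (f x * f x) + a k x * ((- \<i> * z * f x + u x * g x) * f x + f x * (- \<i> * z * f x + u x * g x))) +
        ((- 2 * (a k x * u x + c k x * v x)) * (f x * g x) + b k x * ((- \<i> * z * f x + u x * g x) * g x + f x * (\<i> * z * g x + v x * f x))) +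
        ((- c (Suc k) x - b k x * u x) * (g x * g x) + c k x * ((\<i> * z * g x + v x * f x) * g x + g x * (\<i> * z * g x + v x * f x)))))
      = (\<Sum>k\<le>N. (f x)\<^sup>2 * (q ^ k * (a (Suc k) x - \<nu> * a k x)) - (g x)\<^sup>2 * (q ^ k * (c (Suc k) x - \<nu> * c k x)))"
      by (intro sum.cong refl) (simp add: \<nu>_def power2_eq_square algebra_simps)
    also have "\<dots> = (f x)\<^sup>2 * (\<Sum>k\<le>N. q ^ k * (a (Suc k) x - \<nu> * a k x)) - (g x)\<^sup>2 * (\<Sum>k\<le>N. q ^ k * (c (Suc k) x - \<nu> * c k x))"
      by (simp only: sum_subtractf sum_distrib_left)
    also have "\<dots> = q ^ N * (a (Suc N) x * (f x)\<^sup>2 - c (Suc N) x * (g x)\<^sup>2)"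
    proof -
      have "a 0 x = 0" "c 0 x = 0" using sys by (auto simp: akns_sys_def)
      moreover have h: "q * \<nu> = 1" using q by (simp add: \<nu>_def)
      ultimately show ?thesis unfolding telescope_power[OF h, of "\<lambda>k. a k x"] telescope_power[OF h, of "\<lambda>k. c k x"]
        by (simp add: algebra_simps)
    qed
    finally show "q ^ N * (a (Suc N) x * (f x)\<^sup>2 - c (Suc N) x * (g x)\<^sup>2) = (\<Sum>k\<le>N. q ^ k * (
        ((a (Suc k) x - b k x * v x) * (f x * f x) + a k x * ((- \<i> * z * f x + u x * g x) * f x + f x * (- \<i> * z * f x + u x * g x))) +
        ((- 2 * (a k x * u x + c k x * v x)) * (f x * g x) + b k x * ((- \<i> * z * f x + u x * g x) * g x + f x * (\<i> * z * g x + v x * f x))) +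
        ((- c (Suc k) x - b k x * u x) * (g x * g x) + c k x * ((\<i> * z * g x + v x * f x) * g x + g x * (\<i> * z * g x + v x * f x)))))"
      by simp
  qed (simp add: Y_def)
  from abs_cont_total[OF this] have "q ^ N * integral {0..1} (\<lambda>x. a (Suc N) x * (f x)\<^sup>2 - c (Suc N) x * (g x)\<^sup>2) = Y 1 - Y 0"
    by simp
  moreover have "Y 1 = (f 1)\<^sup>2 * (\<Sum>k\<le>N. q ^ k * (a k 0 + b k 0 + c k 0))"
    unfolding Y_def sum_distrib_left using A(4,5,6)
    by (intro sum.cong refl) (simp add: e[symmetric] power2_eq_square algebra_simps)
  moreover have "Y 0 = (\<Sum>k\<le>N. q ^ k * (a k 0 + b k 0 + c k 0))"
    unfolding Y_def using i by simp
  ultimately show ?thesis by (simp add: left_diff_distrib)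
qed

section \<open>Second-order asymptotics of squared solutions\<close>

text \<open>Taylor's formula; the constant only has to exceed \<open>exp 2\<close>.\<close>

lemma exp_near_1:
  fixes y :: complex
  assumes "cmod y \<le> 2"
  shows "cmod (exp y - 1) \<le> 8 * cmod y" "cmod (exp y - 1 - y) \<le> 8 * (cmod y)\<^sup>2"
proof -
  have "\<bar>Re y\<bar> \<le> 2" using assms abs_Re_le_cmod[of y] by linarith
  then have "exp \<bar>Re y\<bar> \<le> exp 2" by simp
  also have "exp (2::real) = exp 1 * exp 1" by (simp flip: exp_add)
  also have "\<dots> \<le> 2.8 * 2.8" using e_less_272 by (intro mult_mono) auto
  finally have e: "exp \<bar>Re y\<bar> \<le> 8" by simp
  have "cmod (exp y - (\<Sum>k\<le>0. y ^ k / fact k)) \<le> exp \<bar>Re y\<bar> * cmod y ^ Suc 0 / fact 0" by (rule Taylor_exp)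
  also have "\<dots> \<le> 8 * cmod y" using e by (simp add: mult_right_mono)
  finally show "cmod (exp y - 1) \<le> 8 * cmod y" by simp
  have "cmod (exp y - (\<Sum>k\<le>1. y ^ k / fact k)) \<le> exp \<bar>Re y\<bar> * cmod y ^ Suc 1 / fact 1" by (rule Taylor_exp)
  also have "\<dots> \<le> 8 * (cmod y)\<^sup>2" using e by (simp add: mult_right_mono power2_eq_square)
  finally show "cmod (exp y - 1 - y) \<le> 8 * (cmod y)\<^sup>2" by (simp add: algebra_simps)
qed

definition product_const :: "real \<Rightarrow> real" where "product_const K = 3 * (first_order_const K)\<^sup>2"

lemma product_const_ge1: "1 \<le> K \<Longrightarrow> 1 \<le> product_const K"
  unfolding product_const_def using one_le_power[OF first_order_const_ge1, of K 2] by linarith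

text \<open>In each product the exponentials of the first-order asymptotics cancel.\<close>

lemma zs_products:
  assumes data: "potential_bound K u u' v v'" and s: "zs_sol z u v f g" and K: "\<bar>Im z\<bar> \<le> K"
    and i: "f 0 = 1" "g 0 = 1" and x: "x \<in> {0..1}" and z: "z \<noteq> 0" and m: "1 / cmod z \<le> m" "m \<le> 1"
  shows "cmod (f x * g x - 1) \<le> product_const K * m"
    "cmod (cexp (2 * \<i> * z) x * (f x * f x) - 1) \<le> product_const K * m"
    "cmod (cexp (- (2 * \<i> * z)) x * (g x * g x) - 1) \<le> product_const K * m"
proof -
  define a b where "a = cexp (\<i> * z) x * f x" and "b = cexp (- \<i> * z) x * g x"
  have K1: "1 \<le> K" using data by (simp add: potential_bound_def)
  note C = first_order_const_ge1[OF K1]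
  have m0: "0 \<le> m" using m(1) by (meson norm_ge_zero order_trans zero_le_divide_1_iff)
  have le: "first_order_const K / cmod z \<le> first_order_const K * m" using mult_left_mono[OF m(1), of "first_order_const K"] C by simp
  have a: "cmod (a - 1) \<le> first_order_const K * m" and b: "cmod (b - 1) \<le> first_order_const K * m"
    using zs_first_order[OF data s K i x z] le unfolding a_def b_def by linarith+
  have Cm: "first_order_const K * m \<le> first_order_const K" using C m mult_left_mono[of m 1 "first_order_const K"] by simp
  have b': "cmod b \<le> 1 + first_order_const K" using b Cm norm_triangle_ineq[of "b - 1" 1] by simp
  have a': "cmod a \<le> 1 + first_order_const K" using a Cm norm_triangle_ineq[of "a - 1" 1] by simp
  have gen: "cmod (p * q - 1) \<le> product_const K * m" if "cmod (p - 1) \<le> first_order_const K * m" "cmod (q - 1) \<le> first_order_const K * m" "cmod q \<le> 1 + first_order_const K" for p q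
  proof -
    have "p * q - 1 = (p - 1) * q + (q - 1)" by (simp add: algebra_simps)
    then have "cmod (p * q - 1) \<le> cmod (p - 1) * cmod q + cmod (q - 1)"
      by (metis norm_mult norm_triangle_ineq)
    also have "\<dots> \<le> (first_order_const K * m) * (1 + first_order_const K) + first_order_const K * m"
      using that C m0 by (intro add_mono mult_mono) auto
    also have "\<dots> = m * (first_order_const K * first_order_const K + 2 * first_order_const K)" by (simp add: algebra_simps)
    also have "\<dots> \<le> m * (first_order_const K * first_order_const K + 2 * (first_order_const K * first_order_const K))"
      using C m0 mult_mono[of 1 "first_order_const K" 1 "first_order_const K"] mult_left_mono[OF C, of "first_order_const K"] by (intro mult_left_mono) auto
    finally show ?thesis by (simp add: product_const_def power2_eq_square mult.commute)
  qed
  have "a * b = (cexp (\<i> * z) x * cexp (- \<i> * z) x) * (f x * g x)" by (simp add: a_def b_def mult_ac)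
  then have "a * b = f x * g x" by (simp add: cexp_add)
  then show "cmod (f x * g x - 1) \<le> product_const K * m" using gen[OF a b b'] by simp
  have "a * a = (cexp (\<i> * z) x * cexp (\<i> * z) x) * (f x * f x)" by (simp add: a_def mult_ac)
  then have "a * a = cexp (2 * \<i> * z) x * (f x * f x)" by (simp add: cexp_add mult.assoc)
  then show "cmod (cexp (2 * \<i> * z) x * (f x * f x) - 1) \<le> product_const K * m" using gen[OF a a a'] by simp
  have "b * b = (cexp (- \<i> * z) x * cexp (- \<i> * z) x) * (g x * g x)" by (simp add: b_def mult_ac)
  then have "b * b = cexp (- (2 * \<i> * z)) x * (g x * g x)" by (simp add: cexp_add mult.assoc)
  then show "cmod (cexp (- (2 * \<i> * z)) x * (g x * g x) - 1) \<le> product_const K * m" using gen[OF b b b'] by simp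
qed

lemma cont_integral_bound:
  fixes h :: "real \<Rightarrow> complex"
  assumes "continuous_on {0..1} h" "\<And>t. t \<in> {0..1} \<Longrightarrow> cmod (h t) \<le> B" "x \<in> {0..1}"
  shows "cmod (integral {0..x} h) \<le> B"
proof -
  have B: "0 \<le> B" using assms(2)[of 0] order_trans[OF norm_ge_zero] by auto
  have "cmod (integral {0..x} h) \<le> B * (x - 0)"
    by (rule integral_bound) (use assms in \<open>auto intro: continuous_on_subset\<close>)
  also have "\<dots> \<le> B * 1" using assms(3) B by (intro mult_left_mono) auto
  finally show ?thesis by simp
qed

definition second_order_const :: "real \<Rightarrow> real \<Rightarrow> real" where "second_order_const K W = 20 * W * (K\<^sup>2 * exp (4 * K) * product_const K)"

lemma fourier_mode_cexp: "fourier_mode n x = cexp (- (2 * \<i> * (of_int n * of_real pi))) x"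
  by (simp add: fourier_mode_def cexp_def mult_ac)

text \<open>Of the three terms on the left, the one with \<open>u'\<close> becomes a partial Fourier integral, the one with \<open>u\<^sup>2\<close> oscillates and is small by
integration by parts, and the one with \<open>u v\<close> loses its oscillation.\<close>

lemma second_order_integrals:
  assumes data: "potential_bound K u u' v v'" and s: "zs_sol z u v f g" and i: "f 0 = 1" "g 0 = 1" and x: "x \<in> {0..1}"
    and z: "z = of_int n * of_real pi + w" and w: "cmod w \<le> W * m" "cmod w \<le> 1" and m: "0 < m" "m \<le> 1" "1 / cmod z \<le> m" and W: "1 \<le> W" and z0: "z \<noteq> 0"
  defines "\<nu> \<equiv> 2 * \<i> * z"
  shows "cmod (integral {0..x} (\<lambda>t. u' t * (cexp \<nu> t * (f t * g t)) + u t * u t * (cexp \<nu> t * (g t * g t)) + u t * v t * (cexp \<nu> t * (f t * f t)))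
       - integral {0..x} (\<lambda>t. u' t * fourier_mode (- n) t) - integral {0..x} (\<lambda>t. u t * v t)) \<le> second_order_const K W * m"
proof -
  have D: "1 \<le> K" "abs_cont u u'" "abs_cont v v'" "L2_bound K u'" "L2_bound K v'" "\<And>x. x \<in> {0..1} \<Longrightarrow> cmod (u x) \<le> K" "\<And>x. x \<in> {0..1} \<Longrightarrow> cmod (v x) \<le> K"
    using data by (auto simp: potential_bound_def)
  note uc = abs_cont_cont[OF D(2)] and vc = abs_cont_cont[OF D(3)] and fg = zs_cont[OF s]
  have Im: "\<bar>Im z\<bar> \<le> K" using w(2) D(1) abs_Im_le_cmod[of w] z by simp
  note pr = zs_products[OF data s Im i _ z0 m(3,2)]
  define Q where "Q = product_const K"
  have Q1: "1 \<le> Q" unfolding Q_def by (rule product_const_ge1[OF D(1)])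
  define e4 where "e4 = exp (4 * K)"
  have e41: "1 \<le> e4" using D(1) by (simp add: e4_def)
  have E: "cmod (cexp \<nu> t) \<le> e4" if "t \<in> {0..1}" for t
    unfolding e4_def by (rule cexp_bound[OF that]) (use Im D(1) in \<open>simp add: \<nu>_def\<close>)
  have E2: "cmod (cexp (2 * \<nu>) t) \<le> e4" if "t \<in> {0..1}" for t
    unfolding e4_def by (rule cexp_bound[OF that]) (use Im D(1) in \<open>simp add: \<nu>_def\<close>)
  have u'i: "set_integrable lborel {0..1} u'" and u'n: "integral {0..1} (\<lambda>t. cmod (u' t)) \<le> K"
    using D(4) L2_bound_integral_norm[OF D(4)] by (auto simp: L2_bound_def)
  define M where "M = K\<^sup>2 * e4 * Q * m"
  have M0: "0 \<le> M" using D(1) e41 Q1 m by (simp add: M_def)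
  have K2: "K \<le> K\<^sup>2" using D(1) by (simp add: power2_eq_square mult_left_mono)
  have Me: "K * (e4 * (Q * m)) \<le> M"
    unfolding M_def mult.assoc using K2 e41 Q1 m by (intro mult_right_mono) auto
  define h1 where "h1 = (\<lambda>t. cexp \<nu> t * (f t * g t - 1))"
  define h2 where "h2 = (\<lambda>t. cexp \<nu> t - fourier_mode (- n) t)"
  have h1c: "continuous_on {0..1} h1" and h2c: "continuous_on {0..1} h2"
    unfolding h1_def h2_def by (intro continuous_intros fg)+
  have h1b: "cmod (h1 t) \<le> e4 * (Q * m)" if "t \<in> {0..1}" for t
    unfolding h1_def norm_mult[of "cexp \<nu> t"] using E[OF that] pr(1)[OF that] e41 by (intro mult_mono) (auto simp: Q_def)
  have T1: "cmod (integral {0..x} (\<lambda>t. u' t * h1 t)) \<le> M"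
    by (rule order_trans[OF integral_mult_bound[OF u'i h1c h1b x u'n] Me]) (use x in auto)
  have h2b: "cmod (h2 t) \<le> 16 * W * m" if t: "t \<in> {0..1}" for t
  proof -
    have "fourier_mode (- n) t * cexp (2 * \<i> * w) t = cexp \<nu> t"
      unfolding fourier_mode_cexp cexp_add by (simp add: \<nu>_def z algebra_simps)
    then have "h2 t = fourier_mode (- n) t * (cexp (2 * \<i> * w) t - 1)" by (simp add: h2_def right_diff_distrib)
    then have "cmod (h2 t) = cmod (exp (2 * \<i> * w * of_real t) - 1)" by (simp add: norm_mult cexp_def)
    also have n: "cmod (2 * \<i> * w * of_real t) \<le> 2 * cmod w"
      using t mult_left_mono[of t 1 "2 * cmod w"] by (simp add: norm_mult)
    then have "cmod (exp (2 * \<i> * w * of_real t) - 1) \<le> 8 * cmod (2 * \<i> * w * of_real t)"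
      by (intro exp_near_1) (use w(2) in linarith)
    also have "\<dots> \<le> 8 * (2 * (W * m))" using n w(1) by linarith
    finally show ?thesis by simp
  qed
  have T4: "cmod (integral {0..x} (\<lambda>t. u' t * h2 t)) \<le> 16 * W * M"
  proof -
    have "cmod (integral {0..x} (\<lambda>t. u' t * h2 t)) \<le> K * (16 * W * m)"
      by (rule integral_mult_bound[OF u'i h2c h2b x u'n]) (use x in auto)
    also have "\<dots> = 16 * W * (K * (1 * (1 * m)))" by simp
    also have "\<dots> \<le> 16 * W * (K * (e4 * (Q * m)))"
      using W D(1) e41 Q1 m by (intro mult_left_mono mult_mono) auto
    also have "\<dots> \<le> 16 * W * M" using Me W by (intro mult_left_mono) auto
    finally show ?thesis .
  qed
  define h3 where "h3 = (\<lambda>t. u t * v t * (cexp \<nu> t * (f t * f t) - 1))"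
  have h3c: "continuous_on {0..1} h3" unfolding h3_def by (intro continuous_intros fg uc vc)
  have T3: "cmod (integral {0..x} h3) \<le> M"
  proof (rule cont_integral_bound[OF h3c _ x])
    fix t :: real assume t: "t \<in> {0..1}"
    have "cmod (h3 t) \<le> (K * K) * (Q * m)"
      unfolding h3_def norm_mult[of "u t * v t"] norm_mult[of "u t" "v t"] using D(1) D(6,7)[OF t] pr(2)[OF t]
      by (intro mult_mono) (auto simp: \<nu>_def Q_def)
    also have "\<dots> = K\<^sup>2 * (1 * (Q * m))" by (simp add: power2_eq_square)
    also have "\<dots> \<le> K\<^sup>2 * (e4 * (Q * m))" using e41 Q1 m by (intro mult_left_mono mult_right_mono) auto
    finally show "cmod (h3 t) \<le> M" by (simp add: M_def mult.assoc)
  qed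
  define h5 where "h5 = (\<lambda>t. u t * u t * (cexp (2 * \<nu>) t * (cexp (- \<nu>) t * (g t * g t) - 1)))"
  have h5c: "continuous_on {0..1} h5" unfolding h5_def by (intro continuous_intros fg uc vc)
  have T5: "cmod (integral {0..x} h5) \<le> M"
  proof (rule cont_integral_bound[OF h5c _ x])
    fix t :: real assume t: "t \<in> {0..1}"
    have "cmod (h5 t) \<le> (K * K) * (e4 * (Q * m))"
      unfolding h5_def norm_mult[of "u t * u t"] norm_mult[of "u t" "u t"] norm_mult[of "cexp _ _" "_ - 1"] using D(1) D(6)[OF t] E2[OF t] pr(3)[OF t] Q1 m e41
      by (intro mult_mono) (auto simp: \<nu>_def Q_def)
    then show "cmod (h5 t) \<le> M" by (simp add: M_def mult.assoc power2_eq_square)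
  qed
  define h6 where "h6 = (\<lambda>t. u t * u t * cexp (2 * \<nu>) t)"
  have h6c: "continuous_on {0..1} h6" unfolding h6_def by (intro continuous_intros uc)
  have T6: "cmod (integral {0..x} h6) \<le> M"
  proof -
    define k where "k = (\<lambda>t. 2 * (u t * cexp (2 * \<nu>) t))"
    have kc: "continuous_on {0..1} k" unfolding k_def by (intro continuous_intros uc)
    have kb: "cmod (k t) \<le> 2 * (K * e4)" if "t \<in> {0..1}" for t
      unfolding k_def norm_mult using D(1) D(6)[OF that] E2[OF that] by (intro mult_mono) auto
    have hac: "abs_cont h6 (\<lambda>t. u' t * k t + (2 * \<nu>) * h6 t)"
      unfolding h6_def by (rule abs_cont_cong[OF abs_cont_mult[OF abs_cont_mult[OF D(2) D(2)] cexp_abs_cont]]) (auto simp: k_def algebra_simps)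
    have i1: "(\<lambda>t. u' t * k t) integrable_on {0..x}" "h6 integrable_on {0..x}"
      using set_integrable_sub(2)[OF set_integrable_mult_cont[OF u'i kc], of 0 x] set_integrable_sub(2)[OF set_integrable_cont[OF h6c], of 0 x] x by auto
    have "h6 x = h6 0 + integral {0..x} (\<lambda>t. u' t * k t + (2 * \<nu>) * h6 t)" by (rule abs_cont_eval[OF hac x])
    also have "integral {0..x} (\<lambda>t. u' t * k t + (2 * \<nu>) * h6 t) = integral {0..x} (\<lambda>t. u' t * k t) + (2 * \<nu>) * integral {0..x} h6"
      using i1 by (simp add: Henstock_Kurzweil_Integration.integral_add integrable_on_mult_right)
    finally have eq: "(2 * \<nu>) * integral {0..x} h6 = h6 x - h6 0 - integral {0..x} (\<lambda>t. u' t * k t)" by simp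
    have hb: "cmod (h6 t) \<le> K * K * e4" if "t \<in> {0..1}" for t
      unfolding h6_def norm_mult using D(1) D(6)[OF that] E2[OF that] by (intro mult_mono) auto
    have "cmod (2 * \<nu>) * cmod (integral {0..x} h6) \<le> K * K * e4 + K * K * e4 + K * (2 * (K * e4))"
      unfolding norm_mult[symmetric] eq
      by (intro order_trans[OF norm_triangle_ineq4] add_mono hb integral_mult_bound[OF u'i kc kb x u'n]) (use x in auto)
    then have "4 * cmod z * cmod (integral {0..x} h6) \<le> 4 * (K\<^sup>2 * e4)"
      by (simp add: \<nu>_def norm_mult power2_eq_square)
    then have "cmod (integral {0..x} h6) \<le> (K\<^sup>2 * e4) * (1 / cmod z)" using z0 by (simp add: field_simps)
    also have "\<dots> \<le> (K\<^sup>2 * e4) * (1 * m)" using m e41 by (intro mult_left_mono) auto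
    also have "\<dots> \<le> (K\<^sup>2 * e4) * (Q * m)" using m e41 Q1 by (intro mult_left_mono mult_right_mono) auto
    finally show ?thesis by (simp add: M_def mult.assoc)
  qed
  have I: "(\<lambda>t. u' t * h1 t) integrable_on {0..x}" "(\<lambda>t. u' t * h2 t) integrable_on {0..x}" "(\<lambda>t. u' t * fourier_mode (- n) t) integrable_on {0..x}"
    "h3 integrable_on {0..x}" "h5 integrable_on {0..x}" "h6 integrable_on {0..x}" "(\<lambda>t. u t * v t) integrable_on {0..x}"
    using set_integrable_sub(2)[OF set_integrable_mult_cont[OF u'i h1c], of 0 x] set_integrable_sub(2)[OF set_integrable_mult_cont[OF u'i h2c], of 0 x]
      set_integrable_sub(2)[OF set_integrable_mult_cont[OF u'i fourier_mode_cont], of 0 x "- n"]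
      set_integrable_sub(2)[OF set_integrable_cont[OF h3c], of 0 x] set_integrable_sub(2)[OF set_integrable_cont[OF h5c], of 0 x]
      set_integrable_sub(2)[OF set_integrable_cont[OF h6c], of 0 x]
      set_integrable_sub(2)[OF set_integrable_cont[OF continuous_on_mult[OF uc vc]], of 0 x] x by auto
  \<comment> \<open>Each \<open>h\<^sub>i\<close> is a product of one factor that stays bounded and one that is small or oscillates.\<close>
  have split: "u' t * (cexp \<nu> t * (f t * g t)) + u t * u t * (cexp \<nu> t * (g t * g t)) + u t * v t * (cexp \<nu> t * (f t * f t))
     = (((((u' t * h1 t + u' t * h2 t) + h3 t) + h5 t) + h6 t) + u' t * fourier_mode (- n) t) + u t * v t" for t
  proof -
    have F: "cexp (2 * \<nu>) t * (cexp (- \<nu>) t * (g t * g t)) = cexp \<nu> t * (g t * g t)"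
      by (simp add: mult.assoc[symmetric] cexp_add)
    have h5e: "h5 t = u t * u t * (cexp \<nu> t * (g t * g t)) - h6 t"
      unfolding h5_def h6_def F[symmetric] by (simp only: right_diff_distrib mult_1_right)
    show ?thesis unfolding h1_def h2_def h3_def h5e by (simp add: algebra_simps)
  qed
  have "integral {0..x} (\<lambda>t. u' t * (cexp \<nu> t * (f t * g t)) + u t * u t * (cexp \<nu> t * (g t * g t)) + u t * v t * (cexp \<nu> t * (f t * f t)))
    = (((((integral {0..x} (\<lambda>t. u' t * h1 t) + integral {0..x} (\<lambda>t. u' t * h2 t)) + integral {0..x} h3) + integral {0..x} h5)
       + integral {0..x} h6) + integral {0..x} (\<lambda>t. u' t * fourier_mode (- n) t)) + integral {0..x} (\<lambda>t. u t * v t)"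
    unfolding split using I by (simp only: Henstock_Kurzweil_Integration.integral_add integrable_add)
  then have "cmod (integral {0..x} (\<lambda>t. u' t * (cexp \<nu> t * (f t * g t)) + u t * u t * (cexp \<nu> t * (g t * g t)) + u t * v t * (cexp \<nu> t * (f t * f t)))
       - integral {0..x} (\<lambda>t. u' t * fourier_mode (- n) t) - integral {0..x} (\<lambda>t. u t * v t))
     = cmod ((((integral {0..x} (\<lambda>t. u' t * h1 t) + integral {0..x} (\<lambda>t. u' t * h2 t)) + integral {0..x} h3) + integral {0..x} h5)
       + integral {0..x} h6)" by (simp add: algebra_simps)
  also have "\<dots> \<le> (((M + 16 * W * M) + M) + M) + M"
    by (intro order_trans[OF norm_triangle_ineq] add_mono T1 T3 T4 T5 T6)
  also have "\<dots> = 4 * (1 * M) + 16 * W * M" by simp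
  also have "\<dots> \<le> 4 * (W * M) + 16 * W * M" using W M0 by (intro add_right_mono mult_left_mono mult_right_mono) auto
  also have "\<dots> = second_order_const K W * m" by (simp add: second_order_const_def M_def Q_def e4_def algebra_simps)
  finally show ?thesis .
qed

text \<open>With \<open>\<nu> = 2 \<i> z\<close> and \<open>q = 2/\<nu>\<close>, the function \<open>P = f\<^sup>2 - q u f g\<close> satisfies
\<open>P' = - \<nu> P - q (u' f g + u\<^sup>2 g\<^sup>2 + u v f\<^sup>2)\<close>. Removal of \<open>q u f g\<close> has cancelled the term \<open>2 u f g\<close>, which does not oscillate, and so
\<open>exp (\<nu> x) P\<close> is constant up to the integrals of the previous lemma, multiplied by \<open>q = O(1/n)\<close>.\<close>

lemma second_order_expansion:
  assumes data: "potential_bound K u u' v v'" and s: "zs_sol z u v f g" and i: "f 0 = 1" "g 0 = 1" and x: "x \<in> {0..1}"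
    and z: "z = of_int n * of_real pi + w" and w: "cmod w \<le> W * m" "cmod w \<le> 1" and m: "0 < m" "m \<le> 1" "1 / cmod z \<le> m" and W: "1 \<le> W" and z0: "z \<noteq> 0"
    and q: "q * (2 * \<i> * z) = 2"
  shows "cmod (f x * f x - q * (u x * (f x * g x)) - fourier_mode n x * (1 - 2 * \<i> * w * x
      - q * u 0 - q * integral {0..x} (\<lambda>t. u t * v t) - q * integral {0..x} (\<lambda>t. u' t * fourier_mode (- n) t)))
    \<le> 68 * W\<^sup>2 * second_order_const K W * m\<^sup>2"
proof -
  define \<nu> where "\<nu> = 2 * \<i> * z"
  have q\<nu>: "q * \<nu> = 2" using q by (simp add: \<nu>_def)
  have D: "1 \<le> K" "abs_cont u u'" "abs_cont v v'" "L2_bound K u'" "\<And>x. x \<in> {0..1} \<Longrightarrow> cmod (u x) \<le> K" "\<And>x. x \<in> {0..1} \<Longrightarrow> cmod (v x) \<le> K"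
    using data by (auto simp: potential_bound_def)
  note uc = abs_cont_cont[OF D(2)] and vc = abs_cont_cont[OF D(3)] and fg = zs_cont[OF s]
  note fa = zs_abs_cont[OF s uc vc]
  have u'i: "set_integrable lborel {0..1} u'" and u'n: "integral {0..1} (\<lambda>t. cmod (u' t)) \<le> K"
    using D(4) L2_bound_integral_norm[OF D(4)] by (auto simp: L2_bound_def)
  define H where "H = (\<lambda>t. u' t * (cexp \<nu> t * (f t * g t)) + u t * u t * (cexp \<nu> t * (g t * g t)) + u t * v t * (cexp \<nu> t * (f t * f t)))"
  define I1 where "I1 = integral {0..x} (\<lambda>t. u' t * fourier_mode (- n) t)"
  define I2 where "I2 = integral {0..x} (\<lambda>t. u t * v t)"
  define R where "R = integral {0..x} H - I1 - I2"
  have R: "cmod R \<le> second_order_const K W * m"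
    using second_order_integrals[OF data s i x z w m W z0] by (simp add: R_def H_def I1_def I2_def \<nu>_def)
  define p where "p = (\<lambda>x. cexp \<nu> x * (f x * f x + (- q) * (u x * (f x * g x))))"
  have pac: "abs_cont p (\<lambda>x. (- q) * H x)"
    unfolding p_def
  proof (rule abs_cont_cong[OF abs_cont_mult[OF cexp_abs_cont abs_cont_add[OF abs_cont_mult[OF fa(1) fa(1)] abs_cont_cmult[OF abs_cont_mult[OF D(2) abs_cont_mult[OF fa]]]]]])
    fix x :: real
    have *: "(\<nu> * cexp \<nu> x * (f x * f x + (- q) * (u x * (f x * g x))) +
       cexp \<nu> x * ((- \<i> * z * f x + u x * g x) * f x + f x * (- \<i> * z * f x + u x * g x) +
         (- q) * (u' x * (f x * g x) + u x * ((- \<i> * z * f x + u x * g x) * g x + f x * (\<i> * z * g x + v x * f x)))))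
       - (- q) * H x = cexp \<nu> x * (u x * (f x * g x)) * (2 - q * \<nu>)"
      unfolding H_def by (simp add: \<nu>_def algebra_simps)
    show "(- q) * H x = \<nu> * cexp \<nu> x * (f x * f x + (- q) * (u x * (f x * g x))) +
       cexp \<nu> x * ((- \<i> * z * f x + u x * g x) * f x + f x * (- \<i> * z * f x + u x * g x) +
         (- q) * (u' x * (f x * g x) + u x * ((- \<i> * z * f x + u x * g x) * g x + f x * (\<i> * z * g x + v x * f x))))"
      by (rule sym, rule iffD2[OF eq_iff_diff_eq_0], rule trans[OF *]) (simp add: q\<nu>)
  qed simp
  define \<theta> where "\<theta> = - q * u 0 - q * I2 - q * I1"
  define e' where "e' = - q * R"
  have px: "p x = 1 + \<theta> + e'"
    using abs_cont_eval[OF pac x] i by (simp add: p_def \<theta>_def e'_def R_def algebra_simps)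
  have qm: "cmod q \<le> m"
  proof -
    have "cmod q * (2 * cmod z) = 2" using arg_cong[OF q, of cmod] by (simp add: norm_mult)
    then have "cmod q = 1 / cmod z" using z0 by (simp add: field_simps)
    then show ?thesis using m by simp
  qed
  define DD where "DD = second_order_const K W"
  have K2W: "20 * K\<^sup>2 \<le> DD" "20 * W \<le> DD" "20 \<le> DD"
  proof -
    have K1: "1 \<le> K\<^sup>2" using D(1) by simp
    have a: "1 \<le> exp (4 * K) * product_const K" using D(1) product_const_ge1[OF D(1)] mult_mono[of 1 "exp (4 * K)" 1 "product_const K"] by simp
    have "20 * W * (K\<^sup>2 * 1) \<le> 20 * W * (K\<^sup>2 * (exp (4 * K) * product_const K))" using a W by (intro mult_left_mono) auto
    then have b: "20 * (W * K\<^sup>2) \<le> DD" by (simp add: DD_def second_order_const_def mult.assoc)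
    have "1 * K\<^sup>2 \<le> W * K\<^sup>2" "W * 1 \<le> W * K\<^sup>2" using W K1 by (intro mult_mono; simp)+
    then show "20 * K\<^sup>2 \<le> DD" "20 * W \<le> DD" "20 \<le> DD" using b W by linarith+
  qed
  have e'b: "cmod e' \<le> DD * m\<^sup>2"
  proof -
    have "cmod e' \<le> m * (DD * m)" unfolding e'_def norm_mult norm_minus_cancel DD_def
      using qm R m by (intro mult_mono) auto
    then show ?thesis by (simp add: power2_eq_square mult_ac)
  qed
  have I2b: "cmod I2 \<le> K\<^sup>2"
    unfolding I2_def power2_eq_square
    by (rule cont_integral_bound[OF _ _ x]) (use D(1,5,6) in \<open>auto simp: norm_mult intro!: continuous_intros uc vc mult_mono\<close>)
  have I1b: "cmod I1 \<le> K * 1"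
    unfolding I1_def by (rule integral_mult_bound[OF u'i fourier_mode_cont _ x u'n]) simp
  have KK: "K \<le> K\<^sup>2" using D(1) by (simp add: power2_eq_square mult_left_mono)
  have \<theta>b: "cmod \<theta> \<le> 3 * K\<^sup>2 * m"
  proof -
    have "cmod \<theta> \<le> m * K\<^sup>2 + m * K\<^sup>2 + m * K\<^sup>2"
      unfolding \<theta>_def
      by (intro order_trans[OF norm_triangle_ineq4] add_mono)
        (unfold norm_mult norm_minus_cancel, use qm m D(5)[of 0] I1b I2b KK in \<open>auto intro!: mult_mono\<close>)
    then show ?thesis by (simp add: algebra_simps)
  qed
  define y where "y = - 2 * \<i> * w * of_real x"
  define \<tau> where "\<tau> = exp y - 1 - y"
  have yb: "cmod y \<le> 2 * (W * m)" "cmod y \<le> 2"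
  proof -
    have "cmod y = 2 * cmod w * x" using x by (simp add: y_def norm_mult)
    also have "\<dots> \<le> 2 * cmod w * 1" using x by (intro mult_left_mono) auto
    finally show "cmod y \<le> 2 * (W * m)" "cmod y \<le> 2" using w by linarith+
  qed
  have \<tau>b: "cmod \<tau> \<le> 32 * W\<^sup>2 * m\<^sup>2"
  proof -
    have "cmod \<tau> \<le> 8 * (cmod y)\<^sup>2" unfolding \<tau>_def by (rule exp_near_1(2)[OF yb(2)])
    also have "\<dots> \<le> 8 * (2 * (W * m))\<^sup>2" using yb by (intro mult_left_mono power_mono) auto
    finally show ?thesis by (simp add: power_mult_distrib)
  qed
  have "cexp (- \<nu>) x = fourier_mode n x * exp y"
    unfolding fourier_mode_cexp by (simp add: cexp_def mult_exp_exp \<nu>_def y_def z algebra_simps)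
  moreover have "f x * f x - q * (u x * (f x * g x)) = (cexp (- \<nu>) x * cexp \<nu> x) * (f x * f x + (- q) * (u x * (f x * g x)))"
    by (simp add: cexp_add)
  then have "f x * f x - q * (u x * (f x * g x)) = cexp (- \<nu>) x * p x" by (simp add: p_def mult.assoc)
  ultimately have e1: "f x * f x - q * (u x * (f x * g x)) = fourier_mode n x * (exp y * p x)" by simp
  have expand: "exp y * p x - (1 + y + \<theta>) = y * \<theta> + \<tau> * (1 + \<theta> + e') + (1 + y) * e'"
    unfolding px \<tau>_def by (simp add: algebra_simps)
  have "cmod (exp y * p x - (1 + y + \<theta>)) \<le> cmod y * cmod \<theta> + cmod \<tau> * cmod (1 + \<theta> + e') + cmod (1 + y) * cmod e'"
    unfolding expand norm_mult[symmetric] by (intro order_trans[OF norm_triangle_ineq] add_mono order_refl)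
  also have "\<dots> \<le> W\<^sup>2 * DD * m\<^sup>2 + 64 * W\<^sup>2 * DD * m\<^sup>2 + 3 * W\<^sup>2 * DD * m\<^sup>2"
  proof (intro add_mono)
    have WW: "W \<le> W\<^sup>2" using W by (simp add: power2_eq_square mult_left_mono)
    have m2: "m\<^sup>2 \<le> 1" using m by (simp add: power_le_one)
    have "cmod y * cmod \<theta> \<le> (2 * (W * m)) * (3 * K\<^sup>2 * m)" using yb \<theta>b W m by (intro mult_mono) auto
    also have "\<dots> = (W * m\<^sup>2) * (6 * K\<^sup>2)" by (simp add: power2_eq_square)
    also have "\<dots> \<le> (W\<^sup>2 * m\<^sup>2) * DD" using K2W W WW m by (intro mult_mono) auto
    finally show "cmod y * cmod \<theta> \<le> W\<^sup>2 * DD * m\<^sup>2" by (simp add: mult_ac)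
    have "cmod (1 + \<theta> + e') \<le> 1 + 3 * K\<^sup>2 * m + DD * m\<^sup>2"
      by (intro order_trans[OF norm_triangle_ineq] add_mono \<theta>b e'b) auto
    also have "\<dots> \<le> 1 + 3 * K\<^sup>2 * 1 + DD * 1" using m m2 K2W by (intro add_mono mult_left_mono) auto
    also have "\<dots> \<le> 2 * DD" using K2W by linarith
    finally have "cmod \<tau> * cmod (1 + \<theta> + e') \<le> (32 * W\<^sup>2 * m\<^sup>2) * (2 * DD)" using \<tau>b by (intro mult_mono) auto
    then show "cmod \<tau> * cmod (1 + \<theta> + e') \<le> 64 * W\<^sup>2 * DD * m\<^sup>2" by (simp add: mult_ac)
    have "cmod (1 + y) \<le> 1 + 2" by (intro order_trans[OF norm_triangle_ineq] add_mono yb) auto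
    also have "\<dots> \<le> 3 * W\<^sup>2" using WW W by linarith
    finally have "cmod (1 + y) * cmod e' \<le> (3 * W\<^sup>2) * (DD * m\<^sup>2)" using e'b by (intro mult_mono) auto
    then show "cmod (1 + y) * cmod e' \<le> 3 * W\<^sup>2 * DD * m\<^sup>2" by (simp add: mult_ac)
  qed
  finally have "cmod (exp y * p x - (1 + y + \<theta>)) \<le> 68 * W\<^sup>2 * second_order_const K W * m\<^sup>2" by (simp add: DD_def mult_ac)
  moreover have "f x * f x - q * (u x * (f x * g x)) - fourier_mode n x * (1 + y + \<theta>) = fourier_mode n x * (exp y * p x - (1 + y + \<theta>))"
    unfolding e1 by (simp add: right_diff_distrib)
  ultimately have "cmod (f x * f x - q * (u x * (f x * g x)) - fourier_mode n x * (1 + y + \<theta>)) \<le> 68 * W\<^sup>2 * second_order_const K W * m\<^sup>2"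
    by (simp add: norm_mult)
  moreover have "1 + y + \<theta> = 1 - 2 * \<i> * w * x - q * u 0 - q * I2 - q * I1"
    by (simp add: y_def \<theta>_def)
  ultimately show ?thesis by (simp add: I1_def I2_def)
qed

text \<open>The mean square in \<open>x\<close> of the partial Fourier integrals of \<open>u'\<close>. The frequency is \<open>- n\<close> because they arise from \<open>exp (2 \<i> z x)\<close>.\<close>

definition partial_square_norm :: "(real \<Rightarrow> complex) \<Rightarrow> int \<Rightarrow> real" where
  "partial_square_norm u' n = sqrt (integral {0..1} (\<lambda>x. (cmod (integral {0..x} (\<lambda>t. u' t * fourier_mode (- n) t)))\<^sup>2))"

text \<open>Every summand on the right other than the last is a Fourier coefficient of a function that does not depend on \<open>n\<close>, or a mean
square of partial Fourier integrals; each is square summable in \<open>n\<close>.\<close>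

lemma second_order_integrated:
  assumes data: "potential_bound K u u' v v'" and s: "zs_sol z u v f g" and i: "f 0 = 1" "g 0 = 1"
    and z: "z = of_int n * of_real pi + w" and w: "cmod w \<le> W * m" "cmod w \<le> 1" and m: "0 < m" "m \<le> 1" "1 / cmod z \<le> m" and W: "1 \<le> W" and z0: "z \<noteq> 0"
    and q: "q * (2 * \<i> * z) = 2" and \<gamma>: "L2_bound G \<gamma>"
  shows "cmod (integral {0..1} (\<lambda>x. \<gamma> x * (f x * f x - q * (u x * (f x * g x)))) - fcoeff \<gamma> n)
    \<le> m * (K * cmod (fcoeff \<gamma> n) + 2 * W * cmod (fcoeff (\<lambda>x. \<gamma> x * of_real x) n)
        + cmod (fcoeff (\<lambda>x. \<gamma> x * integral {0..x} (\<lambda>t. u t * v t)) n) + G * partial_square_norm u' n + G * (68 * W\<^sup>2 * second_order_const K W) * m)"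
proof -
  have D: "1 \<le> K" "abs_cont u u'" "abs_cont v v'" "L2_bound K u'" "\<And>x. x \<in> {0..1} \<Longrightarrow> cmod (u x) \<le> K" "\<And>x. x \<in> {0..1} \<Longrightarrow> cmod (v x) \<le> K"
    using data by (auto simp: potential_bound_def)
  note uc = abs_cont_cont[OF D(2)] and vc = abs_cont_cont[OF D(3)] and fg = zs_cont[OF s]
  have u'i: "set_integrable lborel {0..1} u'" using D(4) by (auto simp: L2_bound_def)
  have \<gamma>i: "set_integrable lborel {0..1} \<gamma>" "0 \<le> G" "set_integrable lborel {0..1} (\<lambda>x. (cmod (\<gamma> x))\<^sup>2)"
    "integral {0..1} (\<lambda>x. (cmod (\<gamma> x))\<^sup>2) \<le> G\<^sup>2"
    using \<gamma> by (auto simp: L2_bound_def)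
  define I1 where "I1 = (\<lambda>x. integral {0..x} (\<lambda>t. u' t * fourier_mode (- n) t))"
  define I2 where "I2 = (\<lambda>x. integral {0..x} (\<lambda>t. u t * v t))"
  have I1c: "continuous_on {0..1} I1"
    unfolding I1_def using set_integrable_sub(2)[OF set_integrable_mult_cont[OF u'i fourier_mode_cont], of 0 1]
    by (intro indefinite_integral_continuous_1) auto
  have I2c: "continuous_on {0..1} I2"
    unfolding I2_def by (intro indefinite_integral_continuous_1 integrable_continuous_interval continuous_intros uc vc)
  define \<rho> where "\<rho> = (\<lambda>x. f x * f x - q * (u x * (f x * g x)) - fourier_mode n x * (1 - 2 * \<i> * w * of_real x - q * u 0 - q * I2 x - q * I1 x))"
  have \<rho>c: "continuous_on {0..1} \<rho>" unfolding \<rho>_def by (intro continuous_intros fg uc I1c I2c)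
  define B where "B = 68 * W\<^sup>2 * second_order_const K W"
  have \<rho>b: "cmod (\<rho> x) \<le> B * m\<^sup>2" if "x \<in> {0..1}" for x
    using second_order_expansion[OF data s i that z w m W z0 q] by (simp add: \<rho>_def I1_def I2_def B_def)
  have int: "(\<lambda>x. \<gamma> x * h x) integrable_on {0..1}" if "continuous_on {0..1} h" for h
    using set_integrable_sub(2)[OF set_integrable_mult_cont[OF \<gamma>i(1) that], of 0 1] by simp
  have J: "(\<lambda>x. \<gamma> x * fourier_mode n x) integrable_on {0..1}" "(\<lambda>x. \<gamma> x * of_real x * fourier_mode n x) integrable_on {0..1}"
    "(\<lambda>x. \<gamma> x * I2 x * fourier_mode n x) integrable_on {0..1}" "(\<lambda>x. \<gamma> x * (I1 x * fourier_mode n x)) integrable_on {0..1}" "(\<lambda>x. \<gamma> x * \<rho> x) integrable_on {0..1}"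
  proof -
    have "continuous_on {0..1} (\<lambda>x. complex_of_real x * fourier_mode n x)" by (intro continuous_intros)
    moreover have "continuous_on {0..1} (\<lambda>x. I2 x * fourier_mode n x)" "continuous_on {0..1} (\<lambda>x. I1 x * fourier_mode n x)"
      by (intro continuous_intros I1c I2c)+
    ultimately show "(\<lambda>x. \<gamma> x * fourier_mode n x) integrable_on {0..1}" "(\<lambda>x. \<gamma> x * of_real x * fourier_mode n x) integrable_on {0..1}"
    "(\<lambda>x. \<gamma> x * I2 x * fourier_mode n x) integrable_on {0..1}" "(\<lambda>x. \<gamma> x * (I1 x * fourier_mode n x)) integrable_on {0..1}" "(\<lambda>x. \<gamma> x * \<rho> x) integrable_on {0..1}"
      using int[OF fourier_mode_cont] int[OF \<rho>c] by (simp_all only: mult.assoc int)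
  qed
  have e: "\<gamma> x * (f x * f x - q * (u x * (f x * g x))) =
      ((((1 - q * u 0) * (\<gamma> x * fourier_mode n x) + (- 2 * \<i> * w) * (\<gamma> x * of_real x * fourier_mode n x)) + (- q) * (\<gamma> x * I2 x * fourier_mode n x))
       + (- q) * (\<gamma> x * (I1 x * fourier_mode n x))) + \<gamma> x * \<rho> x" for x
    unfolding \<rho>_def by (simp add: algebra_simps)
  have "integral {0..1} (\<lambda>x. \<gamma> x * (f x * f x - q * (u x * (f x * g x)))) =
      ((((1 - q * u 0) * fcoeff \<gamma> n + (- 2 * \<i> * w) * fcoeff (\<lambda>x. \<gamma> x * of_real x) n) + (- q) * fcoeff (\<lambda>x. \<gamma> x * I2 x) n)
       + (- q) * integral {0..1} (\<lambda>x. \<gamma> x * (I1 x * fourier_mode n x))) + integral {0..1} (\<lambda>x. \<gamma> x * \<rho> x)"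
    unfolding e fcoeff_def using J
    by (simp only: Henstock_Kurzweil_Integration.integral_add integrable_add integrable_on_mult_right integral_mult_right)
  then have eq: "integral {0..1} (\<lambda>x. \<gamma> x * (f x * f x - q * (u x * (f x * g x)))) - fcoeff \<gamma> n =
      ((((- q * u 0) * fcoeff \<gamma> n + (- 2 * \<i> * w) * fcoeff (\<lambda>x. \<gamma> x * of_real x) n) + (- q) * fcoeff (\<lambda>x. \<gamma> x * I2 x) n)
       + (- q) * integral {0..1} (\<lambda>x. \<gamma> x * (I1 x * fourier_mode n x))) + integral {0..1} (\<lambda>x. \<gamma> x * \<rho> x)"
    by (simp add: algebra_simps)
  have qm: "cmod q \<le> m"
  proof -
    have "cmod q * (2 * cmod z) = 2" using arg_cong[OF q, of cmod] by (simp add: norm_mult)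
    then have "cmod q = 1 / cmod z" using z0 by (simp add: field_simps)
    then show ?thesis using m by simp
  qed
  have G1: "cmod (integral {0..1} (\<lambda>x. \<gamma> x * (I1 x * fourier_mode n x))) \<le> G * partial_square_norm u' n"
  proof -
    have n: "(\<lambda>x. cmod (\<gamma> x) * cmod (I1 x)) integrable_on {0..1}"
      using set_integrable_sub(2)[OF set_int_norm[OF set_integrable_mult_cont[OF \<gamma>i(1) I1c]], of 0 1] by (simp add: norm_mult)
    have "cmod (integral {0..1} (\<lambda>x. \<gamma> x * (I1 x * fourier_mode n x))) \<le> integral {0..1} (\<lambda>x. cmod (\<gamma> x) * cmod (I1 x))"
      by (rule integral_norm_bound_integral[OF J(4) n]) (simp add: norm_mult)
    also have "\<dots> \<le> sqrt (G\<^sup>2 * integral {0..1} (\<lambda>x. (cmod (I1 x))\<^sup>2))"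
    proof (rule real_le_rsqrt)
      have c: "(integral {0..1} (\<lambda>x. cmod (\<gamma> x) * cmod (I1 x)))\<^sup>2 \<le> integral {0..1} (\<lambda>x. (cmod (\<gamma> x))\<^sup>2) * integral {0..1} (\<lambda>x. (cmod (I1 x))\<^sup>2)"
        by (rule cs_integral) (use set_integrable_sub(2)[OF \<gamma>i(3), of 0 1] n in \<open>auto intro!: integrable_continuous_interval continuous_intros I1c\<close>)
      also have "\<dots> \<le> G\<^sup>2 * integral {0..1} (\<lambda>x. (cmod (I1 x))\<^sup>2)"
        by (intro mult_right_mono \<gamma>i integral_nonneg_always) auto
      finally show "(integral {0..1} (\<lambda>x. cmod (\<gamma> x) * cmod (I1 x)))\<^sup>2 \<le> G\<^sup>2 * integral {0..1} (\<lambda>x. (cmod (I1 x))\<^sup>2)" .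
    qed
    also have "\<dots> = G * partial_square_norm u' n" using \<gamma>i(2) by (simp add: real_sqrt_mult partial_square_norm_def I1_def)
    finally show ?thesis .
  qed
  have G2: "cmod (integral {0..1} (\<lambda>x. \<gamma> x * \<rho> x)) \<le> G * (B * m\<^sup>2)"
    by (rule integral_mult_bound[OF \<gamma>i(1) \<rho>c \<rho>b _ L2_bound_integral_norm[OF \<gamma>]]) auto
  have "cmod (integral {0..1} (\<lambda>x. \<gamma> x * (f x * f x - q * (u x * (f x * g x)))) - fcoeff \<gamma> n)
    \<le> (((m * K) * cmod (fcoeff \<gamma> n) + (2 * (W * m)) * cmod (fcoeff (\<lambda>x. \<gamma> x * of_real x) n)) + m * cmod (fcoeff (\<lambda>x. \<gamma> x * I2 x) n))
       + m * (G * partial_square_norm u' n) + G * (B * m\<^sup>2)"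
    unfolding eq
  proof (intro order_trans[OF norm_triangle_ineq] add_mono G2)
    show "cmod ((- q * u 0) * fcoeff \<gamma> n) \<le> (m * K) * cmod (fcoeff \<gamma> n)"
      unfolding norm_mult norm_minus_cancel using qm D(1) D(5)[of 0] m by (intro mult_mono) auto
    show "cmod ((- 2 * \<i> * w) * fcoeff (\<lambda>x. \<gamma> x * of_real x) n) \<le> (2 * (W * m)) * cmod (fcoeff (\<lambda>x. \<gamma> x * of_real x) n)"
      unfolding norm_mult using w(1) by (intro mult_right_mono) auto
    show "cmod ((- q) * fcoeff (\<lambda>x. \<gamma> x * I2 x) n) \<le> m * cmod (fcoeff (\<lambda>x. \<gamma> x * I2 x) n)"
      unfolding norm_mult norm_minus_cancel using qm by (intro mult_right_mono) auto
    show "cmod ((- q) * integral {0..1} (\<lambda>x. \<gamma> x * (I1 x * fourier_mode n x))) \<le> m * (G * partial_square_norm u' n)"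
      unfolding norm_mult norm_minus_cancel using qm m G1 by (intro mult_mono) auto
  qed
  then show ?thesis by (simp add: B_def I2_def power2_eq_square algebra_simps)
qed

section \<open>Square summable families of remainders\<close>

text \<open>Bounds on finite partial sums; they combine by Minkowski's inequality.\<close>

definition l2_family :: "real \<Rightarrow> (int \<Rightarrow> real) \<Rightarrow> bool" where
  "l2_family C X \<longleftrightarrow> (\<forall>n. 0 \<le> X n) \<and> (\<forall>S. finite S \<longrightarrow> L2_set X S \<le> C)"

lemma l2_family_C0: "l2_family C X \<Longrightarrow> 0 \<le> C"
  unfolding l2_family_def by (metis L2_set_empty finite.emptyI)

lemma l2_family_bound: "l2_family C X \<Longrightarrow> X n \<le> C"
proof -
  assume X: "l2_family C X"
  then have "L2_set X {n} \<le> C" unfolding l2_family_def by blast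
  then show ?thesis using X by (simp add: L2_set_def l2_family_def)
qed

lemma l2_family_add:
  assumes X: "l2_family C X" and Y: "l2_family D Y" shows "l2_family (C + D) (\<lambda>n. X n + Y n)"
  unfolding l2_family_def
proof (intro conjI allI impI)
  show "0 \<le> X n + Y n" for n using X Y by (simp add: l2_family_def)
  fix S :: "int set" assume S: "finite S"
  have "L2_set (\<lambda>n. X n + Y n) S \<le> L2_set X S + L2_set Y S" by (rule L2_set_triangle_ineq)
  also have "\<dots> \<le> C + D" using X Y S by (intro add_mono) (simp_all add: l2_family_def)
  finally show "L2_set (\<lambda>n. X n + Y n) S \<le> C + D" .
qed

lemma l2_family_cmult: "l2_family C X \<Longrightarrow> 0 \<le> c \<Longrightarrow> l2_family (c * C) (\<lambda>n. c * X n)"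
  unfolding l2_family_def by (auto simp: L2_set_right_distrib[symmetric] mult_left_mono)

lemma l2_family_mono: "l2_family C X \<Longrightarrow> C \<le> D \<Longrightarrow> l2_family D X"
  unfolding l2_family_def by (meson order_trans)

lemma l2_family_le:
  assumes X: "l2_family C X" and Y: "\<And>n. 0 \<le> Y n" "\<And>n. Y n \<le> X n" shows "l2_family C Y"
  unfolding l2_family_def
proof (intro conjI allI impI Y(1))
  fix S :: "int set" assume S: "finite S"
  have "L2_set Y S \<le> L2_set X S" by (rule L2_set_mono) (use Y in auto)
  also have "\<dots> \<le> C" using X S by (simp add: l2_family_def)
  finally show "L2_set Y S \<le> C" .
qed

lemma l2_family_reflect: "l2_family C X \<Longrightarrow> l2_family C (\<lambda>n. X (- n))"
proof -
  assume X: "l2_family C X"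
  have "L2_set (\<lambda>n. X (- n)) S = L2_set X (uminus ` S)" for S
    unfolding L2_set_def by (subst sum.reindex) (auto simp: inj_on_def)
  then show ?thesis using X by (auto simp: l2_family_def)
qed

lemma l2_family_fcoeff: "L2_bound K g \<Longrightarrow> l2_family K (\<lambda>n. cmod (fcoeff g n))"
  unfolding l2_family_def L2_set_def using bessel_L2_bound[of K g] by (auto intro!: real_le_lsqrt simp: L2_bound_def sum_nonneg)

lemma l2_family_partial_square_norm: "L2_bound K u' \<Longrightarrow> l2_family K (partial_square_norm u')"
proof -
  assume u: "L2_bound K u'"
  have K: "0 \<le> K" using u by (simp add: L2_bound_def)
  have I0: "0 \<le> integral {0..1} (\<lambda>x. (cmod (integral {0..x} (\<lambda>t. u' t * fourier_mode n t)))\<^sup>2)" for n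
    by (rule integral_nonneg_always) simp
  have e: "(partial_square_norm u' (- n))\<^sup>2 = integral {0..1} (\<lambda>x. (cmod (integral {0..x} (\<lambda>t. u' t * fourier_mode n t)))\<^sup>2)" for n
    unfolding partial_square_norm_def minus_minus by (rule real_sqrt_pow2[OF I0])
  have "l2_family K (\<lambda>n. partial_square_norm u' (- n))"
    unfolding l2_family_def
  proof (intro conjI allI impI)
    show "0 \<le> partial_square_norm u' (- n)" for n unfolding partial_square_norm_def minus_minus using I0 by (rule real_sqrt_ge_zero)
    fix S :: "int set" assume S: "finite S"
    show "L2_set (\<lambda>n. partial_square_norm u' (- n)) S \<le> K"
      unfolding L2_set_def e using bessel_square_function[OF u S] K by (simp add: real_le_lsqrt sum_nonneg I0)
  qed
  from l2_family_reflect[OF this] show ?thesis by simp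
qed

lemma fcoeff_id: "n \<noteq> 0 \<Longrightarrow> cmod (fcoeff (\<lambda>x. of_real x) n) = 1 / (2 * pi * of_int \<bar>n\<bar>)"
proof -
  assume n: "n \<noteq> 0"
  define c where "c = - 2 * of_real pi * \<i> * complex_of_int n"
  have c0: "c \<noteq> 0" using n by (simp add: c_def)
  have x: "abs_cont (\<lambda>x. complex_of_real x) (\<lambda>x. 1)"
    by (rule abs_cont_C1) (auto intro!: derivative_eq_intros continuous_intros)
  have m: "abs_cont (\<lambda>x. of_real x * fourier_mode n x) (\<lambda>x. 1 * fourier_mode n x + of_real x * (c * fourier_mode n x))"
    unfolding c_def by (rule abs_cont_mult[OF x fourier_mode_abs_cont])
  have "1 = integral {0..1} (\<lambda>x. 1 * fourier_mode n x + of_real x * (c * fourier_mode n x))"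
    using abs_cont_total[OF m] by simp
  also have "\<dots> = integral {0..1} (\<lambda>x. fourier_mode n x + c * (of_real x * fourier_mode n x))" by (simp add: algebra_simps)
  also have "\<dots> = integral {0..1} (fourier_mode n) + c * fcoeff (\<lambda>x. of_real x) n"
    unfolding fcoeff_def
    by (subst Henstock_Kurzweil_Integration.integral_add)
      (auto intro!: integrable_continuous_interval continuous_intros fourier_mode_cont)
  also have "integral {0..1} (fourier_mode n) = 0" using n by (simp add: fourier_mode_integral)
  finally have "c * fcoeff (\<lambda>x. of_real x) n = 1" by simp
  then have "cmod c * cmod (fcoeff (\<lambda>x. of_real x) n) = 1" by (metis norm_mult norm_one)
  moreover have "cmod c = 2 * pi * of_int \<bar>n\<bar>" by (simp add: c_def norm_mult)
  ultimately show ?thesis using n by (simp add: field_simps)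
qed

text \<open>Up to the factor \<open>2 \<pi>\<close> these numbers are the Fourier coefficients of \<open>x\<close>, so Bessel's inequality applies. At \<open>n = 0\<close> the value is
\<open>1 / 0 = 0\<close>.\<close>

lemma l2_family_inverse: "l2_family 8 (\<lambda>n. 1 / real_of_int \<bar>n\<bar>)"
proof (rule l2_family_mono)
  have "L2_bound 1 (\<lambda>x. of_real x)" by (rule L2_bound_cont) (auto intro!: continuous_intros)
  then have f: "l2_family (2 * pi * 1) (\<lambda>n. 2 * pi * cmod (fcoeff (\<lambda>x. of_real x) n))"
    by (intro l2_family_cmult l2_family_fcoeff) auto
  show "l2_family (2 * pi * 1) (\<lambda>n. 1 / real_of_int \<bar>n\<bar>)"
  proof (rule l2_family_le[OF f])
    fix n :: int
    show "1 / real_of_int \<bar>n\<bar> \<le> 2 * pi * cmod (fcoeff (\<lambda>x. of_real x) n)"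
      by (cases "n = 0") (auto simp: fcoeff_id)
  qed auto
  show "2 * pi * 1 \<le> 8" using pi_less_4 by simp
qed

definition remainder_term :: "real \<Rightarrow> real \<Rightarrow> real \<Rightarrow> (real \<Rightarrow> complex) \<Rightarrow> (real \<Rightarrow> complex) \<Rightarrow> (real \<Rightarrow> complex) \<Rightarrow> (real \<Rightarrow> complex) \<Rightarrow> int \<Rightarrow> real" where
  "remainder_term K W G \<gamma> u u' v n = K * cmod (fcoeff \<gamma> n) + 2 * W * cmod (fcoeff (\<lambda>x. \<gamma> x * of_real x) n)
        + cmod (fcoeff (\<lambda>x. \<gamma> x * integral {0..x} (\<lambda>t. u t * v t)) n) + G * partial_square_norm u' n + G * (68 * W\<^sup>2 * second_order_const K W) * (1 / real_of_int \<bar>n\<bar>)"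

lemma l2_family_remainder_term:
  assumes data: "potential_bound K u u' v v'" and \<gamma>: "L2_bound G \<gamma>" and W: "1 \<le> W"
  shows "l2_family (K * G + 2 * W * (G * 1) + G * K\<^sup>2 + G * K + G * (68 * W\<^sup>2 * second_order_const K W) * 8) (remainder_term K W G \<gamma> u u' v)"
proof -
  have D: "1 \<le> K" "abs_cont u u'" "abs_cont v v'" "L2_bound K u'" "\<And>x. x \<in> {0..1} \<Longrightarrow> cmod (u x) \<le> K" "\<And>x. x \<in> {0..1} \<Longrightarrow> cmod (v x) \<le> K"
    using data by (auto simp: potential_bound_def)
  note uc = abs_cont_cont[OF D(2)] and vc = abs_cont_cont[OF D(3)]
  have G0: "0 \<le> G" using \<gamma> by (simp add: L2_bound_def)
  have D0: "0 \<le> second_order_const K W" using W product_const_ge1[OF D(1)] by (simp add: second_order_const_def)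
  have 1: "L2_bound (G * 1) (\<lambda>x. \<gamma> x * of_real x)"
    by (rule L2_bound_mult_cont[OF \<gamma>]) (auto intro!: continuous_intros)
  have c: "continuous_on {0..1} (\<lambda>x. integral {0..x} (\<lambda>t. u t * v t))"
    by (intro indefinite_integral_continuous_1 integrable_continuous_interval continuous_intros uc vc)
  have 2: "L2_bound (G * K\<^sup>2) (\<lambda>x. \<gamma> x * integral {0..x} (\<lambda>t. u t * v t))"
  proof (rule L2_bound_mult_cont[OF \<gamma> c])
    fix x :: real assume "x \<in> {0..1}"
    then show "cmod (integral {0..x} (\<lambda>t. u t * v t)) \<le> K\<^sup>2"
      unfolding power2_eq_square
      by (intro cont_integral_bound) (use D(1,5,6) in \<open>auto simp: norm_mult intro!: continuous_intros uc vc mult_mono\<close>)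
  qed
  show ?thesis
    unfolding remainder_term_def[abs_def]
    by (intro l2_family_add l2_family_cmult l2_family_fcoeff l2_family_partial_square_norm l2_family_inverse \<gamma> 1 2 D(4)) (use D G0 W D0 in auto)
qed

text \<open>The parts of \<open>f\<^sup>2\<close> and \<open>g\<^sup>2\<close> without oscillation combine to a multiple of \<open>a\<^sub>N\<^sub>+\<^sub>1 u + c\<^sub>N\<^sub>+\<^sub>1 v\<close> times \<open>f g\<close>. Its integral vanishes
with \<open>f g\<close> replaced by \<open>1\<close>, and \<open>f g - 1\<close> is small.\<close>

lemma kappa_main_integral:
  assumes data: "potential_bound K u u' v v'" and sys: "akns_sys N L u v a b c" and s: "zs_sol z u v f g" and i: "f 0 = 1" "g 0 = 1"
    and z: "z = of_int n * of_real pi + w" and m: "m = 1 / real_of_int \<bar>n\<bar>" and n: "n \<noteq> 0"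
    and w: "cmod w \<le> W * m" "cmod w \<le> 1" and mz: "1 / cmod z \<le> m" and W: "1 \<le> W" and z0: "z \<noteq> 0"
    and G: "L2_bound G (a (Suc N))" "L2_bound G (c (Suc N))"
  shows "cmod (integral {0..1} (\<lambda>x. a (Suc N) x * (f x)\<^sup>2 - c (Suc N) x * (g x)\<^sup>2) - (fcoeff (a (Suc N)) n - fcoeff (c (Suc N)) (- n)))
     \<le> m * (remainder_term K W G (a (Suc N)) u u' v n + remainder_term K W G (c (Suc N)) v v' u (- n) + 2 * G * K * product_const K * m)"
proof -
  have D: "1 \<le> K" "abs_cont u u'" "abs_cont v v'" "L2_bound K u'" "\<And>x. x \<in> {0..1} \<Longrightarrow> cmod (u x) \<le> K" "\<And>x. x \<in> {0..1} \<Longrightarrow> cmod (v x) \<le> K"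
    using data by (auto simp: potential_bound_def)
  note uc = abs_cont_cont[OF D(2)] and vc = abs_cont_cont[OF D(3)] and fg = zs_cont[OF s]
  have m01: "0 < m" "m \<le> 1" using n by (auto simp: m divide_le_eq_1)
  define q where "q = 2 / (2 * \<i> * z)"
  have nz: "2 * \<i> * z \<noteq> 0" using z0 by simp
  have q1: "q * (2 * \<i> * z) = 2"
    unfolding q_def times_divide_eq_left using nz by (rule nonzero_mult_div_cancel_right)
  have q: "q * (2 * \<i> * z) = 2" "(- q) * (2 * \<i> * (- z)) = 2"
    using q1 by (simp_all only: mult_minus_left mult_minus_right minus_minus)
  have qm: "cmod q \<le> m" using mz by (simp add: q_def norm_divide norm_mult)
  define \<alpha> \<beta> where "\<alpha> = a (Suc N)" and "\<beta> = c (Suc N)"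
  have G': "L2_bound G \<alpha>" "L2_bound G \<beta>" "0 \<le> G" using G by (auto simp: \<alpha>_def \<beta>_def L2_bound_def)
  have \<alpha>i: "set_integrable lborel {0..1} \<alpha>" "set_integrable lborel {0..1} \<beta>" using G' by (auto simp: L2_bound_def)
  have z': "- z = of_int (- n) * of_real pi + - w" by (simp add: z)
  have P1: "cmod (integral {0..1} (\<lambda>x. \<alpha> x * (f x * f x - q * (u x * (f x * g x)))) - fcoeff \<alpha> n) \<le> m * remainder_term K W G \<alpha> u u' v n"
    using second_order_integrated[OF data s i z w m01 mz W z0 q(1) G'(1)] by (simp add: remainder_term_def m)
  have P2: "cmod (integral {0..1} (\<lambda>x. \<beta> x * (g x * g x - (- q) * (v x * (g x * f x)))) - fcoeff \<beta> (- n)) \<le> m * remainder_term K W G \<beta> v v' u (- n)"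
    using second_order_integrated[OF potential_bound_swap[OF data] zs_swap[OF s] i(2,1) z' _ _ m01 _ W _ q(2) G'(2)] w mz z0 by (simp add: remainder_term_def m)
  have Im: "\<bar>Im z\<bar> \<le> K" using w(2) D(1) abs_Im_le_cmod[of w] z by simp
  define h where "h = (\<lambda>x. u x * (f x * g x - 1))"
  define k where "k = (\<lambda>x. v x * (f x * g x - 1))"
  have hc: "continuous_on {0..1} h" "continuous_on {0..1} k" unfolding h_def k_def by (intro continuous_intros uc vc fg)+
  have hb: "cmod (h x) \<le> K * (product_const K * m)" "cmod (k x) \<le> K * (product_const K * m)" if x: "x \<in> {0..1}" for x
    unfolding h_def k_def norm_mult[of _ "_ - 1"] using zs_products(1)[OF data s Im i x z0 mz m01(2)] D(1) D(5,6)[OF x]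
    by (auto intro!: mult_mono)
  have H: "cmod (integral {0..1} (\<lambda>x. \<alpha> x * h x)) \<le> G * (K * (product_const K * m))" "cmod (integral {0..1} (\<lambda>x. \<beta> x * k x)) \<le> G * (K * (product_const K * m))"
    by (rule integral_mult_bound[OF \<alpha>i(1) hc(1) hb(1) _ L2_bound_integral_norm[OF G'(1)]]; simp)
      (rule integral_mult_bound[OF \<alpha>i(2) hc(2) hb(2) _ L2_bound_integral_norm[OF G'(2)]]; simp)
  have int: "(\<lambda>x. \<alpha> x * r x) integrable_on {0..1}" "(\<lambda>x. \<beta> x * r x) integrable_on {0..1}" if "continuous_on {0..1} r" for r
    using set_integrable_sub(2)[OF set_integrable_mult_cont[OF \<alpha>i(1) that], of 0 1] set_integrable_sub(2)[OF set_integrable_mult_cont[OF \<alpha>i(2) that], of 0 1] by auto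
  define p1 where "p1 = (\<lambda>x. f x * f x - q * (u x * (f x * g x)))"
  define p2 where "p2 = (\<lambda>x. g x * g x - (- q) * (v x * (g x * f x)))"
  have pc: "continuous_on {0..1} p1" "continuous_on {0..1} p2" unfolding p1_def p2_def by (intro continuous_intros uc vc fg)+
  have e: "\<alpha> x * (f x)\<^sup>2 - \<beta> x * (g x)\<^sup>2 = (((\<alpha> x * p1 x - \<beta> x * p2 x) + q * (\<alpha> x * h x)) + q * (\<beta> x * k x)) + q * (\<alpha> x * u x + \<beta> x * v x)" for x
    unfolding p1_def p2_def h_def k_def by (simp add: power2_eq_square algebra_simps)
  have "integral {0..1} (\<lambda>x. \<alpha> x * (f x)\<^sup>2 - \<beta> x * (g x)\<^sup>2) = (((integral {0..1} (\<lambda>x. \<alpha> x * p1 x) - integral {0..1} (\<lambda>x. \<beta> x * p2 x))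
      + q * integral {0..1} (\<lambda>x. \<alpha> x * h x)) + q * integral {0..1} (\<lambda>x. \<beta> x * k x)) + q * integral {0..1} (\<lambda>x. \<alpha> x * u x + \<beta> x * v x)"
    unfolding e
    using int[OF pc(1)] int[OF pc(2)] int[OF hc(1)] int[OF hc(2)] int[OF uc] int[OF vc]
    by (simp only: Henstock_Kurzweil_Integration.integral_add Henstock_Kurzweil_Integration.integral_diff
        integrable_add integrable_diff integrable_on_mult_right integral_mult_right)
  also have "integral {0..1} (\<lambda>x. \<alpha> x * u x + \<beta> x * v x) = 0"
    using akns_orthogonality[OF sys] by (simp add: \<alpha>_def \<beta>_def)
  finally have "integral {0..1} (\<lambda>x. \<alpha> x * (f x)\<^sup>2 - \<beta> x * (g x)\<^sup>2) - (fcoeff \<alpha> n - fcoeff \<beta> (- n)) =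
     (((integral {0..1} (\<lambda>x. \<alpha> x * p1 x) - fcoeff \<alpha> n) - (integral {0..1} (\<lambda>x. \<beta> x * p2 x) - fcoeff \<beta> (- n)))
      + q * integral {0..1} (\<lambda>x. \<alpha> x * h x)) + q * integral {0..1} (\<lambda>x. \<beta> x * k x)" by (simp add: algebra_simps)
  then have "cmod (integral {0..1} (\<lambda>x. \<alpha> x * (f x)\<^sup>2 - \<beta> x * (g x)\<^sup>2) - (fcoeff \<alpha> n - fcoeff \<beta> (- n)))
     = cmod ((((integral {0..1} (\<lambda>x. \<alpha> x * p1 x) - fcoeff \<alpha> n) - (integral {0..1} (\<lambda>x. \<beta> x * p2 x) - fcoeff \<beta> (- n)))
      + q * integral {0..1} (\<lambda>x. \<alpha> x * h x)) + q * integral {0..1} (\<lambda>x. \<beta> x * k x))" by (rule arg_cong)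
  also have "\<dots> \<le> ((m * remainder_term K W G \<alpha> u u' v n + m * remainder_term K W G \<beta> v v' u (- n)) + m * (G * (K * (product_const K * m)))) + m * (G * (K * (product_const K * m)))"
  proof (intro order_trans[OF norm_triangle_ineq] add_mono)
    show "cmod ((integral {0..1} (\<lambda>x. \<alpha> x * p1 x) - fcoeff \<alpha> n) - (integral {0..1} (\<lambda>x. \<beta> x * p2 x) - fcoeff \<beta> (- n)))
       \<le> m * remainder_term K W G \<alpha> u u' v n + m * remainder_term K W G \<beta> v v' u (- n)"
      unfolding p1_def p2_def by (rule order_trans[OF norm_triangle_ineq4 add_mono[OF P1 P2]])
    show "cmod (q * integral {0..1} (\<lambda>x. \<alpha> x * h x)) \<le> m * (G * (K * (product_const K * m)))"
      "cmod (q * integral {0..1} (\<lambda>x. \<beta> x * k x)) \<le> m * (G * (K * (product_const K * m)))"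
      unfolding norm_mult[of q] using qm m01 by (intro mult_mono H; simp)+
  qed
  finally show ?thesis by (simp add: \<alpha>_def \<beta>_def algebra_simps)
qed

lemma power_near_1:
  fixes \<zeta> :: complex
  assumes "cmod \<zeta> \<le> B" "1 \<le> B"
  shows "cmod (\<zeta> ^ N - 1) \<le> real N * B ^ N * cmod (\<zeta> - 1)"
proof (induction N)
  case (Suc N)
  have "\<zeta> ^ Suc N - 1 = \<zeta> * (\<zeta> ^ N - 1) + (\<zeta> - 1)" by (simp add: algebra_simps)
  then have "cmod (\<zeta> ^ Suc N - 1) \<le> cmod \<zeta> * cmod (\<zeta> ^ N - 1) + cmod (\<zeta> - 1)"
    by (metis norm_mult norm_triangle_ineq)
  also have "\<dots> \<le> B * (real N * B ^ N * cmod (\<zeta> - 1)) + B ^ Suc N * cmod (\<zeta> - 1)"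
  proof (intro add_mono mult_mono Suc)
    have "1 \<le> B ^ Suc N" using assms(2) by (rule one_le_power)
    then show "cmod (\<zeta> - 1) \<le> B ^ Suc N * cmod (\<zeta> - 1)" using mult_right_mono[of 1 "B ^ Suc N" "cmod (\<zeta> - 1)"] by simp
  qed (use assms in auto)
  also have "\<dots> = real (Suc N) * B ^ Suc N * cmod (\<zeta> - 1)" by (simp add: algebra_simps)
  finally show ?case .
qed simp

lemma fcoeff_tower: "sobolev_tower N K d \<Longrightarrow> k \<le> N \<Longrightarrow> fcoeff (d k) n = (2 * of_real pi * \<i> * of_int n) ^ k * fcoeff (d 0) n"
proof (induction k)
  case (Suc k)
  then have "abs_cont (d k) (d (Suc k))" "d k 1 = d k 0" by (auto simp: sobolev_tower_def)
  from fcoeff_deriv[OF this] Suc show ?case by simp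
qed simp

lemma fcoeff_add:
  assumes "set_integrable lborel {0..1} f" "set_integrable lborel {0..1} g"
  shows "fcoeff (\<lambda>x. f x + g x) n = fcoeff f n + fcoeff g n"
  using set_integrable_sub(2)[OF set_integrable_mult_cont[OF assms(1) fourier_mode_cont], of 0 1 n]
    set_integrable_sub(2)[OF set_integrable_mult_cont[OF assms(2) fourier_mode_cont], of 0 1 n]
  by (simp add: fcoeff_def distrib_right Henstock_Kurzweil_Integration.integral_add)

lemma fcoeff_cmult: "fcoeff (\<lambda>x. c * f x) n = c * fcoeff f n"
  by (simp add: fcoeff_def mult.assoc)

lemma sobolev_tower_potential_bound:
  assumes "1 \<le> N" "sobolev_tower N K d" "sobolev_tower N K e" shows "potential_bound K (d 0) (d 1) (e 0) (e 1)"
proof -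
  have "L2_bound K (d 1)" if d: "sobolev_tower N K d" for d
  proof (cases "N = 1")
    case True then show ?thesis using d by (simp add: sobolev_tower_def)
  next
    case False
    then have "1 < N" using assms(1) by simp
    then have "abs_cont (d 1) (d (Suc 1))" "\<forall>x\<in>{0..1}. cmod (d 1 x) \<le> K" using d unfolding sobolev_tower_def by blast+
    then show ?thesis by (intro L2_bound_cont abs_cont_cont) auto
  qed
  then show ?thesis using assms by (auto simp: potential_bound_def sobolev_tower_def dest!: spec[of _ 0])
qed

section \<open>The Floquet multiplier at a Dirichlet eigenvalue\<close>

lemma fcoeff_decay:
  assumes y: "sobolev_tower N K y" and n: "n \<noteq> 0"
  shows "cmod (fcoeff (y 0) n) \<le> (1 / real_of_int \<bar>n\<bar>) ^ N * cmod (fcoeff (y N) n)"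
proof -
  have np: "0 < real_of_int \<bar>n\<bar>" using n by simp
  have "cmod (fcoeff (y N) n) = (2 * pi * real_of_int \<bar>n\<bar>) ^ N * cmod (fcoeff (y 0) n)"
    unfolding fcoeff_tower[OF y order_refl] by (simp add: norm_mult norm_power)
  moreover have "real_of_int \<bar>n\<bar> ^ N \<le> (2 * pi * real_of_int \<bar>n\<bar>) ^ N"
    using pi_gt3 by (intro power_mono) (auto intro!: mult_le_cancel_right1[THEN iffD2])
  ultimately have "real_of_int \<bar>n\<bar> ^ N * cmod (fcoeff (y 0) n) \<le> cmod (fcoeff (y N) n)"
    by (simp add: mult_right_mono)
  then have "cmod (fcoeff (y 0) n) \<le> cmod (fcoeff (y N) n) / real_of_int \<bar>n\<bar> ^ N"
    using np by (subst pos_le_divide_eq) (auto simp: mult.commute)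
  then show ?thesis by (simp add: power_one_over)
qed

text \<open>The leading parts of \<open>a\<^sub>N\<^sub>+\<^sub>1\<close> and \<open>c\<^sub>N\<^sub>+\<^sub>1\<close> contribute \<open>(n \<pi> / z)\<^sup>N\<close> times the main term. The factor and \<open>Y(0)\<close> differ from \<open>1\<close> by \<open>O(1/n)\<close>,
which multiplies a quantity of size \<open>\<ell>\<^sup>2/n\<^sup>N\<close>. The rests gain \<open>1/n\<close> by integration by parts.\<close>

lemma kappa_pointwise:
  assumes N: "1 \<le> N" and d: "sobolev_tower N K d" and e: "sobolev_tower N K e"
    and sys: "akns_sys N L (d 0) (e 0) a b c"
    and aN: "\<And>x. a (Suc N) x = e N x + r x" and cN: "\<And>x. c (Suc N) x = (-1) ^ Suc N * d N x + s x"
    and r: "abs_cont r r'" "r 1 = r 0" "L2_bound L r" and s: "abs_cont s s'" "s 1 = s 0" "L2_bound L s"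
    and sol: "zs_sol z (d 0) (e 0) f g" and i: "f 0 = 1" "g 0 = 1" "f 1 = g 1"
    and z: "z = of_int n * of_real pi + w" and m: "m = 1 / real_of_int \<bar>n\<bar>" and n: "n \<noteq> 0"
    and w: "cmod w \<le> W * m" "cmod w \<le> 1" and W: "1 \<le> W" and mL: "6 * L * N * m \<le> 1" and L: "1 \<le> L"
    and G: "L2_bound G (a (Suc N))" "L2_bound G (c (Suc N))"
  shows "cmod ((f 1)\<^sup>2 - 1 - (fcoeff (e 0) n + fcoeff (d 0) (- n))) \<le> m ^ Suc N * (2 * (
     (N * (1 + W) ^ N * W + 3 * L * N) * (cmod (fcoeff (e N) n) + cmod (fcoeff (d N) (- n)))
      + (cmod (fcoeff r' n) + cmod (fcoeff s' (- n))) + (remainder_term K W G (a (Suc N)) (d 0) (d 1) (e 0) n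
      + remainder_term K W G (c (Suc N)) (e 0) (e 1) (d 0) (- n) + 2 * G * K * product_const K * m)))"
proof -
  have K: "1 \<le> K" using d by (simp add: sobolev_tower_def)
  note data = sobolev_tower_potential_bound[OF N d e]
  have uv: "continuous_on {0..1} (d 0)" "continuous_on {0..1} (e 0)" using data by (auto simp: potential_bound_def intro: abs_cont_cont)
  have m01: "0 < m" "m \<le> 1" using n by (auto simp: m divide_le_eq_1)
  have nm: "real_of_int \<bar>n\<bar> * m = 1" using n by (simp add: m)
  have zge: "real_of_int \<bar>n\<bar> \<le> cmod z"
  proof -
    have "cmod (of_int n * of_real pi :: complex) = real_of_int \<bar>n\<bar> * pi" by (simp add: norm_mult)
    then have "real_of_int \<bar>n\<bar> * pi \<le> cmod z + cmod w"
      using norm_triangle_ineq4[of z w] by (simp add: z)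
    moreover have "real_of_int \<bar>n\<bar> * 3 \<le> real_of_int \<bar>n\<bar> * pi" using pi_gt3 by (intro mult_left_mono) auto
    moreover have "1 \<le> real_of_int \<bar>n\<bar>" using n by simp
    ultimately show ?thesis using w(2) by linarith
  qed
  have z0: "z \<noteq> 0" using zge n by auto
  have mz: "1 / cmod z \<le> m" unfolding m using zge n by (intro frac_le) auto
  define q where "q = 1 / (2 * \<i> * z)"
  have q: "q * (2 * \<i> * z) = 1" using z0 by (simp add: q_def)
  have qm: "cmod q \<le> m"
  proof -
    have "cmod q = 1 / (2 * cmod z)" by (simp add: q_def norm_divide norm_mult)
    also have "\<dots> \<le> 1 / cmod z" using z0 by (intro frac_le) auto
    finally show ?thesis using mz by simp
  qed
  define t where "t = (\<lambda>k. a k 0 + b k 0 + c k 0)"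
  have t0: "t 0 = 1" using sys by (simp add: t_def akns_sys_def)
  have tb: "cmod (t k) \<le> 3 * L" if "k \<le> N" for k
  proof -
    have "cmod (a k 0) \<le> L" "cmod (b k 0) \<le> L" "cmod (c k 0) \<le> L" using sys that by (auto simp: akns_sys_def)
    then show ?thesis using norm_triangle_ineq[of "a k 0 + b k 0" "c k 0"] norm_triangle_ineq[of "a k 0" "b k 0"] by (simp add: t_def)
  qed
  define Y where "Y = (\<Sum>k\<le>N. q ^ k * t k)"
  have Y1: "cmod (Y - 1) \<le> 3 * L * N * m"
  proof -
    have "{..N} = insert 0 {1..N}" by auto
    then have "Y - 1 = (\<Sum>k\<in>{1..N}. q ^ k * t k)" by (simp add: Y_def t0)
    also have "cmod \<dots> \<le> (\<Sum>k\<in>{1..N}. m * (3 * L))"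
    proof (rule sum_norm_le)
      fix k assume k: "k \<in> {1..N}"
      have "cmod q ^ k \<le> m ^ k" using qm by (intro power_mono) auto
      also have "\<dots> \<le> m ^ 1" using k m01 by (intro power_decreasing) auto
      finally show "cmod (q ^ k * t k) \<le> m * (3 * L)"
        unfolding norm_mult norm_power using tb[of k] k m01 by (intro mult_mono) auto
    qed
    also have "\<dots> = 3 * L * N * m" by simp
    finally show ?thesis .
  qed
  define \<kappa> where "\<kappa> = (f 1)\<^sup>2 - 1"
  define Jint where "Jint = integral {0..1} (\<lambda>x. a (Suc N) x * (f x)\<^sup>2 - c (Suc N) x * (g x)\<^sup>2)"
  have id: "\<kappa> * Y = q ^ N * Jint"
    using akns_identity[OF sys sol uv q i] by (simp add: \<kappa>_def Y_def t_def Jint_def)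
  define E where "E = remainder_term K W G (a (Suc N)) (d 0) (d 1) (e 0) n
      + remainder_term K W G (c (Suc N)) (e 0) (e 1) (d 0) (- n) + 2 * G * K * product_const K * m"
  define S where "S = fcoeff (e 0) n + fcoeff (d 0) (- n)"
  define Rr where "Rr = fcoeff r n - fcoeff s (- n)"
  define Err where "Err = Jint - (fcoeff (a (Suc N)) n - fcoeff (c (Suc N)) (- n))"
  have Err: "cmod Err \<le> m * E"
    using kappa_main_integral[OF data sys sol i(1,2) z m n w mz W z0 G] by (simp add: Err_def Jint_def E_def)
  have si: "set_integrable lborel {0..1} (d N)" "set_integrable lborel {0..1} (e N)" "set_integrable lborel {0..1} r" "set_integrable lborel {0..1} s"
    using d e r s by (auto simp: sobolev_tower_def L2_bound_def)
  define \<eta> where "\<eta> = 2 * of_real pi * \<i> * complex_of_int n"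
  have "fcoeff (a (Suc N)) n = \<eta> ^ N * fcoeff (e 0) n + fcoeff r n"
    unfolding aN[abs_def] \<eta>_def by (simp only: fcoeff_add[OF si(2,3)] fcoeff_tower[OF e order_refl])
  moreover have "fcoeff (c (Suc N)) (- n) = - (\<eta> ^ N * fcoeff (d 0) (- n)) + fcoeff s (- n)"
  proof -
    have "set_integrable lborel {0..1} (\<lambda>x. (-1) ^ Suc N * d N x)"
      by (rule set_integrable_mult_right) (rule si(1))
    then have "fcoeff (c (Suc N)) (- n) = (-1) ^ Suc N * fcoeff (d N) (- n) + fcoeff s (- n)"
      unfolding cN[abs_def] using si(4) by (simp only: fcoeff_add fcoeff_cmult)
    also have "fcoeff (d N) (- n) = (- \<eta>) ^ N * fcoeff (d 0) (- n)"
      using fcoeff_tower[OF d order_refl, of "- n"] by (simp add: \<eta>_def)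
    also have "(-1) ^ Suc N * ((- \<eta>) ^ N * fcoeff (d 0) (- n)) = - (\<eta> ^ N * fcoeff (d 0) (- n))"
      by (cases "even N") simp_all
    finally show ?thesis .
  qed
  ultimately have Jint: "Jint = \<eta> ^ N * S + Rr + Err"
    by (simp add: Err_def S_def Rr_def algebra_simps)
  \<comment> \<open>This is \<open>n \<pi> / z\<close>.\<close>
  define \<zeta> where "\<zeta> = q * \<eta>"
  have \<zeta>1: "cmod (\<zeta> - 1) \<le> W * m"
  proof -
    have "\<zeta> - 1 = q * (\<eta> - 2 * \<i> * z)" using q by (simp add: \<zeta>_def right_diff_distrib)
    also have "\<eta> - 2 * \<i> * z = - (2 * \<i> * w)" by (simp add: \<eta>_def z algebra_simps)
    finally have "cmod (\<zeta> - 1) = cmod q * (2 * cmod w)" by (simp add: norm_mult)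
    also have "cmod q = 1 / cmod z / 2" by (simp add: q_def norm_divide norm_mult)
    also have "1 / cmod z / 2 * (2 * cmod w) = 1 / cmod z * cmod w" by simp
    also have "\<dots> \<le> 1 * (W * m)" using mz m01 w W by (intro mult_mono) auto
    finally show ?thesis by simp
  qed
  have \<zeta>b: "cmod \<zeta> \<le> 1 + W"
  proof -
    have "W * m \<le> W" using m01 W by (simp add: mult_left_le)
    then show ?thesis using norm_triangle_ineq[of "\<zeta> - 1" 1] \<zeta>1 by simp
  qed
  define NW where "NW = real N * (1 + W) ^ N"
  have \<zeta>N: "cmod (\<zeta> ^ N - 1) \<le> NW * (W * m)"
  proof -
    have "cmod (\<zeta> ^ N - 1) \<le> NW * cmod (\<zeta> - 1)" using power_near_1[OF \<zeta>b, of N] W by (simp add: NW_def)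
    also have "\<dots> \<le> NW * (W * m)" using \<zeta>1 W by (intro mult_left_mono) (auto simp: NW_def)
    finally show ?thesis .
  qed
  define TT where "TT = cmod (fcoeff (e N) n) + cmod (fcoeff (d N) (- n))"
  have Sb: "cmod S \<le> m ^ N * TT"
    using norm_triangle_ineq[of "fcoeff (e 0) n" "fcoeff (d 0) (- n)"] fcoeff_decay[OF e n] fcoeff_decay[OF d, of "- n"] n
    by (simp add: S_def TT_def m distrib_left)
  have rest: "cmod (fcoeff y k) \<le> m * cmod (fcoeff y' k)" if y: "abs_cont y y'" "y 1 = y 0" "\<bar>k\<bar> = \<bar>n\<bar>" for y y' k
  proof -
    have "cmod (fcoeff y' k) = 2 * pi * real_of_int \<bar>n\<bar> * cmod (fcoeff y k)"
      unfolding fcoeff_deriv[OF y(1,2)] using y(3)[THEN arg_cong[where f = real_of_int]] by (simp add: norm_mult)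
    moreover have "1 * (real_of_int \<bar>n\<bar> * cmod (fcoeff y k)) \<le> (2 * pi) * (real_of_int \<bar>n\<bar> * cmod (fcoeff y k))"
      using pi_gt3 by (intro mult_right_mono) auto
    ultimately have "real_of_int \<bar>n\<bar> * cmod (fcoeff y k) \<le> cmod (fcoeff y' k)" by (simp add: mult.assoc)
    then have "m * (real_of_int \<bar>n\<bar> * cmod (fcoeff y k)) \<le> m * cmod (fcoeff y' k)" using m01 by (intro mult_left_mono) auto
    moreover have mn: "m * real_of_int \<bar>n\<bar> = 1" using nm by (simp only: mult.commute)
    have "m * (real_of_int \<bar>n\<bar> * cmod (fcoeff y k)) = cmod (fcoeff y k)" by (simp only: mult.assoc[symmetric] mn mult_1_left)
    ultimately show ?thesis by linarith
  qed
  have Rb: "cmod Rr \<le> m * (cmod (fcoeff r' n) + cmod (fcoeff s' (- n)))"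
    using norm_triangle_ineq4[of "fcoeff r n" "fcoeff s (- n)"] rest[OF r(1,2), of n] rest[OF s(1,2), of "- n"]
    by (simp add: Rr_def distrib_left)
  have main: "(\<kappa> - S) * Y = S * (\<zeta> ^ N - 1) - S * (Y - 1) + q ^ N * (Rr + Err)"
    unfolding left_diff_distrib id Jint \<zeta>_def by (simp add: power_mult_distrib algebra_simps)
  have qN: "cmod (q ^ N) \<le> m ^ N" unfolding norm_power using qm by (intro power_mono) auto
  have TT0: "0 \<le> TT" by (simp add: TT_def)
  have "cmod ((\<kappa> - S) * Y) \<le> (m ^ N * TT) * (NW * (W * m)) + (m ^ N * TT) * (3 * L * N * m)
      + m ^ N * (m * (cmod (fcoeff r' n) + cmod (fcoeff s' (- n))) + m * E)"
    unfolding main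
  proof (intro order_trans[OF norm_triangle_ineq] order_trans[OF norm_triangle_ineq4] add_mono)
    show "cmod (S * (\<zeta> ^ N - 1)) \<le> (m ^ N * TT) * (NW * (W * m))"
      unfolding norm_mult using Sb \<zeta>N m01 TT0 by (intro mult_mono) auto
    show "cmod (S * (Y - 1)) \<le> (m ^ N * TT) * (3 * L * N * m)"
      unfolding norm_mult using Sb Y1 m01 TT0 by (intro mult_mono) auto
    show "cmod (q ^ N * (Rr + Err)) \<le> m ^ N * (m * (cmod (fcoeff r' n) + cmod (fcoeff s' (- n))) + m * E)"
      unfolding norm_mult[of "q ^ N"] using qN m01 order_trans[OF norm_triangle_ineq add_mono[OF Rb Err]] by (intro mult_mono) auto
  qed
  also have "\<dots> = m ^ Suc N * ((NW * W + 3 * L * N) * TT + (cmod (fcoeff r' n) + cmod (fcoeff s' (- n))) + E)"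
    by (simp add: algebra_simps)
  finally have up: "cmod (\<kappa> - S) * cmod Y \<le> m ^ Suc N * ((NW * W + 3 * L * N) * TT + (cmod (fcoeff r' n) + cmod (fcoeff s' (- n))) + E)"
    by (simp add: norm_mult)
  have "1 / 2 \<le> cmod Y"
  proof -
    have "cmod (Y - 1) \<le> 1 / 2" using Y1 mL by linarith
    then show ?thesis using norm_triangle_ineq4[of Y "Y - 1"] by simp
  qed
  then have "cmod (\<kappa> - S) * (1 / 2) \<le> cmod (\<kappa> - S) * cmod Y" by (intro mult_left_mono) auto
  with up have "cmod (\<kappa> - S) \<le> 2 * (m ^ Suc N * ((NW * W + 3 * L * N) * TT + (cmod (fcoeff r' n) + cmod (fcoeff s' (- n))) + E))" by linarith
  also have "\<dots> = m ^ Suc N * (2 * ((NW * W + 3 * L * N) * TT + (cmod (fcoeff r' n) + cmod (fcoeff s' (- n))) + E))"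
    by (rule mult.left_commute)
  finally show ?thesis unfolding \<kappa>_def S_def TT_def E_def NW_def .
qed

lemma kappa_asymptotics:
  assumes N: "1 \<le> N" and K: "1 \<le> K" and W: "1 \<le> W"
  shows "\<exists>C\<ge>0. \<exists>n0\<ge>1. \<forall>d e. sobolev_tower N K d \<longrightarrow> sobolev_tower N K e \<longrightarrow> (\<exists>X. l2_family C X \<and>
    (\<forall>n z f g. real n0 \<le> real_of_int \<bar>n\<bar> \<longrightarrow> cmod (z - of_int n * of_real pi) \<le> W / real_of_int \<bar>n\<bar> \<longrightarrow>
       zs_sol z (d 0) (e 0) f g \<longrightarrow> f 0 = 1 \<longrightarrow> g 0 = 1 \<longrightarrow> f 1 = g 1 \<longrightarrow>
       cmod ((f 1)\<^sup>2 - 1 - (fcoeff (e 0) n + fcoeff (d 0) (- n))) \<le> (1 / real_of_int \<bar>n\<bar>) ^ Suc N * X n))"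
proof -
  obtain L where L0: "L \<ge> 1 \<and> (\<forall>d e. sobolev_tower N K d \<longrightarrow> sobolev_tower N K e \<longrightarrow>
    (\<exists>a b c r s. akns_sys N L (d 0) (e 0) a b c \<and> smooth_rest L r \<and> smooth_rest L s \<and>
       (\<forall>x. a (Suc N) x = e N x + r x) \<and> (\<forall>x. c (Suc N) x = (-1) ^ Suc N * d N x + s x)))"
    using akns_exists[OF N, of K] by (rule exE)
  have L: "L \<ge> 1" by (rule conjunct1[OF L0])
  note ex = conjunct2[OF L0, rule_format]
  define G where "G = 2 * (K + L)"
  define ZC where "ZC = K * G + 2 * W * (G * 1) + G * K\<^sup>2 + G * K + G * (68 * W\<^sup>2 * second_order_const K W) * 8"
  define A where "A = real N * (1 + W) ^ N * W + 3 * L * N"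
  define C where "C = 2 * (A * (K + K) + (L + L) + (ZC + ZC + 2 * G * K * product_const K * 8))"
  have A0: "0 \<le> A" using W L by (simp add: A_def)
  have G0: "0 \<le> G" using K L by (simp add: G_def)
  \<comment> \<open>The first term makes \<open>|z - n \<pi>| \<le> 1\<close>, the second keeps \<open>Y(0)\<close> above \<open>1/2\<close>.\<close>
  obtain n0 :: nat where n0: "W + 6 * L * N + 1 \<le> real n0" using real_arch_simple by blast
  have pw: "\<exists>X. l2_family C X \<and>
    (\<forall>n z f g. real n0 \<le> real_of_int \<bar>n\<bar> \<longrightarrow> cmod (z - of_int n * of_real pi) \<le> W / real_of_int \<bar>n\<bar> \<longrightarrow>
       zs_sol z (d 0) (e 0) f g \<longrightarrow> f 0 = 1 \<longrightarrow> g 0 = 1 \<longrightarrow> f 1 = g 1 \<longrightarrow>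
       cmod ((f 1)\<^sup>2 - 1 - (fcoeff (e 0) n + fcoeff (d 0) (- n))) \<le> (1 / real_of_int \<bar>n\<bar>) ^ Suc N * X n)"
    if d: "sobolev_tower N K d" and e: "sobolev_tower N K e" for d e
  proof -
    note data = sobolev_tower_potential_bound[OF N d e]
    obtain a b c r s where X0: "akns_sys N L (d 0) (e 0) a b c \<and> smooth_rest L r \<and> smooth_rest L s \<and>
       (\<forall>x. a (Suc N) x = e N x + r x) \<and> (\<forall>x. c (Suc N) x = (-1) ^ Suc N * d N x + s x)"
      using ex[OF d e] by (elim exE) (rule that)
    have sys: "akns_sys N L (d 0) (e 0) a b c" and r: "smooth_rest L r" and s: "smooth_rest L s"
      and aN: "a (Suc N) x = e N x + r x" and cN: "c (Suc N) x = (-1) ^ Suc N * d N x + s x" for x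
      using X0 by simp_all
    obtain r' where r': "abs_cont r r'" "r 1 = r 0" "L2_bound L r" "L2_bound L r'" using r by (auto simp: smooth_rest_def)
    obtain s' where s': "abs_cont s s'" "s 1 = s 0" "L2_bound L s" "L2_bound L s'" using s by (auto simp: smooth_rest_def)
    have dN: "L2_bound K (d N)" and eN: "L2_bound K (e N)" using d e by (auto simp: sobolev_tower_def)
    have Ga: "L2_bound G (a (Suc N))" using L2_bound_add[OF eN r'(3)] by (simp add: G_def aN[abs_def])
    have Gc: "L2_bound G (c (Suc N))"
    proof -
      have "L2_bound (K * 1) (\<lambda>x. d N x * (-1) ^ Suc N)" by (rule L2_bound_mult_cont[OF dN]) (simp_all add: norm_power)
      then have "L2_bound K (\<lambda>x. (-1) ^ Suc N * d N x)" by (simp add: mult.commute)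
      from L2_bound_add[OF this s'(3)] show ?thesis unfolding cN[abs_def] G_def .
    qed
    define X where "X = (\<lambda>n. 2 * (
     A * (cmod (fcoeff (e N) n) + cmod (fcoeff (d N) (- n)))
      + (cmod (fcoeff r' n) + cmod (fcoeff s' (- n))) + (remainder_term K W G (a (Suc N)) (d 0) (d 1) (e 0) n
      + remainder_term K W G (c (Suc N)) (e 0) (e 1) (d 0) (- n) + 2 * G * K * product_const K * (1 / real_of_int \<bar>n\<bar>))))"
    have "l2_family C X"
      unfolding X_def C_def
      by (intro l2_family_add l2_family_cmult l2_family_fcoeff l2_family_reflect[OF l2_family_fcoeff] l2_family_inverse eN dN r' s'
          l2_family_remainder_term[OF data Ga W, folded ZC_def] l2_family_reflect[OF l2_family_remainder_term[OF potential_bound_swap[OF data] Gc W, folded ZC_def]])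
        (use A0 G0 K product_const_ge1[OF K] in auto)
    moreover have "cmod ((f 1)\<^sup>2 - 1 - (fcoeff (e 0) n + fcoeff (d 0) (- n))) \<le> (1 / real_of_int \<bar>n\<bar>) ^ Suc N * X n"
      if h: "real n0 \<le> real_of_int \<bar>n\<bar>" "cmod (z - of_int n * of_real pi) \<le> W / real_of_int \<bar>n\<bar>"
        "zs_sol z (d 0) (e 0) f g" "f 0 = 1" "g 0 = 1" "f 1 = g 1" for n z f g
    proof -
      define m where "m = 1 / real_of_int \<bar>n\<bar>"
      have nb: "W + 6 * L * N + 1 \<le> real_of_int \<bar>n\<bar>" using n0 h(1) by linarith
      have LN: "0 \<le> 6 * L * N" using L by simp
      have n: "n \<noteq> 0" using nb LN W by auto
      have np: "0 < real_of_int \<bar>n\<bar>" using n by simp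
      have w1: "cmod (z - of_int n * of_real pi) \<le> W * m" using h(2) by (simp add: m_def)
      have "W / real_of_int \<bar>n\<bar> \<le> 1" using nb LN np by (simp add: divide_le_eq_1)
      then have w2: "cmod (z - of_int n * of_real pi) \<le> 1" using h(2) by linarith
      have mL: "6 * L * N * m \<le> 1" using nb W np by (simp add: m_def divide_le_eq_1)
      show ?thesis
        using kappa_pointwise[OF N d e sys aN cN r'(1,2,3) s'(1,2,3) h(3,4,5,6) _ m_def n w1 w2 W mL L Ga Gc]
        by (simp add: X_def A_def m_def)
    qed
    ultimately show ?thesis by blast
  qed
  have C0: "0 \<le> C"
  proof -
    have "0 \<le> second_order_const K W" using W product_const_ge1[OF K] by (simp add: second_order_const_def)
    then have "0 \<le> ZC" using K W G0 unfolding ZC_def by (intro add_nonneg_nonneg mult_nonneg_nonneg) auto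
    then show ?thesis using A0 K L G0 product_const_ge1[OF K] unfolding C_def
      by (intro mult_nonneg_nonneg add_nonneg_nonneg) auto
  qed
  have "1 \<le> real n0"
  proof -
    have "0 \<le> 6 * L * N" using L by simp
    then show ?thesis using n0 W by linarith
  qed
  then have "n0 \<ge> 1" by simp
  then show ?thesis using C0 pw by blast
qed

section \<open>Location of the Dirichlet eigenvalues\<close>

definition global_potential_bound :: "real \<Rightarrow> (real \<Rightarrow> complex) \<Rightarrow> (real \<Rightarrow> complex) \<Rightarrow> (real \<Rightarrow> complex) \<Rightarrow> (real \<Rightarrow> complex) \<Rightarrow> bool" where
  "global_potential_bound K u u' v v' \<longleftrightarrow> potential_bound K u u' v v' \<and> continuous_on UNIV u \<and> continuous_on UNIV v \<and>
     (\<forall>x. cmod (u x) \<le> K) \<and> (\<forall>x. cmod (v x) \<le> K)"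

definition dirichlet_solution :: "complex \<Rightarrow> (real \<Rightarrow> complex) \<Rightarrow> (real \<Rightarrow> complex) \<Rightarrow> (real \<Rightarrow> complex) \<Rightarrow> (real \<Rightarrow> complex) \<Rightarrow> bool" where
  "dirichlet_solution z u v f g \<longleftrightarrow> zs_sol z u v f g \<and> f 0 = 1 \<and> g 0 = 1 \<and> f 1 = g 1"

lemma near_product:
  assumes "cmod (p - 1) \<le> \<epsilon>" "cmod (q - 1) \<le> \<epsilon>" "\<epsilon> \<le> 1"
  shows "cmod (p * q - 1) \<le> 3 * \<epsilon>"
proof -
  have \<epsilon>: "0 \<le> \<epsilon>" using order_trans[OF norm_ge_zero assms(1)] .
  have e: "p * q - 1 = (p - 1) * (q - 1) + (p - 1) + (q - 1)" by (simp add: algebra_simps)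
  have "cmod (p * q - 1) \<le> \<epsilon> * 1 + \<epsilon> + \<epsilon>"
    unfolding e
  proof (intro order_trans[OF norm_triangle_ineq] add_mono)
    show "cmod ((p - 1) * (q - 1)) \<le> \<epsilon> * 1" unfolding norm_mult using assms \<epsilon> by (intro mult_mono) auto
  qed (use assms in auto)
  then show ?thesis by simp
qed

text \<open>Take logarithms; the bound on \<open>\<epsilon>\<close> keeps \<open>a/b\<close> away from the branch cut.\<close>

lemma log_near_pi_multiple:
  assumes e: "exp (2 * \<i> * z) * b = a" and a: "cmod (a - 1) \<le> \<epsilon>" and b: "cmod (b - 1) \<le> \<epsilon>" and \<epsilon>: "\<epsilon> \<le> 1 / 16"
  shows "cmod (a / b - 1) \<le> 4 * \<epsilon>" "b \<noteq> 0" "\<exists>m::int. cmod (z - of_int m * of_real pi) \<le> 4 * \<epsilon>"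
proof -
  have b2: "1 / 2 \<le> cmod b" using b \<epsilon> norm_triangle_ineq4[of b "b - 1"] by simp
  then show b0: "b \<noteq> 0" by auto
  have e0: "0 \<le> \<epsilon>" using order_trans[OF norm_ge_zero a] .
  define s where "s = a / b - 1"
  have "cmod (a - b) \<le> 2 * \<epsilon>" using norm_triangle_ineq4[of "a - 1" "b - 1"] a b by simp
  moreover have "s = (a - b) / b" using b0 by (simp add: s_def diff_divide_distrib)
  ultimately have "cmod s \<le> 2 * \<epsilon> / (1 / 2)"
    using b2 e0 by (simp only: norm_divide) (intro frac_le; simp)
  then have s: "cmod s \<le> 4 * \<epsilon>" by simp
  then show "cmod (a / b - 1) \<le> 4 * \<epsilon>" by (simp add: s_def)
  have s2: "cmod s < 1 / 2" using s \<epsilon> by simp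
  then have "0 < Re (1 + s)" using abs_Re_le_cmod[of s] by simp
  then have s1: "1 + s \<noteq> 0" by (metis less_irrefl zero_complex.sel(1))
  have ab: "a / b = 1 + s" by (simp add: s_def)
  have "exp (2 * \<i> * z) = exp (Ln (1 + s))" using e b0 s1 by (simp add: ab[symmetric] eq_divide_eq)
  then obtain m :: int where m: "2 * \<i> * z = Ln (1 + s) + of_int (2 * m) * of_real pi * \<i>"
    unfolding exp_eq by auto
  have "2 * \<i> * (z - of_int m * of_real pi) = Ln (1 + s)" using m by (simp add: algebra_simps)
  then have "2 * cmod (z - of_int m * of_real pi) = cmod (Ln (1 + s))"
    by (metis norm_mult norm_ii norm_numeral mult.right_neutral)
  also have "\<dots> \<le> 2 * cmod s" by (rule norm_Ln_le[OF s2])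
  finally have "cmod (z - of_int m * of_real pi) \<le> 4 * \<epsilon>" using s by simp
  then show "\<exists>m::int. cmod (z - of_int m * of_real pi) \<le> 4 * \<epsilon>" by blast
qed

lemma dirichlet_solution_Im: "potential_bound K u u' v v' \<Longrightarrow> dirichlet_solution z u v f g \<Longrightarrow> \<bar>Im z\<bar> \<le> K"
  unfolding dirichlet_solution_def potential_bound_def using dirichlet_Im_bound[of z u v f g K] abs_cont_cont by blast

text \<open>The quotient of the two first-order asymptotics at \<open>x = 1\<close> turns \<open>f(1) = g(1)\<close> into \<open>exp (2 \<i> z) = 1 + O(1/|z|)\<close>.\<close>

lemma dirichlet_location:
  assumes data: "potential_bound K u u' v v'" and s: "dirichlet_solution z u v f g" and z: "16 * first_order_const K \<le> cmod z"
  shows "\<exists>m::int. m \<noteq> 0 \<and> cmod (z - of_int m * of_real pi) \<le> 1 / 2 \<and> cmod (z - of_int m * of_real pi) \<le> 4 * first_order_const K / real_of_int \<bar>m\<bar>"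
proof -
  have K: "1 \<le> K" using data by (simp add: potential_bound_def)
  note C = first_order_const_ge1[OF K]
  have sol: "zs_sol z u v f g" "f 0 = 1" "g 0 = 1" "f 1 = g 1" using s by (auto simp: dirichlet_solution_def)
  have z0: "z \<noteq> 0" using z C by auto
  define \<epsilon> where "\<epsilon> = first_order_const K / cmod z"
  have \<epsilon>: "\<epsilon> \<le> 1 / 16" using z z0 by (simp add: \<epsilon>_def divide_le_eq)
  have ab: "cmod (exp (\<i> * z) * f 1 - 1) \<le> \<epsilon>" "cmod (exp (- \<i> * z) * g 1 - 1) \<le> \<epsilon>"
    using zs_first_order[OF data sol(1) dirichlet_solution_Im[OF data s] sol(2,3) _ z0, of 1] by (auto simp: \<epsilon>_def cexp_1)
  have "exp (2 * \<i> * z) * (exp (- \<i> * z) * g 1) = exp (\<i> * z) * f 1"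
    by (simp add: sol(4) mult.assoc[symmetric] mult_exp_exp)
  from log_near_pi_multiple(3)[OF this ab \<epsilon>] obtain m :: int where m: "cmod (z - of_int m * of_real pi) \<le> 4 * \<epsilon>" by blast
  have m2: "cmod (z - of_int m * of_real pi) \<le> 1 / 2" using m \<epsilon> by simp
  have m0: "m \<noteq> 0" using m2 z C by auto
  have "real_of_int \<bar>m\<bar> * pi = cmod (of_int m * of_real pi :: complex)" by (simp add: norm_mult)
  also have "\<dots> \<le> cmod z + cmod (z - of_int m * of_real pi)"
    using norm_triangle_ineq4[of z "z - of_int m * of_real pi"] by simp
  finally have "real_of_int \<bar>m\<bar> * pi \<le> cmod z + 1 / 2" using m2 by simp
  moreover have "real_of_int \<bar>m\<bar> * 3 \<le> real_of_int \<bar>m\<bar> * pi" using pi_gt3 by (intro mult_left_mono) auto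
  moreover have "1 \<le> real_of_int \<bar>m\<bar>" using m0 by simp
  ultimately have "real_of_int \<bar>m\<bar> \<le> cmod z" by linarith
  then have "\<epsilon> \<le> first_order_const K / real_of_int \<bar>m\<bar>" unfolding \<epsilon>_def using C m0 by (intro frac_le) auto
  then have "cmod (z - of_int m * of_real pi) \<le> 4 * first_order_const K / real_of_int \<bar>m\<bar>" using m by simp
  then show ?thesis using m0 m2 by blast
qed

text \<open>The Wronskians of the solution at \<open>z\<close> with a basis of solutions at \<open>z\<^sub>0\<close> change by \<open>O(|z - z\<^sub>0|)\<close> over \<open>[0,1]\<close>, and they determine its value
at \<open>1\<close>.\<close>

lemma zs_solution_lipschitz:
  assumes per: "global_potential_bound K u u' v v'"
    and F: "\<And>z. zs_sol z u v (F z) (G z) \<and> F z 0 = 1 \<and> G z 0 = 1"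
    and z0: "\<bar>Im z0\<bar> \<le> K"
  shows "\<exists>B. \<forall>z. \<bar>Im z\<bar> \<le> K \<longrightarrow> cmod (F z 1 - F z0 1) \<le> B * cmod (z - z0) \<and> cmod (G z 1 - G z0 1) \<le> B * cmod (z - z0)"
proof -
  have data: "potential_bound K u u' v v'" and U: "continuous_on UNIV u" "\<And>x. cmod (u x) \<le> K" and V: "continuous_on UNIV v" "\<And>x. cmod (v x) \<le> K"
    using per by (auto simp: global_potential_bound_def)
  obtain p q where p: "p 0 = 1" "q 0 = 0" "zs_on UNIV z0 u v p q" using zs_exists[OF U V] .
  obtain r s where r: "r 0 = 0" "s 0 = 1" "zs_on UNIV z0 u v r s" using zs_exists[OF U V] .
  have p': "zs_sol z0 u v p q" and r': "zs_sol z0 u v r s"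
    using zs_on_subset[OF p(3)] zs_on_subset[OF r(3)] by auto
  have bd: "\<exists>B\<ge>0. \<forall>x\<in>{0..1}. cmod (h x) \<le> B" if "continuous_on {0..1} h" for h :: "real \<Rightarrow> complex"
  proof -
    have "compact (h ` {0..1})" by (rule compact_continuous_image[OF that]) simp
    then obtain B where "\<forall>y\<in>h ` {0..1}. cmod y \<le> B" using compact_imp_bounded bounded_iff by blast
    then show ?thesis by (intro exI[of _ "max 0 B"]) (auto simp: le_max_iff_disj)
  qed
  obtain B1 B2 B3 B4 where B: "B1 \<ge> 0" "B2 \<ge> 0" "B3 \<ge> 0" "B4 \<ge> 0"
     "\<forall>x\<in>{0..1}. cmod (p x) \<le> B1" "\<forall>x\<in>{0..1}. cmod (q x) \<le> B2" "\<forall>x\<in>{0..1}. cmod (r x) \<le> B3" "\<forall>x\<in>{0..1}. cmod (s x) \<le> B4"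
    using bd[OF zs_cont(1)[OF p']] bd[OF zs_cont(2)[OF p']] bd[OF zs_cont(1)[OF r']] bd[OF zs_cont(2)[OF r']] by metis
  define M where "M = B1 + B2 + B3 + B4"
  have M: "0 \<le> M" "cmod (p x) \<le> M" "cmod (q x) \<le> M" "cmod (r x) \<le> M" "cmod (s x) \<le> M" if "x \<in> {0..1}" for x
    using B that unfolding M_def by fastforce+
  have M0: "0 \<le> M" using B by (simp add: M_def)
  define E where "E = 2 * exp (2 * K)"
  have E0: "0 \<le> E" by (simp add: E_def)
  have wb: "cmod ((F z 1 * k 1 - G z 1 * h 1) - (k 0 - h 0)) \<le> 2 * (E * M) * cmod (z - z0)"
    if hk: "zs_sol z0 u v h k" "\<And>x. x \<in> {0..1} \<Longrightarrow> cmod (h x) \<le> M" "\<And>x. x \<in> {0..1} \<Longrightarrow> cmod (k x) \<le> M" and z: "\<bar>Im z\<bar> \<le> K" for h k z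
  proof -
    have Fz: "zs_sol z u v (F z) (G z)" "F z 0 = 1" "G z 0 = 1" using F by auto
    have gr: "cmod (F z x) \<le> E" "cmod (G z x) \<le> E" if "x \<in> {0..1}" for x
      using zs_growth[OF Fz(1) z _ Fz(2,3) that] U V unfolding E_def by auto
    have "((\<lambda>x. \<i> * (z0 - z) * (F z x * k x + G z x * h x)) has_integral
        ((F z 1 * k 1 - G z 1 * h 1) - (F z 0 * k 0 - G z 0 * h 0))) {0..1}"
      by (rule fundamental_theorem_of_calculus) (use zs_wronskian_deriv[OF Fz(1) hk(1)] in auto)
    then have e: "(F z 1 * k 1 - G z 1 * h 1) - (k 0 - h 0) = integral {0..1} (\<lambda>x. \<i> * (z0 - z) * (F z x * k x + G z x * h x))"
      unfolding Fz(2,3) mult_1_left by (rule integral_unique[symmetric])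
    show ?thesis unfolding e
    proof (rule cont_integral_bound)
      show "continuous_on {0..1} (\<lambda>x. \<i> * (z0 - z) * (F z x * k x + G z x * h x))"
        by (intro continuous_intros zs_cont[OF Fz(1)] zs_cont[OF hk(1)])
      fix x :: real assume x: "x \<in> {0..1}"
      have "cmod (F z x * k x + G z x * h x) \<le> E * M + E * M"
        by (intro order_trans[OF norm_triangle_ineq] add_mono) (unfold norm_mult, use gr[OF x] hk(2,3)[OF x] E0 in \<open>auto intro!: mult_mono\<close>)
      then have "cmod (z0 - z) * cmod (F z x * k x + G z x * h x) \<le> cmod (z - z0) * (2 * (E * M))"
        by (intro mult_mono) (auto simp: norm_minus_commute)
      then show "cmod (\<i> * (z0 - z) * (F z x * k x + G z x * h x)) \<le> 2 * (E * M) * cmod (z - z0)"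
        by (simp add: norm_mult mult_ac)
    qed simp
  qed
  have det: "p 1 * s 1 - q 1 * r 1 = 1" using zs_wronskian_const[OF p' r', of 1] p r by simp
  have rep: "F z 1 = p 1 * (F z 1 * s 1 - G z 1 * r 1) - r 1 * (F z 1 * q 1 - G z 1 * p 1)"
    "G z 1 = q 1 * (F z 1 * s 1 - G z 1 * r 1) - s 1 * (F z 1 * q 1 - G z 1 * p 1)" for z
  proof -
    have "p 1 * (F z 1 * s 1 - G z 1 * r 1) - r 1 * (F z 1 * q 1 - G z 1 * p 1) = F z 1 * (p 1 * s 1 - q 1 * r 1)"
      "q 1 * (F z 1 * s 1 - G z 1 * r 1) - s 1 * (F z 1 * q 1 - G z 1 * p 1) = G z 1 * (p 1 * s 1 - q 1 * r 1)"
      by (simp_all add: algebra_simps)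
    then show "F z 1 = p 1 * (F z 1 * s 1 - G z 1 * r 1) - r 1 * (F z 1 * q 1 - G z 1 * p 1)"
    "G z 1 = q 1 * (F z 1 * s 1 - G z 1 * r 1) - s 1 * (F z 1 * q 1 - G z 1 * p 1)" by (simp_all add: det)
  qed
  define w1 w2 where "w1 = (\<lambda>z. (F z 1 * s 1 - G z 1 * r 1) - (s 0 - r 0))" and "w2 = (\<lambda>z. (F z 1 * q 1 - G z 1 * p 1) - (q 0 - p 0))"
  have wz: "cmod (w1 z) \<le> 2 * (E * M) * cmod (z - z0)" "cmod (w2 z) \<le> 2 * (E * M) * cmod (z - z0)" if "\<bar>Im z\<bar> \<le> K" for z
    using wb[OF r' M(4,5) that] wb[OF p' M(2,3) that] by (auto simp: w1_def w2_def)
  \<comment> \<open>The Lipschitz bound at \<open>z = z\<^sub>0\<close> itself.\<close>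
  have wz0: "w1 z0 = 0" "w2 z0 = 0" using wz[OF z0] by auto
  have Fw: "F z 1 - F z0 1 = p 1 * w1 z - r 1 * w2 z" "G z 1 - G z0 1 = q 1 * w1 z - s 1 * w2 z" for z
  proof -
    have 1: "F y 1 = p 1 * (w1 y + (s 0 - r 0)) - r 1 * (w2 y + (q 0 - p 0))" "G y 1 = q 1 * (w1 y + (s 0 - r 0)) - s 1 * (w2 y + (q 0 - p 0))" for y
      using rep[of y] by (simp_all add: w1_def w2_def)
    show "F z 1 - F z0 1 = p 1 * w1 z - r 1 * w2 z" "G z 1 - G z0 1 = q 1 * w1 z - s 1 * w2 z"
      unfolding 1[of z] 1[of z0] wz0 by (simp_all add: algebra_simps)
  qed
  show ?thesis
  proof (intro exI[of _ "2 * (M * (2 * (E * M)))"] allI impI conjI)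
    fix z assume z: "\<bar>Im z\<bar> \<le> K"
    define T where "T = 2 * (E * M) * cmod (z - z0)"
    have "cmod (p 1 * w1 z - r 1 * w2 z) \<le> M * T + M * T" "cmod (q 1 * w1 z - s 1 * w2 z) \<le> M * T + M * T"
      by (intro order_trans[OF norm_triangle_ineq4] add_mono; unfold norm_mult; use M[of 1] M0 wz[OF z] in \<open>auto intro!: mult_mono simp: T_def\<close>)+
    then show "cmod (F z 1 - F z0 1) \<le> 2 * (M * (2 * (E * M))) * cmod (z - z0)" "cmod (G z 1 - G z0 1) \<le> 2 * (M * (2 * (E * M))) * cmod (z - z0)"
      unfolding Fw by (simp_all add: T_def mult_ac)
  qed
qed

lemma tendsto_lipschitz:
  fixes h :: "complex \<Rightarrow> complex"
  assumes "\<And>z. z \<in> S \<Longrightarrow> cmod (h z - h z0) \<le> B * cmod (z - z0)"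
  shows "(h \<longlongrightarrow> h z0) (at z0 within S)"
proof (rule LIM_zero_cancel, rule Lim_null_comparison)
  show "\<forall>\<^sub>F z in at z0 within S. norm (h z - h z0) \<le> B * cmod (z - z0)"
    unfolding eventually_at_filter using assms by (simp add: eventually_mono)
  have "((\<lambda>z. B * cmod (z - z0)) \<longlongrightarrow> B * cmod (z0 - z0)) (at z0 within S)"
    by (intro tendsto_intros)
  then show "((\<lambda>z. B * cmod (z - z0)) \<longlongrightarrow> 0) (at z0 within S)" by simp
qed

text \<open>An eigenvalue is a solution of \<open>exp (2 \<i> z) = a(z) / b(z)\<close>, where \<open>a\<close> and \<open>b\<close> are the normalised values of \<open>f\<close> and \<open>g\<close> at \<open>1\<close>. This is a
fixed point equation for a continuous map of a small disc around \<open>n \<pi>\<close> to itself, to which Brouwer's theorem applies.\<close>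

lemma dirichlet_exists:
  assumes per: "global_potential_bound K u u' v v'" and n: "8 * first_order_const K \<le> real_of_int \<bar>n\<bar>"
  shows "\<exists>z f g. dirichlet_solution z u v f g \<and> cmod (z - of_int n * of_real pi) \<le> 1 / 2"
proof -
  have data: "potential_bound K u u' v v'" and U: "continuous_on UNIV u" "\<And>x. cmod (u x) \<le> K" and V: "continuous_on UNIV v" "\<And>x. cmod (v x) \<le> K"
    using per by (auto simp: global_potential_bound_def)
  have K: "1 \<le> K" using data by (simp add: potential_bound_def)
  note C = first_order_const_ge1[OF K]
  have "\<forall>z. \<exists>f g. zs_sol z u v f g \<and> f 0 = 1 \<and> g 0 = 1"
  proof
    fix z
    obtain f g where "f 0 = 1" "g 0 = 1" "zs_on UNIV z u v f g" using zs_exists[OF U V] .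
    then show "\<exists>f g. zs_sol z u v f g \<and> f 0 = 1 \<and> g 0 = 1" using zs_on_subset by blast
  qed
  then obtain F G where FG: "\<And>z. zs_sol z u v (F z) (G z) \<and> F z 0 = 1 \<and> G z 0 = 1" by metis
  define c :: complex where "c = of_int n * of_real pi"
  have ball: "\<bar>Im z\<bar> \<le> K" "8 * first_order_const K \<le> cmod z" if z: "z \<in> cball c (1/2)" for z
  proof -
    have d: "cmod (z - c) \<le> 1 / 2" using z by (simp add: dist_norm norm_minus_commute)
    have "\<bar>Im z\<bar> \<le> cmod (z - c)" using abs_Im_le_cmod[of "z - c"] by (simp add: c_def)
    then show "\<bar>Im z\<bar> \<le> K" using d K by simp
    have "cmod c = real_of_int \<bar>n\<bar> * pi" by (simp add: c_def norm_mult)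
    then have "real_of_int \<bar>n\<bar> * pi \<le> cmod z + 1 / 2" using norm_triangle_ineq4[of z "z - c"] d by simp
    moreover have "real_of_int \<bar>n\<bar> * 3 \<le> real_of_int \<bar>n\<bar> * pi" using pi_gt3 by (intro mult_left_mono) auto
    ultimately show "8 * first_order_const K \<le> cmod z" using n C by linarith
  qed
  define a where "a = (\<lambda>z. exp (\<i> * z) * F z 1)"
  define b where "b = (\<lambda>z. exp (- \<i> * z) * G z 1)"
  have ab: "cmod (a z - 1) \<le> 1 / 8" "cmod (b z - 1) \<le> 1 / 8" if z: "z \<in> cball c (1/2)" for z
  proof -
    have z0: "z \<noteq> 0" using ball(2)[OF z] C by auto
    have "first_order_const K / cmod z \<le> 1 / 8" using ball(2)[OF z] z0 by (simp add: divide_le_eq)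
    moreover have "cmod (a z - 1) \<le> first_order_const K / cmod z" "cmod (b z - 1) \<le> first_order_const K / cmod z"
      using zs_first_order[OF data conjunct1[OF FG] ball(1)[OF z] _ _ _ z0, of 1] FG by (auto simp: a_def b_def cexp_1)
    ultimately show "cmod (a z - 1) \<le> 1 / 8" "cmod (b z - 1) \<le> 1 / 8" by linarith+
  qed
  define s where "s = (\<lambda>z. a z / b z - 1)"
  have bs: "b z \<noteq> 0" "cmod (s z) < 1 / 2" "1 + s z \<noteq> 0" "1 + s z \<notin> \<real>\<^sub>\<le>\<^sub>0" if z: "z \<in> cball c (1/2)" for z
  proof -
    have b2: "7 / 8 \<le> cmod (b z)" using ab(2)[OF z] norm_triangle_ineq4[of "b z" "b z - 1"] by simp
    then show b0: "b z \<noteq> 0" by auto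
    have "cmod (a z - b z) \<le> 1 / 4" using norm_triangle_ineq4[of "a z - 1" "b z - 1"] ab[OF z] by simp
    moreover have "s z = (a z - b z) / b z" using b0 by (simp add: s_def diff_divide_distrib)
    ultimately have "cmod (s z) \<le> (1 / 4) / (7 / 8)" using b2 by (simp only: norm_divide) (intro frac_le, auto)
    then show s2: "cmod (s z) < 1 / 2" by simp
    then have "0 < Re (1 + s z)" using abs_Re_le_cmod[of "s z"] by simp
    then show "1 + s z \<noteq> 0" "1 + s z \<notin> \<real>\<^sub>\<le>\<^sub>0" by (auto simp: complex_nonpos_Reals_iff complex_eq_iff)
  qed
  define \<Psi> where "\<Psi> = (\<lambda>z. c + Ln (1 + s z) / (2 * \<i>))"
  have cont1: "continuous_on (cball c (1/2)) (\<lambda>z. F z 1)" "continuous_on (cball c (1/2)) (\<lambda>z. G z 1)"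
  proof -
    have L: "\<exists>B. \<forall>z\<in>cball c (1/2). cmod (F z 1 - F z0 1) \<le> B * cmod (z - z0) \<and> cmod (G z 1 - G z0 1) \<le> B * cmod (z - z0)" if "z0 \<in> cball c (1/2)" for z0
      using zs_solution_lipschitz[of K u u' v v' F G z0, OF per FG ball(1)[OF that]] ball(1) by blast
    show "continuous_on (cball c (1/2)) (\<lambda>z. F z 1)"
      unfolding continuous_on_def
    proof
      fix z0 assume z0: "z0 \<in> cball c (1/2)"
      obtain B where "\<forall>z\<in>cball c (1/2). cmod (F z 1 - F z0 1) \<le> B * cmod (z - z0)" using L[OF z0] by blast
      then show "((\<lambda>z. F z 1) \<longlongrightarrow> F z0 1) (at z0 within cball c (1/2))" by (intro tendsto_lipschitz[where B = B]) auto
    qed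
    show "continuous_on (cball c (1/2)) (\<lambda>z. G z 1)"
      unfolding continuous_on_def
    proof
      fix z0 assume z0: "z0 \<in> cball c (1/2)"
      obtain B where "\<forall>z\<in>cball c (1/2). cmod (G z 1 - G z0 1) \<le> B * cmod (z - z0)" using L[OF z0] by blast
      then show "((\<lambda>z. G z 1) \<longlongrightarrow> G z0 1) (at z0 within cball c (1/2))" by (intro tendsto_lipschitz[where B = B]) auto
    qed
  qed
  have sc: "continuous_on (cball c (1/2)) s"
    unfolding s_def a_def b_def using bs(1) by (intro continuous_intros cont1) (auto simp: b_def)
  have \<Psi>c: "continuous_on (cball c (1/2)) \<Psi>"
    unfolding \<Psi>_def using bs(4) by (intro continuous_intros sc) auto
  have \<Psi>m: "\<Psi> z \<in> cball c (1/2)" if z: "z \<in> cball c (1/2)" for z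
  proof -
    have "cmod (Ln (1 + s z)) \<le> 2 * cmod (s z)" by (rule norm_Ln_le) (use bs(2)[OF z] in simp)
    then have "cmod (\<Psi> z - c) \<le> 1 / 2" using bs(2)[OF z] by (simp add: \<Psi>_def norm_divide norm_mult)
    then show ?thesis by (simp add: dist_norm norm_minus_commute)
  qed
  obtain z where z: "z \<in> cball c (1/2)" "\<Psi> z = z"
    using brouwer_ball[of "1/2" c \<Psi>] \<Psi>c \<Psi>m by auto
  have e: "2 * \<i> * z = 2 * \<i> * c + Ln (1 + s z)"
  proof -
    have "2 * \<i> * z = 2 * \<i> * \<Psi> z" using z(2) by simp
    also have "\<dots> = 2 * \<i> * c + (2 * \<i>) * (Ln (1 + s z) / (2 * \<i>))" unfolding \<Psi>_def by (simp only: distrib_left mult.assoc)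
    also have "(2 * \<i>) * (Ln (1 + s z) / (2 * \<i>)) = Ln (1 + s z)" by simp
    finally show ?thesis .
  qed
  have "exp (2 * \<i> * c) = 1"
    unfolding exp_eq_1 by (auto simp: c_def intro!: exI[of _ n])
  then have "exp (2 * \<i> * z) = 1 + s z" unfolding e exp_add using bs(3)[OF z(1)] by simp
  then have "exp (2 * \<i> * z) * b z = a z" using bs(1)[OF z(1)] by (simp add: s_def)
  moreover have "exp (2 * \<i> * z) * b z = exp (\<i> * z) * G z 1"
    by (simp add: b_def mult.assoc[symmetric] mult_exp_exp)
  ultimately have "F z 1 = G z 1" by (simp add: a_def)
  then have "dirichlet_solution z u v (F z) (G z)" using FG by (simp add: dirichlet_solution_def)
  moreover have "cmod (z - of_int n * of_real pi) \<le> 1 / 2" using z(1) by (simp add: c_def dist_norm norm_minus_commute)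
  ultimately show ?thesis by blast
qed

lemma integral_nonzero:
  fixes h :: "real \<Rightarrow> complex"
  assumes h: "continuous_on {0..1} h" and c: "\<And>x. x \<in> {0..1} \<Longrightarrow> cmod (h x - c) \<le> r" and r: "r < cmod c"
  shows "integral {0..1} h \<noteq> 0"
proof
  assume 0: "integral {0..1} h = 0"
  have "integral {0..1} (\<lambda>x. h x - c) = integral {0..1} h - integral {0..1} (\<lambda>x::real. c)"
    by (intro Henstock_Kurzweil_Integration.integral_diff integrable_continuous_interval h continuous_intros)
  moreover have "cmod (integral {0..1} (\<lambda>x. h x - c)) \<le> r"
    by (rule cont_integral_bound) (use h c in \<open>auto intro!: continuous_intros\<close>)
  ultimately show False using r 0 by simp
qed

text \<open>The numbers only need to leave room for the comparisons with \<open>1\<close> in the next two lemmas.\<close>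

lemma dirichlet_near_n:
  assumes data: "potential_bound K u u' v v'" and s: "dirichlet_solution z u v f g"
    and n: "256 * first_order_const K \<le> real_of_int \<bar>n\<bar>" and z: "cmod (z - of_int n * of_real pi) \<le> 4 * first_order_const K / real_of_int \<bar>n\<bar>" and x: "x \<in> {0..1}"
  shows "cmod (cexp (\<i> * z) x * f x - 1) \<le> 1 / 256" "cmod (cexp (- \<i> * z) x * g x - 1) \<le> 1 / 256"
    "cmod (z - of_int n * of_real pi) \<le> 1 / 64"
proof -
  have K: "1 \<le> K" using data by (simp add: potential_bound_def)
  note C = first_order_const_ge1[OF K]
  have sol: "zs_sol z u v f g" "f 0 = 1" "g 0 = 1" using s by (auto simp: dirichlet_solution_def)
  have n0: "0 < real_of_int \<bar>n\<bar>" using n C by linarith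
  have "4 * first_order_const K / real_of_int \<bar>n\<bar> \<le> 1 / 64" using n n0 by (simp add: divide_le_eq)
  then show z': "cmod (z - of_int n * of_real pi) \<le> 1 / 64" using z by linarith
  have "real_of_int \<bar>n\<bar> * pi = cmod (of_int n * of_real pi :: complex)" by (simp add: norm_mult)
  also have "\<dots> \<le> cmod z + cmod (z - of_int n * of_real pi)"
    using norm_triangle_ineq4[of z "z - of_int n * of_real pi"] by simp
  finally have "real_of_int \<bar>n\<bar> * pi \<le> cmod z + 1 / 64" using z' by simp
  moreover have "real_of_int \<bar>n\<bar> * 3 \<le> real_of_int \<bar>n\<bar> * pi" using pi_gt3 by (intro mult_left_mono) auto
  ultimately have zn: "256 * first_order_const K \<le> cmod z" using n C by linarith
  then have z0: "z \<noteq> 0" using C by auto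
  have "first_order_const K / cmod z \<le> 1 / 256" using zn z0 by (simp add: divide_le_eq)
  moreover have "cmod (cexp (\<i> * z) x * f x - 1) \<le> first_order_const K / cmod z" "cmod (cexp (- \<i> * z) x * g x - 1) \<le> first_order_const K / cmod z"
    using zs_first_order[OF data sol(1) dirichlet_solution_Im[OF data s] sol(2,3) x z0] by auto
  ultimately show "cmod (cexp (\<i> * z) x * f x - 1) \<le> 1 / 256" "cmod (cexp (- \<i> * z) x * g x - 1) \<le> 1 / 256" by linarith+
qed

text \<open>The integrand is close to \<open>1\<close>. If the integral vanished, a second vector of a Jordan chain could exist.\<close>

lemma dirichlet_simple:
  assumes data: "potential_bound K u u' v v'" and s: "dirichlet_solution z u v f g"
    and n: "256 * first_order_const K \<le> real_of_int \<bar>n\<bar>" and z: "cmod (z - of_int n * of_real pi) \<le> 4 * first_order_const K / real_of_int \<bar>n\<bar>"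
  shows "integral {0..1} (\<lambda>x. f x * g x) \<noteq> 0"
proof (rule integral_nonzero[of _ 1 "3 / 256"])
  have sol: "zs_sol z u v f g" using s by (simp add: dirichlet_solution_def)
  show "continuous_on {0..1} (\<lambda>x. f x * g x)" by (intro continuous_intros zs_cont[OF sol])
  fix x :: real assume x: "x \<in> {0..1}"
  have "(cexp (\<i> * z) x * f x) * (cexp (- \<i> * z) x * g x) = (cexp (\<i> * z) x * cexp (- \<i> * z) x) * (f x * g x)"
    by (simp add: mult_ac)
  also have "\<dots> = f x * g x" by (simp add: cexp_add)
  finally have E: "(cexp (\<i> * z) x * f x) * (cexp (- \<i> * z) x * g x) = f x * g x" .
  show "cmod (f x * g x - 1) \<le> 3 / 256"
    using near_product[OF dirichlet_near_n(1,2)[OF data s n z x]] unfolding E by simp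
qed simp

text \<open>For eigenfunctions of different eigenvalues the integral of \<open>f k + g h\<close> vanishes, by the Wronskian identity and the boundary
conditions. Here both summands are close to \<open>1\<close>.\<close>

lemma dirichlet_unique:
  assumes data: "potential_bound K u u' v v'" and s: "dirichlet_solution z u v f g" and t: "dirichlet_solution w u v h k"
    and n: "256 * first_order_const K \<le> real_of_int \<bar>n\<bar>" and z: "cmod (z - of_int n * of_real pi) \<le> 4 * first_order_const K / real_of_int \<bar>n\<bar>"
    and w: "cmod (w - of_int n * of_real pi) \<le> 4 * first_order_const K / real_of_int \<bar>n\<bar>"
  shows "z = w"
proof (rule ccontr)
  assume zw: "z \<noteq> w"
  have S: "zs_sol z u v f g" "f 0 = 1" "g 0 = 1" "f 1 = g 1" "zs_sol w u v h k" "h 0 = 1" "k 0 = 1" "h 1 = k 1"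
    using s t by (auto simp: dirichlet_solution_def)
  have "((\<lambda>x. \<i> * (w - z) * (f x * k x + g x * h x)) has_integral
        ((f 1 * k 1 - g 1 * h 1) - (f 0 * k 0 - g 0 * h 0))) {0..1}"
    by (rule fundamental_theorem_of_calculus) (use zs_wronskian_deriv[OF S(1,5)] in auto)
  then have "integral {0..1} (\<lambda>x. \<i> * (w - z) * (f x * k x + g x * h x)) = 0"
    using S by (simp only: integral_unique) simp
  then have "integral {0..1} (\<lambda>x. f x * k x + g x * h x) = 0" using zw by (simp only: integral_mult_right) simp
  moreover have "integral {0..1} (\<lambda>x. f x * k x + g x * h x) \<noteq> 0"
  proof (rule integral_nonzero[of _ 2 "3 / 2"])
    show "continuous_on {0..1} (\<lambda>x. f x * k x + g x * h x)" by (intro continuous_intros zs_cont[OF S(1)] zs_cont[OF S(5)])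
    fix x :: real assume x: "x \<in> {0..1}"
    note N = dirichlet_near_n[OF data s n z x] dirichlet_near_n[OF data t n w x]
    have d: "cmod (w - z) \<le> 1 / 32"
      using norm_triangle_ineq4[of "w - of_int n * of_real pi" "z - of_int n * of_real pi"] N(3,6) by simp
    have e: "cmod (cexp (c * (w - z)) x - 1) \<le> 1 / 4" if "cmod c = 1" for c
    proof -
      have "cmod (c * (w - z) * of_real x) = cmod (w - z) * x" using x that by (simp add: norm_mult)
      also have "\<dots> \<le> 1 / 32 * 1" using x d by (intro mult_mono) auto
      finally have b: "cmod (c * (w - z) * of_real x) \<le> 1 / 32" by simp
      then have "cmod (exp (c * (w - z) * of_real x) - 1) \<le> 8 * cmod (c * (w - z) * of_real x)" by (intro exp_near_1) simp
      then show ?thesis using b by (simp add: cexp_def)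
    qed
    have p: "cmod ((cexp (\<i> * z) x * f x) * (cexp (- \<i> * w) x * k x) - 1) \<le> 1 / 4"
      "cmod ((cexp (- \<i> * z) x * g x) * (cexp (\<i> * w) x * h x) - 1) \<le> 1 / 4"
      using near_product[OF N(1,5)] near_product[OF N(2,4)] by auto
    have "cexp (\<i> * (w - z)) x * ((cexp (\<i> * z) x * f x) * (cexp (- \<i> * w) x * k x)) = (cexp (\<i> * (w - z)) x * cexp (\<i> * z) x * cexp (- \<i> * w) x) * (f x * k x)"
      by (simp add: mult_ac)
    also have "\<dots> = f x * k x" by (simp only: cexp_add) (simp add: algebra_simps)
    finally have E1: "cexp (\<i> * (w - z)) x * ((cexp (\<i> * z) x * f x) * (cexp (- \<i> * w) x * k x)) = f x * k x" .
    have 1: "cmod (f x * k x - 1) \<le> 3 / 4" using near_product[OF e[of \<i>] p(1)] unfolding E1 by simp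
    have "cexp (- \<i> * (w - z)) x * ((cexp (- \<i> * z) x * g x) * (cexp (\<i> * w) x * h x)) = (cexp (- \<i> * (w - z)) x * cexp (- \<i> * z) x * cexp (\<i> * w) x) * (g x * h x)"
      by (simp add: mult_ac)
    also have "\<dots> = g x * h x" by (simp only: cexp_add) (simp add: algebra_simps)
    finally have E2: "cexp (- \<i> * (w - z)) x * ((cexp (- \<i> * z) x * g x) * (cexp (\<i> * w) x * h x)) = g x * h x" .
    have 2: "cmod (g x * h x - 1) \<le> 3 / 4" using near_product[OF e[of "- \<i>"] p(2)] unfolding E2 by simp
    show "cmod (f x * k x + g x * h x - 2) \<le> 3 / 2"
      using norm_triangle_ineq[of "f x * k x - 1" "g x * h x - 1"] 1 2 by simp
  qed simp
  ultimately show False by simp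
qed

lemma integral_cong_AE_01:
  fixes f g :: "real \<Rightarrow> 'a::euclidean_space"
  assumes f: "set_integrable lborel {a..b} f" and g: "set_integrable lborel {a..b} g"
    and e: "AE x in lborel. x \<in> {a..b} \<longrightarrow> f x = g x"
  shows "integral {a..b} f = integral {a..b} g"
proof -
  have "(LINT t:{a..b}|lborel. f t) = (LINT t:{a..b}|lborel. g t)"
    unfolding set_lebesgue_integral_def
  proof (rule integral_cong_AE)
    show "AE x in lborel. indicat_real {a..b} x *\<^sub>R f x = indicat_real {a..b} x *\<^sub>R g x"
      using e by eventually_elim (auto simp: indicator_def)
  qed (use f g in \<open>auto simp: set_integrable_def\<close>)
  then show ?thesis using set_borel_integral_eq_integral(2)[OF f] set_borel_integral_eq_integral(2)[OF g] by simp
qed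

lemma weak_deriv_oriented_integral:
  fixes F :: "real \<Rightarrow> 'b::euclidean_space"
  assumes w: "has_weak_deriv_on F F' S" and S: "S = {0..1} \<or> S = UNIV" and x: "x \<in> S"
  shows "F x = F 0 + oriented_integral F' x"
proof -
  have "(LBINT t=0..x. F' t) = oriented_integral F' x"
    by (rule oriented_integral_LBINT[of S]) (use w S x in \<open>auto simp: has_weak_deriv_on_def\<close>)
  then show ?thesis using w x by (auto simp: has_weak_deriv_on_def)
qed

lemma weak_deriv_cont_01:
  fixes F :: "real \<Rightarrow> 'b::euclidean_space"
  assumes w: "has_weak_deriv_on F F' {0..1}" shows "continuous_on {0..1} F"
proof -
  have "F' integrable_on {0..1}"
    using w by (intro set_borel_integral_eq_integral) (auto simp: has_weak_deriv_on_def)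
  then have "continuous_on {0..1} (\<lambda>x. F 0 + integral {0..x} F')"
    by (intro continuous_intros indefinite_integral_continuous_1)
  then show ?thesis
  proof (rule continuous_on_eq)
    fix x :: real assume x: "x \<in> {0..1}"
    show "F 0 + integral {0..x} F' = F x" using weak_deriv_oriented_integral[OF w _ x] x by (simp add: oriented_integral_nonneg)
  qed
qed

lemma weak_deriv_cont_UNIV:
  fixes F :: "real \<Rightarrow> 'b::euclidean_space"
  assumes w: "has_weak_deriv_on F F' UNIV" shows "continuous_on UNIV F"
proof -
  have "F' integrable_on {-b..b}" for b
    using w by (intro set_borel_integral_eq_integral) (auto simp: has_weak_deriv_on_def)
  then have "continuous_on UNIV (\<lambda>x. F 0 + oriented_integral F' x)" by (intro continuous_intros oriented_integral_cont)
  then show ?thesis by (rule continuous_on_eq) (rule weak_deriv_oriented_integral[OF w, symmetric], auto)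
qed

text \<open>With a continuous potential the differential equation makes weak derivatives continuous, and so the solutions are classical.\<close>

lemma weak_classical_01:
  fixes F :: "real \<Rightarrow> 'b::euclidean_space"
  assumes w: "has_weak_deriv_on F F' {0..1}" and r: "continuous_on {0..1} r"
    and e: "AE x in lborel. x \<in> {0..1} \<longrightarrow> F' x = r x" and x: "x \<in> {0..1}"
  shows "(F has_vector_derivative r x) (at x within {0..1})"
proof -
  have FE: "F y = F 0 + integral {0..y} r" if y: "y \<in> {0..1}" for y
  proof -
    have "set_integrable lborel {0..y} F'" using w y by (auto simp: has_weak_deriv_on_def)
    moreover have "set_integrable lborel {0..y} r"
      by (rule borel_integrable_atLeastAtMost') (use y in \<open>auto intro: continuous_on_subset[OF r]\<close>)
    ultimately have "integral {0..y} F' = integral {0..y} r"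
      by (rule integral_cong_AE_01) (use e y in \<open>auto elim!: eventually_mono\<close>)
    then show ?thesis using weak_deriv_oriented_integral[OF w _ y] y by (simp add: oriented_integral_nonneg)
  qed
  have D: "((\<lambda>y. F 0 + integral {0..y} r) has_vector_derivative 0 + r x) (at x within {0..1})"
    by (intro has_vector_derivative_add has_vector_derivative_const integral_has_vector_derivative r x)
  show ?thesis
    using has_vector_derivative_transform[OF x FE D] by (simp only: add_0_left)
qed

lemma weak_classical_UNIV:
  fixes F :: "real \<Rightarrow> 'b::euclidean_space"
  assumes w: "has_weak_deriv_on F F' UNIV" and r: "continuous_on UNIV r"
    and e: "AE x in lborel. F' x = r x"
  shows "(F has_vector_derivative r x) (at x)"
proof -
  have "integral {a..b} F' = integral {a..b} r" for a b
    by (rule integral_cong_AE_01)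
      (use w e r in \<open>auto simp: has_weak_deriv_on_def elim!: eventually_mono intro!: borel_integrable_atLeastAtMost' continuous_on_subset[OF r]\<close>)
  then have "oriented_integral F' y = oriented_integral r y" for y by (simp add: oriented_integral_def)
  then have "F y = F 0 + oriented_integral r y" for y
    using weak_deriv_oriented_integral[OF w, of y] by (metis UNIV_I)
  then have F: "(\<lambda>y. F 0 + oriented_integral r y) = F" by (intro ext) (rule sym)
  have "((\<lambda>y. F 0 + oriented_integral r y) has_vector_derivative 0 + r x) (at x)"
    by (intro has_vector_derivative_add has_vector_derivative_const oriented_integral_deriv r)
  then show ?thesis unfolding F by simp
qed

lemma classical_weak:
  fixes F :: "real \<Rightarrow> 'b::euclidean_space"
  assumes S: "S = {0..1} \<or> S = UNIV" and d: "\<And>x. x \<in> S \<Longrightarrow> (F has_vector_derivative F' x) (at x within S)" and c: "continuous_on S F'"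
  shows "has_weak_deriv_on F F' S"
proof -
  have si: "set_integrable lborel {a..b} F'" if "{a..b} \<subseteq> S" for a b
    by (rule borel_integrable_atLeastAtMost'[OF continuous_on_subset[OF c that]])
  have "F x = F 0 + (LBINT t=0..x. F' t)" if x: "x \<in> S" for x
  proof -
    have 1: "(LBINT t=0..x. F' t) = oriented_integral F' x"
      by (rule oriented_integral_LBINT[of S, OF si]) (use S x in auto)
    show ?thesis
    proof (cases "0 \<le> x")
      case True
      have "(F' has_integral (F x - F 0)) {0..x}"
        by (rule fundamental_theorem_of_calculus[OF True])
          (use S x in \<open>auto intro!: has_vector_derivative_within_subset[OF d]\<close>)
      then show ?thesis using 1 True by (simp add: oriented_integral_nonneg integral_unique)
    next
      case False
      then have U: "S = UNIV" and le: "x \<le> 0" using S x by auto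
      have "(F' has_integral (F 0 - F x)) {x..0}"
        by (rule fundamental_theorem_of_calculus[OF le])
          (use U in \<open>auto intro!: has_vector_derivative_within_subset[OF d]\<close>)
      then show ?thesis using 1 le by (simp add: oriented_integral_nonpos integral_unique)
    qed
  qed
  then show ?thesis using si by (auto simp: has_weak_deriv_on_def)
qed

section \<open>The Dirichlet operator and the fundamental matrix\<close>

definition pot_u :: "potential \<Rightarrow> real \<Rightarrow> complex" where "pot_u \<phi> x = \<i> * fst \<phi> x"
definition pot_v :: "potential \<Rightarrow> real \<Rightarrow> complex" where "pot_v \<phi> x = - \<i> * snd \<phi> x"

definition continuous_potential :: "potential \<Rightarrow> bool" where
  "continuous_potential \<phi> \<longleftrightarrow> continuous_on UNIV (fst \<phi>) \<and> continuous_on UNIV (snd \<phi>) \<and>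
     (\<exists>U. \<forall>x. cmod (fst \<phi> x) \<le> U \<and> cmod (snd \<phi> x) \<le> U)"

lemma continuous_potential_bound:
  assumes "continuous_potential \<phi>"
  obtains U where "continuous_on UNIV (pot_u \<phi>)" "\<And>x. cmod (pot_u \<phi> x) \<le> U" "continuous_on UNIV (pot_v \<phi>)" "\<And>x. cmod (pot_v \<phi> x) \<le> U"
proof -
  from assms obtain U where U: "continuous_on UNIV (fst \<phi>)" "continuous_on UNIV (snd \<phi>)"
    "\<And>x. cmod (fst \<phi> x) \<le> U \<and> cmod (snd \<phi> x) \<le> U" unfolding continuous_potential_def by blast
  show thesis
    by (rule that[of U]; use U in \<open>simp add: pot_u_def[abs_def] pot_v_def[abs_def] norm_mult continuous_on_mult_left continuous_on_minus\<close>)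
qed

lemma bounded_linear_vec2: "bounded_linear (\<lambda>p::complex \<times> complex. vector [fst p, snd p] :: complex^2)"
  unfolding linear_conv_bounded_linear[symmetric]
  by (rule linearI) (simp_all add: vec_eq_iff forall_2)

lemma vec2_deriv:
  assumes "(f has_vector_derivative f') (at x within S)" "(g has_vector_derivative g') (at x within S)"
  shows "((\<lambda>x. vector [f x, g x] :: complex^2) has_vector_derivative vector [f', g']) (at x within S)"
proof -
  have "((\<lambda>x. (f x, g x)) has_vector_derivative (f', g')) (at x within S)"
    by (rule has_vector_derivative_Pair[OF assms])
  from bounded_linear.has_vector_derivative[OF bounded_linear_vec2 this] show ?thesis by simp
qed

lemma vec2_cont:
  assumes "continuous_on S f" "continuous_on S g"
  shows "continuous_on S (\<lambda>x. vector [f x, g x] :: complex^2)"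
  using bounded_linear.continuous_on[OF bounded_linear_vec2 continuous_on_Pair[OF assms]] by simp

lemma solve_i: "c = \<i> * y + d \<Longrightarrow> y = - \<i> * (c - d)"
  by (simp add: mult.assoc[symmetric])

text \<open>The first two components of \<open>(L(\<phi>) - z) F = G\<close>, solved for the derivatives.\<close>

lemma shift_solution:
  assumes \<phi>: "continuous_potential \<phi>" and sh: "dirichlet_shift \<phi> z F G" and G: "continuous_on {0..1} G"
  shows "\<And>x. x \<in> {0..1} \<Longrightarrow> ((\<lambda>x. F x $ 1) has_vector_derivative (- \<i> * z * F x $ 1 + pot_u \<phi> x * F x $ 2 - \<i> * G x $ 1)) (at x within {0..1})"
    "\<And>x. x \<in> {0..1} \<Longrightarrow> ((\<lambda>x. F x $ 2) has_vector_derivative (\<i> * z * F x $ 2 + pot_v \<phi> x * F x $ 1 + \<i> * G x $ 2)) (at x within {0..1})"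
    "F 0 $ 1 = F 0 $ 2" "F 1 $ 1 = F 1 $ 2" "\<And>x. x \<notin> {0..1} \<Longrightarrow> F x = 0" "continuous_on {0..1} F"
proof -
  obtain F' where F': "has_weak_deriv_on F F' {0..1}" and dom: "F \<in> dirichlet_dom"
    and ae: "AE x in lborel. x \<in> {0..1} \<longrightarrow> z *s F x + G x = ZS_sigma *v F' x + ZS_pot \<phi> x *v F x"
    using sh unfolding dirichlet_shift_def dirichlet_graph_def by blast
  show Fc: "continuous_on {0..1} F" by (rule weak_deriv_cont_01[OF F'])
  obtain U where "continuous_on UNIV (pot_u \<phi>)" "continuous_on UNIV (pot_v \<phi>)" using continuous_potential_bound[OF \<phi>] by blast
  then have c: "continuous_on {0..1} (pot_u \<phi>)" "continuous_on {0..1} (pot_v \<phi>)" by (auto intro: continuous_on_subset)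
  define r :: "real \<Rightarrow> complex^2" where
    "r = (\<lambda>x. vector [- \<i> * z * F x $ 1 + pot_u \<phi> x * F x $ 2 - \<i> * G x $ 1, \<i> * z * F x $ 2 + pot_v \<phi> x * F x $ 1 + \<i> * G x $ 2])"
  have rc: "continuous_on {0..1} r" unfolding r_def
    by (intro vec2_cont continuous_intros c Fc G)
  have "AE x in lborel. x \<in> {0..1} \<longrightarrow> F' x = r x"
    using ae
  proof eventually_elim
    case (elim x)
    show ?case
    proof
      assume "x \<in> {0..1}"
      then have e: "z *s F x + G x = ZS_sigma *v F' x + ZS_pot \<phi> x *v F x" using elim by blast
      have "(z *s F x + G x) $ 1 = \<i> * F' x $ 1 + fst \<phi> x * F x $ 2"
        unfolding e by (simp add: matrix_vector_mult_def sum_2 ZS_sigma_def ZS_pot_def)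
      then have 1: "F' x $ 1 = - \<i> * ((z *s F x + G x) $ 1 - fst \<phi> x * F x $ 2)" by (rule solve_i)
      have "(z *s F x + G x) $ 2 = \<i> * (- F' x $ 2) + snd \<phi> x * F x $ 1"
        unfolding e by (simp add: matrix_vector_mult_def sum_2 ZS_sigma_def ZS_pot_def)
      then have 2: "- F' x $ 2 = - \<i> * ((z *s F x + G x) $ 2 - snd \<phi> x * F x $ 1)" by (rule solve_i)
      show "F' x = r x"
        using 1 2 by (simp add: vec_eq_iff forall_2 r_def pot_u_def pot_v_def algebra_simps)
    qed
  qed
  then have D: "(F has_vector_derivative r x) (at x within {0..1})" if "x \<in> {0..1}" for x
    by (rule weak_classical_01[OF F' rc _ that])
  show "((\<lambda>x. F x $ 1) has_vector_derivative (- \<i> * z * F x $ 1 + pot_u \<phi> x * F x $ 2 - \<i> * G x $ 1)) (at x within {0..1})" if "x \<in> {0..1}" for x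
    using bounded_linear.has_vector_derivative[OF bounded_linear_vec_nth D[OF that], of 1] by (simp add: r_def)
  show "((\<lambda>x. F x $ 2) has_vector_derivative (\<i> * z * F x $ 2 + pot_v \<phi> x * F x $ 1 + \<i> * G x $ 2)) (at x within {0..1})" if "x \<in> {0..1}" for x
    using bounded_linear.has_vector_derivative[OF bounded_linear_vec_nth D[OF that], of 2] by (simp add: r_def)
  show "F 0 $ 1 = F 0 $ 2" "F 1 $ 1 = F 1 $ 2" "\<And>x. x \<notin> {0..1} \<Longrightarrow> F x = 0" using dom by (auto simp: dirichlet_dom_def)
qed

definition extend_by_zero :: "(real \<Rightarrow> complex) \<Rightarrow> (real \<Rightarrow> complex) \<Rightarrow> real \<Rightarrow> complex^2" where
  "extend_by_zero f g x = (if x \<in> {0..1} then vector [f x, g x] else 0)"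

lemma L2_on_cont:
  fixes h :: "real \<Rightarrow> 'b::euclidean_space"
  assumes "continuous_on {0..1} h" shows "L2_on {0..1} h"
  unfolding L2_on_def
  by (intro conjI set_meas set_integrable_cont continuous_intros assms)

lemma solution_shift:
  assumes \<phi>: "continuous_potential \<phi>" and s: "zs_sol z (pot_u \<phi>) (pot_v \<phi>) f g" and b: "f 0 = g 0" "f 1 = g 1"
  shows "dirichlet_shift \<phi> z (extend_by_zero f g) (\<lambda>x. 0)"
proof -
  obtain U where "continuous_on UNIV (pot_u \<phi>)" "continuous_on UNIV (pot_v \<phi>)" using continuous_potential_bound[OF \<phi>] by blast
  then have c: "continuous_on {0..1} (pot_u \<phi>)" "continuous_on {0..1} (pot_v \<phi>)" by (auto intro: continuous_on_subset)
  note fg = zs_cont[OF s]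
  define F' :: "real \<Rightarrow> complex^2" where "F' = (\<lambda>x. vector [- \<i> * z * f x + pot_u \<phi> x * g x, \<i> * z * g x + pot_v \<phi> x * f x])"
  have F'c: "continuous_on {0..1} F'" unfolding F'_def by (intro vec2_cont continuous_intros c fg)
  have d: "(extend_by_zero f g has_vector_derivative F' x) (at x within {0..1})" if x: "x \<in> {0..1}" for x
  proof -
    have "((\<lambda>x. vector [f x, g x] :: complex^2) has_vector_derivative F' x) (at x within {0..1})"
      unfolding F'_def using s x by (intro vec2_deriv) (auto simp: zs_on_def)
    then show ?thesis by (rule has_vector_derivative_transform[OF x, rotated]) (simp add: extend_by_zero_def)
  qed
  have w: "has_weak_deriv_on (extend_by_zero f g) F' {0..1}"
    by (rule classical_weak[OF _ d F'c]) auto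
  have L: "L2_on {0..1} F'" by (rule L2_on_cont[OF F'c])
  have ae: "AE x in lborel. x \<in> {0..1} \<longrightarrow> z *s extend_by_zero f g x + 0 = ZS_sigma *v F' x + ZS_pot \<phi> x *v extend_by_zero f g x"
    by (rule AE_I2) (simp add: extend_by_zero_def F'_def vec_eq_iff forall_2 matrix_vector_mult_def sum_2 ZS_sigma_def ZS_pot_def pot_u_def pot_v_def algebra_simps)
  have "extend_by_zero f g \<in> dirichlet_dom"
    unfolding dirichlet_dom_def using L w b by (auto simp: extend_by_zero_def)
  then show ?thesis unfolding dirichlet_shift_def dirichlet_graph_def using L w ae by auto
qed

lemma zs_scale: "zs_on S z u v f g \<Longrightarrow> zs_on S z u v (\<lambda>x. c * f x) (\<lambda>x. c * g x)"
  using zs_on_combine[of S z u v f g f g c 0] by simp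

lemma kernel_solution:
  assumes \<phi>: "continuous_potential \<phi>" and sh: "dirichlet_shift \<phi> z F (\<lambda>x. 0)"
  shows "zs_sol z (pot_u \<phi>) (pot_v \<phi>) (\<lambda>x. F x $ 1) (\<lambda>x. F x $ 2)"
  using shift_solution(1,2)[OF \<phi> sh] by (simp add: zs_on_def)

lemma kernel_unique:
  assumes \<phi>: "continuous_potential \<phi>" and sh: "dirichlet_shift \<phi> z F (\<lambda>x. 0)"
    and s: "zs_sol z (pot_u \<phi>) (pot_v \<phi>) f g" "f 0 = F 0 $ 1" "g 0 = F 0 $ 1"
  shows "F = extend_by_zero f g"
proof
  fix x
  obtain U where U: "continuous_on UNIV (pot_u \<phi>)" "\<And>x. cmod (pot_u \<phi> x) \<le> U" "continuous_on UNIV (pot_v \<phi>)" "\<And>x. cmod (pot_v \<phi> x) \<le> U"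
    using continuous_potential_bound[OF \<phi>] by blast
  note S = shift_solution(3,5)[OF \<phi> sh, OF continuous_on_const]
  show "F x = extend_by_zero f g x"
  proof (cases "x \<in> {0..1}")
    case True
    have i: "F 0 $ 1 = f 0" "F 0 $ 2 = g 0" using s(2,3) S(1) by metis+
    have z: "(0::real) \<in> {0..1}" by simp
    have "F x $ 1 = f x" "F x $ 2 = g x"
      by (rule zs_unique[OF U kernel_solution[OF \<phi> sh] s(1) i convex_real_interval(5) z True])+
    then show ?thesis using True by (simp add: extend_by_zero_def vec_eq_iff forall_2)
  next
    case False
    then have "extend_by_zero f g x = 0" by (simp only: extend_by_zero_def if_False)
    then show ?thesis using S(2)[OF False] by simp
  qed
qed

text \<open>If the kernel of \<open>L(\<phi>) - z\<close> is trivial, so are the kernels of all powers.\<close>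

lemma no_eigenfunction_mult:
  assumes \<phi>: "continuous_potential \<phi>" and ne: "\<And>f g. \<not> dirichlet_solution z (pot_u \<phi>) (pot_v \<phi>) f g"
  shows "dirichlet_mult \<phi> z = 0"
proof -
  interpret cs: vector_space cscale by (rule vector_space_cscale)
  have k0: "F = (0 :: real \<Rightarrow> complex^2)" if sh: "dirichlet_shift \<phi> z F (\<lambda>x. 0)" for F
  proof -
    note S = shift_solution(3,4,5)[OF \<phi> sh continuous_on_const]
    have F: "zs_sol z (pot_u \<phi>) (pot_v \<phi>) (\<lambda>x. F x $ 1) (\<lambda>x. F x $ 2)" by (rule kernel_solution[OF \<phi> sh])
    have F0: "F 0 $ 1 = 0"
    proof (rule ccontr)
      assume nz: "F 0 $ 1 \<noteq> 0"
      define c where "c = 1 / F 0 $ 1"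
      have c: "c * F 0 $ 1 = 1" using nz by (simp add: c_def)
      have "dirichlet_solution z (pot_u \<phi>) (pot_v \<phi>) (\<lambda>x. c * F x $ 1) (\<lambda>x. c * F x $ 2)"
        unfolding dirichlet_solution_def using zs_scale[OF F, of c] c S(1,2) by simp
      then show False using ne by blast
    qed
    have "zs_sol z (pot_u \<phi>) (pot_v \<phi>) (\<lambda>x. 0) (\<lambda>x. 0)" by (auto simp: zs_on_def)
    from kernel_unique[OF \<phi> sh this] F0 have "F = extend_by_zero (\<lambda>x. 0) (\<lambda>x. 0)" by simp
    moreover have "extend_by_zero (\<lambda>x. 0) (\<lambda>x. 0) = (0 :: real \<Rightarrow> complex^2)"
      by (rule ext) (simp add: extend_by_zero_def vec_eq_iff forall_2)
    ultimately show ?thesis by simp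
  qed
  have "dirichlet_ker \<phi> z k \<subseteq> {0}" for k
  proof (induction k)
    case (Suc k)
    show ?case
    proof
      fix F assume "F \<in> dirichlet_ker \<phi> z (Suc k)"
      then obtain G where "G \<in> dirichlet_ker \<phi> z k" "dirichlet_shift \<phi> z F G" by auto
      then have "dirichlet_shift \<phi> z F (\<lambda>x. 0)" using Suc by (auto simp: zero_fun_def cong: if_cong)
      then have "F = 0" by (rule k0)
      then show "F \<in> {0}" by (simp only: singleton_iff)
    qed
  next
    case 0
    show ?case by (simp only: dirichlet_ker.simps order_refl)
  qed
  then have "(\<Union>k. dirichlet_ker \<phi> z k) \<subseteq> {0}" by blast
  moreover have "0 \<in> (\<Union>k. dirichlet_ker \<phi> z k)" using dirichlet_ker.simps(1) by blast
  ultimately have "(\<Union>k. dirichlet_ker \<phi> z k) = {0}" by blast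
  moreover have "cs.dim {0} = 0" using cs.dim_le_card[of "{0}" "{}"] by (simp add: cs.span_empty)
  ultimately show ?thesis unfolding dirichlet_mult_def by (simp only:)
qed

text \<open>Let \<open>(L(\<phi>) - z) F = c (f, g)\<close>. The Wronskian of \<open>F\<close> and \<open>(f, g)\<close> has derivative \<open>- 2 \<i> c f g\<close> and vanishes at both ends, hence \<open>c = 0\<close> and
the generalised eigenspace does not grow.\<close>

lemma simple_mult:
  assumes \<phi>: "continuous_potential \<phi>" and s: "dirichlet_solution z (pot_u \<phi>) (pot_v \<phi>) f g" and ne: "integral {0..1} (\<lambda>x. f x * g x) \<noteq> 0"
  shows "dirichlet_mult \<phi> z \<le> 1"
proof -
  interpret cs: vector_space cscale by (rule vector_space_cscale)
  have sol: "zs_sol z (pot_u \<phi>) (pot_v \<phi>) f g" "f 0 = 1" "g 0 = 1" "f 1 = g 1" using s by (auto simp: dirichlet_solution_def)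
  have extend_by_zero_scale: "cscale c (extend_by_zero f g) = extend_by_zero (\<lambda>x. c * f x) (\<lambda>x. c * g x)" for c
    by (auto simp: cscale_def extend_by_zero_def fun_eq_iff vec_eq_iff forall_2)
  have ker: "dirichlet_ker \<phi> z k \<subseteq> range (\<lambda>c. cscale c (extend_by_zero f g))" for k
  proof (induction k)
    case 0
    have "(0 :: real \<Rightarrow> complex^2) = cscale 0 (extend_by_zero f g)" by (rule cs.scale_zero_left[symmetric])
    then show ?case unfolding dirichlet_ker.simps by blast
  next
    case (Suc k)
    show ?case
    proof
      fix F assume "F \<in> dirichlet_ker \<phi> z (Suc k)"
      then obtain G where G: "G \<in> dirichlet_ker \<phi> z k" "dirichlet_shift \<phi> z F G" by auto
      then obtain c where c: "G = cscale c (extend_by_zero f g)" using Suc by blast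
      have Gx: "G x $ 1 = c * f x" "G x $ 2 = c * g x" if "x \<in> {0..1}" for x
        using that by (auto simp: c cscale_def extend_by_zero_def)
      have Gc: "continuous_on {0..1} G"
      proof (rule continuous_on_eq)
        show "continuous_on {0..1} (\<lambda>x. vector [c * f x, c * g x] :: complex^2)"
          by (intro vec2_cont continuous_intros zs_cont[OF sol(1)])
      qed (simp add: vec_eq_iff forall_2 Gx)
      note S = shift_solution[OF \<phi> G(2) Gc]
      have "((\<lambda>x. (- 2 * \<i> * c) * (f x * g x)) has_integral
          ((F 1 $ 1 * g 1 - F 1 $ 2 * f 1) - (F 0 $ 1 * g 0 - F 0 $ 2 * f 0))) {0..1}"
      proof (rule fundamental_theorem_of_calculus)
        fix x :: real assume x: "x \<in> {0..1}"
        have d: "(f has_vector_derivative (- \<i> * z * f x + pot_u \<phi> x * g x)) (at x within {0..1})"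
          "(g has_vector_derivative (\<i> * z * g x + pot_v \<phi> x * f x)) (at x within {0..1})"
          using sol(1) x by (auto simp: zs_on_def)
        have "((\<lambda>x. F x $ 1 * g x - F x $ 2 * f x) has_vector_derivative
          ((F x $ 1 * (\<i> * z * g x + pot_v \<phi> x * f x) + (- \<i> * z * F x $ 1 + pot_u \<phi> x * F x $ 2 - \<i> * G x $ 1) * g x)
          - (F x $ 2 * (- \<i> * z * f x + pot_u \<phi> x * g x) + (\<i> * z * F x $ 2 + pot_v \<phi> x * F x $ 1 + \<i> * G x $ 2) * f x))) (at x within {0..1})"
          by (intro has_vector_derivative_diff has_vector_derivative_mult S(1,2) d x)
        then show "((\<lambda>x. F x $ 1 * g x - F x $ 2 * f x) has_vector_derivative (- 2 * \<i> * c) * (f x * g x)) (at x within {0..1})"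
          by (rule back_subst) (simp add: Gx[OF x] algebra_simps)
      qed simp
      then have "integral {0..1} (\<lambda>x. (- 2 * \<i> * c) * (f x * g x)) = 0"
        using S(3,4) sol by (simp only: integral_unique) simp
      then have c0: "c = 0" using ne by (simp only: integral_mult_right) simp
      then have "G = (\<lambda>x. 0)" by (simp add: c cscale_def)
      then have sh: "dirichlet_shift \<phi> z F (\<lambda>x. 0)" using G by simp
      have "F = extend_by_zero (\<lambda>x. F 0 $ 1 * f x) (\<lambda>x. F 0 $ 1 * g x)"
        by (rule kernel_unique[OF \<phi> sh zs_scale[OF sol(1)]]) (simp_all add: sol)
      then show "F \<in> range (\<lambda>c. cscale c (extend_by_zero f g))" unfolding extend_by_zero_scale by blast
    qed
  qed
  have "(\<Union>k. dirichlet_ker \<phi> z k) \<subseteq> cs.span {extend_by_zero f g}"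
    using ker by (fastforce intro: cs.span_scale cs.span_base)
  then have "cs.dim (\<Union>k. dirichlet_ker \<phi> z k) \<le> card {extend_by_zero f g}" by (rule cs.dim_le_card) simp
  then show ?thesis by (simp add: dirichlet_mult_def)
qed

lemma eigenfunction_spectrum:
  assumes \<phi>: "continuous_potential \<phi>" and s: "dirichlet_solution z (pot_u \<phi>) (pot_v \<phi>) f g"
  shows "z \<in> dirichlet_spectrum \<phi>"
proof (rule ccontr)
  assume "z \<notin> dirichlet_spectrum \<phi>"
  then have "z \<in> dirichlet_resolvent_set \<phi>" by (simp add: dirichlet_spectrum_def)
  moreover have "L2_on {0..1} (\<lambda>x. 0 :: complex^2)" by (rule L2_on_cont) simp
  ultimately have "\<exists>!F. dirichlet_shift \<phi> z F (\<lambda>x. 0)" unfolding dirichlet_resolvent_set_def by blast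
  moreover have "dirichlet_shift \<phi> z (extend_by_zero f g) (\<lambda>x. 0)"
    using s by (intro solution_shift[OF \<phi>]) (auto simp: dirichlet_solution_def)
  moreover have "dirichlet_shift \<phi> z (extend_by_zero (\<lambda>x. 0) (\<lambda>x. 0)) (\<lambda>x. 0)"
    by (intro solution_shift[OF \<phi>]) (auto simp: zs_on_def)
  ultimately have "extend_by_zero f g = extend_by_zero (\<lambda>x. 0) (\<lambda>x. 0)" by blast
  then have "extend_by_zero f g 0 $ 1 = extend_by_zero (\<lambda>x. 0) (\<lambda>x. 0) 0 $ 1" by simp
  then show False using s by (simp add: extend_by_zero_def dirichlet_solution_def)
qed

text \<open>The weak solution that defines the fundamental matrix exists and is unique, because it is the classical one.\<close>

lemma ZS_fund_entries:
  assumes \<phi>: "continuous_potential \<phi>"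
    and p: "zs_on UNIV z (pot_u \<phi>) (pot_v \<phi>) p q" "p 0 = 1" "q 0 = 0" and r: "zs_on UNIV z (pot_u \<phi>) (pot_v \<phi>) r s" "r 0 = 0" "s 0 = 1"
  shows "ZS_fund \<phi> z x $ 1 $ 1 = p x" "ZS_fund \<phi> z x $ 2 $ 1 = q x" "ZS_fund \<phi> z x $ 1 $ 2 = r x" "ZS_fund \<phi> z x $ 2 $ 2 = s x"
proof -
  obtain U where U: "continuous_on UNIV (pot_u \<phi>)" "\<And>x. cmod (pot_u \<phi> x) \<le> U" "continuous_on UNIV (pot_v \<phi>)" "\<And>x. cmod (pot_v \<phi> x) \<le> U"
    using continuous_potential_bound[OF \<phi>] by blast
  have bl: "bounded_linear (\<lambda>(P::(complex^2) \<times> (complex^2)). vector [fst P, snd P] :: complex^2^2)"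
    unfolding linear_conv_bounded_linear[symmetric] by (rule linearI) (simp_all add: vec_eq_iff forall_2)
  define MK :: "complex \<Rightarrow> complex \<Rightarrow> complex \<Rightarrow> complex \<Rightarrow> complex^2^2" where
    "MK = (\<lambda>a b c d. vector [vector [a, b], vector [c, d]])"
  have MKd: "((\<lambda>x. MK (a x) (b x) (c x) (d x)) has_vector_derivative MK a' b' c' d') (at x)"
    if "(a has_vector_derivative a') (at x)" "(b has_vector_derivative b') (at x)" "(c has_vector_derivative c') (at x)" "(d has_vector_derivative d') (at x)"
    for a b c d a' b' c' d' and x :: real
  proof -
    have "((\<lambda>x. (vector [a x, b x], vector [c x, d x]) :: (complex^2) \<times> (complex^2)) has_vector_derivative (vector [a', b'], vector [c', d'])) (at x)"
      by (intro has_vector_derivative_Pair vec2_deriv that)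
    from bounded_linear.has_vector_derivative[OF bl this] show ?thesis by (simp add: MK_def)
  qed
  have MKc: "continuous_on UNIV (\<lambda>x. MK (a x) (b x) (c x) (d x))"
    if "continuous_on UNIV a" "continuous_on UNIV b" "continuous_on UNIV c" "continuous_on UNIV d" for a b c d :: "real \<Rightarrow> complex"
    using bounded_linear.continuous_on[OF bl continuous_on_Pair[OF vec2_cont[OF that(1,2)] vec2_cont[OF that(3,4)]]] by (simp add: MK_def)
  have MKn: "MK a b c d $ 1 $ 1 = a" "MK a b c d $ 1 $ 2 = b" "MK a b c d $ 2 $ 1 = c" "MK a b c d $ 2 $ 2 = d" for a b c d
    by (simp_all add: MK_def)
  define M where "M = (\<lambda>x. MK (p x) (r x) (q x) (s x))"
  define M' where "M' = (\<lambda>x. MK (- \<i> * z * p x + pot_u \<phi> x * q x) (- \<i> * z * r x + pot_u \<phi> x * s x) (\<i> * z * q x + pot_v \<phi> x * p x) (\<i> * z * s x + pot_v \<phi> x * r x))"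
  have "ZS_fund \<phi> z = M"
    unfolding ZS_fund_def
  proof (rule the_equality)
    have "M 0 = mat 1" using p r by (simp add: M_def vec_eq_iff forall_2 MKn mat_def)
    moreover have "has_weak_deriv_on M M' UNIV"
    proof (rule classical_weak)
      show "(M has_vector_derivative M' x) (at x)" for x
        unfolding M_def M'_def using p(1) r(1) by (intro MKd) (auto simp: zs_on_def)
      show "continuous_on UNIV M'" unfolding M'_def
        by (intro MKc continuous_intros U zs_cont[OF p(1)] zs_cont[OF r(1)])
    qed simp
    moreover have "AE x in lborel. ZS_sigma ** M' x + ZS_pot \<phi> x ** M x = mat z ** M x"
      by (rule AE_I2) (simp add: M_def M'_def vec_eq_iff forall_2 MKn matrix_matrix_mult_def sum_2 ZS_sigma_def ZS_pot_def mat_def pot_u_def pot_v_def algebra_simps)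
    ultimately show "M 0 = mat 1 \<and> (\<exists>M'. has_weak_deriv_on M M' UNIV \<and> (AE x in lborel. ZS_sigma ** M' x + ZS_pot \<phi> x ** M x = mat z ** M x))"
      by blast
  next
    fix P assume P: "P 0 = mat 1 \<and> (\<exists>M'. has_weak_deriv_on P M' UNIV \<and> (AE x in lborel. ZS_sigma ** M' x + ZS_pot \<phi> x ** P x = mat z ** P x))"
    then obtain P' where P': "has_weak_deriv_on P P' UNIV" and ae: "AE x in lborel. ZS_sigma ** P' x + ZS_pot \<phi> x ** P x = mat z ** P x" by blast
    have Pc: "continuous_on UNIV P" by (rule weak_deriv_cont_UNIV[OF P'])
    define R where "R = (\<lambda>x. MK (- \<i> * z * P x $ 1 $ 1 + pot_u \<phi> x * P x $ 2 $ 1) (- \<i> * z * P x $ 1 $ 2 + pot_u \<phi> x * P x $ 2 $ 2)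
        (\<i> * z * P x $ 2 $ 1 + pot_v \<phi> x * P x $ 1 $ 1) (\<i> * z * P x $ 2 $ 2 + pot_v \<phi> x * P x $ 1 $ 2))"
    have Rc: "continuous_on UNIV R" unfolding R_def by (intro MKc continuous_intros U Pc)
    have "AE x in lborel. P' x = R x"
      using ae
    proof eventually_elim
      case (elim x)
      have 1: "P' x $ 1 $ j = - \<i> * (z * P x $ 1 $ j - fst \<phi> x * P x $ 2 $ j)" for j
      proof (rule solve_i)
        have "(mat z ** P x) $ 1 $ j = \<i> * P' x $ 1 $ j + fst \<phi> x * P x $ 2 $ j"
          unfolding elim[symmetric] by (simp add: matrix_matrix_mult_def sum_2 ZS_sigma_def ZS_pot_def)
        then show "z * P x $ 1 $ j = \<i> * P' x $ 1 $ j + fst \<phi> x * P x $ 2 $ j"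
          by (simp add: matrix_matrix_mult_def sum_2 mat_def)
      qed
      have 2: "- P' x $ 2 $ j = - \<i> * (z * P x $ 2 $ j - snd \<phi> x * P x $ 1 $ j)" for j
      proof (rule solve_i)
        have "(mat z ** P x) $ 2 $ j = \<i> * (- P' x $ 2 $ j) + snd \<phi> x * P x $ 1 $ j"
          unfolding elim[symmetric] by (simp add: matrix_matrix_mult_def sum_2 ZS_sigma_def ZS_pot_def)
        then show "z * P x $ 2 $ j = \<i> * (- P' x $ 2 $ j) + snd \<phi> x * P x $ 1 $ j"
          by (simp add: matrix_matrix_mult_def sum_2 mat_def)
      qed
      show ?case using 1 2[of 1] 2[of 2]
        by (simp add: vec_eq_iff forall_2 R_def MKn pot_u_def pot_v_def algebra_simps)
    qed
    from weak_classical_UNIV[OF P' Rc this] have D: "(P has_vector_derivative R x) (at x)" for x .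
    have Dij: "((\<lambda>x. P x $ i $ j) has_vector_derivative R x $ i $ j) (at x)" for x i j
      using bounded_linear.has_vector_derivative[OF bounded_linear_compose[OF bounded_linear_vec_nth bounded_linear_vec_nth] D] .
    have c1: "zs_on UNIV z (pot_u \<phi>) (pot_v \<phi>) (\<lambda>x. P x $ 1 $ 1) (\<lambda>x. P x $ 2 $ 1)"
      and c2: "zs_on UNIV z (pot_u \<phi>) (pot_v \<phi>) (\<lambda>x. P x $ 1 $ 2) (\<lambda>x. P x $ 2 $ 2)"
      unfolding zs_on_def using Dij[of 1 1] Dij[of 2 1] Dij[of 1 2] Dij[of 2 2] by (simp_all add: R_def MKn)
    have P0: "P 0 $ 1 $ 1 = 1" "P 0 $ 2 $ 1 = 0" "P 0 $ 1 $ 2 = 0" "P 0 $ 2 $ 2 = 1" using P by (simp_all add: mat_def)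
    show "P = M"
    proof
      fix x
      have "P x $ 1 $ 1 = p x" "P x $ 2 $ 1 = q x" "P x $ 1 $ 2 = r x" "P x $ 2 $ 2 = s x"
        using zs_unique[OF U c1 p(1) _ _ convex_UNIV UNIV_I UNIV_I] zs_unique[OF U c2 r(1) _ _ convex_UNIV UNIV_I UNIV_I] P0 p r by auto
      then show "P x = M x" by (simp add: M_def vec_eq_iff forall_2 MKn)
    qed
  qed
  then show "ZS_fund \<phi> z x $ 1 $ 1 = p x" "ZS_fund \<phi> z x $ 2 $ 1 = q x" "ZS_fund \<phi> z x $ 1 $ 2 = r x" "ZS_fund \<phi> z x $ 2 $ 2 = s x"
    by (simp_all add: M_def MKn)
qed

text \<open>With \<open>\<kappa> = f(1)\<close> the Dirichlet condition says that both rows of the fundamental matrix at \<open>1\<close> have sum \<open>\<kappa>\<close>. The determinant then gives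
\<open>\<kappa> (\<Delta> - \<kappa>) = 1\<close>.\<close>

lemma ZS_Delta_delta_eigen:
  assumes \<phi>: "continuous_potential \<phi>" and s: "dirichlet_solution z (pot_u \<phi>) (pot_v \<phi>) f g"
  shows "f 1 \<noteq> 0" "ZS_Delta \<phi> z = f 1 + 1 / f 1" "ZS_delta \<phi> z = f 1 - 1 / f 1"
proof -
  obtain U where U: "continuous_on UNIV (pot_u \<phi>)" "\<And>x. cmod (pot_u \<phi> x) \<le> U" "continuous_on UNIV (pot_v \<phi>)" "\<And>x. cmod (pot_v \<phi> x) \<le> U"
    using continuous_potential_bound[OF \<phi>] by blast
  obtain p q where p: "p 0 = 1" "q 0 = 0" "zs_on UNIV z (pot_u \<phi>) (pot_v \<phi>) p q" using zs_exists[OF U] .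
  obtain r t where r: "r 0 = 0" "t 0 = 1" "zs_on UNIV z (pot_u \<phi>) (pot_v \<phi>) r t" using zs_exists[OF U] .
  note M = ZS_fund_entries[OF \<phi> p(3,1,2) r(3,1,2)]
  have sol: "zs_sol z (pot_u \<phi>) (pot_v \<phi>) f g" "f 0 = 1" "g 0 = 1" "f 1 = g 1" using s by (auto simp: dirichlet_solution_def)
  have "zs_sol z (pot_u \<phi>) (pot_v \<phi>) (\<lambda>x. 1 * p x + 1 * r x) (\<lambda>x. 1 * q x + 1 * t x)"
    using zs_on_combine[OF p(3) r(3)] zs_on_subset by blast
  from zs_unique[OF U sol(1) this _ _ convex_real_interval(5), of 1] p r sol
  have k: "f 1 = p 1 + r 1" "f 1 = q 1 + t 1" by auto
  have det: "p 1 * t 1 - q 1 * r 1 = 1" using zs_wronskian_const[OF p(3) r(3), of 1] p r by simp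
  define \<kappa> where "\<kappa> = f 1"
  have r1: "r 1 = \<kappa> - p 1" and q1: "q 1 = \<kappa> - t 1" using k unfolding \<kappa>_def eq_diff_eq by (simp_all add: add.commute)
  have e: "\<kappa> * (p 1 + t 1 - \<kappa>) = 1" using det unfolding r1 q1 by (simp add: algebra_simps)
  then show k0: "f 1 \<noteq> 0" by (auto simp: \<kappa>_def)
  then have "p 1 + t 1 - \<kappa> = 1 / \<kappa>" using e by (simp add: \<kappa>_def field_simps)
  then have D: "p 1 + t 1 = \<kappa> + 1 / \<kappa>" by (simp add: algebra_simps)
  then show "ZS_Delta \<phi> z = f 1 + 1 / f 1" by (simp add: ZS_Delta_def M \<kappa>_def)
  have "r 1 + q 1 = 2 * \<kappa> - (p 1 + t 1)" unfolding r1 q1 by simp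
  then have "r 1 + q 1 = \<kappa> - 1 / \<kappa>" unfolding D by simp
  then show "ZS_delta \<phi> z = f 1 - 1 / f 1" by (simp add: ZS_delta_def M \<kappa>_def)
qed

section \<open>The index of an eigenvalue in the listing\<close>

text \<open>Let \<open>\<kappa> m\<close> be the index of the eigenvalue near \<open>m \<pi>\<close>. Monotonicity of the listing makes \<open>\<kappa>\<close> strictly increasing, and since there are no
other eigenvalues to the right, \<open>\<kappa> (m + 1) = \<kappa> m + 1\<close>. So \<open>\<kappa> m - m\<close> is constant, and it is zero for large \<open>m\<close>.\<close>

lemma listing_index_pos:
  fixes \<mu> :: "int \<Rightarrow> complex"
  assumes mono: "\<And>n. lex_le (\<mu> n) (\<mu> (n + 1))"
    and loc: "\<And>k. (of_int n1 - 1 / 2) * pi \<le> Re (\<mu> k) \<Longrightarrow> \<exists>m\<ge>n1. cmod (\<mu> k - of_int m * of_real pi) \<le> 1 / 2"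
    and ex: "\<And>m. n1 \<le> m \<Longrightarrow> \<exists>k. cmod (\<mu> k - of_int m * of_real pi) \<le> 1 / 2"
    and un: "\<And>m k k'. n1 \<le> m \<Longrightarrow> cmod (\<mu> k - of_int m * of_real pi) \<le> 1 / 2 \<Longrightarrow> cmod (\<mu> k' - of_int m * of_real pi) \<le> 1 / 2 \<Longrightarrow> k = k'"
    and lim: "\<exists>M. \<forall>m\<ge>M. cmod (\<mu> m - of_int m * of_real pi) \<le> 1 / 2"
    and m: "n1 \<le> m"
  shows "cmod (\<mu> m - of_int m * of_real pi) \<le> 1 / 2"
proof -
  define near where "near = (\<lambda>k m. cmod (\<mu> k - of_int m * of_real pi) \<le> 1 / 2)"
  have Re_near: "\<bar>Re (\<mu> k) - of_int m * pi\<bar> \<le> 1 / 2" if "near k m" for k m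
    using abs_Re_le_cmod[of "\<mu> k - of_int m * of_real pi"] that by (simp add: near_def)
  have Re_mono: "Re (\<mu> k) \<le> Re (\<mu> k')" if "k \<le> k'" for k k'
    using that
  proof (induction k' rule: int_ge_induct)
    case (step i)
    then show ?case using mono[of i] by (auto simp: lex_le_def)
  qed simp
  have "\<forall>m\<in>{n1..}. \<exists>k. near k m" using ex by (auto simp: near_def)
  then obtain \<kappa> where \<kappa>: "\<And>m. n1 \<le> m \<Longrightarrow> near (\<kappa> m) m" using bchoice[of "{n1..}" "\<lambda>m k. near k m"] by auto
  have \<kappa>_un: "near k m \<Longrightarrow> n1 \<le> m \<Longrightarrow> k = \<kappa> m" for k m using un \<kappa> unfolding near_def by blast
  have strict: "\<kappa> m < \<kappa> m'" if "n1 \<le> m" "m < m'" for m m'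
  proof (rule ccontr)
    assume "\<not> \<kappa> m < \<kappa> m'"
    then have "Re (\<mu> (\<kappa> m')) \<le> Re (\<mu> (\<kappa> m))" by (intro Re_mono) simp
    moreover have r: "\<bar>Re (\<mu> (\<kappa> m)) - of_int m * pi\<bar> \<le> 1 / 2" "\<bar>Re (\<mu> (\<kappa> m')) - of_int m' * pi\<bar> \<le> 1 / 2"
      using that by (intro Re_near \<kappa>; simp)+
    moreover have "Re (\<mu> (\<kappa> m)) \<le> of_int m * pi + 1 / 2" "of_int m' * pi - 1 / 2 \<le> Re (\<mu> (\<kappa> m'))"
      using r by linarith+
    moreover have "(of_int m + 1) * pi \<le> of_int m' * pi" using that by (intro mult_right_mono) auto
    ultimately show False using pi_gt3 by (simp add: algebra_simps)
  qed
  have step: "\<kappa> (m + 1) = \<kappa> m + 1" if m: "n1 \<le> m" for m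
  proof -
    have 1: "\<kappa> m + 1 \<le> \<kappa> (m + 1)" using strict[of m "m + 1"] m by simp
    have "of_int n1 * pi \<le> of_int m * pi" using m by (intro mult_right_mono) auto
    moreover have "(of_int n1 - 1 / 2) * pi = of_int n1 * pi - pi / 2" by (simp add: left_diff_distrib)
    ultimately have "(of_int n1 - 1 / 2) * pi \<le> of_int m * pi - 1 / 2" using pi_gt3 by linarith
    also have "\<dots> \<le> Re (\<mu> (\<kappa> m))" using Re_near[OF \<kappa>[OF m]] by linarith
    also have "\<dots> \<le> Re (\<mu> (\<kappa> m + 1))" by (rule Re_mono) simp
    finally obtain m' where m': "n1 \<le> m'" "near (\<kappa> m + 1) m'" using loc[of "\<kappa> m + 1"] by (auto simp: near_def)
    then have e: "\<kappa> m + 1 = \<kappa> m'" by (intro \<kappa>_un)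
    have "m < m'"
    proof (rule ccontr)
      assume "\<not> m < m'"
      then have "\<kappa> m' \<le> \<kappa> m" using strict[of m' m] m' by (cases "m' = m") auto
      then show False using e by simp
    qed
    then have "\<kappa> (m + 1) \<le> \<kappa> m'" using strict[of "m + 1" m'] m by (cases "m + 1 = m'") auto
    then show ?thesis using 1 e by simp
  qed
  have lin: "\<kappa> m = \<kappa> n1 + (m - n1)" if "n1 \<le> m" for m
    using that by (induction m rule: int_ge_induct) (auto simp: step)
  obtain M where M: "\<forall>m\<ge>M. near m m" using lim by (auto simp: near_def)
  have "max M n1 = \<kappa> (max M n1)" using M by (intro \<kappa>_un) auto
  then have "\<kappa> n1 = n1" using lin[of "max M n1"] by simp
  then have "\<kappa> m = m" using lin[OF m] by simp
  then show ?thesis using \<kappa>[OF m] by (simp add: near_def)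
qed

lemma summable_square_tail:
  fixes h :: "int \<Rightarrow> real"
  assumes "(\<lambda>n. (h n)\<^sup>2) summable_on UNIV" shows "\<exists>M. \<forall>n\<ge>M. \<bar>h n\<bar> \<le> 1 / 2"
proof -
  have "(\<lambda>n. (h n)\<^sup>2) summable_on range int" by (rule summable_on_subset_banach[OF assms]) simp
  then have "((\<lambda>n. (h n)\<^sup>2) \<circ> int) summable_on UNIV" by (subst summable_on_reindex[symmetric]) auto
  then have "summable (\<lambda>n. (h (int n))\<^sup>2)" by (simp add: summable_on_UNIV_nonneg_real_iff o_def)
  then have "(\<lambda>n. (h (int n))\<^sup>2) \<longlonglongrightarrow> 0" by (rule summable_LIMSEQ_zero)
  then have "\<forall>\<^sub>F n in sequentially. (h (int n))\<^sup>2 < 1 / 4" by (rule order_tendstoD) simp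
  then obtain M where M: "\<forall>n\<ge>M. (h (int n))\<^sup>2 < 1 / 4" by (auto simp: eventually_sequentially)
  have "\<bar>h n\<bar> \<le> 1 / 2" if n: "int M \<le> n" for n
  proof -
    have "(h n)\<^sup>2 < 1 / 4" using M[rule_format, of "nat n"] n by (simp add: le_nat_iff)
    then have "\<bar>h n\<bar>\<^sup>2 \<le> (1 / 2)\<^sup>2" by (simp add: power2_eq_square)
    then show ?thesis by (rule power2_le_imp_le) simp
  qed
  then show ?thesis by blast
qed

lemma pi_multiples_close:
  assumes "cmod (z - of_int m * of_real pi) \<le> 1 / 2" "cmod (z - of_int n * of_real pi) \<le> 1 / 2"
  shows "m = n"
proof (rule ccontr)
  assume "m \<noteq> n"
  then have "1 \<le> \<bar>of_int (m - n) :: real\<bar>" by linarith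
  then have "1 * pi \<le> \<bar>of_int (m - n) :: real\<bar> * pi" by (intro mult_right_mono) auto
  also have "\<dots> = cmod (of_int (m - n) * of_real pi :: complex)"
    by (simp only: norm_mult norm_of_int norm_of_real abs_of_pos[OF pi_gt_zero])
  also have "of_int (m - n) * of_real pi = (z - of_int n * of_real pi) - (z - of_int m * of_real pi :: complex)"
    by (simp add: algebra_simps)
  also have "cmod \<dots> \<le> 1 / 2 + 1 / 2" by (intro order_trans[OF norm_triangle_ineq4] add_mono assms)
  finally show False using pi_gt3 by simp
qed

text \<open>For negative \<open>n\<close> the previous argument is applied to the reflected listing \<open>- \<mu> (- k)\<close>.\<close>

lemma listing_location:
  assumes per: "global_potential_bound K (pot_u \<phi>) u' (pot_v \<phi>) v'" and \<phi>: "continuous_potential \<phi>" and L: "dirichlet_listing \<phi> \<mu>"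
    and n: "256 * first_order_const K + 1 \<le> real_of_int \<bar>n\<bar>"
  shows "\<exists>f g. dirichlet_solution (\<mu> n) (pot_u \<phi>) (pot_v \<phi>) f g"
    "cmod (\<mu> n - of_int n * of_real pi) \<le> 4 * first_order_const K / real_of_int \<bar>n\<bar>"
proof -
  have data: "potential_bound K (pot_u \<phi>) u' (pot_v \<phi>) v'" using per by (simp add: global_potential_bound_def)
  have K: "1 \<le> K" using data by (simp add: potential_bound_def)
  note C = first_order_const_ge1[OF K]
  define n1 where "n1 = \<lceil>256 * first_order_const K\<rceil>"
  have n1: "256 * first_order_const K \<le> of_int n1" "of_int n1 \<le> 256 * first_order_const K + 1" unfolding n1_def by linarith+
  have rng: "range \<mu> = dirichlet_spectrum \<phi>" and crd: "\<And>z. finite {n. \<mu> n = z}" "\<And>z. card {n. \<mu> n = z} = dirichlet_mult \<phi> z"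
    and mono: "\<And>n. lex_le (\<mu> n) (\<mu> (n + 1))" and sm: "(\<lambda>n. (cmod (\<mu> n - of_real (of_int n * pi)))\<^sup>2) summable_on UNIV"
    using L by (auto simp: dirichlet_listing_def)
  have ev: "\<exists>f g. dirichlet_solution (\<mu> k) (pot_u \<phi>) (pot_v \<phi>) f g" for k
  proof (rule ccontr)
    assume "\<nexists>f g. dirichlet_solution (\<mu> k) (pot_u \<phi>) (pot_v \<phi>) f g"
    then have "dirichlet_mult \<phi> (\<mu> k) = 0" by (intro no_eigenfunction_mult[OF \<phi>]) blast
    then have "{n. \<mu> n = \<mu> k} = {}" using crd[of "\<mu> k"] by simp
    then show False by blast
  qed
  have A: "\<exists>m. cmod (\<mu> k - of_int m * of_real pi) \<le> 1 / 2 \<and> cmod (\<mu> k - of_int m * of_real pi) \<le> 4 * first_order_const K / real_of_int \<bar>m\<bar>"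
    if "16 * first_order_const K \<le> cmod (\<mu> k)" for k
    using ev[of k] dirichlet_location[OF data _ that] by blast
  have big: "16 * first_order_const K \<le> cmod (\<mu> k)" if "cmod (\<mu> k - of_int m * of_real pi) \<le> 1 / 2" "n1 \<le> \<bar>m\<bar>" for k m
  proof -
    have "real_of_int \<bar>m\<bar> * pi = cmod (of_int m * of_real pi :: complex)" by (simp add: norm_mult)
    also have "\<dots> \<le> cmod (\<mu> k) + cmod (\<mu> k - of_int m * of_real pi)"
      using norm_triangle_ineq4[of "\<mu> k" "\<mu> k - of_int m * of_real pi"] by simp
    finally have "real_of_int \<bar>m\<bar> * pi \<le> cmod (\<mu> k) + 1 / 2" using that(1) by simp
    moreover have "real_of_int \<bar>m\<bar> * 3 \<le> real_of_int \<bar>m\<bar> * pi" using pi_gt3 by (intro mult_left_mono) auto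
    moreover have "256 * first_order_const K \<le> real_of_int \<bar>m\<bar>" using n1(1) that(2) by linarith
    ultimately show ?thesis using C by linarith
  qed
  have strong: "cmod (\<mu> k - of_int m * of_real pi) \<le> 4 * first_order_const K / real_of_int \<bar>m\<bar>"
    if near: "cmod (\<mu> k - of_int m * of_real pi) \<le> 1 / 2" and m: "n1 \<le> \<bar>m\<bar>" for k m
    using A[OF big[OF near m]] pi_multiples_close[OF near] by blast
  have B: "\<exists>k. cmod (\<mu> k - of_int m * of_real pi) \<le> 1 / 2" if m: "n1 \<le> \<bar>m\<bar>" for m
  proof -
    have "8 * first_order_const K \<le> real_of_int \<bar>m\<bar>" using n1(1) m C by linarith
    then obtain z f g where z: "dirichlet_solution z (pot_u \<phi>) (pot_v \<phi>) f g" "cmod (z - of_int m * of_real pi) \<le> 1 / 2"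
      using dirichlet_exists[OF per] by blast
    have "z \<in> range \<mu>" unfolding rng by (rule eigenfunction_spectrum[OF \<phi> z(1)])
    then show ?thesis using z(2) by auto
  qed
  have un: "k = k'" if m: "n1 \<le> \<bar>m\<bar>" and k: "cmod (\<mu> k - of_int m * of_real pi) \<le> 1 / 2" and k': "cmod (\<mu> k' - of_int m * of_real pi) \<le> 1 / 2" for m k k'
  proof -
    have mb: "256 * first_order_const K \<le> real_of_int \<bar>m\<bar>" using n1(1) m by linarith
    obtain f g h l where fg: "dirichlet_solution (\<mu> k) (pot_u \<phi>) (pot_v \<phi>) f g" "dirichlet_solution (\<mu> k') (pot_u \<phi>) (pot_v \<phi>) h l" using ev by blast
    have e: "\<mu> k = \<mu> k'" by (rule dirichlet_unique[OF data fg mb strong[OF k m] strong[OF k' m]])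
    have "card {n. \<mu> n = \<mu> k} \<le> Suc 0"
      unfolding crd using simple_mult[OF \<phi> fg(1) dirichlet_simple[OF data fg(1) mb strong[OF k m]]] by simp
    then show ?thesis using card_le_Suc0_iff_eq[OF crd(1)] e by auto
  qed
  have bigRe: "16 * first_order_const K \<le> cmod z" if "(of_int n1 - 1 / 2) * pi \<le> \<bar>Re z\<bar>" for z
  proof -
    have "(of_int n1 - 1 / 2) * 3 \<le> (of_int n1 - 1 / 2) * pi" using n1 C pi_gt3 by (intro mult_left_mono) auto
    also have "\<dots> \<le> \<bar>Re z\<bar>" by (rule that)
    also have "\<dots> \<le> cmod z" by (rule abs_Re_le_cmod)
    finally have "(of_int n1 - 1 / 2) * 3 \<le> cmod z" .
    moreover have "(256 * first_order_const K - 1 / 2) * 3 \<le> (of_int n1 - 1 / 2) * 3" using n1(1) by simp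
    ultimately have "(256 * first_order_const K - 1 / 2) * 3 \<le> cmod z" by (rule order_trans[rotated])
    moreover have "16 * first_order_const K \<le> (256 * first_order_const K - 1 / 2) * 3" using C by simp
    ultimately show ?thesis by (rule order_trans[rotated])
  qed
  have near_n: "cmod (\<mu> n - of_int n * of_real pi) \<le> 1 / 2" if n: "n1 \<le> \<bar>n\<bar>" for n
  proof (cases "0 \<le> n")
    case True
    show ?thesis
    proof (rule listing_index_pos[of \<mu> n1 n])
      fix k assume k: "(of_int n1 - 1 / 2) * pi \<le> Re (\<mu> k)"
      have "(of_int n1 - 1 / 2) * pi \<le> \<bar>Re (\<mu> k)\<bar>" using k abs_ge_self by (rule order_trans)
      then obtain m where m: "cmod (\<mu> k - of_int m * of_real pi) \<le> 1 / 2" using A[OF bigRe] by blast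
      have "\<bar>Re (\<mu> k) - of_int m * pi\<bar> \<le> 1 / 2" using abs_Re_le_cmod[of "\<mu> k - of_int m * of_real pi"] m by simp
      then have "(of_int n1 - of_int m) * pi \<le> 1 / 2 + pi / 2" using k unfolding left_diff_distrib by linarith
      then have "(of_int n1 - of_int m) * pi < 1 * pi" using pi_gt3 by linarith
      then have "of_int n1 - of_int m < (1::real)" by (simp add: mult_less_cancel_right_pos)
      then have "n1 \<le> m" by linarith
      then show "\<exists>m\<ge>n1. cmod (\<mu> k - of_int m * of_real pi) \<le> 1 / 2" using m by blast
    next
      show "\<exists>M. \<forall>m\<ge>M. cmod (\<mu> m - of_int m * of_real pi) \<le> 1 / 2"
        using summable_square_tail[OF sm] by simp
    next
      fix m assume "n1 \<le> m"
      then show "\<exists>k. cmod (\<mu> k - of_int m * of_real pi) \<le> 1 / 2" by (intro B) linarith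
    next
      fix m k k' assume h: "n1 \<le> m" "cmod (\<mu> k - of_int m * of_real pi) \<le> 1 / 2" "cmod (\<mu> k' - of_int m * of_real pi) \<le> 1 / 2"
      show "k = k'" by (rule un[OF _ h(2,3)]) (use h(1) in linarith)
    qed (use mono n True in auto)
  next
    case False
    define \<mu>' where "\<mu>' = (\<lambda>k. - \<mu> (- k))"
    have sw: "cmod (\<mu>' k - of_int m * of_real pi) = cmod (\<mu> (- k) - of_int (- m) * of_real pi)" for k m
      using norm_minus_cancel[of "\<mu> (- k) - of_int (- m) * of_real pi"] by (simp add: \<mu>'_def)
    have "cmod (\<mu>' (- n) - of_int (- n) * of_real pi) \<le> 1 / 2"
    proof (rule listing_index_pos[of \<mu>' n1 "- n"])
      show "lex_le (\<mu>' k) (\<mu>' (k + 1))" for k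
        using mono[of "- k - 1"] by (auto simp: lex_le_def \<mu>'_def)
    next
      fix k assume k: "(of_int n1 - 1 / 2) * pi \<le> Re (\<mu>' k)"
      have "Re (\<mu>' k) \<le> \<bar>Re (\<mu> (- k))\<bar>" by (simp add: \<mu>'_def)
      with k have "(of_int n1 - 1 / 2) * pi \<le> \<bar>Re (\<mu> (- k))\<bar>" by (rule order_trans)
      then obtain m where m: "cmod (\<mu> (- k) - of_int m * of_real pi) \<le> 1 / 2" using A[OF bigRe] by blast
      have "\<bar>Re (\<mu> (- k)) - of_int m * pi\<bar> \<le> 1 / 2" using abs_Re_le_cmod[of "\<mu> (- k) - of_int m * of_real pi"] m by simp
      then have "(of_int n1 + of_int m) * pi \<le> 1 / 2 + pi / 2"
        using k unfolding \<mu>'_def minus_complex.sel uminus_complex.sel left_diff_distrib distrib_right by linarith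
      then have "(of_int n1 + of_int m) * pi < 1 * pi" using pi_gt3 by linarith
      then have "of_int n1 + of_int m < (1::real)" by (simp add: mult_less_cancel_right_pos)
      then have "n1 \<le> - m" by linarith
      moreover have "cmod (\<mu>' k - of_int (- m) * of_real pi) \<le> 1 / 2" using m unfolding sw by simp
      ultimately show "\<exists>m\<ge>n1. cmod (\<mu>' k - of_int m * of_real pi) \<le> 1 / 2" by blast
    next
      fix m assume m: "n1 \<le> m"
      then have "n1 \<le> \<bar>- m\<bar>" by linarith
      then obtain k where "cmod (\<mu> k - of_int (- m) * of_real pi) \<le> 1 / 2" using B by blast
      then have "cmod (\<mu>' (- k) - of_int m * of_real pi) \<le> 1 / 2" unfolding sw by simp
      then show "\<exists>k. cmod (\<mu>' k - of_int m * of_real pi) \<le> 1 / 2" by blast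
    next
      fix m k k' assume h: "n1 \<le> m" "cmod (\<mu>' k - of_int m * of_real pi) \<le> 1 / 2" "cmod (\<mu>' k' - of_int m * of_real pi) \<le> 1 / 2"
      have "n1 \<le> \<bar>- m\<bar>" using h(1) by linarith
      from un[OF this h(2,3)[unfolded sw]] have "- k = - k'" .
      then show "k = k'" by simp
    next
      define h where "h = (\<lambda>k. cmod (\<mu> k - of_real (of_int k * pi)))"
      have "((\<lambda>n. (h n)\<^sup>2) \<circ> uminus) summable_on UNIV"
        using sm by (subst summable_on_reindex[symmetric]) (auto simp: h_def)
      then have "(\<lambda>k. (h (- k))\<^sup>2) summable_on UNIV" by (simp add: o_def)
      from summable_square_tail[OF this] obtain M where "\<forall>k\<ge>M. h (- k) \<le> 1 / 2" by (auto simp: h_def)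
      then show "\<exists>M. \<forall>m\<ge>M. cmod (\<mu>' m - of_int m * of_real pi) \<le> 1 / 2" unfolding sw by (auto simp: h_def)
    qed (use n False in auto)
    then show ?thesis unfolding sw by simp
  qed
  have nn: "n1 \<le> \<bar>n\<bar>" using n n1(2) by linarith
  show "\<exists>f g. dirichlet_solution (\<mu> n) (pot_u \<phi>) (pot_v \<phi>) f g" by (rule ev)
  show "cmod (\<mu> n - of_int n * of_real pi) \<le> 4 * first_order_const K / real_of_int \<bar>n\<bar>"
    by (rule strong[OF near_n[OF nn] nn])
qed

section \<open>From Sobolev norms to the asymptotics of the traces\<close>

lemma periodic_int:
  fixes w :: "real \<Rightarrow> complex"
  assumes "\<And>x. w (x + 1) = w x" shows "w (x + of_int n) = w x"
proof (induction n rule: int_induct[of _ 0])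
  case (step1 i)
  then show ?case using assms[of "x + of_int i"] by (simp add: add.assoc)
next
  case (step2 i)
  then show ?case using assms[of "x + of_int (i - 1)"] by (simp add: add.assoc)
qed simp

text \<open>The chosen derivatives in the definition of the norm are used throughout. The supremum bound is the Sobolev embedding: the mean
of \<open>|w|\<close> and the oscillation of \<open>w\<close> are bounded by \<open>L\<^sup>2\<close> norms.\<close>

lemma sobolev_norm_tower:
  assumes N: "1 \<le> N" and w: "w \<in> sobolev N" and R: "sobolev_norm N w \<le> R"
  shows "\<exists>d. d 0 = w \<and> sobolev_tower N (3 * R + 1) d \<and> continuous_on UNIV w \<and> (\<forall>x. cmod (w x) \<le> 3 * R + 1)"
proof -
  define d where "d = (SOME d. sobolev_derivs N w d)"
  have d: "sobolev_derivs N w d"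
    unfolding d_def using w someI_ex[of "sobolev_derivs N w"] by (simp only: sobolev_def mem_Collect_eq)
  have R0: "0 \<le> R" using R unfolding sobolev_norm_def by (meson order_trans real_sqrt_ge_zero sum_nonneg zero_le_power2)
  have d0: "d 0 = w" and per: "\<And>k. k \<le> N \<Longrightarrow> L2_per (d k)" and wd: "\<And>k. k < N \<Longrightarrow> has_weak_deriv_on (d k) (d (Suc k)) UNIV"
    using d by (auto simp: sobolev_derivs_def)
  have l2: "L2_bound R (d k)" if k: "k \<le> N" for k
  proof -
    have m: "set_borel_measurable lborel {0..1} (d k)" and i: "set_integrable lborel {0..1} (\<lambda>x. (cmod (d k x))\<^sup>2)"
      using per[OF k] by (auto simp: L2_per_def L2_on_def)
    have "set_integrable lborel {0..1} (\<lambda>x. 1 + (cmod (d k x))\<^sup>2)"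
      by (intro set_integral_add i set_integrable_cont) simp
    then have s: "set_integrable lborel {0..1} (d k)"
    proof (rule set_int_dominated[OF _ m])
      fix x
      show "cmod (d k x) \<le> 1 + (cmod (d k x))\<^sup>2"
        using zero_le_power2[of "cmod (d k x) - 1"] norm_ge_zero[of "d k x"] unfolding power2_diff by (simp del: zero_le_power2 norm_ge_zero)
    qed
    have "(L2_norm_on {0..1} (d k))\<^sup>2 \<le> (\<Sum>k\<le>N. (L2_norm_on {0..1} (d k))\<^sup>2)"
      by (rule member_le_sum) (use k in auto)
    also have "\<dots> = (sobolev_norm N w)\<^sup>2"
      unfolding sobolev_norm_def d_def[symmetric] by (simp add: sum_nonneg)
    also have "\<dots> \<le> R\<^sup>2" using R by (intro power_mono) (auto simp: sobolev_norm_def sum_nonneg)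
    finally have b: "(L2_norm_on {0..1} (d k))\<^sup>2 \<le> R\<^sup>2" .
    have "(L2_norm_on {0..1} (d k))\<^sup>2 = integral {0..1} (\<lambda>x. (cmod (d k x))\<^sup>2)"
    proof -
      have "0 \<le> (LINT x:{0..1}|lborel. (cmod (d k x))\<^sup>2)"
        unfolding set_lebesgue_integral_def by (rule Bochner_Integration.integral_nonneg) simp
      then show ?thesis unfolding L2_norm_on_def using set_borel_integral_eq_integral(2)[OF i] by simp
    qed
    then show ?thesis using b s i R0 by (simp add: L2_bound_def)
  qed
  have abs_cont: "abs_cont (d k) (d (Suc k))" if k: "k < N" for k
    unfolding abs_cont_def
  proof (intro conjI ballI)
    show "set_integrable lborel {0..1} (d (Suc k))" using wd[OF k] by (simp add: has_weak_deriv_on_def)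
    fix x :: real assume "x \<in> {0..1}"
    then show "integral {0..x} (d (Suc k)) = d k x - d k 0"
      using weak_deriv_oriented_integral[OF wd[OF k], of x] by (simp add: oriented_integral_nonneg)
  qed
  have sup: "cmod (d k x) \<le> 3 * R" if k: "k < N" and x: "x \<in> {0..1}" for k x
  proof -
    have n: "integral {0..1} (\<lambda>t. cmod (d (Suc k) t)) \<le> R" "integral {0..1} (\<lambda>t. cmod (d k t)) \<le> R"
      using L2_bound_integral_norm[OF l2[of "Suc k"]] L2_bound_integral_norm[OF l2[of k]] k by auto
    have v: "cmod (d k y - d k 0) \<le> R" if y: "y \<in> {0..1}" for y
    proof -
      have "d k y - d k 0 = integral {0..y} (d (Suc k))" using abs_cont_eval[OF abs_cont[OF k] y] by simp
      then show ?thesis using integral_norm_le[OF abs_cont_int[OF abs_cont[OF k]] y] n(1) by simp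
    qed
    have i: "(\<lambda>y. cmod (d k y)) integrable_on {0..1}"
      by (intro integrable_continuous_interval continuous_intros abs_cont_cont[OF abs_cont[OF k]])
    have "cmod (d k 0) = integral {0..1} (\<lambda>y::real. cmod (d k 0))" by simp
    also have "\<dots> \<le> integral {0..1} (\<lambda>y. cmod (d k y) + R)"
    proof (rule integral_le)
      fix y :: real assume "y \<in> {0..1}"
      from v[OF this] show "cmod (d k 0) \<le> cmod (d k y) + R"
        using norm_triangle_ineq2[of "d k 0" "d k y"] by (simp add: norm_minus_commute)
    qed (use i in \<open>auto intro!: integrable_add\<close>)
    also have "\<dots> = integral {0..1} (\<lambda>y. cmod (d k y)) + R"
      using i by (subst Henstock_Kurzweil_Integration.integral_add) auto
    finally have "cmod (d k 0) \<le> 2 * R" using n(2) by simp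
    then show ?thesis using v[OF x] norm_triangle_ineq2[of "d k x" "d k 0"] by simp
  qed
  have h: "sobolev_tower N (3 * R + 1) d"
    unfolding sobolev_tower_def
  proof (intro conjI allI impI ballI)
    show "1 \<le> 3 * R + 1" using R0 by simp
    show "L2_bound (3 * R + 1) (d N)" by (rule L2_bound_mono[OF l2]) (use R0 in auto)
    fix k assume k: "k < N"
    show "abs_cont (d k) (d (Suc k))" by (rule abs_cont[OF k])
    have "d k (0 + 1) = d k 0" using per[of k] k unfolding L2_per_def by (metis less_imp_le)
    then show "d k 1 = d k 0" by simp
    fix x :: real assume "x \<in> {0..1}"
    from sup[OF k this] show "cmod (d k x) \<le> 3 * R + 1" by simp
  qed
  have c: "continuous_on UNIV w" using weak_deriv_cont_UNIV[OF wd[of 0]] N d0 by simp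
  have "cmod (w x) \<le> 3 * R + 1" for x
  proof -
    have p: "w (x + 1) = w x" for x using per[of 0] d0 by (simp add: L2_per_def)
    have "w x = w (frac x)"
      using periodic_int[of w "frac x" "\<lfloor>x\<rfloor>", OF p] by (simp add: frac_def)
    moreover have "frac x \<in> {0..1}" using frac_ge_0[of x] frac_lt_1[of x] by simp
    ultimately show ?thesis using sup[of 0 "frac x"] N d0 by simp
  qed
  then show ?thesis using d0 h c by blast
qed

lemma sobolev_tower_cmult:
  assumes h: "sobolev_tower N K d" and c: "cmod c = 1" shows "sobolev_tower N K (\<lambda>k x. c * d k x)"
proof -
  have "L2_bound (K * 1) (\<lambda>x. d N x * c)"
    by (rule L2_bound_mult_cont) (use h c in \<open>auto simp: sobolev_tower_def\<close>)
  then have "L2_bound K (\<lambda>x. c * d N x)" by (simp add: mult.commute)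
  then show ?thesis using h c by (auto simp: sobolev_tower_def norm_mult intro: abs_cont_cmult)
qed

lemma fourier_coeff_fcoeff:
  assumes "continuous_on UNIV w" shows "fourier_coeff w n = fcoeff w n"
proof -
  have c: "continuous_on {0..1} (\<lambda>x. w x * fourier_mode n x)"
    by (intro continuous_intros continuous_on_subset[OF assms]) auto
  have "(LBINT x=0..1. w x * fourier_mode n x) = integral {0..1} (\<lambda>x. w x * fourier_mode n x)"
    using interval_integral_eq_integral[of 0 1 "\<lambda>x. w x * fourier_mode n x"] set_integrable_cont[OF c] by (simp add: zero_ereal_def one_ereal_def)
  then show ?thesis by (simp add: fourier_coeff_def fcoeff_def fourier_mode_def)
qed

text \<open>The first bound uses \<open>\<kappa> - 1/\<kappa> - s S = s (\<kappa>\<^sup>2 - 1 - S) + (\<kappa>\<^sup>2 - 1) (1/\<kappa> - s)\<close>, the second \<open>\<kappa> + 1/\<kappa> - 2 s = (\<kappa> - s)\<^sup>2 / \<kappa>\<close> and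
\<open>2 N \<ge> N + 1\<close>.\<close>

lemma trace_pointwise:
  fixes \<kappa> S s :: complex
  assumes s: "s * s = 1" "cmod s = 1" and X: "cmod (\<kappa>\<^sup>2 - 1 - S) \<le> m ^ Suc N * X" and S: "cmod S \<le> m ^ N * T"
    and A: "cmod (\<kappa> - s) \<le> A * m" "A * m \<le> 1 / 2" and m: "0 < m" "m \<le> 1" and N: "1 \<le> N"
    and D: "T + X \<le> D" "0 \<le> T" "0 \<le> X"
  shows "cmod (\<kappa> - 1 / \<kappa> - s * S) \<le> m ^ Suc N * (X + 2 * A * (T + X))"
    "cmod (\<kappa> + 1 / \<kappa> - 2 * s) \<le> m ^ Suc N * (2 * D * (T + X))"
proof -
  have k2: "1 / 2 \<le> cmod \<kappa>" using norm_triangle_ineq2[of s "s - \<kappa>"] A s(2) by (simp add: norm_minus_commute)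
  then have k0: "\<kappa> \<noteq> 0" by auto
  have mN: "0 \<le> m ^ N" "m ^ Suc N \<le> m ^ N" using m by (auto intro: mult_left_le_one_le)
  have sq: "cmod (\<kappa>\<^sup>2 - 1) \<le> m ^ N * (T + X)"
  proof -
    have "cmod (\<kappa>\<^sup>2 - 1) \<le> cmod (\<kappa>\<^sup>2 - 1 - S) + cmod S" using norm_triangle_ineq[of "\<kappa>\<^sup>2 - 1 - S" S] by simp
    also have "\<dots> \<le> m ^ Suc N * X + m ^ N * T" using X S by simp
    also have "\<dots> \<le> m ^ N * X + m ^ N * T" using mN D by (intro add_right_mono mult_right_mono) auto
    finally show ?thesis by (simp add: algebra_simps)
  qed
  have TX: "0 \<le> m ^ N * (T + X)" using mN D by simp
  have inv: "cmod (1 / \<kappa> - s) \<le> 2 * (A * m)"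
  proof -
    have "\<kappa> * (1 / \<kappa> - s) = s * (s - \<kappa>)" using k0 s(1) by (simp add: right_diff_distrib mult.commute)
    then have "cmod \<kappa> * cmod (1 / \<kappa> - s) = cmod (\<kappa> - s)" using s(2) by (metis norm_mult mult_1 norm_minus_commute)
    moreover have "1 / 2 * cmod (1 / \<kappa> - s) \<le> cmod \<kappa> * cmod (1 / \<kappa> - s)" using k2 by (intro mult_right_mono) auto
    ultimately show ?thesis using A(1) by simp
  qed
  have "\<kappa> - 1 / \<kappa> - s * S = s * (\<kappa>\<^sup>2 - 1 - S) + (\<kappa>\<^sup>2 - 1) * (1 / \<kappa> - s)"
    using k0 by (simp add: power2_eq_square right_diff_distrib left_diff_distrib diff_divide_distrib)
  then have "cmod (\<kappa> - 1 / \<kappa> - s * S) \<le> cmod (\<kappa>\<^sup>2 - 1 - S) + cmod (\<kappa>\<^sup>2 - 1) * cmod (1 / \<kappa> - s)"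
    using norm_triangle_ineq[of "s * (\<kappa>\<^sup>2 - 1 - S)" "(\<kappa>\<^sup>2 - 1) * (1 / \<kappa> - s)"] s(2) by (simp add: norm_mult)
  also have "\<dots> \<le> m ^ Suc N * X + (m ^ N * (T + X)) * (2 * (A * m))"
    using X sq inv TX by (intro add_mono mult_mono) auto
  also have "\<dots> = m ^ Suc N * (X + 2 * A * (T + X))" by (simp add: algebra_simps)
  finally show "cmod (\<kappa> - 1 / \<kappa> - s * S) \<le> m ^ Suc N * (X + 2 * A * (T + X))" .
  have ks: "cmod (\<kappa> - s) \<le> m ^ N * (T + X)"
  proof -
    have "1 \<le> cmod (\<kappa> + s)" using norm_triangle_ineq2[of "2 * s" "s - \<kappa>"] A s(2) by (simp add: norm_minus_commute norm_mult add.commute)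
    then have "cmod (\<kappa> - s) * 1 \<le> cmod (\<kappa> - s) * cmod (\<kappa> + s)" by (intro mult_left_mono) auto
    also have "\<dots> = cmod (\<kappa>\<^sup>2 - 1)" unfolding norm_mult[symmetric] by (rule arg_cong[where f = cmod]) (simp add: power2_eq_square s(1)[symmetric] algebra_simps)
    finally show ?thesis using sq by simp
  qed
  have "\<kappa> * (\<kappa> + 1 / \<kappa> - 2 * s) = (\<kappa> - s) * (\<kappa> - s)"
    using k0 s(1) by (simp add: algebra_simps)
  then have e: "cmod \<kappa> * cmod (\<kappa> + 1 / \<kappa> - 2 * s) = cmod (\<kappa> - s) * cmod (\<kappa> - s)" by (metis norm_mult)
  have "1 / 2 * cmod (\<kappa> + 1 / \<kappa> - 2 * s) \<le> cmod \<kappa> * cmod (\<kappa> + 1 / \<kappa> - 2 * s)" using k2 by (intro mult_right_mono) auto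
  also have "\<dots> \<le> (m ^ N * (T + X)) * (m ^ N * (T + X))" unfolding e using ks TX by (intro mult_mono) auto
  also have "\<dots> = m ^ (N + N) * ((T + X) * (T + X))" by (simp add: power_add algebra_simps)
  also have "\<dots> \<le> m ^ Suc N * (D * (T + X))"
  proof (intro mult_mono)
    show "m ^ (N + N) \<le> m ^ Suc N" using m N by (intro power_decreasing) auto
  qed (use m D in auto)
  finally show "cmod (\<kappa> + 1 / \<kappa> - 2 * s) \<le> m ^ Suc N * (2 * D * (T + X))" by (simp add: algebra_simps)
qed

text \<open>First-order asymptotics give \<open>exp (\<i> z) f(1) = 1 + O(1/n)\<close>, and \<open>exp (\<i> z)\<close> is \<open>(-1)\<^sup>n\<close> up to \<open>O(1/n)\<close>.\<close>

lemma multiplier_near_sign: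
  assumes data: "potential_bound K u u' v v'" and s: "dirichlet_solution z u v f g"
    and n: "256 * first_order_const K + 1 \<le> real_of_int \<bar>n\<bar>" and z: "cmod (z - of_int n * of_real pi) \<le> 4 * first_order_const K / real_of_int \<bar>n\<bar>"
  shows "cmod (f 1 - (-1) powi n) \<le> (first_order_const K + 64 * exp (2 * K) * first_order_const K) * (1 / real_of_int \<bar>n\<bar>)"
proof -
  have K: "1 \<le> K" and uv: "\<And>x. x \<in> {0..1} \<Longrightarrow> cmod (u x) \<le> K \<and> cmod (v x) \<le> K" using data by (auto simp: potential_bound_def)
  note C = first_order_const_ge1[OF K]
  have sol: "zs_sol z u v f g" "f 0 = 1" "g 0 = 1" using s by (auto simp: dirichlet_solution_def)
  define m where "m = 1 / real_of_int \<bar>n\<bar>"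
  define w where "w = z - of_int n * of_real pi"
  have np: "0 < real_of_int \<bar>n\<bar>" using n C by linarith
  have wm: "cmod w \<le> 4 * first_order_const K * m" using z by (simp add: w_def m_def)
  have "4 * first_order_const K / real_of_int \<bar>n\<bar> \<le> 1" using n np C by (simp add: divide_le_eq)
  then have w1: "cmod w \<le> 1" using z by (simp add: w_def)
  have "real_of_int \<bar>n\<bar> * pi = cmod (of_int n * of_real pi :: complex)" by (simp add: norm_mult)
  also have "\<dots> \<le> cmod z + cmod w" using norm_triangle_ineq4[of z w] by (simp add: w_def)
  finally have "real_of_int \<bar>n\<bar> * pi \<le> cmod z + 1" using w1 by simp
  moreover have "real_of_int \<bar>n\<bar> * 3 \<le> real_of_int \<bar>n\<bar> * pi" using pi_gt3 by (intro mult_left_mono) auto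
  ultimately have zn: "real_of_int \<bar>n\<bar> \<le> cmod z" using n C by linarith
  then have z0: "z \<noteq> 0" using np by auto
  have "first_order_const K / cmod z \<le> first_order_const K / real_of_int \<bar>n\<bar>" using zn np C by (intro frac_le) auto
  then have a: "cmod (exp (\<i> * z) * f 1 - 1) \<le> first_order_const K * m"
    using zs_first_order(1)[OF data sol(1) dirichlet_solution_Im[OF data s] sol(2,3) _ z0, of 1] by (simp add: cexp_1 m_def)
  define \<sigma> :: complex where "\<sigma> = (-1) powi n"
  have \<sigma>n: "cmod \<sigma> = 1" by (simp add: \<sigma>_def norm_power_int)
  have \<sigma>2: "\<sigma> * \<sigma> = 1" by (simp add: \<sigma>_def power_int_mult_distrib[symmetric])
  have "exp (\<i> * z) = exp (of_int n * (\<i> * of_real pi)) * exp (\<i> * w)"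
    by (simp add: w_def mult_exp_exp algebra_simps)
  also have "exp (of_int n * (\<i> * of_real pi)) = \<sigma>"
    unfolding \<sigma>_def exp_power_int[symmetric] by (simp add: exp_pi_i)
  finally have e: "exp (\<i> * z) = \<sigma> * exp (\<i> * w)" .
  have fb: "cmod (f 1) \<le> 2 * exp (2 * K)" by (rule zs_growth(1)[OF sol(1) dirichlet_solution_Im[OF data s] uv sol(2,3)]) auto
  have x: "cmod (exp (\<i> * w) - 1) \<le> 32 * first_order_const K * m"
    using exp_near_1(1)[of "\<i> * w"] w1 wm by (simp add: norm_mult)
  have se: "\<sigma> * f 1 - 1 = (exp (\<i> * z) * f 1 - 1) - \<sigma> * f 1 * (exp (\<i> * w) - 1)" unfolding e by (simp add: algebra_simps)
  have "cmod (\<sigma> * f 1 - 1) \<le> cmod (exp (\<i> * z) * f 1 - 1) + cmod (f 1) * cmod (exp (\<i> * w) - 1)"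
    unfolding se using norm_triangle_ineq4[of "exp (\<i> * z) * f 1 - 1" "\<sigma> * f 1 * (exp (\<i> * w) - 1)"] \<sigma>n by (simp add: norm_mult)
  also have "\<dots> \<le> first_order_const K * m + (2 * exp (2 * K)) * (32 * first_order_const K * m)"
    using a fb x by (intro add_mono mult_mono) auto
  finally have "cmod (\<sigma> * f 1 - 1) \<le> (first_order_const K + 64 * exp (2 * K) * first_order_const K) * m" by (simp add: algebra_simps)
  moreover have "\<sigma> * (f 1 - \<sigma>) = \<sigma> * f 1 - 1" using \<sigma>2 by (simp add: right_diff_distrib)
  then have "cmod (f 1 - \<sigma>) = cmod (\<sigma> * f 1 - 1)" using \<sigma>n by (metis norm_mult mult_1)
  ultimately show ?thesis by (simp add: \<sigma>_def m_def)
qed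

lemma lp_from_l2_family:
  assumes Z: "l2_family D Z" and n0: "1 \<le> n0"
    and b: "\<And>n. int n0 \<le> \<bar>n\<bar> \<Longrightarrow> cmod (x n - y n) \<le> (1 / real_of_int \<bar>n\<bar>) ^ Suc N * Z n"
  shows "lp_asymp_bound n0 (D\<^sup>2 + 1) 2 (N + 1) x y"
proof -
  define e where "e = (\<lambda>n. (x n - y n) * of_int \<bar>n\<bar> ^ (N + 1))"
  define S where "S = {n::int. int n0 \<le> \<bar>n\<bar>}"
  have eb: "cmod (e n) \<le> Z n" if n: "n \<in> S" for n
  proof -
    have np: "0 < real_of_int \<bar>n\<bar>" using n n0 by (auto simp: S_def)
    have "cmod (e n) = cmod (x n - y n) * real_of_int \<bar>n\<bar> ^ Suc N" by (simp add: e_def norm_mult norm_power)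
    also have "\<dots> \<le> ((1 / real_of_int \<bar>n\<bar>) ^ Suc N * Z n) * real_of_int \<bar>n\<bar> ^ Suc N"
      using b n np by (intro mult_right_mono) (auto simp: S_def)
    also have "\<dots> = Z n" using np by (simp add: power_one_over)
    finally show ?thesis .
  qed
  have fin: "(\<Sum>n\<in>F. (cmod (e n))\<^sup>2) \<le> D\<^sup>2" if F: "finite F" "F \<subseteq> S" for F
  proof -
    have "(\<Sum>n\<in>F. (cmod (e n))\<^sup>2) \<le> (\<Sum>n\<in>F. (Z n)\<^sup>2)" by (intro sum_mono power_mono) (use eb F in auto)
    also have "\<dots> = (L2_set Z F)\<^sup>2" by (simp add: L2_set_def sum_nonneg)
    also have "\<dots> \<le> D\<^sup>2" using Z F by (intro power_mono) (auto simp: l2_family_def)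
    finally show ?thesis .
  qed
  have sum: "(\<lambda>n. (cmod (e n))\<^sup>2) summable_on S"
    by (rule nonneg_bdd_above_summable_on) (use fin in \<open>auto intro!: bdd_aboveI2\<close>)
  have "infsum (\<lambda>n. (cmod (e n))\<^sup>2) S \<le> D\<^sup>2"
    by (rule infsum_le_finite_sums[OF sum]) (use fin in auto)
  then have le: "infsum (\<lambda>n. (cmod (e n))\<^sup>2) S \<le> D\<^sup>2 + 1" by simp
  have "remainder_from n0 (N + 1) x y e"
    unfolding remainder_from_def e_def using n0 by auto
  then show ?thesis unfolding lp_asymp_bound_def using sum le unfolding S_def by blast
qed

lemma sobolev_norm_component:
  assumes "Hc_norm N \<phi> \<le> R"
  shows "sobolev_norm N (fst \<phi>) \<le> R" "sobolev_norm N (snd \<phi>) \<le> R"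
  using assms real_sqrt_sum_squares_ge1[of "sobolev_norm N (fst \<phi>)" "sobolev_norm N (snd \<phi>)"]
    real_sqrt_sum_squares_ge2[of "sobolev_norm N (snd \<phi>)" "sobolev_norm N (fst \<phi>)"]
  unfolding Hc_norm_def by linarith+

lemma potential_data:
  assumes N: "1 \<le> N" and \<phi>: "\<phi> \<in> Hc N" and R: "Hc_norm N \<phi> \<le> R"
  shows "\<exists>d e. d 0 = pot_u \<phi> \<and> e 0 = pot_v \<phi> \<and> sobolev_tower N (3 * R + 1) d \<and> sobolev_tower N (3 * R + 1) e \<and> continuous_potential \<phi> \<and>
    global_potential_bound (3 * R + 1) (pot_u \<phi>) (d 1) (pot_v \<phi>) (e 1)"
proof -
  have f: "fst \<phi> \<in> sobolev N" and s: "snd \<phi> \<in> sobolev N" using \<phi> by (auto simp: Hc_def)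
  obtain d where d: "d 0 = fst \<phi>" "sobolev_tower N (3 * R + 1) d" "continuous_on UNIV (fst \<phi>)" "\<forall>x. cmod (fst \<phi> x) \<le> 3 * R + 1"
    using sobolev_norm_tower[OF N f sobolev_norm_component(1)[OF R]] by blast
  obtain e where e: "e 0 = snd \<phi>" "sobolev_tower N (3 * R + 1) e" "continuous_on UNIV (snd \<phi>)" "\<forall>x. cmod (snd \<phi> x) \<le> 3 * R + 1"
    using sobolev_norm_tower[OF N s sobolev_norm_component(2)[OF R]] by blast
  define d' where "d' = (\<lambda>k x. \<i> * d k x)"
  define e' where "e' = (\<lambda>k x. - \<i> * e k x)"
  have d': "sobolev_tower N (3 * R + 1) d'" "d' 0 = pot_u \<phi>" unfolding d'_def using sobolev_tower_cmult[OF d(2), of \<i>] d(1) by (auto simp: pot_u_def fun_eq_iff)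
  have e': "sobolev_tower N (3 * R + 1) e'" "e' 0 = pot_v \<phi>" unfolding e'_def using sobolev_tower_cmult[OF e(2), of "- \<i>"] e(1) by (auto simp: pot_v_def fun_eq_iff)
  have c: "continuous_potential \<phi>" unfolding continuous_potential_def using d e by blast
  have "continuous_on UNIV (pot_u \<phi>)" "continuous_on UNIV (pot_v \<phi>)"
    unfolding pot_u_def[abs_def] pot_v_def[abs_def] by (intro continuous_intros d e)+
  then have "global_potential_bound (3 * R + 1) (pot_u \<phi>) (d' 1) (pot_v \<phi>) (e' 1)"
    unfolding global_potential_bound_def using sobolev_tower_potential_bound[OF N d'(1) e'(1)] d' e' d(4) e(4) by (auto simp: pot_u_def pot_v_def norm_mult)
  then show ?thesis using d' e' c by blast
qed

text \<open>One pair \<open>n\<^sub>0\<close>, \<open>C\<close> serves both asymptotics. The result for a single potential is that for a set with one element.\<close>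

lemma uniform_asymptotics:
  assumes N: "1 \<le> N" and B: "Hc_bounded N B"
  shows "\<exists>n0\<ge>1. \<exists>C>0. \<forall>\<phi>\<in>B. \<forall>\<mu>. dirichlet_listing \<phi> \<mu> \<longrightarrow>
     lp_asymp_bound n0 C 2 (N + 1) (\<lambda>n. ZS_Delta \<phi> (\<mu> n)) (\<lambda>n. 2 * (-1) powi n) \<and>
     lp_asymp_bound n0 C 2 (N + 1) (\<lambda>n. ZS_delta \<phi> (\<mu> n))
        (\<lambda>n. (-1) powi n * \<i> * (fourier_coeff (fst \<phi>) (- n) - fourier_coeff (snd \<phi>) n))"
proof -
  obtain R0 where R0: "B \<subseteq> Hc N" "\<forall>\<phi>\<in>B. Hc_norm N \<phi> \<le> R0" using B by (auto simp: Hc_bounded_def)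
  define R where "R = max R0 0"
  define K where "K = 3 * R + 1"
  have K: "1 \<le> K" by (simp add: K_def R_def)
  note first_order_const = first_order_const_ge1[OF K]
  define W where "W = 4 * first_order_const K"
  have W: "1 \<le> W" using first_order_const by (simp add: W_def)
  obtain C n1 where C: "0 \<le> C" and n1: "1 \<le> n1" and ka: "\<forall>d e. sobolev_tower N K d \<longrightarrow> sobolev_tower N K e \<longrightarrow> (\<exists>X. l2_family C X \<and>
    (\<forall>n z f g. real n1 \<le> real_of_int \<bar>n\<bar> \<longrightarrow> cmod (z - of_int n * of_real pi) \<le> W / real_of_int \<bar>n\<bar> \<longrightarrow>
       zs_sol z (d 0) (e 0) f g \<longrightarrow> f 0 = 1 \<longrightarrow> g 0 = 1 \<longrightarrow> f 1 = g 1 \<longrightarrow>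
       cmod ((f 1)\<^sup>2 - 1 - (fcoeff (e 0) n + fcoeff (d 0) (- n))) \<le> (1 / real_of_int \<bar>n\<bar>) ^ Suc N * X n))"
    using kappa_asymptotics[OF N K W] by (elim exE conjE) (rule that)
  define A where "A = first_order_const K + 64 * exp (2 * K) * first_order_const K"
  have A0: "0 \<le> A" using first_order_const by (simp add: A_def)
  obtain n2 :: nat where n2: "real n1 + 256 * first_order_const K + 1 + 2 * A \<le> real n2" using real_arch_simple by blast
  have n21: "1 \<le> n2"
  proof -
    have "1 \<le> real n2" using n2 first_order_const A0 by linarith
    then show ?thesis by simp
  qed
  define T0 where "T0 = (K + K) + C"
  define D where "D = max (2 * T0 * T0) (C + 2 * A * T0)"
  show ?thesis
  proof (intro exI[of _ n2] conjI n21 exI[of _ "D\<^sup>2 + 1"] ballI allI impI)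
    show "0 < D\<^sup>2 + 1" by (simp add: add_nonneg_pos)
    fix \<phi> \<mu> assume \<phi>: "\<phi> \<in> B" and L: "dirichlet_listing \<phi> \<mu>"
    have "\<phi> \<in> Hc N" "Hc_norm N \<phi> \<le> R" using R0 \<phi> by (auto simp: R_def le_max_iff_disj)
    from potential_data[OF N this, folded K_def] obtain d e where d: "d 0 = pot_u \<phi>" "sobolev_tower N K d" and e: "e 0 = pot_v \<phi>" "sobolev_tower N K e"
      and cp: "continuous_potential \<phi>" and per: "global_potential_bound K (pot_u \<phi>) (d 1) (pot_v \<phi>) (e 1)" by blast
    have data: "potential_bound K (pot_u \<phi>) (d 1) (pot_v \<phi>) (e 1)" using per by (simp add: global_potential_bound_def)
    obtain X where X: "l2_family C X" and kX: "\<And>n z f g. real n1 \<le> real_of_int \<bar>n\<bar> \<Longrightarrow> cmod (z - of_int n * of_real pi) \<le> W / real_of_int \<bar>n\<bar> \<Longrightarrow>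
       dirichlet_solution z (pot_u \<phi>) (pot_v \<phi>) f g \<Longrightarrow>
       cmod ((f 1)\<^sup>2 - 1 - (fcoeff (pot_v \<phi>) n + fcoeff (pot_u \<phi>) (- n))) \<le> (1 / real_of_int \<bar>n\<bar>) ^ Suc N * X n"
      using ka[rule_format, OF d(2) e(2)] unfolding d(1) e(1) dirichlet_solution_def by blast
    define T where "T = (\<lambda>n. cmod (fcoeff (e N) n) + cmod (fcoeff (d N) (- n)))"
    have T: "l2_family (K + K) T"
      unfolding T_def using d(2) e(2) by (intro l2_family_add l2_family_fcoeff l2_family_reflect[OF l2_family_fcoeff]) (auto simp: sobolev_tower_def)
    have TX: "l2_family T0 (\<lambda>n. T n + X n)" unfolding T0_def by (rule l2_family_add[OF T X])
    have T00: "0 \<le> T0" by (rule l2_family_C0[OF TX])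
    have nonneg: "0 \<le> T n" "0 \<le> X n" for n using T X by (auto simp: l2_family_def)
    define S where "S = (\<lambda>n. fcoeff (pot_v \<phi>) n + fcoeff (pot_u \<phi>) (- n))"
    have c: "continuous_on UNIV (fst \<phi>)" "continuous_on UNIV (snd \<phi>)" using cp by (auto simp: continuous_potential_def)
    have Sfc: "S n = \<i> * (fourier_coeff (fst \<phi>) (- n) - fourier_coeff (snd \<phi>) n)" for n
      unfolding S_def fourier_coeff_fcoeff[OF c(1)] fourier_coeff_fcoeff[OF c(2)] pot_u_def[abs_def] pot_v_def[abs_def] fcoeff_cmult
      by (simp add: algebra_simps)
    have pw: "cmod (ZS_Delta \<phi> (\<mu> n) - 2 * (-1) powi n) \<le> (1 / real_of_int \<bar>n\<bar>) ^ Suc N * (2 * T0 * (T n + X n)) \<and>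
       cmod (ZS_delta \<phi> (\<mu> n) - (-1) powi n * \<i> * (fourier_coeff (fst \<phi>) (- n) - fourier_coeff (snd \<phi>) n))
         \<le> (1 / real_of_int \<bar>n\<bar>) ^ Suc N * (X n + 2 * A * (T n + X n))"
      if n: "int n2 \<le> \<bar>n\<bar>" for n
    proof -
      define m where "m = 1 / real_of_int \<bar>n\<bar>"
      have nb: "real n1 + 256 * first_order_const K + 1 + 2 * A \<le> real_of_int \<bar>n\<bar>" using n2 n by linarith
      have nb2: "real n1 \<le> real_of_int \<bar>n\<bar>" "256 * first_order_const K + 1 \<le> real_of_int \<bar>n\<bar>" "2 * A \<le> real_of_int \<bar>n\<bar>" "1 \<le> real_of_int \<bar>n\<bar>"
        using nb first_order_const A0 by linarith+
      have nn: "n \<noteq> 0" using nb2(4) by auto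
      have m: "0 < m" "m \<le> 1" using nb2(4) by (auto simp: m_def)
      obtain f g where fg: "dirichlet_solution (\<mu> n) (pot_u \<phi>) (pot_v \<phi>) f g" using listing_location(1)[OF per cp L nb2(2)] by blast
      have near: "cmod (\<mu> n - of_int n * of_real pi) \<le> 4 * first_order_const K / real_of_int \<bar>n\<bar>"
        by (rule listing_location(2)[OF per cp L nb2(2)])
      define \<sigma> :: complex where "\<sigma> = (-1) powi n"
      have \<sigma>: "\<sigma> * \<sigma> = 1" "cmod \<sigma> = 1" by (simp_all add: \<sigma>_def norm_power_int power_int_mult_distrib[symmetric])
      have 1: "cmod ((f 1)\<^sup>2 - 1 - S n) \<le> m ^ Suc N * X n"
        using kX[OF nb2(1) near[folded W_def] fg] by (simp add: S_def m_def)
      have 2: "cmod (S n) \<le> m ^ N * T n"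
        using norm_triangle_ineq[of "fcoeff (pot_v \<phi>) n" "fcoeff (pot_u \<phi>) (- n)"] fcoeff_decay[OF e(2) nn] fcoeff_decay[OF d(2), of "- n"] nn
        by (simp add: S_def T_def m_def d(1) e(1) distrib_left)
      have 3: "cmod (f 1 - \<sigma>) \<le> A * m"
        using multiplier_near_sign[OF data fg nb2(2) near] by (simp add: \<sigma>_def A_def m_def)
      have 4: "A * m \<le> 1 / 2" using nb2(3,4) by (simp add: m_def field_simps)
      have 5: "T n + X n \<le> T0" by (rule l2_family_bound[OF TX])
      note tp = trace_pointwise[OF \<sigma> 1 2 3 4 m N 5 nonneg]
      note Dd = ZS_Delta_delta_eigen[OF cp fg]
      have e: "\<sigma> * S n = \<sigma> * \<i> * (fourier_coeff (fst \<phi>) (- n) - fourier_coeff (snd \<phi>) n)"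
        by (simp add: Sfc)
      show ?thesis
        unfolding Dd(2,3) m_def[symmetric] \<sigma>_def[symmetric] e[symmetric] using tp by blast
    qed
    have Z1: "l2_family D (\<lambda>n. 2 * T0 * (T n + X n))"
      by (rule l2_family_mono[OF l2_family_cmult[OF TX]]) (use T00 in \<open>auto simp: D_def\<close>)
    have Z2: "l2_family D (\<lambda>n. X n + 2 * A * (T n + X n))"
      by (rule l2_family_mono[OF l2_family_add[OF X l2_family_cmult[OF TX]]]) (use A0 in \<open>auto simp: D_def\<close>)
    show "lp_asymp_bound n2 (D\<^sup>2 + 1) 2 (N + 1) (\<lambda>n. ZS_Delta \<phi> (\<mu> n)) (\<lambda>n. 2 * (-1) powi n)"
      by (rule lp_from_l2_family[OF Z1 n21]) (use pw in blast)
    show "lp_asymp_bound n2 (D\<^sup>2 + 1) 2 (N + 1) (\<lambda>n. ZS_delta \<phi> (\<mu> n))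
        (\<lambda>n. (-1) powi n * \<i> * (fourier_coeff (fst \<phi>) (- n) - fourier_coeff (snd \<phi>) n))"
      by (rule lp_from_l2_family[OF Z2 n21]) (use pw in blast)
  qed
qed

lemma lp_asymp_bound_imp: "1 \<le> n0 \<Longrightarrow> lp_asymp_bound n0 C p s x y \<Longrightarrow> lp_asymp p s x y"
  unfolding lp_asymp_bound_def lp_asymp_def by blast

theorem theorem1p4:
  fixes N :: nat
  assumes "N \<ge> 1"
  shows
    "(\<forall>\<phi>\<in>Hc N. \<forall>\<mu>. dirichlet_listing \<phi> \<mu> \<longrightarrow>
        lp_asymp 2 (N + 1) (\<lambda>n. ZS_Delta \<phi> (\<mu> n)) (\<lambda>n. 2 * (-1) powi n) \<and>
        lp_asymp 2 (N + 1) (\<lambda>n. ZS_delta \<phi> (\<mu> n))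
          (\<lambda>n. (-1) powi n * \<i> * (fourier_coeff (fst \<phi>) (- n) - fourier_coeff (snd \<phi>) n))) \<and>
     (\<forall>B. Hc_bounded N B \<longrightarrow>
        (\<exists>n0\<ge>1. \<exists>C>0. \<forall>\<phi>\<in>B. \<forall>\<mu>. dirichlet_listing \<phi> \<mu> \<longrightarrow>
           lp_asymp_bound n0 C 2 (N + 1) (\<lambda>n. ZS_Delta \<phi> (\<mu> n)) (\<lambda>n. 2 * (-1) powi n)) \<and>
        (\<exists>n0\<ge>1. \<exists>C>0. \<forall>\<phi>\<in>B. \<forall>\<mu>. dirichlet_listing \<phi> \<mu> \<longrightarrow>
           lp_asymp_bound n0 C 2 (N + 1) (\<lambda>n. ZS_delta \<phi> (\<mu> n))
             (\<lambda>n. (-1) powi n * \<i> * (fourier_coeff (fst \<phi>) (- n) - fourier_coeff (snd \<phi>) n))))"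
proof (intro conjI ballI allI impI)
  fix B assume B: "Hc_bounded N B"
  note U = uniform_asymptotics[OF assms B]
  show "\<exists>n0\<ge>1. \<exists>C>0. \<forall>\<phi>\<in>B. \<forall>\<mu>. dirichlet_listing \<phi> \<mu> \<longrightarrow>
           lp_asymp_bound n0 C 2 (N + 1) (\<lambda>n. ZS_Delta \<phi> (\<mu> n)) (\<lambda>n. 2 * (-1) powi n)"
    using U by (elim exE conjE) (intro exI conjI, assumption, assumption, blast)
  show "\<exists>n0\<ge>1. \<exists>C>0. \<forall>\<phi>\<in>B. \<forall>\<mu>. dirichlet_listing \<phi> \<mu> \<longrightarrow>
           lp_asymp_bound n0 C 2 (N + 1) (\<lambda>n. ZS_delta \<phi> (\<mu> n))
             (\<lambda>n. (-1) powi n * \<i> * (fourier_coeff (fst \<phi>) (- n) - fourier_coeff (snd \<phi>) n))"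
    using U by (elim exE conjE) (intro exI conjI, assumption, assumption, blast)
next
  fix \<phi> \<mu> assume \<phi>: "\<phi> \<in> Hc N" and L: "dirichlet_listing \<phi> \<mu>"
  have "Hc_bounded N {\<phi>}" using \<phi> by (auto simp: Hc_bounded_def)
  from uniform_asymptotics[OF assms this] obtain n0 C where n0: "1 \<le> n0"
    and b: "\<forall>\<psi>\<in>{\<phi>}. \<forall>\<mu>. dirichlet_listing \<psi> \<mu> \<longrightarrow>
     lp_asymp_bound n0 C 2 (N + 1) (\<lambda>n. ZS_Delta \<psi> (\<mu> n)) (\<lambda>n. 2 * (-1) powi n) \<and>
     lp_asymp_bound n0 C 2 (N + 1) (\<lambda>n. ZS_delta \<psi> (\<mu> n))
        (\<lambda>n. (-1) powi n * \<i> * (fourier_coeff (fst \<psi>) (- n) - fourier_coeff (snd \<psi>) n))"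
    by (elim exE conjE) (rule that)
  have bb: "lp_asymp_bound n0 C 2 (N + 1) (\<lambda>n. ZS_Delta \<phi> (\<mu> n)) (\<lambda>n. 2 * (-1) powi n) \<and>
     lp_asymp_bound n0 C 2 (N + 1) (\<lambda>n. ZS_delta \<phi> (\<mu> n))
        (\<lambda>n. (-1) powi n * \<i> * (fourier_coeff (fst \<phi>) (- n) - fourier_coeff (snd \<phi>) n))"
    using b L by blast
  show "lp_asymp 2 (N + 1) (\<lambda>n. ZS_Delta \<phi> (\<mu> n)) (\<lambda>n. 2 * (-1) powi n)"
    by (rule lp_asymp_bound_imp[OF n0 conjunct1[OF bb]])
  show "lp_asymp 2 (N + 1) (\<lambda>n. ZS_delta \<phi> (\<mu> n))
          (\<lambda>n. (-1) powi n * \<i> * (fourier_coeff (fst \<phi>) (- n) - fourier_coeff (snd \<phi>) n))"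
    by (rule lp_asymp_bound_imp[OF n0 conjunct2[OF bb]])
qed

end
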